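(* Consider the setting and assumptions (A1)–(A3) described in the context, let $d\ge1$ be an integer possibly depending on $(n,p)$, and let $h\ge1$ be fixed. If $n\gtrsim d^{2\alpha+2}(\mathcal M_1^W)^2\log(pd)$, then there exist positive constants $c_3,c_4$ independent of $(n,p,d)$ such that $$\max_{j,k\in[p],\,l,m\in[d]}\frac{|\hat\sigma^{(h)}_{jklm}-\sigma^{(h)}_{jklm}|}{(l\vee m)^{\alpha+1}}\lesssim\mathcal M_1^W\sqrt{\frac{\log(pd)}{n}}$$ holds with probability greater than $1-c_3(pd)^{-c_4}$.
   Context: Let $\mathcal U$ be a compact interval and $\mathbb H=L_2(\mathcal U)$ with $\langle f,g\rangle=\int_{\mathcal U}fg$, $\|f\|=\langle f,f\rangle^{1/2}$; for $\mathbf f,\mathbf g\in\mathbb H^p$, $\langle\mathbf f,\mathbf g\rangle=\sum_i\langle f_i,g_i\rangle$, $\|\mathbf f\|_0=\#\{i:\|f_i\|\ne0\}$. A kernel matrix $\mathbf K=(K_{ij})_{q\times p}$, $K_{ij}\in\mathbb H\otimes\mathbb H$, acts by $\mathbf K(\mathbf f)(u)=(\sum_j\langle K_{ij}(u,\cdot),f_j\rangle)_i$; $\|\cdot\|_{\mathcal S}$ is the Hilbert–Schmidt norm and $\|\mathbf K\|_\infty=\max_i\sum_j\|K_{ij}\|_{\mathcal S}$. $a\lesssim b$ means $a\le cb$ with $c$ independent of $(n,p,d)$. Setting: $\{\mathbf W_t\}_{t\in\mathbb Z}$ mean-zero weakly stationary in $\mathbb H^p$, $\mathbf W_t=\mathbf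 X_t+\mathbf e_t$ with $\{\mathbf e_t\}$ white noise (mean zero, zero autocovariance at all lags $h\ne0$) uncorrelated with $\{\mathbf X_t\}$; $\boldsymbol\Sigma^W_h(u,v)=\mathrm{Cov}\{\mathbf W_t(u),\mathbf W_{t+h}(v)\}=(\Sigma^W_{h,jk})$, $\boldsymbol\Sigma^X_h$ analogous; from data $\mathbf W_1,\dots,\mathbf W_n$, $\widehat{\boldsymbol\Sigma}^W_h=(n-h)^{-1}\sum_{t=1}^{n-h}\mathbf W_t(u)\mathbf W_{t+h}(v)^{\mathrm T}$. For fixed integer $L\ge1$, $K_{jj}(u,v)=\sum_{h=1}^L\int\Sigma^W_{h,jj}(u,z)\Sigma^W_{h,jj}(v,z)dz$ with eigenpairs $(\lambda_{jl},\psi_{jl})$, and $\widehat K_{jj}$ defined with $\widehat\Sigma^W_{h,jj}$, eigenpairs $(\hat\lambda_{jl},\hat\psi_{jl})$. Basis coefficients: $\eta_{tjl}=\langle X_{tj},\psi_{jl}\rangle$, $\hat\eta_{tjl}=\langle W_{tj},\hat\psi_{jl}\rangle$; $\sigma^{(h)}_{jklm}=\mathbb E(\eta_{tjl}\eta_{(t+h)km})$ and $\hat\sigma^{(h)}_{jklm}=(n-h)^{-1}\sum_{t=1}^{n-h}\hat\eta_{tjl}\hat\eta_{(t+h)km}$. Let $\nu_{jl}$ be eigenfunctions of $\Sigma^X_{0,jj}$. Stability measure: $\mathbf f^W_\theta=(2\pi)^{-1}\sum_h\boldsymbol\Sigma^W_he^{-ih\theta}$; $\mathbb H^p_0=\{\boldsymbol\Phi:\langle\boldsymbol\Phi,\boldsymbol\Sigma^W_0(\boldsymbol\Phi)\rangle\in(0,\infty)\}$;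 $\mathcal M^W=2\pi\,\mathrm{ess\,sup}_{\theta\in[-\pi,\pi],\boldsymbol\Phi\in\mathbb H^p_0}\langle\boldsymbol\Phi,\mathbf f^W_\theta(\boldsymbol\Phi)\rangle/\langle\boldsymbol\Phi,\boldsymbol\Sigma^W_0(\boldsymbol\Phi)\rangle$; $\mathcal M^W_k$ is the same with $\|\boldsymbol\Phi\|_0\le k$. Sub-Gaussian: a mean-zero $Z\in\mathbb H$ with covariance operator $\Sigma_0$ is sub-Gaussian if $\mathbb E e^{\langle x,Z\rangle}\le e^{c^2\langle x,\Sigma_0(x)\rangle/2}$ for all $x$, some $c>0$. Assumptions: (A1) $\mathbf f^W_\theta$ exists and $\mathcal M^W<\infty$. (A2) $\mathbf W_t=\sum_{l\ge0}\mathbf B_l(\boldsymbol\varepsilon_{t-l})$, $\mathbf B_l=(B_{l,jk})_{p\times p}$ with $B_{l,jk}\in\mathbb H\otimes\mathbb H$, components of $\{\boldsymbol\varepsilon_t\}$ independent sub-Gaussian processes, $\sum_l\|\mathbf B_l\|_\infty=O(1)$, $\max_j\int\mathrm{Cov}\{\varepsilon_{tj}(u),\varepsilon_{tj}(u)\}du=O(1)$. (A3) For each $j$: $\lambda_{j1}>\lambda_{j2}>\dots>0$, $\lambda_{jl}-\lambda_{j(l+1)}\ge c_0l^{-\alpha-1}$ for constants $c_0>0,\alpha>1$; and $\mathrm{span}\{\nu_{jl}\}_l=\mathrm{span}\{\psi_{jl}\}_l$.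
   Formalization: The estimated eigenfunctions are assumed sign-aligned, with ⟨ψ̂_jl, ψ_jl⟩ ≥ 0 (otherwise flipping one sign makes the bound false), and one sub-Gaussian constant c is assumed to serve all the innovation components. *)

theory Defs
  imports "HOL-Probability.Probability"
begin

text \<open>Elements of H are represented by real functions that are Borel measurable and
square integrable on U = {a..b}; equalities in H are expressed as zero L2-distance.\<close>

definition sqint :: "real \<Rightarrow> real \<Rightarrow> (real \<Rightarrow> real) \<Rightarrow> bool" where
  "sqint a b f \<longleftrightarrow> f \<in> borel_measurable lborel \<and> set_integrable lborel {a..b} (\<lambda>u. (f u)^2)"

definition ip :: "real \<Rightarrow> real \<Rightarrow> (real \<Rightarrow> real) \<Rightarrow> (real \<Rightarrow> real) \<Rightarrow> real" where
  "ip a b f g = (LINT u:{a..b}|lborel. f u * g u)"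

definition nrm :: "real \<Rightarrow> real \<Rightarrow> (real \<Rightarrow> real) \<Rightarrow> real" where
  "nrm a b f = sqrt (ip a b f f)"

definition l2_closed_span :: "real \<Rightarrow> real \<Rightarrow> (real \<Rightarrow> real) set \<Rightarrow> (real \<Rightarrow> real) set" where
  "l2_closed_span a b S = {f. sqint a b f \<and> (\<forall>\<epsilon>>0. \<exists>F c. finite F \<and> F \<subseteq> S \<and>
       nrm a b (\<lambda>u. f u - (\<Sum>g\<in>F. c g * g u)) < \<epsilon>)}"

definition hs_kernel :: "real \<Rightarrow> real \<Rightarrow> (real \<Rightarrow> real \<Rightarrow> real) \<Rightarrow> bool" where
  "hs_kernel a b K \<longleftrightarrow> (\<lambda>(u,v). K u v) \<in> borel_measurable (lborel \<Otimes>\<^sub>M lborel) \<and>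
      set_integrable (lborel \<Otimes>\<^sub>M lborel) ({a..b} \<times> {a..b}) (\<lambda>(u,v). (K u v)^2)"

definition hs_norm :: "real \<Rightarrow> real \<Rightarrow> (real \<Rightarrow> real \<Rightarrow> real) \<Rightarrow> real" where
  "hs_norm a b K = sqrt (set_lebesgue_integral (lborel \<Otimes>\<^sub>M lborel) ({a..b} \<times> {a..b}) (\<lambda>(u,v). (K u v)^2))"

definition kop :: "real \<Rightarrow> real \<Rightarrow> (real \<Rightarrow> real \<Rightarrow> real) \<Rightarrow> (real \<Rightarrow> real) \<Rightarrow> real \<Rightarrow> real" where
  "kop a b K f = (\<lambda>u. LINT v:{a..b}|lborel. K u v * f v)"

definition kinf :: "real \<Rightarrow> real \<Rightarrow> nat \<Rightarrow> (nat \<Rightarrow> nat \<Rightarrow> real \<Rightarrow> real \<Rightarrow> real) \<Rightarrow> real" where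
  "kinf a b p K = Max ((\<lambda>i. \<Sum>j<p. hs_norm a b (K i j)) ` {..<p})"

definition qf :: "real \<Rightarrow> real \<Rightarrow> nat \<Rightarrow> (nat \<Rightarrow> nat \<Rightarrow> real \<Rightarrow> real \<Rightarrow> real) \<Rightarrow> (nat \<Rightarrow> real \<Rightarrow> real) \<Rightarrow> real" where
  "qf a b p K \<Phi> = (\<Sum>i<p. \<Sum>j<p. LINT u:{a..b}|lborel. \<Phi> i u * kop a b (K i j) (\<Phi> j) u)"

definition in_Hp :: "real \<Rightarrow> real \<Rightarrow> nat \<Rightarrow> (nat \<Rightarrow> real \<Rightarrow> real) \<Rightarrow> bool" where
  "in_Hp a b p \<Phi> \<longleftrightarrow> (\<forall>i<p. sqint a b (\<Phi> i))"

definition l0 :: "real \<Rightarrow> real \<Rightarrow> nat \<Rightarrow> (nat \<Rightarrow> real \<Rightarrow> real) \<Rightarrow> nat" where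
  "l0 a b p \<Phi> = card {i. i < p \<and> nrm a b (\<Phi> i) \<noteq> 0}"

definition cov :: "'w measure \<Rightarrow> ('w \<Rightarrow> real) \<Rightarrow> ('w \<Rightarrow> real) \<Rightarrow> real" where
  "cov M f g = (\<integral>\<omega>. f \<omega> * g \<omega> \<partial>M) - (\<integral>\<omega>. f \<omega> \<partial>M) * (\<integral>\<omega>. g \<omega> \<partial>M)"

definition rfun :: "'w measure \<Rightarrow> real \<Rightarrow> real \<Rightarrow> ('w \<Rightarrow> real \<Rightarrow> real) \<Rightarrow> bool" where
  "rfun M a b Z \<longleftrightarrow> (\<forall>\<omega>\<in>space M. sqint a b (Z \<omega>)) \<and>
     (\<lambda>(\<omega>,u). Z \<omega> u) \<in> borel_measurable (M \<Otimes>\<^sub>M lborel) \<and>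
     (\<forall>u\<in>{a..b}. (\<lambda>\<omega>. Z \<omega> u) \<in> borel_measurable M \<and> integrable M (\<lambda>\<omega>. (Z \<omega> u)^2))"

definition wstat :: "'w measure \<Rightarrow> real \<Rightarrow> real \<Rightarrow> nat \<Rightarrow> (int \<Rightarrow> nat \<Rightarrow> 'w \<Rightarrow> real \<Rightarrow> real) \<Rightarrow> bool" where
  "wstat M a b p W \<longleftrightarrow>
     (\<forall>t j. j < p \<longrightarrow> rfun M a b (W t j) \<and> (\<forall>u\<in>{a..b}. (\<integral>\<omega>. W t j \<omega> u \<partial>M) = 0)) \<and>
     (\<forall>t s h j k u v. j < p \<longrightarrow> k < p \<longrightarrow> u \<in> {a..b} \<longrightarrow> v \<in> {a..b} \<longrightarrow>
        cov M (\<lambda>\<omega>. W t j \<omega> u) (\<lambda>\<omega>. W (t + h) k \<omega> v) = cov M (\<lambda>\<omega>. W s j \<omega> u) (\<lambda>\<omega>. W (s + h) k \<omega> v))"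

definition acov :: "'w measure \<Rightarrow> (int \<Rightarrow> nat \<Rightarrow> 'w \<Rightarrow> real \<Rightarrow> real) \<Rightarrow> int \<Rightarrow> nat \<Rightarrow> nat \<Rightarrow> real \<Rightarrow> real \<Rightarrow> real" where
  "acov M W h j k u v = cov M (\<lambda>\<omega>. W 0 j \<omega> u) (\<lambda>\<omega>. W h k \<omega> v)"

definition sacov :: "nat \<Rightarrow> (int \<Rightarrow> nat \<Rightarrow> 'w \<Rightarrow> real \<Rightarrow> real) \<Rightarrow> 'w \<Rightarrow> int \<Rightarrow> nat \<Rightarrow> nat \<Rightarrow> real \<Rightarrow> real \<Rightarrow> real" where
  "sacov n W \<omega> h j k u v =
     (\<Sum>t\<in>{1..int n - h}. W t j \<omega> u * W (t + h) k \<omega> v) / (real n - real_of_int h)"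

definition sd_partial :: "real \<Rightarrow> real \<Rightarrow> nat \<Rightarrow> (int \<Rightarrow> nat \<Rightarrow> nat \<Rightarrow> real \<Rightarrow> real \<Rightarrow> real) \<Rightarrow> real \<Rightarrow> (nat \<Rightarrow> real \<Rightarrow> real) \<Rightarrow> nat \<Rightarrow> complex" where
  "sd_partial a b p S \<theta> \<Phi> N =
     (\<Sum>h\<in>{- int N..int N}. complex_of_real (qf a b p (S h) \<Phi>) * cis (- real_of_int h * \<theta>)) / complex_of_real (2 * pi)"

text \<open>Existence of the spectral density f_theta (series converging, in the weak/quadratic-form sense).\<close>
definition sd_exists :: "real \<Rightarrow> real \<Rightarrow> nat \<Rightarrow> (int \<Rightarrow> nat \<Rightarrow> nat \<Rightarrow> real \<Rightarrow> real \<Rightarrow> real) \<Rightarrow> bool" where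
  "sd_exists a b p S \<longleftrightarrow> (\<forall>\<theta> \<Phi>. in_Hp a b p \<Phi> \<longrightarrow> convergent (sd_partial a b p S \<theta> \<Phi>))"

definition sdq :: "real \<Rightarrow> real \<Rightarrow> nat \<Rightarrow> (int \<Rightarrow> nat \<Rightarrow> nat \<Rightarrow> real \<Rightarrow> real \<Rightarrow> real) \<Rightarrow> real \<Rightarrow> (nat \<Rightarrow> real \<Rightarrow> real) \<Rightarrow> real" where
  "sdq a b p S \<theta> \<Phi> = Re (lim (sd_partial a b p S \<theta> \<Phi>))"

definition ess_sup_theta :: "(real \<Rightarrow> ereal) \<Rightarrow> ereal" where
  "ess_sup_theta F = Inf {z. AE \<theta> in lborel. \<theta> \<in> {-pi..pi} \<longrightarrow> F \<theta> \<le> z}"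

definition H0 :: "real \<Rightarrow> real \<Rightarrow> nat \<Rightarrow> (nat \<Rightarrow> nat \<Rightarrow> real \<Rightarrow> real \<Rightarrow> real) \<Rightarrow> (nat \<Rightarrow> real \<Rightarrow> real) set" where
  "H0 a b p S0 = {\<Phi>. in_Hp a b p \<Phi> \<and> qf a b p S0 \<Phi> > 0}"

text \<open>Stability measure M_k (sparsity level k); M^W is stab ... p.\<close>
definition stab :: "real \<Rightarrow> real \<Rightarrow> nat \<Rightarrow> (int \<Rightarrow> nat \<Rightarrow> nat \<Rightarrow> real \<Rightarrow> real \<Rightarrow> real) \<Rightarrow> nat \<Rightarrow> ereal" where
  "stab a b p S k = ereal (2 * pi) * ess_sup_theta (\<lambda>\<theta>.
      SUP \<Phi>\<in>{\<Phi>\<in>H0 a b p (S 0). l0 a b p \<Phi> \<le> k}. ereal (sdq a b p S \<theta> \<Phi> / qf a b p (S 0) \<Phi>))"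

definition subgauss :: "'w measure \<Rightarrow> real \<Rightarrow> real \<Rightarrow> real \<Rightarrow> ('w \<Rightarrow> real \<Rightarrow> real) \<Rightarrow> bool" where
  "subgauss M a b c Z \<longleftrightarrow> (\<forall>u\<in>{a..b}. (\<integral>\<omega>. Z \<omega> u \<partial>M) = 0) \<and>
     (\<forall>x. sqint a b x \<longrightarrow>
        (\<integral>\<^sup>+ \<omega>. ennreal (exp (ip a b x (Z \<omega>))) \<partial>M) \<le>
        ennreal (exp (c^2 * (LINT u:{a..b}|lborel. x u *
            (LINT v:{a..b}|lborel. cov M (\<lambda>\<omega>. Z \<omega> u) (\<lambda>\<omega>. Z \<omega> v) * x v)) / 2)))"

definition ma_rep :: "'w measure \<Rightarrow> real \<Rightarrow> real \<Rightarrow> nat \<Rightarrow> (int \<Rightarrow> nat \<Rightarrow> 'w \<Rightarrow> real \<Rightarrow> real)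
    \<Rightarrow> (nat \<Rightarrow> nat \<Rightarrow> nat \<Rightarrow> real \<Rightarrow> real \<Rightarrow> real) \<Rightarrow> (int \<Rightarrow> nat \<Rightarrow> 'w \<Rightarrow> real \<Rightarrow> real) \<Rightarrow> bool" where
  "ma_rep M a b p W B \<epsilon> \<longleftrightarrow> (\<forall>t j. j < p \<longrightarrow> (AE \<omega> in M.
      (\<lambda>N. nrm a b (\<lambda>u. W t j \<omega> u - (\<Sum>l<N. \<Sum>k<p. kop a b (B l j k) (\<epsilon> (t - int l) k \<omega>) u)))
        \<longlonglongrightarrow> 0))"

definition eigpairs :: "real \<Rightarrow> real \<Rightarrow> (real \<Rightarrow> real \<Rightarrow> real) \<Rightarrow> (nat \<Rightarrow> real) \<Rightarrow> (nat \<Rightarrow> real \<Rightarrow> real) \<Rightarrow> bool" where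
  "eigpairs a b K lam psi \<longleftrightarrow>
     (\<forall>l\<ge>1. sqint a b (psi l)) \<and>
     (\<forall>l\<ge>1. \<forall>m\<ge>1. ip a b (psi l) (psi m) = (if l = m then 1 else 0)) \<and>
     (\<forall>l\<ge>1. nrm a b (\<lambda>u. kop a b K (psi l) u - lam l * psi l u) = 0) \<and>
     (\<forall>l\<ge>1. lam (Suc l) \<le> lam l) \<and>
     (\<forall>\<mu> f. \<mu> \<noteq> 0 \<longrightarrow> sqint a b f \<longrightarrow> nrm a b (\<lambda>u. kop a b K f u - \<mu> * f u) = 0 \<longrightarrow>
        (\<exists>F c. finite F \<and> F \<subseteq> {l. l \<ge> 1 \<and> lam l = \<mu>} \<and>
           nrm a b (\<lambda>u. f u - (\<Sum>l\<in>F. c l * psi l u)) = 0))"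

definition Kmat :: "real \<Rightarrow> real \<Rightarrow> (int \<Rightarrow> nat \<Rightarrow> nat \<Rightarrow> real \<Rightarrow> real \<Rightarrow> real) \<Rightarrow> nat \<Rightarrow> nat \<Rightarrow> real \<Rightarrow> real \<Rightarrow> real" where
  "Kmat a b S L j = (\<lambda>u v. \<Sum>h\<in>{1..L}. LINT z:{a..b}|lborel. S (int h) j j u z * S (int h) j j v z)"

definition sig :: "'w measure \<Rightarrow> real \<Rightarrow> real \<Rightarrow> (int \<Rightarrow> nat \<Rightarrow> 'w \<Rightarrow> real \<Rightarrow> real) \<Rightarrow> (nat \<Rightarrow> nat \<Rightarrow> real \<Rightarrow> real)
     \<Rightarrow> nat \<Rightarrow> nat \<Rightarrow> nat \<Rightarrow> nat \<Rightarrow> nat \<Rightarrow> real" where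
  "sig M a b X psi h j k l m =
     (\<integral>\<omega>. ip a b (X 0 j \<omega>) (psi j l) * ip a b (X (int h) k \<omega>) (psi k m) \<partial>M)"

definition sighat :: "real \<Rightarrow> real \<Rightarrow> nat \<Rightarrow> (int \<Rightarrow> nat \<Rightarrow> 'w \<Rightarrow> real \<Rightarrow> real) \<Rightarrow> ('w \<Rightarrow> nat \<Rightarrow> nat \<Rightarrow> real \<Rightarrow> real)
     \<Rightarrow> 'w \<Rightarrow> nat \<Rightarrow> nat \<Rightarrow> nat \<Rightarrow> nat \<Rightarrow> nat \<Rightarrow> real" where
  "sighat a b n W psih \<omega> h j k l m =
     (\<Sum>t\<in>{1..int n - int h}. ip a b (W t j \<omega>) (psih \<omega> j l) * ip a b (W (t + int h) k \<omega>) (psih \<omega> k m))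
       / (real n - real h)"

end

theory Submission
  imports Defs
begin

text \<open>
  The true and the estimated basis coefficients are values of the (sample) lag-\<open>h\<close> autocovariance kernel of
  \<open>W\<close>, regarded as an element of \<open>L\<^sup>2({a..b}\<^sup>2)\<close>, at tensor products of (estimated) eigenfunctions; for \<open>h \<ge> 1\<close> the
  noise \<open>e\<close> does not contribute to this kernel. So it suffices to bound the kernels and the eigenfunctions.

  The operators \<open>K\<^sub>j\<^sub>j\<close> depend on finitely many autocovariance kernels. Weyl's inequality and the gap condition
  turn a kernel error \<open>\<eta>\<close> into an eigenfunction error of order \<open>l powr (\<alpha> + 1) * \<eta>\<close>.

  The kernel error is of order \<open>sqrt (ln (p * d) / n)\<close> with an absolute constant: sub-Gaussian innovations have
  exponential square moments, the sample autocovariance of the linear process is a weighted average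
  of sums of products of two innovations, each such sum splits into two sums of independent Hilbert space
  valued terms, and Pinelis' inequality applies to these; a union bound over the components follows.

  The stability measure enters through \<open>M\<^sub>1 \<ge> 1\<close> only: the spectral density in the direction of an
  eigenfunction of \<open>K\<^sub>1\<^sub>1\<close> averages over the frequencies to the variance in that direction, divided by \<open>2 * pi\<close>.
\<close>

section \<open>Perturbation of positive Hilbert--Schmidt operators\<close>

text \<open>Once the kernel errors at the lags \<open>h\<close> and \<open>1..L\<close> are below
  some \<eta> \<le> 1, every eigenfunction bound is deterministic. The union bound therefore runs
  over lags and pairs of components only; \<open>l\<close> and \<open>m\<close> enter through the
  factor \<open>real (max l m) powr (\<alpha> + 1)\<close>, which the normalization in the claim
  divides out. The level \<open>\<eta> = 24 * D * sqrt (ln (p * d) / n)\<close> makes each single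
  tail at most 2 over the cube of \<open>p * d\<close>; at most \<open>(L + 1) * p * p\<close> such
  events leave a failure probability of order 1 over \<open>p * d\<close>.

  The obstacle is that the processes are given by their values at points, while compactness,
  Pinelis' inequality and expectations of tensors call for random elements of a separable Hilbert
  space. L2 is therefore constructed as a type, and functions and kernels enter it cut off outside
  \<open>{a..b}\<close>. The price is the transfer of the hypotheses: the embedding must be
  measurable, pointwise covariance kernels must be expectations of random tensors, and square
  integrability and independence of the innovations must survive.\<close>

definition orthonormal :: "'a::real_inner set \<Rightarrow> bool" where
  "orthonormal E \<longleftrightarrow> pairwise orthogonal E \<and> (\<forall>e\<in>E. norm e = 1)"

text \<open>On a Hilbert space the least such \<open>s\<close> is the squared Hilbert--Schmidt norm;
  testing finite orthonormal sets avoids the choice of a basis.\<close>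

definition hs_bounded :: "('a::real_inner \<Rightarrow> 'b::real_normed_vector) \<Rightarrow> real \<Rightarrow> bool" where
  "hs_bounded K s \<longleftrightarrow> (\<forall>E. finite E \<longrightarrow> orthonormal E \<longrightarrow> (\<Sum>e\<in>E. (norm (K e))\<^sup>2) \<le> s)"

section \<open>Compactness of Hilbert--Schmidt operators\<close>

lemma orthonormal_insert:
  assumes "orthonormal E" "norm g = 1" "\<And>e. e \<in> E \<Longrightarrow> inner g e = 0"
  shows "orthonormal (insert g E)" "g \<notin> E"
proof -
  show "orthonormal (insert g E)"
    using assms unfolding orthonormal_def
    by (auto simp: pairwise_insert orthogonal_def inner_commute)
  show "g \<notin> E" using assms(2) assms(3)[of g] by (auto simp: norm_eq_1)
qed

lemma orthonormal_inner:
  assumes "orthonormal E" "x \<in> E" "y \<in> E"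
  shows "inner x y = (if x = y then 1 else 0)"
  using assms unfolding orthonormal_def pairwise_def orthogonal_def by (auto simp: norm_eq_1)

text \<open>The supremum of the sums of squares over finite orthonormal sets is finite, so some
  \<open>E\<close> comes within \<open>\<delta>\<^sup>2\<close> of it. A unit vector orthogonal to
  \<open>E\<close> can be adjoined, and its image can then contribute no more than
  \<open>\<delta>\<^sup>2\<close>.\<close>

lemma hs_bounded_tail:
  assumes K: "bounded_linear K" and hs: "hs_bounded K s" and d: "\<delta> > 0"
  shows "\<exists>E. finite E \<and> orthonormal E \<and> (\<forall>g. (\<forall>e\<in>E. inner g e = 0) \<longrightarrow> norm (K g) \<le> \<delta> * norm g)"
proof -
  interpret K: bounded_linear K by fact
  define S where "S = {\<Sum>e\<in>E. (norm (K e))\<^sup>2 | E. finite E \<and> orthonormal E}"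
  have "0 \<in> S" unfolding S_def by (auto intro!: exI[of _ "{}"] simp: orthonormal_def)
  hence ne: "S \<noteq> {}" by auto
  have bdd: "bdd_above S" using hs unfolding S_def hs_bounded_def by (auto intro!: bdd_aboveI[of _ s])
  have "Sup S - \<delta>\<^sup>2 < Sup S" using d by simp
  then obtain y where "y \<in> S" "y > Sup S - \<delta>\<^sup>2" using less_cSup_iff[OF ne bdd] by blast
  then obtain E where E: "finite E" "orthonormal E" "(\<Sum>e\<in>E. (norm (K e))\<^sup>2) > Sup S - \<delta>\<^sup>2"
    unfolding S_def by auto
  have unit: "norm (K g) \<le> \<delta>" if g: "norm g = 1" "\<forall>e\<in>E. inner g e = 0" for g
  proof -
    have on: "orthonormal (insert g E)" "g \<notin> E" using orthonormal_insert[OF E(2)] g by auto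
    have "(\<Sum>e\<in>insert g E. (norm (K e))\<^sup>2) \<in> S" unfolding S_def using E(1) on by blast
    hence "(\<Sum>e\<in>insert g E. (norm (K e))\<^sup>2) \<le> Sup S" using bdd by (rule cSup_upper)
    hence "(norm (K g))\<^sup>2 \<le> \<delta>\<^sup>2" using E on by simp
    thus ?thesis using d by (simp add: power2_le_iff_abs_le)
  qed
  have "norm (K g) \<le> \<delta> * norm g" if "\<forall>e\<in>E. inner g e = 0" for g
  proof (cases "g = 0")
    case False
    have "norm (K (g /\<^sub>R norm g)) \<le> \<delta>" using False that by (intro unit) auto
    thus ?thesis using False by (simp add: K.scaleR field_simps)
  qed (simp add: K.zero)
  thus ?thesis using E by blast
qed

text \<open>The set grows by one vector at a time, each time as the continuous image of a product
  with \<open>{-1..1}\<close>. It serves as the finite-dimensional part of the image of the unit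
  ball under a Hilbert--Schmidt operator.\<close>

lemma compact_bounded_combinations:
  fixes v :: "'i \<Rightarrow> 'b::real_normed_vector"
  assumes "finite E"
  shows "compact {\<Sum>e\<in>E. c e *\<^sub>R v e | c. \<forall>e\<in>E. \<bar>c e\<bar> \<le> (1::real)}"
  using assms
proof (induction E)
  case (insert x E)
  let ?C = "{\<Sum>e\<in>E. c e *\<^sub>R v e | c. \<forall>e\<in>E. \<bar>c e\<bar> \<le> (1::real)}"
  let ?f = "\<lambda>(t::real, y). t *\<^sub>R v x + y"
  have "compact (?f ` ({-1..1} \<times> ?C))"
    by (intro compact_continuous_image compact_Times insert.IH)
       (auto simp: case_prod_unfold intro!: continuous_intros)
  moreover have "{\<Sum>e\<in>insert x E. c e *\<^sub>R v e | c. \<forall>e\<in>insert x E. \<bar>c e\<bar> \<le> (1::real)} = ?f ` ({-1..1} \<times> ?C)"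
  proof (intro equalityI subsetI)
    fix y assume "y \<in> {\<Sum>e\<in>insert x E. c e *\<^sub>R v e | c. \<forall>e\<in>insert x E. \<bar>c e\<bar> \<le> (1::real)}"
    then obtain c where c: "\<forall>e\<in>insert x E. \<bar>c e\<bar> \<le> (1::real)" "y = (\<Sum>e\<in>insert x E. c e *\<^sub>R v e)" by auto
    have "y = ?f (c x, \<Sum>e\<in>E. c e *\<^sub>R v e)" using c insert.hyps by simp
    moreover have "(c x, \<Sum>e\<in>E. c e *\<^sub>R v e) \<in> {-1..1} \<times> ?C" using c(1) by (auto simp: abs_le_iff)
    ultimately show "y \<in> ?f ` ({-1..1} \<times> ?C)" by blast
  next
    fix y assume "y \<in> ?f ` ({-1..1} \<times> ?C)"
    then obtain t c where c: "\<bar>t\<bar> \<le> 1" "\<forall>e\<in>E. \<bar>c e\<bar> \<le> (1::real)" "y = t *\<^sub>R v x + (\<Sum>e\<in>E. c e *\<^sub>R v e)"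
      by (auto simp: abs_le_iff)
    have "(\<Sum>e\<in>E. (c(x:=t)) e *\<^sub>R v e) = (\<Sum>e\<in>E. c e *\<^sub>R v e)"
      using insert.hyps by (intro sum.cong) auto
    hence "y = (\<Sum>e\<in>insert x E. (c(x:=t)) e *\<^sub>R v e)" using c insert.hyps by simp
    moreover have "\<forall>e\<in>insert x E. \<bar>(c(x:=t)) e\<bar> \<le> 1" using c by auto
    ultimately show "y \<in> {\<Sum>e\<in>insert x E. c e *\<^sub>R v e | c. \<forall>e\<in>insert x E. \<bar>c e\<bar> \<le> (1::real)}" by blast
  qed
  ultimately show ?case by simp
qed simp

lemma orthonormal_proj_orth:
  assumes "finite E" "orthonormal E" "e \<in> E"
  shows "inner (g - (\<Sum>e\<in>E. inner g e *\<^sub>R e)) e = 0"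
proof -
  have "inner (\<Sum>e'\<in>E. inner g e' *\<^sub>R e') e = (\<Sum>e'\<in>E. if e' = e then inner g e' else 0)"
    unfolding inner_sum_left using assms by (intro sum.cong) (auto simp: orthonormal_inner)
  also have "\<dots> = inner g e" using assms by simp
  finally show ?thesis by (simp add: inner_diff_left)
qed

lemma orthonormal_proj_norm:
  assumes "finite E" "orthonormal E"
  shows "(norm g)\<^sup>2 = (\<Sum>e\<in>E. (inner g e)\<^sup>2) + (norm (g - (\<Sum>e\<in>E. inner g e *\<^sub>R e)))\<^sup>2"
proof -
  let ?P = "\<Sum>e\<in>E. inner g e *\<^sub>R e"
  have 1: "inner (g - ?P) ?P = 0" using orthonormal_proj_orth[OF assms] by (simp add: inner_sum_right)
  have 2: "inner ?P ?P = (\<Sum>e\<in>E. (inner g e)\<^sup>2)"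
  proof -
    have "inner g ?P = (\<Sum>e\<in>E. (inner g e)\<^sup>2)" by (simp add: inner_sum_right power2_eq_square)
    thus ?thesis using 1 by (simp add: inner_diff_left)
  qed
  have "inner g g = inner ?P ?P + inner (g - ?P) (g - ?P)"
    using 1 by (simp add: inner_diff_left inner_diff_right inner_commute)
  thus ?thesis using 2 by (simp add: power2_norm_eq_inner)
qed

text \<open>The unit ball is split along the finite set \<open>E\<close> of
  \<open>hs_bounded_tail\<close>: projected vectors have coefficients in \<open>{-1..1}\<close> and
  hence images in a compact set, and the orthogonal remainder is mapped into a ball of radius
  \<epsilon>/4. A finite net for the compact set is thus a net for the whole image.\<close>

lemma hs_bounded_imp_compact:
  fixes K :: "'a::real_inner \<Rightarrow> 'b::{real_normed_vector, complete_space}"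
  assumes K: "bounded_linear K" and hs: "hs_bounded K s"
  shows "compact (closure (K ` cball 0 1))"
  unfolding compact_eq_totally_bounded
proof (intro conjI allI impI)
  show "Topological_Spaces.complete (closure (K ` cball 0 1))" by (simp add: complete_eq_closed)
  fix \<epsilon> :: real assume "\<epsilon> > 0"
  interpret K: bounded_linear K by fact
  obtain E where E: "finite E" "orthonormal E"
    and tail: "\<And>g. (\<forall>e\<in>E. inner g e = 0) \<Longrightarrow> norm (K g) \<le> \<epsilon>/4 * norm g"
    using hs_bounded_tail[OF K hs, of "\<epsilon>/4"] \<open>\<epsilon> > 0\<close> by auto
  let ?C = "{\<Sum>e\<in>E. c e *\<^sub>R K e | c. \<forall>e\<in>E. \<bar>c e\<bar> \<le> (1::real)}"
  have "compact ?C" using compact_bounded_combinations[OF E(1)] .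
  then obtain k where k: "finite k" "?C \<subseteq> (\<Union>x\<in>k. ball x (\<epsilon>/4))"
    unfolding compact_eq_totally_bounded using \<open>\<epsilon> > 0\<close> by (meson divide_pos_pos zero_less_numeral)
  \<comment> \<open>Closed balls of half the radius: their finite union is closed, hence also covers
    the closure.\<close>
  have "K ` cball 0 1 \<subseteq> (\<Union>x\<in>k. cball x (\<epsilon>/2))"
  proof (intro subsetI)
    fix y assume "y \<in> K ` cball 0 1"
    then obtain g where g: "norm g \<le> 1" "y = K g" by auto
    let ?P = "\<Sum>e\<in>E. inner g e *\<^sub>R e"
    have "(norm (g - ?P))\<^sup>2 \<le> (norm g)\<^sup>2"
      using orthonormal_proj_norm[OF E, of g] by (simp add: sum_nonneg)
    hence "norm (g - ?P) \<le> 1" using g by (meson norm_ge_zero order_trans power2_le_imp_le)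
    hence "\<epsilon>/4 * norm (g - ?P) \<le> \<epsilon>/4 * 1" using \<open>\<epsilon> > 0\<close> by (intro mult_left_mono) auto
    moreover have "norm (K (g - ?P)) \<le> \<epsilon>/4 * norm (g - ?P)"
      by (rule tail) (auto intro: orthonormal_proj_orth[OF E])
    ultimately have 1: "norm (K (g - ?P)) \<le> \<epsilon>/4" by simp
    have "\<bar>inner g e\<bar> \<le> 1" if "e \<in> E" for e
      using Cauchy_Schwarz_ineq2[of g e] that E(2) g unfolding orthonormal_def by auto
    hence "(\<Sum>e\<in>E. inner g e *\<^sub>R K e) \<in> ?C" by blast
    moreover have "K ?P = (\<Sum>e\<in>E. inner g e *\<^sub>R K e)" by (simp add: K.sum K.scaleR)
    ultimately obtain x where x: "x \<in> k" "dist x (K ?P) < \<epsilon>/4" using k by auto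
    have "K g = K ?P + K (g - ?P)" by (simp add: K.diff)
    hence "dist (K ?P) y \<le> \<epsilon>/4" using 1 g by (simp add: dist_norm)
    hence "dist x y \<le> \<epsilon>/2" using x dist_triangle[of x y "K ?P"] by linarith
    thus "y \<in> (\<Union>x\<in>k. cball x (\<epsilon>/2))" using x by auto
  qed
  hence "closure (K ` cball 0 1) \<subseteq> (\<Union>x\<in>k. cball x (\<epsilon>/2))"
    using k by (intro closure_minimal) auto
  also have "\<dots> \<subseteq> (\<Union>x\<in>k. ball x \<epsilon>)" using \<open>\<epsilon> > 0\<close> by auto
  finally show "\<exists>k. finite k \<and> closure (K ` cball 0 1) \<subseteq> (\<Union>x\<in>k. ball x \<epsilon>)" using k by blast
qed

text \<open>The abstract content of \<open>eigpairs\<close> for a positive self-adjoint operator,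
  with indices starting at 1. Completeness of the eigenvectors is not postulated; in its place
  stands \<open>exh\<close>, by which every eigenvector for a nonzero eigenvalue is a combination of
  listed ones with the same eigenvalue.\<close>

locale psd_spectrum =
  fixes K :: "'a::{real_inner, complete_space} \<Rightarrow> 'a" and s :: real
    and lam :: "nat \<Rightarrow> real" and psi :: "nat \<Rightarrow> 'a"
  assumes bl: "bounded_linear K" and sym: "inner (K x) y = inner x (K y)"
    and psd: "inner (K x) x \<ge> 0" and hs: "hs_bounded K s"
    and orth: "l \<ge> 1 \<Longrightarrow> m \<ge> 1 \<Longrightarrow> inner (psi l) (psi m) = (if l = m then 1 else 0)"
    and eig: "l \<ge> 1 \<Longrightarrow> K (psi l) = lam l *\<^sub>R psi l"
    and decr: "l \<ge> 1 \<Longrightarrow> lam (Suc l) \<le> lam l"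
    and exh: "\<mu> \<noteq> 0 \<Longrightarrow> K f = \<mu> *\<^sub>R f \<Longrightarrow>
      \<exists>F c. finite F \<and> F \<subseteq> {l. l \<ge> 1 \<and> lam l = \<mu>} \<and> f = (\<Sum>l\<in>F. c l *\<^sub>R psi l)"
begin

sublocale K: bounded_linear K by (rule bl)

lemma lam_nonneg: "l \<ge> 1 \<Longrightarrow> lam l \<ge> 0"
  using psd[of "psi l"] eig[of l] orth[of l l] by simp

lemma lam_mono:
  assumes "1 \<le> l" "l \<le> m"
  shows "lam m \<le> lam l"
  using assms(2)
proof (induction m rule: dec_induct)
  case (step n) thus ?case using decr[of n] assms(1) by simp
qed simp

text \<open>The form of \<open>K\<close> may be degenerate. The inequality comes from its
  nonnegativity at \<open>t *\<^sub>R x + y\<close>, a quadratic polynomial in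
  \<open>t\<close>.\<close>

lemma form_cauchy_schwarz: "(inner (K x) y)\<^sup>2 \<le> inner (K x) x * inner (K y) y"
proof -
  have q: "inner (K x) x * t\<^sup>2 + 2 * inner (K x) y * t + inner (K y) y \<ge> 0" for t :: real
  proof -
    have "inner (K (t *\<^sub>R x + y)) (t *\<^sub>R x + y) \<ge> 0" by (rule psd)
    moreover have "inner (K y) x = inner (K x) y" using sym[of y x] by (simp add: inner_commute)
    ultimately show ?thesis
      by (simp add: K.add K.scaleR inner_add_left inner_add_right power2_eq_square algebra_simps)
  qed
  define A B C where "A = inner (K x) x" and "B = inner (K x) y" and "C = inner (K y) y"
  have q': "A * t\<^sup>2 + 2 * B * t + C \<ge> 0" for t using q[of t] by (simp add: A_def B_def C_def)
  have "A \<ge> 0" "C \<ge> 0" by (auto simp: A_def C_def psd)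
  have "B\<^sup>2 \<le> A * C"
  proof (cases "A = 0")
    case True
    have "B = 0"
    proof (rule ccontr)
      assume "B \<noteq> 0"
      \<comment> \<open>With \<open>A = 0\<close> the polynomial is affine, and this argument makes
        it negative.\<close>
      hence "2 * B * (-(C+1)/(2*B)) + C = -1" by (simp add: field_simps)
      thus False using q'[of "-(C+1)/(2*B)"] True by simp
    qed
    thus ?thesis using True by simp
  next
    case False
    hence "A > 0" using \<open>A \<ge> 0\<close> by simp
    have "A * (-B/A)\<^sup>2 + 2 * B * (-B/A) + C \<ge> 0" by (rule q')
    moreover have "A * (-B/A)\<^sup>2 + 2 * B * (-B/A) + C = C - B\<^sup>2/A" using \<open>A > 0\<close>
      by (simp add: field_simps power2_eq_square)
    ultimately have "B\<^sup>2/A \<le> C" by simp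
    thus ?thesis using \<open>A > 0\<close> by (simp add: divide_le_eq mult.commute)
  qed
  thus ?thesis by (simp add: A_def B_def C_def)
qed

text \<open>One half of the min-max principle, obtained without an eigenbasis. If the form exceeded
  \<open>lam l\<close> on the complement \<open>V\<close>, its supremum \<mu> over unit vectors of
  \<open>V\<close> would be attained, by compactness, at an eigenvector for \<mu>. By
  \<open>exh\<close> this is a combination of vectors \<open>psi m\<close> with
  \<open>lam m = \<mu> > lam l\<close>; they have \<open>m < l\<close> and are orthogonal to
  \<open>V\<close>, so the eigenvector would vanish.\<close>

lemma rayleigh_complement:
  assumes l: "l \<ge> 1" and f: "\<And>m. 1 \<le> m \<Longrightarrow> m < l \<Longrightarrow> inner f (psi m) = 0"
  shows "inner (K f) f \<le> lam l * (norm f)\<^sup>2"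
proof (rule ccontr)
  assume neg: "\<not> ?thesis"
  define V where "V = {g. \<forall>m. 1 \<le> m \<longrightarrow> m < l \<longrightarrow> inner g (psi m) = 0}"
  have KV: "K g \<in> V" if "g \<in> V" for g
    using that unfolding V_def by (auto simp: sym eig)
  have VS: "c *\<^sub>R g \<in> V" if "g \<in> V" for g c using that unfolding V_def by auto
  have fV: "f \<in> V" using f unfolding V_def by auto
  have f0: "f \<noteq> 0" using neg by (auto simp: K.zero)
  define R where "R = {inner (K g) g | g. g \<in> V \<and> norm g = 1}"
  obtain k where k: "\<And>g. norm (K g) \<le> norm g * k" using K.bounded by blast
  have bdd: "bdd_above R"
  proof (rule bdd_aboveI[of _ k])
    fix y assume "y \<in> R"
    then obtain g where "y = inner (K g) g" "norm g = 1" unfolding R_def by auto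
    thus "y \<le> k" using norm_cauchy_schwarz[of "K g" g] k[of g] by simp
  qed
  define \<mu> where "\<mu> = Sup R"
  have f1: "inner (K (f /\<^sub>R norm f)) (f /\<^sub>R norm f) \<in> R"
    unfolding R_def using VS[OF fV] f0 by (intro CollectI exI[of _ "f /\<^sub>R norm f"] conjI refl) auto
  have f1': "inner (K (f /\<^sub>R norm f)) (f /\<^sub>R norm f) = inner (K f) f / (norm f)\<^sup>2"
    using f0 by (simp add: K.scaleR power2_eq_square field_simps)
  have "lam l < inner (K f) f / (norm f)\<^sup>2" using neg f0 by (simp add: field_simps)
  also have "\<dots> \<le> \<mu>" unfolding \<mu>_def f1'[symmetric] using f1 bdd by (rule cSup_upper)
  finally have mu: "\<mu> > lam l" .
  hence mu0: "\<mu> > 0" using lam_nonneg[OF l] by linarith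
  have ray: "inner (K g) g \<le> \<mu> * (norm g)\<^sup>2" if "g \<in> V" for g
  proof (cases "g = 0")
    case False
    have "inner (K (g /\<^sub>R norm g)) (g /\<^sub>R norm g) \<le> \<mu>"
      unfolding \<mu>_def
    proof (rule cSup_upper[OF _ bdd])
      show "inner (K (g /\<^sub>R norm g)) (g /\<^sub>R norm g) \<in> R"
        unfolding R_def using VS[OF that] False by (intro CollectI exI[of _ "g /\<^sub>R norm g"] conjI refl) auto
    qed
    moreover have "inner (K (g /\<^sub>R norm g)) (g /\<^sub>R norm g) = inner (K g) g / (norm g)\<^sup>2"
      using False by (simp add: K.scaleR power2_eq_square field_simps)
    ultimately have "inner (K g) g / (norm g)\<^sup>2 \<le> \<mu>" by simp
    thus ?thesis using False by (simp add: divide_le_eq)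
  qed (simp add: K.zero)
  \<comment> \<open>\<open>K\<close> maps \<open>V\<close> into itself, so Cauchy--Schwarz for the
    form, applied to \<open>g\<close> and \<open>K g\<close>, upgrades the bound on the form to a
    bound on the norm.\<close>
  have nK: "norm (K g) \<le> \<mu> * norm g" if "g \<in> V" for g
  proof (cases "K g = 0")
    case False
    have "((norm (K g))\<^sup>2)\<^sup>2 = (inner (K g) (K g))\<^sup>2" by (simp add: power2_norm_eq_inner)
    also have "\<dots> \<le> inner (K g) g * inner (K (K g)) (K g)" by (rule form_cauchy_schwarz)
    also have "\<dots> \<le> (\<mu> * (norm g)\<^sup>2) * (\<mu> * (norm (K g))\<^sup>2)"
      using that KV psd mu0 by (intro mult_mono ray) auto
    finally have "(norm (K g))\<^sup>2 * (norm (K g))\<^sup>2 \<le> (\<mu> * norm g)\<^sup>2 * (norm (K g))\<^sup>2"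
      by (simp add: power2_eq_square algebra_simps)
    hence "(norm (K g))\<^sup>2 \<le> (\<mu> * norm g)\<^sup>2" by (rule mult_right_le_imp_le) (use False in simp)
    thus ?thesis using mu0 by (simp add: power2_le_iff_abs_le)
  qed (use mu0 in simp)
  have "\<exists>g. g \<in> V \<and> norm g = 1 \<and> inner (K g) g > \<mu> - 1 / Suc n" for n :: nat
  proof -
    have "\<mu> - 1 / Suc n < \<mu>" by simp
    then obtain y where "y \<in> R" "\<mu> - 1 / Suc n < y"
      unfolding \<mu>_def using less_cSup_iff[OF _ bdd] f1 by blast
    thus ?thesis unfolding R_def by auto
  qed
  then obtain g where g: "\<And>n. g n \<in> V" "\<And>n. norm (g n) = 1" "\<And>n::nat. inner (K (g n)) (g n) > \<mu> - 1 / Suc n"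
    by metis
  \<comment> \<open>The norm bound from above and the form bound from below make a maximizing
    sequence a sequence of approximate eigenvectors.\<close>
  have diff: "(norm (K (g n) - \<mu> *\<^sub>R g n))\<^sup>2 \<le> 2 * \<mu> / Suc n" for n
  proof -
    have "(norm (K (g n) - \<mu> *\<^sub>R g n))\<^sup>2 = (norm (K (g n)))\<^sup>2 - 2 * \<mu> * inner (K (g n)) (g n) + \<mu>\<^sup>2"
    proof -
      have "inner (g n) (g n) = 1" using g(2)[of n] by (simp add: norm_eq_1)
      thus ?thesis unfolding power2_norm_eq_inner
        by (simp add: inner_diff_left inner_diff_right inner_commute[of "g n" "K (g n)"] power2_eq_square algebra_simps)
    qed
    moreover have "(norm (K (g n)))\<^sup>2 \<le> \<mu>\<^sup>2" using nK[OF g(1), of n] g(2)[of n] by (intro power_mono) auto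
    moreover have "2 * \<mu> * inner (K (g n)) (g n) \<ge> 2 * \<mu> * (\<mu> - 1 / Suc n)"
      using g(3)[of n] mu0 by (intro mult_left_mono) auto
    ultimately show ?thesis by (simp add: power2_eq_square algebra_simps)
  qed
  have l0: "(\<lambda>n. 2 * \<mu> * (1 / Suc n)) \<longlonglongrightarrow> 2 * \<mu> * 0"
    by (intro tendsto_mult_left) (use LIMSEQ_inverse_real_of_nat in \<open>simp add: inverse_eq_divide\<close>)
  have "(\<lambda>n. (norm (K (g n) - \<mu> *\<^sub>R g n))\<^sup>2) \<longlonglongrightarrow> 0"
  proof (rule real_tendsto_sandwich[where f="\<lambda>_. 0" and h="\<lambda>n. 2 * \<mu> * (1 / Suc n)"])
    show "\<forall>\<^sub>F n in sequentially. (norm (K (g n) - \<mu> *\<^sub>R g n))\<^sup>2 \<le> 2 * \<mu> * (1 / Suc n)"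
      using diff by (intro always_eventually allI) simp
  qed (use l0 in simp_all)
  hence "(\<lambda>n. sqrt ((norm (K (g n) - \<mu> *\<^sub>R g n))\<^sup>2)) \<longlonglongrightarrow> sqrt 0" by (rule tendsto_real_sqrt)
  hence "(\<lambda>n. norm (K (g n) - \<mu> *\<^sub>R g n)) \<longlonglongrightarrow> 0" by simp
  hence diff0: "(\<lambda>n. K (g n) - \<mu> *\<^sub>R g n) \<longlonglongrightarrow> 0" by (rule tendsto_norm_zero_cancel)
  have "K (g n) \<in> closure (K ` cball 0 1)" for n
  proof -
    have "K (g n) \<in> K ` cball 0 1" using g(2)[of n] by (intro imageI) simp
    thus ?thesis by (rule subsetD[OF closure_subset])
  qed
  then obtain r w where r: "strict_mono r" "((\<lambda>n. K (g n)) \<circ> r) \<longlonglongrightarrow> w"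
    using seq_compactE[OF compact_imp_seq_compact[OF hs_bounded_imp_compact[OF bl hs]], of "\<lambda>n. K (g n)"] by metis
  \<comment> \<open>Compactness gives convergence of the images only; since \<mu> is nonzero and the
    residuals vanish, the vectors themselves converge.\<close>
  have "(\<lambda>n. inverse \<mu> *\<^sub>R (((\<lambda>n. K (g n)) \<circ> r) n - ((\<lambda>n. K (g n) - \<mu> *\<^sub>R g n) \<circ> r) n)) \<longlonglongrightarrow> inverse \<mu> *\<^sub>R (w - 0)"
    by (intro tendsto_intros r LIMSEQ_subseq_LIMSEQ[OF diff0])
  hence glim: "(g \<circ> r) \<longlonglongrightarrow> inverse \<mu> *\<^sub>R w" using mu0 by (simp add: o_def)
  define v where "v = inverse \<mu> *\<^sub>R w"
  have "(\<lambda>n. norm ((g \<circ> r) n)) \<longlonglongrightarrow> norm v" using glim unfolding v_def by (rule tendsto_norm)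
  hence nv: "norm v = 1" using g(2) by (simp add: LIMSEQ_const_iff)
  have vV: "inner v (psi m) = 0" if "1 \<le> m" "m < l" for m
  proof -
    have "(\<lambda>n. inner ((g \<circ> r) n) (psi m)) \<longlonglongrightarrow> inner v (psi m)"
      using glim unfolding v_def by (intro tendsto_intros)
    moreover have "inner ((g \<circ> r) n) (psi m) = 0" for n using g(1)[of "r n"] that unfolding V_def by auto
    ultimately show ?thesis by (simp add: LIMSEQ_const_iff)
  qed
  have "(\<lambda>n. K ((g \<circ> r) n)) \<longlonglongrightarrow> K v" using glim unfolding v_def by (rule K.tendsto)
  hence "K v = w" using r(2) by (auto simp: o_def intro: LIMSEQ_unique)
  hence "K v = \<mu> *\<^sub>R v" using mu0 by (simp add: v_def)
  then obtain F c where F: "finite F" "F \<subseteq> {l. l \<ge> 1 \<and> lam l = \<mu>}" "v = (\<Sum>l\<in>F. c l *\<^sub>R psi l)"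
    using exh[of \<mu> v] mu0 by auto
  have "m < l" if "m \<in> F" for m
  proof (rule ccontr)
    assume "\<not> m < l"
    hence "lam m \<le> lam l" using l by (intro lam_mono) auto
    thus False using F(2) that mu by auto
  qed
  hence "inner v (\<Sum>l\<in>F. c l *\<^sub>R psi l) = 0" unfolding inner_sum_right using F(2) vV by (intro sum.neutral) auto
  hence "inner v v = 0" using F(3) by simp
  thus False using nv by (simp add: norm_eq_1)
qed

end

text \<open>Linear dependence of more vectors than a spanning set has elements, for indexed
  families: repeated vectors count separately, and two equal ones already give the coefficients 1
  and -1.\<close>

lemma nontrivial_combination:
  fixes v :: "nat \<Rightarrow> 'a::real_vector"
  assumes "finite t" "card t < l" "\<And>m. m \<in> {1..l} \<Longrightarrow> v m \<in> span t"
  shows "\<exists>c. (\<exists>m\<in>{1..l}. c m \<noteq> 0) \<and> (\<Sum>m\<in>{1..l}. c m *\<^sub>R v m) = 0"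
proof (cases "inj_on v {1..l}")
  case False
  then obtain i j where ij: "i \<in> {1..l}" "j \<in> {1..l}" "i \<noteq> j" "v i = v j" by (auto simp: inj_on_def)
  let ?c = "\<lambda>m. if m = i then 1 else if m = j then -1 else (0::real)"
  have "(\<Sum>m\<in>{1..l}. ?c m *\<^sub>R v m) = (\<Sum>m\<in>{1..l}. (if m = i then v i else 0) - (if m = j then v j else 0))"
    using ij by (intro sum.cong) auto
  also have "\<dots> = 0" using ij by (simp add: sum_subtractf)
  finally show ?thesis using ij by (intro exI[of _ ?c]) auto
next
  case True
  have "dependent (v ` {1..l})"
  proof (rule ccontr)
    assume "independent (v ` {1..l})"
    moreover have "v ` {1..l} \<subseteq> span t" using assms(3) by blast
    ultimately have "card (v ` {1..l}) \<le> card t" using independent_span_bound[OF assms(1)] by blast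
    thus False using True assms by (simp add: card_image)
  qed
  then obtain u where u: "\<exists>w\<in>v ` {1..l}. u w \<noteq> 0" "(\<Sum>w\<in>v ` {1..l}. u w *\<^sub>R w) = 0"
    using dependent_finite[of "v ` {1..l}"] by auto
  have "(\<Sum>m\<in>{1..l}. (u \<circ> v) m *\<^sub>R v m) = 0" using u(2) True by (simp add: sum.reindex)
  thus ?thesis using u(1) by (intro exI[of _ "u \<circ> v"]) auto
qed

text \<open>Counting dimensions, the span of \<open>psi2 1\<close>, ..., \<open>psi2 l\<close>
  contains a nonzero \<open>f\<close> orthogonal to the first \<open>l - 1\<close> vectors of
  \<open>psi1\<close>. On \<open>f\<close> the form of \<open>K2\<close> is at least
  \<open>lam2 l\<close> and, by \<open>rayleigh_complement\<close>, the form of \<open>K1\<close> is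
  at most \<open>lam1 l\<close>, both times \<open>(norm f)\<^sup>2\<close>.\<close>

lemma weyl_inequality:
  assumes "psd_spectrum K1 s1 lam1 psi1" "psd_spectrum K2 s2 lam2 psi2"
    and \<eta>: "\<And>x. norm (K1 x - K2 x) \<le> \<eta> * norm x" and l: "l \<ge> 1"
  shows "lam2 l \<le> lam1 l + \<eta>"
proof -
  interpret A: psd_spectrum K1 s1 lam1 psi1 by fact
  interpret B: psd_spectrum K2 s2 lam2 psi2 by fact
  let ?t = "psi1 ` {1..<l}"
  \<comment> \<open>The projections of the \<open>psi2 m\<close> onto the first \<open>l - 1\<close>
    vectors of \<open>psi1\<close>: these are \<open>l\<close> vectors in a space spanned by
    fewer.\<close>
  let ?v = "\<lambda>m. \<Sum>i\<in>{1..<l}. inner (psi2 m) (psi1 i) *\<^sub>R psi1 i"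
  have "\<exists>c. (\<exists>m\<in>{1..l}. c m \<noteq> 0) \<and> (\<Sum>m\<in>{1..l}. c m *\<^sub>R ?v m) = 0"
  proof (rule nontrivial_combination[of ?t])
    show "card ?t < l" using l card_image_le[of "{1..<l}" psi1] by simp
    show "?v m \<in> span ?t" for m by (intro span_sum span_scale span_base) auto
  qed auto
  then obtain c where c: "\<exists>m\<in>{1..l}. c m \<noteq> 0" "(\<Sum>m\<in>{1..l}. c m *\<^sub>R ?v m) = 0" by auto
  define f where "f = (\<Sum>m\<in>{1..l}. c m *\<^sub>R psi2 m)"
  have nf: "(norm f)\<^sup>2 = (\<Sum>m\<in>{1..l}. (c m)\<^sup>2)"
  proof -
    have "inner f f = (\<Sum>m\<in>{1..l}. \<Sum>i\<in>{1..l}. if i = m then c m * c m else 0)"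
      unfolding f_def inner_sum_left inner_sum_right by (intro sum.cong) (auto simp: B.orth)
    thus ?thesis unfolding power2_norm_eq_inner by (simp add: power2_eq_square)
  qed
  have Kf: "inner (K2 f) f = (\<Sum>m\<in>{1..l}. lam2 m * (c m)\<^sup>2)"
  proof -
    have "inner (K2 f) f = (\<Sum>m\<in>{1..l}. \<Sum>i\<in>{1..l}. if i = m then lam2 m * (c m)\<^sup>2 else 0)"
      unfolding f_def inner_sum_left inner_sum_right B.K.sum B.K.scaleR
      by (intro sum.cong) (auto simp: B.orth B.eig power2_eq_square)
    thus ?thesis by simp
  qed
  have "0 < (\<Sum>m\<in>{1..l}. (c m)\<^sup>2)"
    using c(1) by (auto intro: sum_pos2)
  hence f0: "0 < (norm f)\<^sup>2" using nf by simp
  have orth0: "inner f (psi1 i) = 0" if i: "1 \<le> i" "i < l" for i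
  proof -
    have "0 = inner (\<Sum>m\<in>{1..l}. c m *\<^sub>R ?v m) (psi1 i)" using c(2) by simp
    also have "\<dots> = (\<Sum>m\<in>{1..l}. c m * (\<Sum>k\<in>{1..<l}. if k = i then inner (psi2 m) (psi1 i) else 0))"
      unfolding inner_sum_left inner_scaleR_left using i
      by (intro sum.cong arg_cong2[where f="(*)"] refl) (auto simp: A.orth)
    also have "\<dots> = inner f (psi1 i)" using i by (simp add: f_def inner_sum_left)
    finally show ?thesis by simp
  qed
  have "lam2 l * (norm f)\<^sup>2 \<le> inner (K2 f) f"
    unfolding nf Kf sum_distrib_left by (intro sum_mono mult_right_mono B.lam_mono) auto
  also have "\<dots> = inner (K1 f) f - inner (K1 f - K2 f) f" by (simp add: inner_diff_left)
  also have "\<dots> \<le> lam1 l * (norm f)\<^sup>2 + \<eta> * (norm f)\<^sup>2"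
  proof -
    have "inner (K1 f) f \<le> lam1 l * (norm f)\<^sup>2" using l orth0 by (rule A.rayleigh_complement)
    moreover have "\<bar>inner (K1 f - K2 f) f\<bar> \<le> norm (K1 f - K2 f) * norm f" by (rule Cauchy_Schwarz_ineq2)
    moreover have "norm (K1 f - K2 f) * norm f \<le> (\<eta> * norm f) * norm f" by (intro mult_right_mono \<eta>) simp
    ultimately show ?thesis by (simp add: power2_eq_square)
  qed
  finally have "lam2 l * (norm f)\<^sup>2 \<le> (lam1 l + \<eta>) * (norm f)\<^sup>2" by (simp add: algebra_simps)
  thus ?thesis using f0 by simp
qed

text \<open>A residual argument. By Weyl's inequality \<open>psi2 l\<close> is an eigenvector of
  \<open>K1\<close> for \<open>lam1 l\<close> up to an error 2 \<eta>. The operator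
  \<open>K1\<close> minus \<open>lam1 l\<close> stretches by at least \<delta> the part of
  \<open>psi2 l\<close> orthogonal to \<open>psi1 l\<close>: the components along earlier
  \<open>psi1 m\<close> by the gaps, the remainder beyond \<open>l\<close> by the Rayleigh bound. So
  this part has norm at most 2 \<eta> / \<delta>, and the sign condition excludes the
  antipode.\<close>

lemma eigenvector_perturbation:
  assumes P1: "psd_spectrum K1 s1 lam1 psi1" and P2: "psd_spectrum K2 s2 lam2 psi2"
    and \<eta>: "\<And>x. norm (K1 x - K2 x) \<le> \<eta> * norm x" and l: "l \<ge> 1"
    and gap: "\<delta> > 0" "lam1 l - lam1 (Suc l) \<ge> \<delta>" "\<And>m. 1 \<le> m \<Longrightarrow> m < l \<Longrightarrow> lam1 m - lam1 l \<ge> \<delta>"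
    and sgn: "inner (psi2 l) (psi1 l) \<ge> 0"
  shows "norm (psi2 l - psi1 l) \<le> 3 * \<eta> / \<delta>"
proof -
  interpret A: psd_spectrum K1 s1 lam1 psi1 by fact
  interpret B: psd_spectrum K2 s2 lam2 psi2 by fact
  have n2: "norm (psi2 l) = 1" "norm (psi1 l) = 1" using A.orth[of l l] B.orth[of l l] l by (auto simp: norm_eq_1)
  have eta0: "\<eta> \<ge> 0" using order_trans[OF norm_ge_zero \<eta>[of "psi2 l"]] n2 by simp
  have w: "\<bar>lam1 l - lam2 l\<bar> \<le> \<eta>"
  proof -
    have "norm (K2 x - K1 x) \<le> \<eta> * norm x" for x using \<eta>[of x] by (simp add: norm_minus_commute)
    hence "lam1 l \<le> lam2 l + \<eta>" by (rule weyl_inequality[OF P2 P1 _ l])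
    moreover have "lam2 l \<le> lam1 l + \<eta>" by (rule weyl_inequality[OF P1 P2 \<eta> l])
    ultimately show ?thesis by linarith
  qed
  have res: "norm (K1 (psi2 l) - lam1 l *\<^sub>R psi2 l) \<le> 2 * \<eta>"
  proof -
    have "K1 (psi2 l) - lam1 l *\<^sub>R psi2 l = (K1 (psi2 l) - K2 (psi2 l)) - (lam1 l - lam2 l) *\<^sub>R psi2 l"
      using B.eig[OF l] by (simp add: algebra_simps)
    also have "norm \<dots> \<le> norm (K1 (psi2 l) - K2 (psi2 l)) + norm ((lam1 l - lam2 l) *\<^sub>R psi2 l)"
      by (rule norm_triangle_ineq4)
    also have "\<dots> \<le> \<eta> + \<eta>" using \<eta>[of "psi2 l"] n2 w by (intro add_mono) auto
    finally show ?thesis by simp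
  qed
  define a where "a m = inner (psi2 l) (psi1 m)" for m
  define r where "r = psi2 l - (\<Sum>m\<in>{1..l}. a m *\<^sub>R psi1 m)"
  have inj: "inj_on psi1 {1..l}"
  proof (rule inj_onI)
    fix x y assume "x \<in> {1..l}" "y \<in> {1..l}" "psi1 x = psi1 y"
    thus "x = y" using A.orth[of x y] A.orth[of x x] by (auto split: if_splits)
  qed
  have on: "orthonormal (psi1 ` {1..l})"
    unfolding orthonormal_def pairwise_def orthogonal_def using A.orth by (auto simp: norm_eq_1)
  have sumi: "(\<Sum>e\<in>psi1 ` {1..l}. f e) = (\<Sum>m\<in>{1..l}. f (psi1 m))" for f :: "'a \<Rightarrow> 'b::comm_monoid_add"
    using inj by (simp add: sum.reindex)
  have rorth: "inner r (psi1 m) = 0" if "1 \<le> m" "m \<le> l" for m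
    using orthonormal_proj_orth[of "psi1 ` {1..l}" "psi1 m" "psi2 l"] on that
    unfolding r_def a_def sumi by auto
  have one: "1 = (\<Sum>m\<in>{1..l}. (a m)\<^sup>2) + (norm r)\<^sup>2"
    using orthonormal_proj_norm[of "psi1 ` {1..l}" "psi2 l"] on n2 unfolding r_def a_def sumi
    by simp
  have spl: "{1..l} = insert l {1..<l}" using l by auto
  have one': "1 = (a l)\<^sup>2 + (\<Sum>m\<in>{1..<l}. (a m)\<^sup>2) + (norm r)\<^sup>2" using one spl by simp
  define z where "z = K1 r - lam1 l *\<^sub>R r"
  define y where "y = (\<Sum>m\<in>{1..<l}. (a m * (lam1 m - lam1 l)) *\<^sub>R psi1 m)"
  have dec: "K1 (psi2 l) - lam1 l *\<^sub>R psi2 l = y + z"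
  proof -
    have p: "psi2 l = (\<Sum>m\<in>{1..l}. a m *\<^sub>R psi1 m) + r" unfolding r_def by simp
    have "K1 (\<Sum>m\<in>{1..l}. a m *\<^sub>R psi1 m) - lam1 l *\<^sub>R (\<Sum>m\<in>{1..l}. a m *\<^sub>R psi1 m)
       = (\<Sum>m\<in>{1..l}. (a m * (lam1 m - lam1 l)) *\<^sub>R psi1 m)"
      unfolding A.K.sum A.K.scaleR scaleR_sum_right sum_subtractf[symmetric]
      by (intro sum.cong) (auto simp: A.eig algebra_simps)
    also have "\<dots> = y" unfolding y_def spl by simp
    finally have "K1 (\<Sum>m\<in>{1..l}. a m *\<^sub>R psi1 m) - lam1 l *\<^sub>R (\<Sum>m\<in>{1..l}. a m *\<^sub>R psi1 m) = y" .
    thus ?thesis unfolding z_def by (subst (1 2) p) (simp add: A.K.add algebra_simps)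
  qed
  have zorth: "inner (psi1 m) z = 0" if "1 \<le> m" "m \<le> l" for m
    unfolding z_def using that rorth[of m] A.sym[of r "psi1 m"] by (simp add: inner_diff_right A.eig inner_commute)
  have yz: "inner y z = 0" unfolding y_def inner_sum_left using zorth by (intro sum.neutral) auto
  have ny: "(norm y)\<^sup>2 \<ge> \<delta>\<^sup>2 * (\<Sum>m\<in>{1..<l}. (a m)\<^sup>2)"
  proof -
    have "inner y y = (\<Sum>m\<in>{1..<l}. \<Sum>i\<in>{1..<l}. if i = m then (a m * (lam1 m - lam1 l))\<^sup>2 else 0)"
      unfolding y_def inner_sum_left inner_sum_right
      by (intro sum.cong) (auto simp: A.orth power2_eq_square)
    also have "\<dots> = (\<Sum>m\<in>{1..<l}. (a m)\<^sup>2 * (lam1 m - lam1 l)\<^sup>2)" by (simp add: power_mult_distrib)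
    also have "\<dots> \<ge> (\<Sum>m\<in>{1..<l}. (a m)\<^sup>2 * \<delta>\<^sup>2)"
      using gap by (intro sum_mono mult_left_mono power_mono) auto
    finally show ?thesis by (simp add: power2_norm_eq_inner sum_distrib_left mult.commute)
  qed
  \<comment> \<open>Beyond the index \<open>l\<close> no expansion in eigenvectors is available; the
    Rayleigh bound on the complement takes its place and brings in the gap to
    \<open>lam1 (Suc l)\<close>.\<close>
  have nz: "norm z \<ge> \<delta> * norm r"
  proof (cases "r = 0")
    case False
    have "inner (K1 r) r \<le> lam1 (Suc l) * (norm r)\<^sup>2"
      using rorth by (intro A.rayleigh_complement) auto
    hence "inner (lam1 l *\<^sub>R r - K1 r) r \<ge> (lam1 l - lam1 (Suc l)) * (norm r)\<^sup>2"
      by (simp add: inner_diff_left power2_norm_eq_inner algebra_simps)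
    moreover have "(lam1 l - lam1 (Suc l)) * (norm r)\<^sup>2 \<ge> \<delta> * (norm r)\<^sup>2" using gap by (intro mult_right_mono) auto
    moreover have "inner (lam1 l *\<^sub>R r - K1 r) r \<le> norm z * norm r"
      using norm_cauchy_schwarz[of "lam1 l *\<^sub>R r - K1 r" r] unfolding z_def by (simp add: norm_minus_commute)
    ultimately have "\<delta> * norm r * norm r \<le> norm z * norm r" by (simp add: power2_eq_square)
    thus ?thesis using False by simp
  qed simp
  have "\<delta>\<^sup>2 * (1 - (a l)\<^sup>2) = \<delta>\<^sup>2 * (\<Sum>m\<in>{1..<l}. (a m)\<^sup>2) + (\<delta> * norm r)\<^sup>2"
  proof -
    have "1 - (a l)\<^sup>2 = (\<Sum>m\<in>{1..<l}. (a m)\<^sup>2) + (norm r)\<^sup>2" using one' by simp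
    thus ?thesis by (simp add: distrib_left power_mult_distrib)
  qed
  also have "\<dots> \<le> (norm y)\<^sup>2 + (norm z)\<^sup>2" using ny nz gap by (intro add_mono power_mono) auto
  also have "\<dots> = (norm (y + z))\<^sup>2" using yz by (simp add: power2_norm_eq_inner inner_add_left inner_add_right inner_commute)
  also have "\<dots> \<le> (2 * \<eta>)\<^sup>2" using res dec by (intro power_mono) auto
  finally have key: "\<delta>\<^sup>2 * (1 - (a l)\<^sup>2) \<le> 4 * \<eta>\<^sup>2" by (simp add: power_mult_distrib)
  have a1: "a l \<le> 1" "a l \<ge> 0"
    using norm_cauchy_schwarz[of "psi2 l" "psi1 l"] n2 sgn unfolding a_def by auto
  have "(norm (psi2 l - psi1 l))\<^sup>2 = 2 * (1 - a l)"
    using n2 by (simp add: power2_norm_eq_inner inner_diff_left inner_diff_right inner_commute norm_eq_1 a_def)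
  also have "\<dots> \<le> 2 * (1 - (a l)\<^sup>2)" using a1 by (simp add: power2_eq_square mult_left_le)
  finally have "\<delta>\<^sup>2 * (norm (psi2 l - psi1 l))\<^sup>2 \<le> \<delta>\<^sup>2 * (2 * (1 - (a l)\<^sup>2))" by (intro mult_left_mono) auto
  also have "\<dots> \<le> 8 * \<eta>\<^sup>2" using key by (simp add: algebra_simps)
  \<comment> \<open>The argument yields the square root of 8, rounded up to 3.\<close>
  also have "\<dots> \<le> (3 * \<eta>)\<^sup>2" by (simp add: power_mult_distrib)
  finally have "(\<delta> * norm (psi2 l - psi1 l))\<^sup>2 \<le> (3 * \<eta>)\<^sup>2" by (simp add: power_mult_distrib)
  hence "\<delta> * norm (psi2 l - psi1 l) \<le> 3 * \<eta>" by (rule power2_le_imp_le) (use eta0 in simp)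
  thus ?thesis using gap by (simp add: field_simps)
qed

section \<open>Exponential inequalities in Hilbert spaces\<close>

lemma borel_measurable_cosh [measurable (raw)]:
  "f \<in> borel_measurable M \<Longrightarrow> (\<lambda>x. cosh (f x :: real)) \<in> borel_measurable M"
  by (rule measurable_compose[OF _ borel_measurable_continuous_onI]) (auto intro: continuous_on_cosh)

lemma cosh_sums: "(\<lambda>n. x ^ (2 * n) / fact (2 * n)) sums cosh (x :: real)"
proof -
  have "(\<lambda>n. if even (2 * n) then x ^ (2 * n) /\<^sub>R fact (2 * n) else 0) sums cosh x"
    by (subst sums_mono_reindex[of "\<lambda>n. 2 * n" "\<lambda>n. if even n then x ^ n /\<^sub>R fact n else 0"])
       (auto simp: strict_mono_def cosh_converges elim!: evenE)
  thus ?thesis by (simp add: divide_inverse mult.commute)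
qed

text \<open>As a function of \<open>z\<close>, \<open>cosh (sqrt z)\<close> is a power series with
  nonnegative coefficients, so it inherits the convexity of the monomials.\<close>

lemma cosh_sqrt_convex:
  assumes "0 \<le> z1" "0 \<le> z2" "0 \<le> u" "u \<le> 1"
  shows "cosh (sqrt ((1 - u) * z1 + u * z2)) \<le> (1 - u) * cosh (sqrt z1) + u * cosh (sqrt z2)"
proof -
  let ?z = "(1 - u) * z1 + u * z2"
  have z: "?z \<ge> 0" using assms by simp
  have s: "(\<lambda>n. w ^ n / fact (2 * n)) sums cosh (sqrt w)" if "w \<ge> 0" for w :: real
    using cosh_sums[of "sqrt w"] that by (simp add: power_mult)
  have "cosh (sqrt ?z) \<le> (1 - u) * cosh (sqrt z1) + u * cosh (sqrt z2)"
  proof (rule sums_le[OF _ s[OF z] sums_add[OF sums_mult[OF s[OF assms(1)]] sums_mult[OF s[OF assms(2)]]]])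
    fix n
    have "?z ^ n \<le> (1 - u) * z1 ^ n + u * z2 ^ n"
      using convex_onD[of "{0..}" "\<lambda>x. x ^ n" u z1 z2] convex_power_odd[of n] assms
        convex_on_subset[OF convex_power_even[of n], of "{0..}"] by (cases "even n") auto
    hence "?z ^ n / fact (2 * n) \<le> ((1 - u) * z1 ^ n + u * z2 ^ n) / fact (2 * n)"
      by (intro divide_right_mono) auto
    thus "?z ^ n / fact (2 * n) \<le> (1 - u) * (z1 ^ n / fact (2 * n)) + u * (z2 ^ n / fact (2 * n))"
      by (simp add: add_divide_distrib)
  qed
  thus ?thesis .
qed

lemma sinh_ge_self: "x \<ge> 0 \<Longrightarrow> sinh (x :: real) \<ge> x"
  using real_le_x_sinh[of x] by (simp add: sinh_field_def exp_minus)

text \<open>The term linear in \<open>y\<close> is isolated so that it vanishes upon taking expectations over a centered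
  \<open>y\<close>, which is what drives Pinelis' inequality below.\<close>

lemma cosh_norm_add_le:
  fixes x y :: "'a::real_inner"
  shows "cosh (norm (x + y)) \<le> cosh (norm x) * (exp (norm y) - norm y) + inner x y * (sinh (norm x) / norm x)"
proof (cases "x = 0 \<or> y = 0")
  case True
  have "cosh (norm y) \<le> exp (norm y) - norm y"
    using sinh_ge_self[of "norm y"] sinh_plus_cosh[of "norm y"] by simp
  thus ?thesis using True by auto
next
  case False
  define \<alpha> \<delta> where "\<alpha> = norm x" and "\<delta> = norm y"
  have pos: "\<alpha> > 0" "\<delta> > 0" using False by (auto simp: \<alpha>_def \<delta>_def)
  define c where "c = inner x y / (\<alpha> * \<delta>)"
  have ic: "inner x y = c * (\<alpha> * \<delta>)" using pos by (simp add: c_def)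
  have "\<bar>inner x y\<bar> \<le> \<alpha> * \<delta>" unfolding \<alpha>_def \<delta>_def by (rule Cauchy_Schwarz_ineq2)
  hence "\<bar>c\<bar> \<le> 1" using pos by (simp add: c_def abs_mult)
  hence c: "-1 \<le> c" "c \<le> 1" by auto
  \<comment> \<open>Here \<open>c\<close> is the cosine of the angle between \<open>x\<close> and
    \<open>y\<close>. The squared norm of the sum interpolates linearly in \<open>c\<close> between
    the parallel and the antiparallel case, so convexity of \<open>cosh (sqrt z)\<close> reduces
    everything to real numbers.\<close>
  let ?u = "(1 - c) / 2"
  have "(norm (x + y))\<^sup>2 = (1 - ?u) * (\<alpha> + \<delta>)\<^sup>2 + ?u * (\<alpha> - \<delta>)\<^sup>2"
  proof -
    have "(norm (x + y))\<^sup>2 = \<alpha>\<^sup>2 + 2 * c * (\<alpha> * \<delta>) + \<delta>\<^sup>2"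
      unfolding \<alpha>_def \<delta>_def using ic
      by (simp add: power2_norm_eq_inner inner_add_left inner_add_right inner_commute \<alpha>_def \<delta>_def)
    thus ?thesis by (simp add: field_simps power2_eq_square)
  qed
  hence "norm (x + y) = sqrt ((1 - ?u) * (\<alpha> + \<delta>)\<^sup>2 + ?u * (\<alpha> - \<delta>)\<^sup>2)"
    by (metis norm_ge_zero real_sqrt_unique)
  hence "cosh (norm (x + y)) \<le> (1 - ?u) * cosh (sqrt ((\<alpha> + \<delta>)\<^sup>2)) + ?u * cosh (sqrt ((\<alpha> - \<delta>)\<^sup>2))"
    using c by (simp only:, intro cosh_sqrt_convex) auto
  also have "\<dots> = cosh \<alpha> * cosh \<delta> + c * (sinh \<alpha> * sinh \<delta>)"
    using pos by (simp add: cosh_add cosh_diff field_simps)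
  also have "\<dots> \<le> cosh \<alpha> * (exp \<delta> - \<delta>) + c * \<delta> * sinh \<alpha>"
  proof -
    have "c * sinh \<alpha> \<le> 1 * cosh \<alpha>"
      using c pos sinh_le_cosh_real[of \<alpha>] by (intro mult_mono) auto
    hence "(c * sinh \<alpha>) * (sinh \<delta> - \<delta>) \<le> cosh \<alpha> * (sinh \<delta> - \<delta>)"
      using sinh_ge_self[of \<delta>] pos by (intro mult_right_mono) auto
    moreover have "exp \<delta> = cosh \<delta> + sinh \<delta>" by (simp add: cosh_plus_sinh)
    ultimately show ?thesis by (simp add: algebra_simps)
  qed
  also have "c * \<delta> * sinh \<alpha> = inner x y * (sinh \<alpha> / \<alpha>)" using ic pos by simp
  finally show ?thesis unfolding \<alpha>_def \<delta>_def .
qed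

text \<open>The expansion starts at order 2, where every power of \<open>r\<close> is at most
  \<open>r\<^sup>2\<close>. An exponential moment at one fixed rate \<kappa> thus yields a remainder
  that is quadratic in \<tau> / \<kappa> for smaller rates \<tau>.\<close>

lemma exp_remainder_scale:
  fixes x r :: real
  assumes "x \<ge> 0" "0 \<le> r" "r \<le> 1"
  shows "exp (r * x) - r * x \<le> 1 + r\<^sup>2 * exp x"
proof -
  have s: "(\<lambda>n. y ^ (n + 2) / fact (n + 2)) sums (exp y - 1 - y)" for y :: real
    using sums_split_initial_segment[OF exp_converges[of y], of 2]
    by (simp add: eval_nat_numeral divide_inverse mult.commute algebra_simps)
  have "exp (r * x) - 1 - r * x \<le> r\<^sup>2 * (exp x - 1 - x)"
  proof (rule sums_le[OF _ s sums_mult[OF s]])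
    fix n
    have "r ^ (n + 2) \<le> r\<^sup>2" using assms by (intro power_decreasing) auto
    hence "r ^ (n + 2) * x ^ (n + 2) \<le> r\<^sup>2 * x ^ (n + 2)" using assms by (intro mult_right_mono) auto
    hence "(r ^ (n + 2) * x ^ (n + 2)) / fact (n + 2) \<le> (r\<^sup>2 * x ^ (n + 2)) / fact (n + 2)"
      by (intro divide_right_mono) auto
    thus "(r * x) ^ (n + 2) / fact (n + 2) \<le> r\<^sup>2 * (x ^ (n + 2) / fact (n + 2))"
      by (simp only: power_mult_distrib times_divide_eq_right)
  qed
  also have "\<dots> \<le> r\<^sup>2 * exp x" using assms by (intro mult_left_mono) auto
  finally show ?thesis by simp
qed

text \<open>Integration of \<open>cosh_norm_add_le\<close> over a centered \<open>Y\<close> with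
  \<open>x\<close> frozen: the linear term disappears and \<open>exp_remainder_scale\<close> leaves
  a growth factor whose excess over 1 is quadratic in \<tau>.\<close>

lemma (in prob_space) pinelis_step:
  fixes Y :: "'a \<Rightarrow> 'b::{real_inner, second_countable_topology}"
  assumes Y[measurable]: "Y \<in> borel_measurable M"
    and int: "integrable M (\<lambda>\<omega>. exp (\<kappa> * norm (Y \<omega>)))" and c: "expectation (\<lambda>\<omega>. exp (\<kappa> * norm (Y \<omega>))) \<le> c"
    and cent: "\<And>v. expectation (\<lambda>\<omega>. inner v (Y \<omega>)) = 0"
    and k: "\<kappa> > 0" "0 \<le> \<tau>" "\<tau> \<le> \<kappa>"
  shows "(\<integral>\<^sup>+\<omega>. cosh (\<tau> * norm (x + Y \<omega>)) \<partial>M) \<le> ennreal (cosh (\<tau> * norm x) * (1 + c * (\<tau>/\<kappa>)\<^sup>2))"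
proof -
  have intn: "integrable M (\<lambda>\<omega>. norm (Y \<omega>))"
  proof (rule Bochner_Integration.integrable_bound[OF integrable_mult_right[OF int, of "1/\<kappa>"]])
    show "AE \<omega> in M. norm (norm (Y \<omega>)) \<le> norm (1/\<kappa> * exp (\<kappa> * norm (Y \<omega>)))"
    proof (rule AE_I2)
      fix \<omega>
      have "\<kappa> * norm (Y \<omega>) \<le> exp (\<kappa> * norm (Y \<omega>))" using exp_ge_add_one_self[of "\<kappa> * norm (Y \<omega>)"] by linarith
      thus "norm (norm (Y \<omega>)) \<le> norm (1/\<kappa> * exp (\<kappa> * norm (Y \<omega>)))" using k by (simp add: field_simps)
    qed
  qed simp
  have inti: "integrable M (\<lambda>\<omega>. inner v (Y \<omega>))" for v
    by (rule Bochner_Integration.integrable_bound[OF integrable_mult_right[OF intn, of "norm v"]])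
       (auto intro: Cauchy_Schwarz_ineq2)
  have pt: "exp (\<tau> * norm y) - \<tau> * norm y \<le> 1 + (\<tau>/\<kappa>)\<^sup>2 * exp (\<kappa> * norm y)" for y :: 'b
    using exp_remainder_scale[of "\<kappa> * norm y" "\<tau>/\<kappa>"] k by simp
  define g where "g \<omega> = cosh (\<tau> * norm x) * (1 + (\<tau>/\<kappa>)\<^sup>2 * exp (\<kappa> * norm (Y \<omega>)))
     + \<tau> * (sinh (norm (\<tau> *\<^sub>R x)) / norm (\<tau> *\<^sub>R x)) * inner (\<tau> *\<^sub>R x) (Y \<omega>)" for \<omega>
  have le: "cosh (\<tau> * norm (x + Y \<omega>)) \<le> g \<omega>" for \<omega>
  proof -
    have "\<tau> * norm (x + Y \<omega>) = norm (\<tau> *\<^sub>R x + \<tau> *\<^sub>R Y \<omega>)"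
      using k by (simp add: scaleR_add_right[symmetric])
    hence "cosh (\<tau> * norm (x + Y \<omega>)) \<le> cosh (norm (\<tau> *\<^sub>R x)) * (exp (norm (\<tau> *\<^sub>R Y \<omega>)) - norm (\<tau> *\<^sub>R Y \<omega>))
       + inner (\<tau> *\<^sub>R x) (\<tau> *\<^sub>R Y \<omega>) * (sinh (norm (\<tau> *\<^sub>R x)) / norm (\<tau> *\<^sub>R x))"
      by (simp only: cosh_norm_add_le)
    also have "\<dots> \<le> cosh (norm (\<tau> *\<^sub>R x)) * (1 + (\<tau>/\<kappa>)\<^sup>2 * exp (\<kappa> * norm (Y \<omega>)))
       + inner (\<tau> *\<^sub>R x) (\<tau> *\<^sub>R Y \<omega>) * (sinh (norm (\<tau> *\<^sub>R x)) / norm (\<tau> *\<^sub>R x))"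
      using pt[of "Y \<omega>"] k by (intro add_right_mono mult_left_mono) auto
    also have "\<dots> = g \<omega>" using k by (simp add: g_def)
    finally show ?thesis .
  qed
  have intg: "integrable M g" unfolding g_def using int inti[of "\<tau> *\<^sub>R x"]
    by (intro Bochner_Integration.integrable_add integrable_mult_right integrable_const) auto
  have "(\<integral>\<^sup>+\<omega>. cosh (\<tau> * norm (x + Y \<omega>)) \<partial>M) \<le> (\<integral>\<^sup>+\<omega>. g \<omega> \<partial>M)"
    by (intro nn_integral_mono ennreal_leI le)
  also have "\<dots> = ennreal (expectation g)"
    using order_trans[OF cosh_real_nonneg le] by (intro nn_integral_eq_integral intg) auto
  also have "expectation g = cosh (\<tau> * norm x) * (1 + (\<tau>/\<kappa>)\<^sup>2 * expectation (\<lambda>\<omega>. exp (\<kappa> * norm (Y \<omega>))))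
     + \<tau> * (sinh (norm (\<tau> *\<^sub>R x)) / norm (\<tau> *\<^sub>R x)) * expectation (\<lambda>\<omega>. inner (\<tau> *\<^sub>R x) (Y \<omega>))"
    unfolding g_def using int inti[of "\<tau> *\<^sub>R x"] 
    by (subst Bochner_Integration.integral_add) (auto simp: prob_space intro!: integrable_mult_right Bochner_Integration.integrable_add)
  also have "\<dots> \<le> cosh (\<tau> * norm x) * (1 + c * (\<tau>/\<kappa>)\<^sup>2)"
    unfolding cent using c by (auto intro!: mult_left_mono simp: mult.commute[of c])
  finally show ?thesis using ennreal_leI order_trans by blast
qed

lemma (in prob_space) indep_vars_sum_insert:
  fixes X :: "'i \<Rightarrow> 'a \<Rightarrow> 'b::{second_countable_topology, real_normed_vector}"
  assumes I: "finite I" "i \<notin> I" and indep: "indep_vars (\<lambda>_. borel) X (insert i I)"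
  shows "indep_var borel (X i) borel (\<lambda>\<omega>. \<Sum>i\<in>I. X i \<omega>)"
proof -
  have "indep_var
    borel ((\<lambda>f. f i) \<circ> (\<lambda>\<omega>. restrict (\<lambda>i. X i \<omega>) {i}))
    borel ((\<lambda>f. \<Sum>i\<in>I. f i) \<circ> (\<lambda>\<omega>. restrict (\<lambda>i. X i \<omega>) I))"
    using I by (intro indep_var_compose[OF indep_var_restrict[OF indep]]) auto
  also have "((\<lambda>f. f i) \<circ> (\<lambda>\<omega>. restrict (\<lambda>i. X i \<omega>) {i})) = X i" by auto
  also have "((\<lambda>f. \<Sum>i\<in>I. f i) \<circ> (\<lambda>\<omega>. restrict (\<lambda>i. X i \<omega>) I)) = (\<lambda>\<omega>. \<Sum>i\<in>I. X i \<omega>)"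
    by (auto cong: rev_conj_cong)
  finally show ?thesis .
qed

text \<open>By independence the joint law of the new summand and the partial sum is a product, so
  the partial sum can be frozen in \<open>pinelis_step\<close>. Each summand costs one factor, and
  the bound does not depend on the dimension.\<close>

lemma (in prob_space) pinelis:
  fixes Y :: "'i \<Rightarrow> 'a \<Rightarrow> 'b::{real_inner, second_countable_topology}"
  assumes fin: "finite I" and ind: "indep_vars (\<lambda>_. borel) Y I"
    and int: "\<And>i. i \<in> I \<Longrightarrow> integrable M (\<lambda>\<omega>. exp (\<kappa> * norm (Y i \<omega>)))"
    and c: "\<And>i. i \<in> I \<Longrightarrow> expectation (\<lambda>\<omega>. exp (\<kappa> * norm (Y i \<omega>))) \<le> c"
    and cent: "\<And>i v. i \<in> I \<Longrightarrow> expectation (\<lambda>\<omega>. inner v (Y i \<omega>)) = 0"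
    and k: "\<kappa> > 0" "0 \<le> \<tau>" "\<tau> \<le> \<kappa>" and c0: "c \<ge> 0"
  shows "(\<integral>\<^sup>+\<omega>. cosh (\<tau> * norm (\<Sum>i\<in>I. Y i \<omega>)) \<partial>M) \<le> ennreal ((1 + c * (\<tau>/\<kappa>)\<^sup>2) ^ card I)"
  using fin ind int c cent
proof (induction I)
  case empty
  show ?case by (simp add: emeasure_space_1)
next
  case (insert i I)
  define S where "S \<omega> = (\<Sum>i\<in>I. Y i \<omega>)" for \<omega>
  have iv: "indep_var borel (Y i) borel S"
    unfolding S_def by (rule indep_vars_sum_insert) (use insert in auto)
  have [measurable]: "Y i \<in> borel_measurable M" "S \<in> borel_measurable M"
    using indep_var_rv1[OF iv] indep_var_rv2[OF iv] by auto
  interpret D: prob_space "distr M borel (Y i)" by (rule prob_space_distr) simp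
  interpret DS: prob_space "distr M borel S" by (rule prob_space_distr) simp
  interpret P: pair_sigma_finite "distr M borel (Y i)" "distr M borel S" ..
  have IH: "(\<integral>\<^sup>+\<omega>. cosh (\<tau> * norm (S \<omega>)) \<partial>M) \<le> ennreal ((1 + c * (\<tau>/\<kappa>)\<^sup>2) ^ card I)"
    unfolding S_def using insert.prems by (intro insert.IH indep_vars_subset[OF insert.prems(1)]) auto
  have "(\<integral>\<^sup>+\<omega>. cosh (\<tau> * norm (\<Sum>i\<in>insert i I. Y i \<omega>)) \<partial>M) = (\<integral>\<^sup>+\<omega>. cosh (\<tau> * norm (S \<omega> + Y i \<omega>)) \<partial>M)"
    using insert.hyps by (simp add: S_def add.commute)
  also have "\<dots> = (\<integral>\<^sup>+z. cosh (\<tau> * norm (snd z + fst z)) \<partial>distr M (borel \<Otimes>\<^sub>M borel) (\<lambda>\<omega>. (Y i \<omega>, S \<omega>)))"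
    by (subst nn_integral_distr) auto
  also have "\<dots> = (\<integral>\<^sup>+z. cosh (\<tau> * norm (snd z + fst z)) \<partial>(distr M borel (Y i) \<Otimes>\<^sub>M distr M borel S))"
    using iv unfolding indep_var_distribution_eq by simp
  also have "\<dots> = (\<integral>\<^sup>+s. \<integral>\<^sup>+y. cosh (\<tau> * norm (s + y)) \<partial>distr M borel (Y i) \<partial>distr M borel S)"
    by (subst P.nn_integral_snd[symmetric]) auto
  also have "\<dots> \<le> (\<integral>\<^sup>+s. ennreal (cosh (\<tau> * norm s) * (1 + c * (\<tau>/\<kappa>)\<^sup>2)) \<partial>distr M borel S)"
  proof (rule nn_integral_mono)
    fix s
    have "(\<integral>\<^sup>+y. cosh (\<tau> * norm (s + y)) \<partial>distr M borel (Y i)) = (\<integral>\<^sup>+\<omega>. cosh (\<tau> * norm (s + Y i \<omega>)) \<partial>M)"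
      by (subst nn_integral_distr) auto
    also have "\<dots> \<le> ennreal (cosh (\<tau> * norm s) * (1 + c * (\<tau>/\<kappa>)\<^sup>2))"
      using insert.prems k by (intro pinelis_step) auto
    finally show "(\<integral>\<^sup>+y. cosh (\<tau> * norm (s + y)) \<partial>distr M borel (Y i)) \<le> \<dots>" .
  qed
  also have "\<dots> = (\<integral>\<^sup>+\<omega>. ennreal (cosh (\<tau> * norm (S \<omega>))) * ennreal (1 + c * (\<tau>/\<kappa>)\<^sup>2) \<partial>M)"
    using c0 by (subst nn_integral_distr) (auto simp: ennreal_mult)
  also have "\<dots> = (\<integral>\<^sup>+\<omega>. ennreal (cosh (\<tau> * norm (S \<omega>))) \<partial>M) * ennreal (1 + c * (\<tau>/\<kappa>)\<^sup>2)"
    by (rule nn_integral_multc) simp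
  also have "\<dots> \<le> ennreal ((1 + c * (\<tau>/\<kappa>)\<^sup>2) ^ card I) * ennreal (1 + c * (\<tau>/\<kappa>)\<^sup>2)"
    by (intro mult_right_mono IH) auto
  also have "\<dots> = ennreal ((1 + c * (\<tau>/\<kappa>)\<^sup>2) ^ card (insert i I))"
    using insert.hyps c0 by (subst ennreal_mult[symmetric]) (auto simp: mult.commute)
  finally show ?case .
qed

text \<open>The exponential of a square is a Gaussian average of exponentials of linear functions.
  In this way a hypothesis on linear exponents is turned into a bound for square exponents.\<close>

lemma exp_half_square_eq_gaussian_mixture:
  "ennreal (exp (t\<^sup>2 / 2)) = (\<integral>\<^sup>+g. ennreal (exp (t * g)) * ennreal (std_normal_density g) \<partial>lborel)"
proof -
  have "(\<integral>\<^sup>+g. ennreal (exp (t * g)) * ennreal (std_normal_density g) \<partial>lborel) =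
     (\<integral>\<^sup>+g. ennreal (exp (t\<^sup>2 / 2)) * ennreal (normal_density t 1 g) \<partial>lborel)"
  proof (intro nn_integral_cong)
    fix g
    have "exp (t * g) * std_normal_density g = exp (t\<^sup>2 / 2) * normal_density t 1 g"
      unfolding normal_density_def
      by (simp add: exp_add[symmetric] exp_diff[symmetric] power2_eq_square field_simps)
    thus "ennreal (exp (t * g)) * ennreal (std_normal_density g) = ennreal (exp (t\<^sup>2 / 2)) * ennreal (normal_density t 1 g)"
      by (simp add: ennreal_mult[symmetric])
  qed
  also have "\<dots> = ennreal (exp (t\<^sup>2 / 2)) * (\<integral>\<^sup>+g. ennreal (normal_density t 1 g) \<partial>lborel)"
    by (rule nn_integral_cmult) simp
  also have "(\<integral>\<^sup>+g. ennreal (normal_density t 1 g) \<partial>lborel) = 1"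
    by (subst nn_integral_eq_integral) auto
  finally show ?thesis by simp
qed

lemma gaussian_exp_quarter_square:
  "(\<integral>\<^sup>+g. ennreal (exp (g\<^sup>2 / 4)) * ennreal (std_normal_density g) \<partial>lborel) = ennreal (sqrt 2)"
proof -
  have "(\<integral>\<^sup>+g. ennreal (exp (g\<^sup>2 / 4)) * ennreal (std_normal_density g) \<partial>lborel) =
     (\<integral>\<^sup>+g. ennreal (sqrt 2) * ennreal (normal_density 0 (sqrt 2) g) \<partial>lborel)"
  proof (intro nn_integral_cong)
    fix g :: real
    have "exp (g\<^sup>2 / 4) * exp (- (g\<^sup>2) / 2) = exp (- (g\<^sup>2) / 4)"
      by (simp add: exp_add[symmetric])
    moreover have "sqrt (2 * pi * 2) = sqrt 2 * sqrt (2 * pi)" by (simp add: real_sqrt_mult)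
    ultimately have "exp (g\<^sup>2 / 4) * std_normal_density g = sqrt 2 * normal_density 0 (sqrt 2) g"
      unfolding normal_density_def by (simp add: field_simps)
    thus "ennreal (exp (g\<^sup>2 / 4)) * ennreal (std_normal_density g) = ennreal (sqrt 2) * ennreal (normal_density 0 (sqrt 2) g)"
      by (simp add: ennreal_mult[symmetric])
  qed
  also have "\<dots> = ennreal (sqrt 2) * (\<integral>\<^sup>+g. ennreal (normal_density 0 (sqrt 2) g) \<partial>lborel)"
    by (rule nn_integral_cmult) simp
  also have "(\<integral>\<^sup>+g. ennreal (normal_density 0 (sqrt 2) g) \<partial>lborel) = 1"
    by (subst nn_integral_eq_integral) auto
  finally show ?thesis by simp
qed

text \<open>After the Gaussian mixture with \<open>t = Y / sqrt (2 * v)\<close> and Tonelli, the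
  sub-Gaussian bound applies inside the Gaussian integral, where it leaves
  \<open>exp (g\<^sup>2 / 4)\<close>; the Gaussian mean of this is \<open>sqrt 2\<close>.\<close>

lemma (in prob_space) subgaussian_exp_square:
  assumes [measurable]: "Y \<in> borel_measurable M" and v: "v > 0"
    and sg: "\<And>s. (\<integral>\<^sup>+\<omega>. ennreal (exp (s * Y \<omega>)) \<partial>M) \<le> ennreal (exp (s\<^sup>2 * v / 2))"
  shows "(\<integral>\<^sup>+\<omega>. ennreal (exp ((Y \<omega>)\<^sup>2 / (4 * v))) \<partial>M) \<le> ennreal (sqrt 2)"
proof -
  interpret P: pair_sigma_finite M lborel ..
  have eq: "(y / sqrt (2 * v))\<^sup>2 / 2 = y\<^sup>2 / (4 * v)" for y using v by (simp add: power_divide)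
  have "(\<integral>\<^sup>+\<omega>. ennreal (exp ((Y \<omega>)\<^sup>2 / (4 * v))) \<partial>M) =
    (\<integral>\<^sup>+\<omega>. \<integral>\<^sup>+g. ennreal (exp (Y \<omega> / sqrt (2 * v) * g)) * ennreal (std_normal_density g) \<partial>lborel \<partial>M)"
    by (subst exp_half_square_eq_gaussian_mixture[symmetric]) (simp only: eq)
  also have "\<dots> = (\<integral>\<^sup>+g. \<integral>\<^sup>+\<omega>. ennreal (exp (Y \<omega> / sqrt (2 * v) * g)) * ennreal (std_normal_density g) \<partial>M \<partial>lborel)"
    by (rule P.Fubini'[symmetric]) simp
  also have "\<dots> = (\<integral>\<^sup>+g. (\<integral>\<^sup>+\<omega>. ennreal (exp ((g / sqrt (2 * v)) * Y \<omega>)) \<partial>M) * ennreal (std_normal_density g) \<partial>lborel)"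
    by (subst nn_integral_multc) (auto simp: mult_ac)
  also have "\<dots> \<le> (\<integral>\<^sup>+g. ennreal (exp ((g / sqrt (2 * v))\<^sup>2 * v / 2)) * ennreal (std_normal_density g) \<partial>lborel)"
    by (intro nn_integral_mono mult_right_mono sg) auto
  also have "\<dots> = (\<integral>\<^sup>+g. ennreal (exp (g\<^sup>2 / 4)) * ennreal (std_normal_density g) \<partial>lborel)"
    using v by (simp add: power_divide)
  also have "\<dots> = ennreal (sqrt 2)" by (rule gaussian_exp_quarter_square)
  finally show ?thesis .
qed

lemma exp_weighted_sum_le:
  fixes w y :: "'i \<Rightarrow> real"
  assumes "finite E" "E \<noteq> {}" "\<And>e. e \<in> E \<Longrightarrow> w e \<ge> 0" "(\<Sum>e\<in>E. w e) = 1"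
  shows "exp (\<Sum>e\<in>E. w e * y e) \<le> (\<Sum>e\<in>E. w e * exp (y e))"
  using convex_on_sum[OF assms(1,2) exp_convex, of w y] assms by simp

lemma bessel_finite:
  assumes "finite E" "orthonormal E"
  shows "(\<Sum>e\<in>E. (inner g e)\<^sup>2) \<le> (norm g)\<^sup>2"
  by (subst orthonormal_proj_norm[OF assms, of g]) simp

text \<open>The coordinates need not be independent. Writing the sum of their squares as an average
  with weights proportional to \<open>v e\<close>, convexity of \<open>exp\<close> reduces to one
  coordinate at a time, so neither the constant nor the rate depends on the number of
  coordinates.\<close>

lemma (in prob_space) subgaussian_exp_norm_square_orthonormal:
  fixes Z :: "'a \<Rightarrow> 'b::{real_inner, second_countable_topology}"
  assumes [measurable]: "Z \<in> borel_measurable M" and c: "c > 0" and T: "T > 0"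
    and int: "integrable M (\<lambda>\<omega>. (norm (Z \<omega>))\<^sup>2)" "expectation (\<lambda>\<omega>. (norm (Z \<omega>))\<^sup>2) \<le> T"
    and sg: "\<And>x. (\<integral>\<^sup>+\<omega>. ennreal (exp (inner x (Z \<omega>))) \<partial>M) \<le> ennreal (exp (c\<^sup>2 * expectation (\<lambda>\<omega>. (inner x (Z \<omega>))\<^sup>2) / 2))"
    and E: "finite E" "orthonormal E"
  shows "(\<integral>\<^sup>+\<omega>. ennreal (exp ((\<Sum>e\<in>E. (inner (Z \<omega>) e)\<^sup>2) / (8 * c\<^sup>2 * T))) \<partial>M) \<le> ennreal (sqrt 2)"
proof (cases "E = {}")
  case True
  have "ennreal 1 \<le> ennreal (sqrt 2)" by (rule ennreal_leI) simp
  thus ?thesis using True by (simp add: emeasure_space_1)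
next
  case False
  define s where "s e = expectation (\<lambda>\<omega>. (inner (Z \<omega>) e)\<^sup>2)" for e
  \<comment> \<open>The share \<open>T / card E\<close> keeps \<open>v e\<close> positive for
    coordinates of variance 0. It adds \<open>c\<^sup>2 * T\<close> in total, which turns the 4 of
    the scalar bound into 8.\<close>
  define v where "v e = c\<^sup>2 * (s e + T / card E)" for e
  define V where "V = (\<Sum>e\<in>E. v e)"
  have intE: "integrable M (\<lambda>\<omega>. (inner (Z \<omega>) e)\<^sup>2)" for e
  proof (rule Bochner_Integration.integrable_bound[OF integrable_mult_right[OF int(1), of "(norm e)\<^sup>2"]])
    show "AE \<omega> in M. norm ((inner (Z \<omega>) e)\<^sup>2) \<le> norm ((norm e)\<^sup>2 * (norm (Z \<omega>))\<^sup>2)"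
    proof (rule AE_I2)
      fix \<omega>
      have "\<bar>inner (Z \<omega>) e\<bar>\<^sup>2 \<le> (norm (Z \<omega>) * norm e)\<^sup>2" by (intro power_mono Cauchy_Schwarz_ineq2) auto
      thus "norm ((inner (Z \<omega>) e)\<^sup>2) \<le> norm ((norm e)\<^sup>2 * (norm (Z \<omega>))\<^sup>2)" by (simp add: power_mult_distrib mult.commute)
    qed
  qed simp
  have s0: "s e \<ge> 0" for e unfolding s_def by simp
  have vpos: "v e > 0" for e
    unfolding v_def using c T s0[of e] False E by (intro mult_pos_pos add_nonneg_pos) (auto simp: card_gt_0_iff)
  have Vpos: "V > 0" unfolding V_def using vpos False E by (intro sum_pos) auto
  have "(\<Sum>e\<in>E. s e) = expectation (\<lambda>\<omega>. \<Sum>e\<in>E. (inner (Z \<omega>) e)\<^sup>2)"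
    unfolding s_def by (subst Bochner_Integration.integral_sum) (auto intro: intE)
  also have "\<dots> \<le> expectation (\<lambda>\<omega>. (norm (Z \<omega>))\<^sup>2)"
    by (intro integral_mono Bochner_Integration.integrable_sum intE int bessel_finite E)
  finally have sT: "(\<Sum>e\<in>E. s e) \<le> T" using int by linarith
  have VT: "V \<le> 2 * c\<^sup>2 * T"
  proof -
    have "V = c\<^sup>2 * ((\<Sum>e\<in>E. s e) + T)"
      unfolding V_def v_def using False E by (simp add: sum_distrib_left[symmetric] sum.distrib)
    also have "\<dots> \<le> c\<^sup>2 * (T + T)" using sT by (intro mult_left_mono add_right_mono) auto
    finally show ?thesis by simp
  qed
  have one: "(\<integral>\<^sup>+\<omega>. ennreal (exp ((inner (Z \<omega>) e)\<^sup>2 / (4 * v e))) \<partial>M) \<le> ennreal (sqrt 2)" for e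
  proof (rule subgaussian_exp_square)
    fix r :: real
    have "(\<integral>\<^sup>+\<omega>. ennreal (exp (r * inner (Z \<omega>) e)) \<partial>M) = (\<integral>\<^sup>+\<omega>. ennreal (exp (inner (r *\<^sub>R e) (Z \<omega>))) \<partial>M)"
      by (simp add: inner_commute)
    also have "\<dots> \<le> ennreal (exp (c\<^sup>2 * expectation (\<lambda>\<omega>. (inner (r *\<^sub>R e) (Z \<omega>))\<^sup>2) / 2))" by (rule sg)
    also have "expectation (\<lambda>\<omega>. (inner (r *\<^sub>R e) (Z \<omega>))\<^sup>2) = r\<^sup>2 * s e"
      by (simp add: s_def power_mult_distrib inner_commute)
    also have "ennreal (exp (c\<^sup>2 * (r\<^sup>2 * s e) / 2)) \<le> ennreal (exp (r\<^sup>2 * v e / 2))"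
    proof -
      have "c\<^sup>2 * s e \<le> v e" using T by (simp add: v_def algebra_simps)
      hence "r\<^sup>2 * (c\<^sup>2 * s e) \<le> r\<^sup>2 * v e" by (intro mult_left_mono) auto
      thus ?thesis by (intro ennreal_leI) (simp add: algebra_simps)
    qed
    finally show "(\<integral>\<^sup>+\<omega>. ennreal (exp (r * inner (Z \<omega>) e)) \<partial>M) \<le> ennreal (exp (r\<^sup>2 * v e / 2))" .
  qed (use vpos in auto)
  have pt: "exp ((\<Sum>e\<in>E. (inner z e)\<^sup>2) / (8 * c\<^sup>2 * T)) \<le> (\<Sum>e\<in>E. v e / V * exp ((inner z e)\<^sup>2 / (4 * v e)))" for z
  proof -
    have "(\<Sum>e\<in>E. (inner z e)\<^sup>2) / (8 * c\<^sup>2 * T) \<le> (\<Sum>e\<in>E. (inner z e)\<^sup>2) / (4 * V)"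
      using VT Vpos c T by (intro divide_left_mono sum_nonneg) (auto simp: mult_ac)
    also have "\<dots> = (\<Sum>e\<in>E. v e / V * ((inner z e)\<^sup>2 / (4 * v e)))"
      unfolding sum_divide_distrib using vpos Vpos by (intro sum.cong) (auto simp: less_imp_neq[THEN not_sym])
    finally have "exp ((\<Sum>e\<in>E. (inner z e)\<^sup>2) / (8 * c\<^sup>2 * T)) \<le> exp (\<Sum>e\<in>E. v e / V * ((inner z e)\<^sup>2 / (4 * v e)))" by simp
    also have "\<dots> \<le> (\<Sum>e\<in>E. v e / V * exp ((inner z e)\<^sup>2 / (4 * v e)))"
      using vpos Vpos E False
      by (intro exp_weighted_sum_le) (auto simp: less_imp_le V_def sum_divide_distrib[symmetric])
    finally show ?thesis .
  qed
  have "(\<integral>\<^sup>+\<omega>. ennreal (exp ((\<Sum>e\<in>E. (inner (Z \<omega>) e)\<^sup>2) / (8 * c\<^sup>2 * T))) \<partial>M)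
     \<le> (\<integral>\<^sup>+\<omega>. ennreal (\<Sum>e\<in>E. v e / V * exp ((inner (Z \<omega>) e)\<^sup>2 / (4 * v e))) \<partial>M)"
    by (intro nn_integral_mono ennreal_leI pt)
  also have "\<dots> = (\<integral>\<^sup>+\<omega>. (\<Sum>e\<in>E. ennreal (v e / V) * ennreal (exp ((inner (Z \<omega>) e)\<^sup>2 / (4 * v e)))) \<partial>M)"
    using vpos Vpos by (intro nn_integral_cong) (simp add: ennreal_mult[symmetric] less_imp_le)
  also have "\<dots> = (\<Sum>e\<in>E. ennreal (v e / V) * (\<integral>\<^sup>+\<omega>. ennreal (exp ((inner (Z \<omega>) e)\<^sup>2 / (4 * v e))) \<partial>M))"
    by (subst nn_integral_sum) (auto simp: nn_integral_cmult)
  also have "\<dots> \<le> (\<Sum>e\<in>E. ennreal (v e / V) * ennreal (sqrt 2))"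
    by (intro sum_mono mult_left_mono one) auto
  also have "\<dots> = ennreal (\<Sum>e\<in>E. v e / V) * ennreal (sqrt 2)"
    using vpos Vpos by (subst sum_distrib_right[symmetric], subst sum_ennreal) (auto simp: less_imp_le)
  also have "(\<Sum>e\<in>E. v e / V) = 1" using Vpos by (simp add: V_def sum_divide_distrib[symmetric])
  finally show ?thesis by simp
qed

text \<open>Gram--Schmidt applied to longer and longer initial pieces of a countable dense set. The
  sets \<open>E n\<close> need not be nested: their spans are, and the projection onto a span is at
  least as close to \<open>z\<close> as any dense point in it.\<close>

lemma orthonormal_exhaustion:
  "\<exists>E :: nat \<Rightarrow> 'b::{real_inner, second_countable_topology} set.
     (\<forall>n. finite (E n) \<and> orthonormal (E n)) \<and> (\<forall>z. (\<lambda>n. \<Sum>e\<in>E n. (inner z e)\<^sup>2) \<longlonglongrightarrow> (norm z)\<^sup>2)"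
proof -
  obtain D :: "'b set" where D: "countable D" "\<And>X. open X \<Longrightarrow> X \<noteq> {} \<Longrightarrow> \<exists>d\<in>D. d \<in> X"
    using countable_dense_exists by blast
  have Dne: "D \<noteq> {}" using D(2)[of UNIV] by auto
  define d where "d = from_nat_into D"
  have "\<exists>E. finite E \<and> orthonormal E \<and> span E = span (d ` {..n})" for n
  proof -
    obtain C where C: "finite C" "span C = span (d ` {..n})" "pairwise orthogonal C"
      using basis_orthogonal[of "d ` {..n}"] by auto
    let ?E = "(\<lambda>x. x /\<^sub>R norm x) ` (C - {0})"
    have "orthonormal ?E"
      unfolding orthonormal_def pairwise_def
    proof (intro conjI ballI impI)
      fix x y assume "x \<in> ?E" "y \<in> ?E" "x \<noteq> y"
      then obtain u w where "u \<in> C" "w \<in> C" "u \<noteq> w" "x = u /\<^sub>R norm u" "y = w /\<^sub>R norm w" by auto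
      thus "orthogonal x y" using C(3) by (auto simp: pairwise_def orthogonal_def)
    next
      fix e assume "e \<in> ?E"
      then obtain u where "u \<noteq> 0" "e = u /\<^sub>R norm u" by auto
      thus "norm e = 1" by simp
    qed
    moreover have "span ?E = span C"
    proof (rule span_eq[THEN iffD2], intro conjI subsetI)
      fix x assume "x \<in> ?E" thus "x \<in> span C" by (auto intro: span_scale span_base)
    next
      fix x assume x: "x \<in> C"
      show "x \<in> span ?E"
      proof (cases "x = 0")
        case False
        have "norm x *\<^sub>R (x /\<^sub>R norm x) \<in> span ?E" using False x by (intro span_scale span_base) auto
        thus ?thesis using False by simp
      qed (simp add: span_zero)
    qed
    ultimately show ?thesis using C by (intro exI[of _ ?E]) auto
  qed
  then obtain E where E: "\<And>n. finite (E n)" "\<And>n. orthonormal (E n)" "\<And>n. span (E n) = span (d ` {..n})" by metis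
  have "(\<lambda>n. \<Sum>e\<in>E n. (inner z e)\<^sup>2) \<longlonglongrightarrow> (norm z)\<^sup>2" for z
  proof (rule LIMSEQ_I)
    fix r :: real assume r: "r > 0"
    have "\<exists>x\<in>D. x \<in> ball z (sqrt r)" using r by (intro D(2)) auto
    then obtain x where x: "x \<in> D" "dist z x < sqrt r" by auto
    then obtain N where N: "x = d N" unfolding d_def using D(1) from_nat_into_surj by metis
    have "norm ((\<Sum>e\<in>E n. (inner z e)\<^sup>2) - (norm z)\<^sup>2) < r" if n: "n \<ge> N" for n
    proof -
      let ?P = "\<Sum>e\<in>E n. inner z e *\<^sub>R e"
      have "x \<in> span (E n)" unfolding E(3) using n N by (intro span_base) auto
      moreover have "?P \<in> span (E n)" by (intro span_sum span_scale span_base)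
      ultimately have "?P - x \<in> span (E n)" by (rule span_diff[rotated])
      hence "inner (z - ?P) (?P - x) = 0"
      proof (induction rule: span_induct_alt)
        case (step c b y)
        thus ?case using orthonormal_proj_orth[OF E(1,2), of b n z] by (simp add: inner_add_right)
      qed simp
      hence "(norm (z - x))\<^sup>2 = (norm (z - ?P))\<^sup>2 + (norm (?P - x))\<^sup>2"
        using norm_add_Pythagorean[of "z - ?P" "?P - x"] by (simp add: orthogonal_def)
      hence "(norm (z - ?P))\<^sup>2 \<le> (norm (z - x))\<^sup>2" by simp
      also have "\<dots> < (sqrt r)\<^sup>2" using x(2) by (intro power_strict_mono) (auto simp: dist_norm)
      finally have "(norm (z - ?P))\<^sup>2 < r" using r by simp
      thus ?thesis using orthonormal_proj_norm[OF E(1,2), of z n] by simp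
    qed
    thus "\<exists>N. \<forall>n\<ge>N. norm ((\<Sum>e\<in>E n. (inner z e)\<^sup>2) - (norm z)\<^sup>2) < r" by blast
  qed
  thus ?thesis using E by blast
qed

text \<open>The finite-dimensional bounds are uniform, so Fatou's lemma carries them to the full
  norm along an exhaustion by orthonormal sets.\<close>

lemma (in prob_space) subgaussian_exp_norm_square:
  fixes Z :: "'a \<Rightarrow> 'b::{real_inner, second_countable_topology}"
  assumes [measurable]: "Z \<in> borel_measurable M" and c: "c > 0" and T: "T > 0"
    and int: "integrable M (\<lambda>\<omega>. (norm (Z \<omega>))\<^sup>2)" "expectation (\<lambda>\<omega>. (norm (Z \<omega>))\<^sup>2) \<le> T"
    and sg: "\<And>x. (\<integral>\<^sup>+\<omega>. ennreal (exp (inner x (Z \<omega>))) \<partial>M) \<le> ennreal (exp (c\<^sup>2 * expectation (\<lambda>\<omega>. (inner x (Z \<omega>))\<^sup>2) / 2))"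
  shows "(\<integral>\<^sup>+\<omega>. ennreal (exp ((norm (Z \<omega>))\<^sup>2 / (8 * c\<^sup>2 * T))) \<partial>M) \<le> ennreal (sqrt 2)"
proof -
  obtain E :: "nat \<Rightarrow> 'b set" where E: "\<And>n. finite (E n)" "\<And>n. orthonormal (E n)"
     "\<And>z. (\<lambda>n. \<Sum>e\<in>E n. (inner z e)\<^sup>2) \<longlonglongrightarrow> (norm z)\<^sup>2"
    using orthonormal_exhaustion by blast
  let ?f = "\<lambda>n \<omega>. ennreal (exp ((\<Sum>e\<in>E n. (inner (Z \<omega>) e)\<^sup>2) / (8 * c\<^sup>2 * T)))"
  have "(\<integral>\<^sup>+\<omega>. ennreal (exp ((norm (Z \<omega>))\<^sup>2 / (8 * c\<^sup>2 * T))) \<partial>M) = (\<integral>\<^sup>+\<omega>. liminf (\<lambda>n. ?f n \<omega>) \<partial>M)"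
  proof (intro nn_integral_cong)
    fix \<omega>
    have "(\<lambda>n. ?f n \<omega>) \<longlonglongrightarrow> ennreal (exp ((norm (Z \<omega>))\<^sup>2 / (8 * c\<^sup>2 * T)))"
      using T c by (intro tendsto_ennrealI tendsto_exp tendsto_divide E(3) tendsto_const) auto
    thus "ennreal (exp ((norm (Z \<omega>))\<^sup>2 / (8 * c\<^sup>2 * T))) = liminf (\<lambda>n. ?f n \<omega>)"
      using lim_imp_Liminf[OF sequentially_bot] by metis
  qed
  also have "\<dots> \<le> liminf (\<lambda>n. \<integral>\<^sup>+\<omega>. ?f n \<omega> \<partial>M)" by (rule nn_integral_liminf) simp
  also have "\<dots> \<le> liminf (\<lambda>n. ennreal (sqrt 2))"
    using E by (intro Liminf_mono always_eventually allI subgaussian_exp_norm_square_orthonormal assms) auto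
  finally show ?thesis by (simp add: Liminf_const)
qed

section \<open>The Hilbert space of square integrable functions\<close>

definition square_integrable :: "('a::euclidean_space \<Rightarrow> real) \<Rightarrow> bool" where
  "square_integrable f \<longleftrightarrow> f \<in> borel_measurable borel \<and> integrable lborel (\<lambda>x. (f x)\<^sup>2)"

lemma square_integrable_measurable [measurable_dest]: "square_integrable f \<Longrightarrow> f \<in> borel_measurable borel"
  by (simp add: square_integrable_def)

lemma square_integrable_mult:
  assumes "square_integrable f" "square_integrable g"
  shows "integrable lborel (\<lambda>x. f x * g x)"
proof (rule Bochner_Integration.integrable_bound[where f="\<lambda>x. (f x)\<^sup>2 + (g x)\<^sup>2"])
  show "integrable lborel (\<lambda>x. (f x)\<^sup>2 + (g x)\<^sup>2)" using assms unfolding square_integrable_def by auto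
  show "(\<lambda>x. f x * g x) \<in> borel_measurable lborel" using assms unfolding square_integrable_def by auto
  show "AE x in lborel. norm (f x * g x) \<le> norm ((f x)\<^sup>2 + (g x)\<^sup>2)"
  proof (rule AE_I2)
    fix x
    have "0 \<le> (\<bar>f x\<bar> - \<bar>g x\<bar>)\<^sup>2" by simp
    hence "2 * (\<bar>f x\<bar> * \<bar>g x\<bar>) \<le> (f x)\<^sup>2 + (g x)\<^sup>2" by (simp add: power2_diff)
    moreover have "\<bar>f x\<bar> * \<bar>g x\<bar> \<ge> 0" by simp
    ultimately have "\<bar>f x\<bar> * \<bar>g x\<bar> \<le> (f x)\<^sup>2 + (g x)\<^sup>2" by linarith
    thus "norm (f x * g x) \<le> norm ((f x)\<^sup>2 + (g x)\<^sup>2)" by (simp add: abs_mult)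
  qed
qed

lemma square_integrable_add:
  assumes "square_integrable f" "square_integrable g"
  shows "square_integrable (\<lambda>x. f x + g x)"
proof -
  have "(\<lambda>x. (f x + g x)\<^sup>2) = (\<lambda>x. (f x)\<^sup>2 + 2 * (f x * g x) + (g x)\<^sup>2)" by (simp add: power2_sum algebra_simps)
  thus ?thesis using assms square_integrable_mult[OF assms] unfolding square_integrable_def by auto
qed

lemma square_integrable_scale: "square_integrable f \<Longrightarrow> square_integrable (\<lambda>x. c * f x)"
  unfolding square_integrable_def by (auto simp: power_mult_distrib)

lemma square_integrable_minus: "square_integrable f \<Longrightarrow> square_integrable (\<lambda>x. - f x)"
  using square_integrable_scale[of f "-1"] by simp

lemma square_integrable_diff:
  assumes "square_integrable f" "square_integrable g"
  shows "square_integrable (\<lambda>x. f x - g x)"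
  using square_integrable_add[OF assms(1) square_integrable_minus[OF assms(2)]] by simp

lemma square_integrable_zero: "square_integrable (\<lambda>x. 0)"
  by (simp add: square_integrable_def)

lemma square_integrable_bound:
  assumes "square_integrable w" "f \<in> borel_measurable borel" "\<And>x. \<bar>f x\<bar> \<le> \<bar>w x\<bar>"
  shows "square_integrable f"
proof -
  have "integrable lborel (\<lambda>x. (f x)\<^sup>2)"
    by (rule Bochner_Integration.integrable_bound[where f="\<lambda>x. (w x)\<^sup>2"])
       (use assms in \<open>auto simp: square_integrable_def abs_le_square_iff\<close>)
  thus ?thesis using assms by (simp add: square_integrable_def)
qed

\<comment> \<open>The relation is reflexive only on square integrable functions, hence partial. The
  domain is any Euclidean space, so that one construction provides both functions on the line and
  kernels on the plane.\<close>
quotient_type (overloaded) 'a l2 = "'a::euclidean_space \<Rightarrow> real" / partial: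
  "\<lambda>f g. square_integrable f \<and> square_integrable g \<and> (AE x in lborel. f x = g x)"
proof (rule part_equivpI)
  show "\<exists>x::'a \<Rightarrow> real. square_integrable x \<and> square_integrable x \<and> (AE y in lborel. x y = x y)"
    using square_integrable_zero by auto
  show "symp (\<lambda>f g :: 'a \<Rightarrow> real. square_integrable f \<and> square_integrable g \<and> (AE x in lborel. f x = g x))"
    by (auto simp: symp_def eq_commute)
  show "transp (\<lambda>f g :: 'a \<Rightarrow> real. square_integrable f \<and> square_integrable g \<and> (AE x in lborel. f x = g x))"
    by (auto simp: transp_def)
qed

instantiation l2 :: (euclidean_space) real_vector
begin

lift_definition zero_l2 :: "'a l2" is "\<lambda>x. 0" by (simp add: square_integrable_zero)

lift_definition plus_l2 :: "'a l2 \<Rightarrow> 'a l2 \<Rightarrow> 'a l2" is "\<lambda>f g x. f x + g x"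
  by (auto simp: square_integrable_add)

lift_definition uminus_l2 :: "'a l2 \<Rightarrow> 'a l2" is "\<lambda>f x. - f x"
  by (auto simp: square_integrable_minus)

lift_definition minus_l2 :: "'a l2 \<Rightarrow> 'a l2 \<Rightarrow> 'a l2" is "\<lambda>f g x. f x - g x"
  by (auto simp: square_integrable_diff)

lift_definition scaleR_l2 :: "real \<Rightarrow> 'a l2 \<Rightarrow> 'a l2" is "\<lambda>c f x. c * f x"
  by (auto simp: square_integrable_scale)

instance
proof
  fix a b c :: "'a l2" and r s :: real
  show "a + b + c = a + (b + c)" by transfer (auto simp: add_ac intro!: square_integrable_add)
  show "a + b = b + a" by transfer (auto simp: add_ac intro!: square_integrable_add)
  show "0 + a = a" by transfer auto
  show "- a + a = 0" by transfer (auto simp: square_integrable_zero)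
  show "a - b = a + - b" by transfer (auto intro!: square_integrable_diff)
  show "r *\<^sub>R (a + b) = r *\<^sub>R a + r *\<^sub>R b"
    by transfer (auto simp: distrib_left simp flip: distrib_left intro!: square_integrable_add square_integrable_scale)
  show "(r + s) *\<^sub>R a = r *\<^sub>R a + s *\<^sub>R a"
    by transfer (auto simp: distrib_right simp flip: distrib_right intro!: square_integrable_add square_integrable_scale)
  show "r *\<^sub>R s *\<^sub>R a = (r * s) *\<^sub>R a"
    by transfer (auto simp: mult_ac intro!: square_integrable_scale)
  show "1 *\<^sub>R a = a" by transfer auto
qed

end

instantiation l2 :: (euclidean_space) real_inner
begin

lift_definition inner_l2 :: "'a l2 \<Rightarrow> 'a l2 \<Rightarrow> real" is "\<lambda>f g. LINT x|lborel. f x * g x"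
proof -
  fix f f' g g' :: "'a \<Rightarrow> real"
  assume a: "square_integrable f \<and> square_integrable f' \<and> (AE x in lborel. f x = f' x)"
     "square_integrable g \<and> square_integrable g' \<and> (AE x in lborel. g x = g' x)"
  have [measurable]: "f \<in> borel_measurable borel" "f' \<in> borel_measurable borel"
    "g \<in> borel_measurable borel" "g' \<in> borel_measurable borel"
    using a by (auto simp: square_integrable_def)
  have "AE x in lborel. f x * g x = f' x * g' x" using a by auto
  thus "(LINT x|lborel. f x * g x) = (LINT x|lborel. f' x * g' x)" by (intro integral_cong_AE) auto
qed

definition norm_l2 :: "'a l2 \<Rightarrow> real" where "norm_l2 x = sqrt (inner x x)"
definition sgn_l2 :: "'a l2 \<Rightarrow> 'a l2" where "sgn_l2 x = x /\<^sub>R norm x"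
definition dist_l2 :: "'a l2 \<Rightarrow> 'a l2 \<Rightarrow> real" where "dist_l2 x y = norm (x - y)"
definition uniformity_l2 :: "('a l2 \<times> 'a l2) filter" where
  "uniformity_l2 = (INF e\<in>{0<..}. principal {(x, y). dist x y < e})"
definition open_l2 :: "'a l2 set \<Rightarrow> bool" where
  "open_l2 U \<longleftrightarrow> (\<forall>x\<in>U. eventually (\<lambda>(x', y). x' = x \<longrightarrow> y \<in> U) uniformity)"

instance
proof
  fix a b c :: "'a l2" and r :: real
  show "inner a b = inner b a" by transfer (simp add: mult.commute)
  show "inner (a + b) c = inner a c + inner b c"
    by transfer (auto simp: distrib_right square_integrable_mult)
  show "inner (r *\<^sub>R a) b = r * inner a b"
    by transfer (auto simp: mult.assoc)
  show "0 \<le> inner a a" by transfer simp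
  show "(inner a a = 0) = (a = 0)"
  proof transfer
    fix f :: "'a \<Rightarrow> real" assume f: "square_integrable f \<and> square_integrable f \<and> (AE x in lborel. f x = f x)"
    hence "((LINT x|lborel. f x * f x) = 0) = (AE x in lborel. f x * f x = 0)"
      by (intro integral_nonneg_eq_0_iff_AE) (auto simp: square_integrable_mult)
    thus "((LINT x|lborel. f x * f x) = 0) = (square_integrable f \<and> square_integrable (\<lambda>x. 0) \<and> (AE x in lborel. f x = 0))"
      using f by (simp add: square_integrable_zero)
  qed
qed (simp_all add: norm_l2_def sgn_l2_def dist_l2_def uniformity_l2_def open_l2_def)

end

text \<open>Made total by the default value 0, so that it can be written down before square
  integrability is known; the algebraic laws carry that condition.\<close>

lift_definition l2of :: "('a::euclidean_space \<Rightarrow> real) \<Rightarrow> 'a l2" is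
  "\<lambda>f. if square_integrable f then f else (\<lambda>x. 0)"
  by (simp add: square_integrable_zero)

lemma l2_cases: obtains f where "x = l2of f" "square_integrable f"
proof -
  have "\<exists>f. x = l2of f \<and> square_integrable f"
    by transfer auto
  thus ?thesis using that by auto
qed

lemma l2of_add: "square_integrable f \<Longrightarrow> square_integrable g \<Longrightarrow> l2of f + l2of g = l2of (\<lambda>x. f x + g x)"
  by transfer (simp add: square_integrable_add)

lemma l2of_diff: "square_integrable f \<Longrightarrow> square_integrable g \<Longrightarrow> l2of f - l2of g = l2of (\<lambda>x. f x - g x)"
  by transfer (simp add: square_integrable_diff)

lemma l2of_scale: "square_integrable f \<Longrightarrow> c *\<^sub>R l2of f = l2of (\<lambda>x. c * f x)"
  by transfer (simp add: square_integrable_scale)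

lemma l2of_zero: "l2of (\<lambda>x. 0) = 0"
  by transfer (simp add: square_integrable_zero)

lemma square_integrable_sum:
  "finite I \<Longrightarrow> (\<And>i. i \<in> I \<Longrightarrow> square_integrable (f i)) \<Longrightarrow> square_integrable (\<lambda>x. \<Sum>i\<in>I. f i x)"
  by (induction I rule: finite_induct) (auto simp: square_integrable_zero intro: square_integrable_add)

lemma l2of_sum:
  "finite I \<Longrightarrow> (\<And>i. i \<in> I \<Longrightarrow> square_integrable (f i)) \<Longrightarrow> (\<Sum>i\<in>I. l2of (f i)) = l2of (\<lambda>x. \<Sum>i\<in>I. f i x)"
  by (induction I rule: finite_induct) (auto simp: l2of_zero l2of_add square_integrable_sum)

lemma inner_l2of: "square_integrable f \<Longrightarrow> square_integrable g \<Longrightarrow> inner (l2of f) (l2of g) = (LINT x|lborel. f x * g x)"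
  by transfer simp

lemma norm_l2of: "square_integrable f \<Longrightarrow> (norm (l2of f))\<^sup>2 = (LINT x|lborel. (f x)\<^sup>2)"
  by (simp add: power2_norm_eq_inner inner_l2of) (simp add: power2_eq_square)

lemma l2of_cong_AE:
  assumes "square_integrable f" "square_integrable g" "AE x in lborel. f x = g x"
  shows "l2of f = l2of g"
  using assms by transfer simp

lemma l2of_eqD:
  assumes "l2of f = l2of g" "square_integrable f" "square_integrable g"
  shows "AE x in lborel. f x = g x"
  using assms by transfer simp

lemma l2of_tendsto:
  fixes f :: "nat \<Rightarrow> 'a::euclidean_space \<Rightarrow> real"
  assumes w: "square_integrable w" and f[measurable]: "\<And>n. f n \<in> borel_measurable borel" "g \<in> borel_measurable borel"
    and b: "\<And>n x. \<bar>f n x\<bar> \<le> \<bar>w x\<bar>" and l: "\<And>x. (\<lambda>n. f n x) \<longlonglongrightarrow> g x"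
  shows "(\<lambda>n. l2of (f n)) \<longlonglongrightarrow> l2of g" "square_integrable g"
proof -
  have [measurable]: "w \<in> borel_measurable borel" using w by measurable
  have gb: "\<bar>g x\<bar> \<le> \<bar>w x\<bar>" for x
    by (rule tendsto_upperbound[OF tendsto_rabs[OF l[of x]]]) (use b in auto)
  show sg: "square_integrable g" by (rule square_integrable_bound[OF w f(2) gb])
  have sf: "square_integrable (f n)" for n by (rule square_integrable_bound[OF w f(1) b])
  have "(\<lambda>n. LINT x|lborel. (f n x - g x)\<^sup>2) \<longlonglongrightarrow> (LINT x|(lborel :: 'a measure). 0)"
  proof (rule integral_dominated_convergence[where w="\<lambda>x. (2 * w x)\<^sup>2"])
    show "integrable lborel (\<lambda>x. (2 * w x)\<^sup>2)" using w by (simp add: square_integrable_def power_mult_distrib)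
    show "AE x in lborel. (\<lambda>n. (f n x - g x)\<^sup>2) \<longlonglongrightarrow> 0"
    proof (rule AE_I2)
      fix x
      have "(\<lambda>n. (f n x - g x)\<^sup>2) \<longlonglongrightarrow> (g x - g x)\<^sup>2" by (intro tendsto_intros l)
      thus "(\<lambda>n. (f n x - g x)\<^sup>2) \<longlonglongrightarrow> 0" by simp
    qed
    fix n
    have "\<bar>f n x - g x\<bar> \<le> \<bar>2 * w x\<bar>" for x using b[of n x] gb[of x] by (simp add: abs_mult)
    hence "(f n x - g x)\<^sup>2 \<le> (2 * w x)\<^sup>2" for x by (simp only: abs_le_square_iff)
    thus "AE x in lborel. norm ((f n x - g x)\<^sup>2) \<le> (2 * w x)\<^sup>2" by simp
  qed auto
  hence "(\<lambda>n. (norm (l2of (f n) - l2of g))\<^sup>2) \<longlonglongrightarrow> 0"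
    by (simp add: l2of_diff sf sg norm_l2of square_integrable_diff)
  hence "(\<lambda>n. sqrt ((norm (l2of (f n) - l2of g))\<^sup>2)) \<longlonglongrightarrow> sqrt 0" by (rule tendsto_real_sqrt)
  hence "(\<lambda>n. norm (l2of (f n) - l2of g)) \<longlonglongrightarrow> 0" by simp
  thus "(\<lambda>n. l2of (f n)) \<longlonglongrightarrow> l2of g" by (simp add: LIM_zero_iff tendsto_norm_zero_iff)
qed

lemma nn_integral_l2of: "square_integrable f \<Longrightarrow> (\<integral>\<^sup>+x. ennreal ((f x)\<^sup>2) \<partial>lborel) = ennreal ((norm (l2of f))\<^sup>2)"
  by (subst nn_integral_eq_integral) (auto simp: norm_l2of square_integrable_def)

lemma square_integrable_nn:
  assumes "f \<in> borel_measurable borel" "(\<integral>\<^sup>+x. ennreal ((f x)\<^sup>2) \<partial>lborel) < \<infinity>"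
  shows "square_integrable f"
  using assms unfolding square_integrable_def by (auto intro!: integrableI_bounded)

text \<open>Riesz--Fischer: along a subsequence with geometric increments the weighted square sum of
  the increments is integrable, hence the representatives converge almost everywhere, and Fatou's
  lemma turns this into convergence in norm.\<close>

instance l2 :: (euclidean_space) complete_space
proof
  fix X :: "nat \<Rightarrow> 'a l2" assume X: "Cauchy X"
  have "\<forall>k. \<exists>N. \<forall>m\<ge>N. \<forall>n\<ge>N. norm (X m - X n) < (1/2) ^ k"
    using X unfolding Cauchy_iff by simp
  then obtain N where N: "\<And>k m n. m \<ge> N k \<Longrightarrow> n \<ge> N k \<Longrightarrow> norm (X m - X n) < (1/2) ^ k" by metis
  \<comment> \<open>\<open>r k\<close> is at least every threshold \<open>N i\<close> with
    \<open>i \<le> k\<close>, so along \<open>r\<close> the differences from index \<open>k\<close>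
    on are below \<open>(1/2) ^ k\<close>.\<close>
  define r where "r k = (\<Sum>i\<le>k. N i) + k" for k
  have rN: "r m \<ge> N k" if "k \<le> m" for k m
    unfolding r_def using that by (metis atMost_iff finite_atMost le_add1 member_le_sum order_trans zero_le)
  have rk: "r k \<ge> k" for k by (simp add: r_def)
  have "\<exists>f. X (r k) = l2of f \<and> square_integrable f" for k using l2_cases[of "X (r k)"] by metis
  then obtain f where f: "\<And>k. X (r k) = l2of (f k)" "\<And>k. square_integrable (f k)" by metis
  have [measurable]: "f k \<in> borel_measurable borel" for k using f(2)[of k] by measurable
  have bd: "(\<integral>\<^sup>+x. ennreal ((f k x - f m x)\<^sup>2) \<partial>lborel) \<le> ennreal (((1/2) ^ k)\<^sup>2)" if "k \<le> m" for k m
  proof -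
    have "(\<integral>\<^sup>+x. ennreal ((f k x - f m x)\<^sup>2) \<partial>lborel) = ennreal ((norm (X (r k) - X (r m)))\<^sup>2)"
      by (simp add: f l2of_diff square_integrable_diff nn_integral_l2of)
    also have "\<dots> \<le> ennreal (((1/2) ^ k)\<^sup>2)"
      using N[of k "r k" "r m"] rN[of k k] rN[of k m] that by (intro ennreal_leI power_mono) auto
    finally show ?thesis .
  qed
  \<comment> \<open>The squared increments integrate to at most \<open>(1/4) ^ k\<close>, so the
    weight \<open>2 ^ k\<close> still leaves a convergent series. Finiteness at a point then bounds
    the increments there by a geometric sequence of ratio \<open>1 / sqrt 2\<close>.\<close>
  have "(\<integral>\<^sup>+x. (\<Sum>k. ennreal (2 ^ k * (f k x - f (Suc k) x)\<^sup>2)) \<partial>lborel)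
      = (\<Sum>k. \<integral>\<^sup>+x. ennreal (2 ^ k * (f k x - f (Suc k) x)\<^sup>2) \<partial>lborel)"
    by (rule nn_integral_suminf) simp
  also have "\<dots> \<le> (\<Sum>k. ennreal ((1/2) ^ k))"
  proof (intro suminf_le)
    fix k
    have "(\<integral>\<^sup>+x. ennreal (2 ^ k * (f k x - f (Suc k) x)\<^sup>2) \<partial>lborel) = ennreal (2 ^ k) * (\<integral>\<^sup>+x. ennreal ((f k x - f (Suc k) x)\<^sup>2) \<partial>lborel)"
      by (subst nn_integral_cmult[symmetric]) (auto simp: ennreal_mult)
    also have "\<dots> \<le> ennreal (2 ^ k) * ennreal (((1/2) ^ k)\<^sup>2)" by (intro mult_left_mono bd) auto
    also have "\<dots> = ennreal ((1/2) ^ k)"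
      by (simp add: ennreal_mult[symmetric] power2_eq_square power_mult_distrib[symmetric] mult.assoc[symmetric])
    finally show "(\<integral>\<^sup>+x. ennreal (2 ^ k * (f k x - f (Suc k) x)\<^sup>2) \<partial>lborel) \<le> ennreal ((1/2) ^ k)" .
  qed auto
  also have "\<dots> = ennreal (\<Sum>k. (1/2) ^ k)" by (rule suminf_ennreal2) (auto intro: summable_geometric)
  finally have "(\<integral>\<^sup>+x. (\<Sum>k. ennreal (2 ^ k * (f k x - f (Suc k) x)\<^sup>2)) \<partial>lborel) \<noteq> \<infinity>"
    by (auto simp: top_unique)
  hence "AE x in lborel. (\<Sum>k. ennreal (2 ^ k * (f k x - f (Suc k) x)\<^sup>2)) \<noteq> \<infinity>"
    by (intro nn_integral_noteq_infinite) auto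
  hence conv: "AE x in lborel. convergent (\<lambda>k. f k x)"
  proof eventually_elim
    case (elim x)
    define S where "S = (\<Sum>k. ennreal (2 ^ k * (f k x - f (Suc k) x)\<^sup>2))"
    have S: "2 ^ k * (f k x - f (Suc k) x)\<^sup>2 \<le> enn2real S" for k
    proof -
      define h where "h n = ennreal (2 ^ n * (f n x - f (Suc n) x)\<^sup>2)" for n
      have "(\<Sum>n\<in>{k}. h n) \<le> (\<Sum>n. h n)" by (rule sum_le_suminf) (auto intro: summableI)
      hence "h k \<le> S" by (simp add: S_def h_def)
      moreover have "S < \<top>" using elim unfolding S_def by (simp add: less_top)
      hence "S = ennreal (enn2real S)" by simp
      ultimately have "ennreal (2 ^ k * (f k x - f (Suc k) x)\<^sup>2) \<le> ennreal (enn2real S)" unfolding h_def by metis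
      thus ?thesis by (subst (asm) ennreal_le_iff) auto
    qed
    have "norm (f (Suc k) x - f k x) \<le> sqrt (enn2real S) * (1 / sqrt 2) ^ k" for k
    proof -
      have "(f k x - f (Suc k) x)\<^sup>2 \<le> enn2real S * (1/2) ^ k" using S[of k] by (simp add: field_simps power_divide)
      hence "sqrt ((f k x - f (Suc k) x)\<^sup>2) \<le> sqrt (enn2real S * (1/2) ^ k)" by (rule real_sqrt_le_mono)
      also have "\<dots> = sqrt (enn2real S) * (1 / sqrt 2) ^ k" by (simp add: real_sqrt_mult real_sqrt_power real_sqrt_divide)
      finally show ?thesis by (simp add: abs_minus_commute)
    qed
    moreover have "summable (\<lambda>k. sqrt (enn2real S) * (1 / sqrt 2) ^ k)"
      by (intro summable_mult summable_geometric) simp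
    ultimately have "summable (\<lambda>k. f (Suc k) x - f k x)" by (rule summable_comparison_test'[rotated])
    hence "convergent (\<lambda>n. \<Sum>k<n. f (Suc k) x - f k x)" by (simp add: summable_iff_convergent)
    hence "convergent (\<lambda>n. (f n x - f 0 x) + f 0 x)"
      by (intro convergent_add convergent_const) (simp only: sum_lessThan_telescope[of "\<lambda>k. f k x"])
    thus ?case by simp
  qed
  define g where "g x = lim (\<lambda>k. f k x)" for x
  have [measurable]: "g \<in> borel_measurable borel" unfolding g_def by measurable
  have gl: "AE x in lborel. (\<lambda>k. f k x) \<longlonglongrightarrow> g x"
    using conv unfolding g_def by eventually_elim (simp add: convergent_LIMSEQ_iff)
  have bg: "(\<integral>\<^sup>+x. ennreal ((f k x - g x)\<^sup>2) \<partial>lborel) \<le> ennreal (((1/2) ^ k)\<^sup>2)" for k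
  proof -
    have "(\<integral>\<^sup>+x. ennreal ((f k x - g x)\<^sup>2) \<partial>lborel) = (\<integral>\<^sup>+x. liminf (\<lambda>m. ennreal ((f k x - f m x)\<^sup>2)) \<partial>lborel)"
    proof (intro nn_integral_cong_AE)
      show "AE x in lborel. ennreal ((f k x - g x)\<^sup>2) = liminf (\<lambda>m. ennreal ((f k x - f m x)\<^sup>2))"
        using gl
      proof eventually_elim
        case (elim x)
        hence "(\<lambda>m. ennreal ((f k x - f m x)\<^sup>2)) \<longlonglongrightarrow> ennreal ((f k x - g x)\<^sup>2)" by (intro tendsto_intros)
        thus ?case using lim_imp_Liminf[OF sequentially_bot] by metis
      qed
    qed
    also have "\<dots> \<le> liminf (\<lambda>m. \<integral>\<^sup>+x. ennreal ((f k x - f m x)\<^sup>2) \<partial>lborel)" by (rule nn_integral_liminf) simp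
    also have "\<dots> \<le> liminf (\<lambda>m. ennreal (((1/2) ^ k)\<^sup>2))"
      by (intro Liminf_mono eventually_sequentiallyI[of k] bd)
    finally show ?thesis by (simp add: Liminf_const)
  qed
  have sd: "square_integrable (\<lambda>x. f k x - g x)" for k
    using bg[of k] by (intro square_integrable_nn) (auto simp: less_top[symmetric] top_unique)
  have sg: "square_integrable g" using square_integrable_diff[OF f(2) sd, of 0 0] by simp
  have nb: "norm (X (r k) - l2of g) \<le> (1/2) ^ k" for k
  proof -
    have "ennreal ((norm (X (r k) - l2of g))\<^sup>2) \<le> ennreal (((1/2) ^ k)\<^sup>2)"
      using bg[of k] by (simp add: f l2of_diff sg nn_integral_l2of sd)
    hence "(norm (X (r k) - l2of g))\<^sup>2 \<le> ((1/2) ^ k)\<^sup>2" by (simp add: ennreal_le_iff)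
    thus ?thesis by (rule power2_le_imp_le) simp
  qed
  have half: "(\<lambda>k. (1/2) ^ k :: real) \<longlonglongrightarrow> 0" by (rule LIMSEQ_power_zero) simp
  have "X \<longlonglongrightarrow> l2of g"
  proof (rule LIMSEQ_I)
    fix e :: real assume e: "e > 0"
    then obtain k where k: "(1/2) ^ k < e / 2" using LIMSEQ_D[OF half, of "e/2"] by auto
    have "norm (X n - l2of g) < e" if "n \<ge> N k" for n
    proof -
      have "norm (X n - X (r k)) < (1/2) ^ k" using that rN[of k k] by (intro N) auto
      thus ?thesis using nb[of k] k norm_triangle_ineq[of "X n - X (r k)" "X (r k) - l2of g"] by simp
    qed
    thus "\<exists>no. \<forall>n\<ge>no. norm (X n - l2of g) < e" by blast
  qed
  thus "convergent X" by (rule convergentI)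
qed

section \<open>Separability of the space of square integrable functions\<close>

lemma square_integrable_indicator:
  assumes "A \<in> sets borel" "emeasure lborel A < \<infinity>"
  shows "square_integrable (indicator A :: 'a::euclidean_space \<Rightarrow> real)"
  using assms unfolding square_integrable_def power2_eq_square indicator_inter_arith[symmetric] by simp

lemma subspace_closure:
  fixes S :: "'b::real_normed_vector set"
  assumes "subspace S"
  shows "subspace (closure S)"
  unfolding subspace_def
proof (intro conjI ballI allI)
  show "0 \<in> closure S" using subspace_0[OF assms] closure_subset by blast
  fix x assume "x \<in> closure S"
  then obtain u where u: "\<And>n. u n \<in> S" "u \<longlonglongrightarrow> x" unfolding closure_sequential by blast
  show "c *\<^sub>R x \<in> closure S" for c
    unfolding closure_sequential using u assms
    by (intro exI[of _ "\<lambda>n. c *\<^sub>R u n"]) (auto intro: subspace_scale tendsto_intros)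
  fix y assume "y \<in> closure S"
  then obtain v where v: "\<And>n. v n \<in> S" "v \<longlonglongrightarrow> y" unfolding closure_sequential by blast
  show "x + y \<in> closure S"
    unfolding closure_sequential using u v assms
    by (intro exI[of _ "\<lambda>n. u n + v n"]) (auto intro: subspace_add tendsto_intros)
qed

text \<open>Finite intersections of a countable base form a countable generator of the Borel sets
  that is stable under intersection. A Dynkin argument puts the indicators of all Borel sets into
  the closed span, and simple functions do the rest. Cutting with the balls \<open>b n\<close> keeps
  all measures finite.\<close>

lemma l2_dense_indicators:
  "\<exists>g :: nat \<Rightarrow> 'a::euclidean_space l2. closure (span (range g)) = UNIV"
proof -
  obtain B :: "'a set set" where B: "countable B" "topological_basis B" using ex_countable_basis by blast
  define G where "G = Inter ` {F. F \<subseteq> B \<and> finite F}"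
  have cG: "countable G" unfolding G_def using countable_Collect_finite_subset[OF B(1)] by (simp add: conj_commute)
  have "{} \<in> {F. F \<subseteq> B \<and> finite F}" by auto
  hence UG: "UNIV \<in> G" unfolding G_def by (metis Inter_empty imageI)
  have iG: "Int_stable G"
  proof (rule Int_stableI)
    fix x y assume "x \<in> G" "y \<in> G"
    then obtain F F' where "x = \<Inter>F" "y = \<Inter>F'" "F \<subseteq> B" "F' \<subseteq> B" "finite F" "finite F'" unfolding G_def by auto
    hence "x \<inter> y = \<Inter>(F \<union> F')" "F \<union> F' \<subseteq> B" "finite (F \<union> F')" by auto
    thus "x \<inter> y \<in> G" unfolding G_def by blast
  qed
  have BG: "B \<subseteq> G"
  proof
    fix x assume "x \<in> B"
    hence "{x} \<in> {F. F \<subseteq> B \<and> finite F}" by auto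
    thus "x \<in> G" unfolding G_def by (metis cInf_singleton imageI)
  qed
  have openG: "open x" if "x \<in> G" for x
    using that topological_basis_open[OF B(2)] unfolding G_def by (auto intro!: open_Inter)
  have sG: "sets (borel :: 'a measure) = sigma_sets UNIV G"
  proof (intro antisym)
    have "sets (borel :: 'a measure) = sigma_sets UNIV B" by (subst borel_eq_countable_basis[OF B]) simp
    also have "\<dots> \<subseteq> sigma_sets UNIV G" using BG by (rule sigma_sets_mono')
    finally show "sets (borel :: 'a measure) \<subseteq> sigma_sets UNIV G" .
    show "sigma_sets UNIV G \<subseteq> sets (borel :: 'a measure)"
      using openG by (intro sets.sigma_sets_subset[of G borel, simplified]) auto
  qed
  define b where "b n = ball (0::'a) (real n)" for n
  have fb: "emeasure lborel (A \<inter> b n) < \<infinity>" if "A \<in> sets borel" for A n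
  proof -
    have "emeasure lborel (A \<inter> b n) \<le> emeasure lborel (b n)" by (intro emeasure_mono) (auto simp: b_def)
    also have "\<dots> < \<infinity>" unfolding b_def by (rule emeasure_bounded_finite) simp
    finally show ?thesis .
  qed
  have [measurable]: "b n \<in> sets borel" for n by (simp add: b_def)
  have si: "square_integrable (indicator (A \<inter> b n) :: 'a \<Rightarrow> real)" if "A \<in> sets borel" for A n
    using that fb by (intro square_integrable_indicator) auto
  define H where "H = (\<lambda>(A, n). l2of (indicator (A \<inter> b n))) ` (G \<times> UNIV)"
  have HI: "l2of (indicator (A \<inter> b n)) \<in> H" if "A \<in> G" for A n
    unfolding H_def by (rule rev_image_eqI[of "(A, n)"]) (use that in auto)
  have H: "countable H" "H \<noteq> {}" unfolding H_def using cG UG by auto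
  define V where "V = closure (span H)"
  have sV: "subspace V" unfolding V_def by (intro subspace_closure subspace_span) 
  have ind: "l2of (indicator (A \<inter> b n)) \<in> V" if "A \<in> sigma_sets UNIV G" for A n
    using iG _ that
  proof (rule sigma_sets_induct_disjoint)
    show "G \<subseteq> Pow UNIV" by simp
    fix A assume "A \<in> G" thus "l2of (indicator (A \<inter> b n)) \<in> V"
      unfolding V_def by (intro subsetD[OF closure_subset] span_base HI)
  next
    show "l2of (indicator ({} \<inter> b n)) \<in> V" 
    proof -
      have "(indicator ({} \<inter> b n) :: 'a \<Rightarrow> real) = (\<lambda>x. 0)" by auto
      thus ?thesis using subspace_0[OF sV] by (simp only: l2of_zero)
    qed
  next
    fix A assume A: "A \<in> sigma_sets UNIV G" "l2of (indicator (A \<inter> b n)) \<in> V"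
    hence "A \<in> sets borel" using sG by auto
    have "l2of (indicator (UNIV \<inter> b n)) \<in> V"
      unfolding V_def by (intro subsetD[OF closure_subset] span_base HI UG)
    hence "l2of (indicator (UNIV \<inter> b n)) - l2of (indicator (A \<inter> b n)) \<in> V"
      using sV A(2) by (intro subspace_diff)
    also have "l2of (indicator (UNIV \<inter> b n)) - l2of (indicator (A \<inter> b n)) = l2of (\<lambda>x. indicator (UNIV \<inter> b n) x - indicator (A \<inter> b n) x)"
      using \<open>A \<in> sets borel\<close> by (intro l2of_diff si) auto
    also have "(\<lambda>x. indicator (UNIV \<inter> b n) x - indicator (A \<inter> b n) x) = (indicator ((UNIV - A) \<inter> b n) :: 'a \<Rightarrow> real)"
      by (auto simp: fun_eq_iff indicator_def)
    finally show "l2of (indicator ((UNIV - A) \<inter> b n)) \<in> V" .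
  next
    fix A :: "nat \<Rightarrow> 'a set"
    assume A: "disjoint_family A" "range A \<subseteq> sigma_sets UNIV G" "\<And>i. l2of (indicator (A i \<inter> b n)) \<in> V"
    have [measurable]: "A i \<in> sets borel" for i using A(2) sG by auto
    have eq: "(\<Sum>i<k. l2of (indicator (A i \<inter> b n))) = l2of (indicator ((\<Union>i<k. A i) \<inter> b n))" for k
    proof -
      have "(\<Sum>i<k. l2of (indicator (A i \<inter> b n))) = l2of (\<lambda>x. \<Sum>i<k. indicator (A i \<inter> b n) x)"
        by (intro l2of_sum si) auto
      also have "(\<lambda>x. \<Sum>i<k. indicator (A i \<inter> b n) x) = (indicator (\<Union>i<k. A i \<inter> b n) :: 'a \<Rightarrow> real)"
        using A(1) by (intro ext, subst indicator_UN_disjoint) (auto simp: disjoint_family_on_def)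
      finally show ?thesis by simp
    qed
    have lim: "(\<lambda>k. l2of (indicator ((\<Union>i<k. A i) \<inter> b n))) \<longlonglongrightarrow> l2of (indicator ((\<Union>i. A i) \<inter> b n))"
    proof (rule l2of_tendsto[where w="indicator (UNIV \<inter> b n)"])
      show "square_integrable (indicator (UNIV \<inter> b n) :: 'a \<Rightarrow> real)" by (rule si) simp
      show "(\<lambda>k. indicator ((\<Union>i<k. A i) \<inter> b n) x :: real) \<longlonglongrightarrow> indicator ((\<Union>i. A i) \<inter> b n) x" for x
        using LIMSEQ_indicator_UN[of A x, where 'a=real] by (simp add: indicator_inter_arith tendsto_intros)
    qed (auto simp: indicator_def)
    have mem: "l2of (indicator ((\<Union>i<k. A i) \<inter> b n)) \<in> V" for k
      unfolding eq[symmetric] by (intro subspace_sum sV A(3))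
    show "l2of (indicator (\<Union> (range A) \<inter> b n)) \<in> V"
      unfolding V_def by (rule closed_sequentially[OF closed_closure mem[unfolded V_def] lim])
  qed
  have "x \<in> V" for x
  proof (rule l2_cases[of x])
    fix f assume f: "x = l2of f" "square_integrable f"
    hence [measurable]: "f \<in> borel_measurable borel" by measurable
    obtain s where s: "\<And>i. simple_function borel (s i)" "\<And>y. (\<lambda>i. s i y) \<longlonglongrightarrow> f y" "\<And>i y. dist (s i y) 0 \<le> 2 * dist (f y) 0"
      using borel_measurable_implies_sequence_metric[of f borel 0] by auto
    have [measurable]: "s i \<in> borel_measurable borel" for i using s(1) by (rule borel_measurable_simple_function)
    have lim: "(\<lambda>n. l2of (\<lambda>y. s n y * indicator (b n) y)) \<longlonglongrightarrow> l2of f"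
    proof (rule l2of_tendsto[where w="\<lambda>y. 2 * f y"])
      show "square_integrable (\<lambda>y. 2 * f y)" by (intro square_integrable_scale f)
      show "\<bar>s n y * indicator (b n) y\<bar> \<le> \<bar>2 * f y\<bar>" for n y
        using s(3)[of n y] by (auto simp: indicator_def abs_mult)
      fix y
      have "eventually (\<lambda>n. indicator (b n) y = (1::real)) sequentially"
      proof (rule eventually_sequentiallyI)
        fix n assume "nat \<lceil>norm y\<rceil> + 1 \<le> n"
        hence "norm y < real n" by linarith
        thus "indicator (b n) y = (1::real)" by (simp add: b_def)
      qed
      hence "(\<lambda>n. indicator (b n) y :: real) \<longlonglongrightarrow> 1" by (rule tendsto_eventually)
      from tendsto_mult[OF s(2) this] show "(\<lambda>n. s n y * indicator (b n) y) \<longlonglongrightarrow> f y" by simp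
    qed auto
    have mem: "l2of (\<lambda>y. s n y * indicator (b n) y) \<in> V" for n
    proof -
      have fin: "finite (range (s n))" using s(1)[of n] by (simp add: simple_function_def)
      have m: "s n -` {c} \<in> sets borel" for c using measurable_sets[of "s n" borel borel "{c}"] by simp
      have eq: "(\<lambda>y. s n y * indicator (b n) y) = (\<lambda>y. \<Sum>c\<in>range (s n). c * indicator (s n -` {c} \<inter> b n) y)"
      proof
        fix y
        have "(\<Sum>c\<in>range (s n). c * indicator (s n -` {c} \<inter> b n) y) = (\<Sum>c\<in>range (s n). if c = s n y then c * indicator (b n) y else 0)"
          by (intro sum.cong) (auto simp: indicator_def)
        thus "s n y * indicator (b n) y = (\<Sum>c\<in>range (s n). c * indicator (s n -` {c} \<inter> b n) y)" using fin by simp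
      qed
      have "l2of (\<lambda>y. s n y * indicator (b n) y) = (\<Sum>c\<in>range (s n). c *\<^sub>R l2of (indicator (s n -` {c} \<inter> b n)))"
        unfolding eq using fin m by (simp add: l2of_scale si l2of_sum square_integrable_scale)
      also have "\<dots> \<in> V" using m sG by (intro subspace_sum sV subspace_scale ind) auto
      finally show ?thesis .
    qed
    show "x \<in> V" unfolding V_def f(1) by (rule closed_sequentially[OF closed_closure mem[unfolded V_def] lim])
  qed
  hence "closure (span (range (from_nat_into H))) = UNIV"
    using H unfolding V_def by (auto simp: range_from_nat_into)
  thus ?thesis by blast
qed

text \<open>Rational coefficients suffice; coding the combinations by lists makes their countability
  immediate.\<close>

lemma countable_dense_of_span:
  fixes g :: "nat \<Rightarrow> 'b::real_normed_vector"
  assumes "closure (span (range g)) = UNIV"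
  shows "\<exists>D :: 'b set. countable D \<and> closure D = UNIV"
proof -
  define f where "f xs = (\<Sum>(q, i)\<leftarrow>xs. real_of_rat q *\<^sub>R g i)" for xs :: "(rat \<times> nat) list"
  define D where "D = range f"
  have "x \<in> closure D" if "x \<in> span (range g)" for x
    using that
  proof (induction rule: span_induct_alt)
    case base
    have "f [] = 0" by (simp add: f_def)
    thus ?case unfolding D_def by (metis closure_subset rangeI subsetD)
  next
    case (step c x y)
    then obtain i where i: "x = g i" by auto
    show ?case unfolding closure_approachable
    proof (intro allI impI)
      fix e :: real assume e: "e > 0"
      obtain d where d: "d \<in> D" "dist d y < e / 2" using step e unfolding closure_approachable by (meson half_gt_zero)
      then obtain xs where xs: "d = f xs" unfolding D_def by auto
      have pos: "e / (2 * (norm x + 1)) > 0" using e by (intro divide_pos_pos) (auto intro: add_nonneg_pos)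
      obtain q where q: "c < of_rat q" "of_rat q < c + e / (2 * (norm x + 1))"
        using of_rat_dense[of c "c + e / (2 * (norm x + 1))"] pos by auto
      have "f ((q, i) # xs) = of_rat q *\<^sub>R x + d" by (simp add: f_def i xs)
      moreover have "dist (of_rat q *\<^sub>R x + d) (c *\<^sub>R x + y) < e"
      proof -
        have "dist (of_rat q *\<^sub>R x + d) (c *\<^sub>R x + y) = norm ((of_rat q - c) *\<^sub>R x + (d - y))"
          by (simp add: dist_norm algebra_simps)
        also have "\<dots> \<le> \<bar>of_rat q - c\<bar> * norm x + norm (d - y)"
          using norm_triangle_ineq[of "(of_rat q - c) *\<^sub>R x" "d - y"] by simp
        also have "\<bar>of_rat q - c\<bar> * norm x \<le> e / (2 * (norm x + 1)) * norm x"
          using q by (intro mult_right_mono) auto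
        also have "\<dots> \<le> e / 2"
        proof -
          have "norm x / (norm x + 1) \<le> 1" by (simp add: divide_le_eq add_nonneg_pos)
          hence "e / 2 * (norm x / (norm x + 1)) \<le> e / 2 * 1" using e by (intro mult_left_mono) auto
          thus ?thesis by simp
        qed
        finally show ?thesis using d(2) by (simp add: dist_norm)
      qed
      ultimately show "\<exists>z\<in>D. dist z (c *\<^sub>R x + y) < e" unfolding D_def by (metis rangeI)
    qed
  qed
  hence "closure (span (range g)) \<subseteq> closure D" by (intro closure_minimal) auto
  moreover have "countable D" unfolding D_def by (rule countableI_type[THEN countable_image])
  ultimately show ?thesis using assms by auto
qed

instance l2 :: (euclidean_space) second_countable_topology
proof
  obtain D :: "'a l2 set" where D: "countable D" "closure D = UNIV"
    using l2_dense_indicators countable_dense_of_span by metis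
  define B where "B = (\<lambda>(d, q). ball d (real_of_rat q)) ` (D \<times> UNIV)"
  have "topological_basis B"
  proof (rule topological_basisI)
    fix O' and x :: "'a l2" assume O': "open O'" "x \<in> O'"
    then obtain e where e: "e > 0" "ball x e \<subseteq> O'" by (meson open_contains_ball)
    obtain q where q: "0 < real_of_rat q" "real_of_rat q < e / 2" using of_rat_dense[of 0 "e/2"] e by auto
    obtain d where d: "d \<in> D" "dist d x < of_rat q" using D(2) q(1) closure_approachable[of x D] by blast
    have "ball d (of_rat q) \<subseteq> O'"
    proof
      fix y assume "y \<in> ball d (of_rat q)"
      hence "dist x y < e" using d q dist_triangle[of x y d] by (simp add: dist_commute)
      thus "y \<in> O'" using e by auto
    qed
    thus "\<exists>B'\<in>B. x \<in> B' \<and> B' \<subseteq> O'" using d unfolding B_def by (intro bexI[of _ "ball d (of_rat q)"]) auto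
  qed (auto simp: B_def)
  moreover have "countable B" unfolding B_def using D by auto
  ultimately show "\<exists>B::'a l2 set set. countable B \<and> open = generate_topology B"
    using topological_basis_imp_subbasis by blast
qed

instance l2 :: (euclidean_space) banach ..

section \<open>Kernels as Hilbert--Schmidt operators\<close>

definition l2rep :: "'a::euclidean_space l2 \<Rightarrow> 'a \<Rightarrow> real" where
  "l2rep x = (SOME f. square_integrable f \<and> l2of f = x)"

lemma l2rep: "square_integrable (l2rep x)" "l2of (l2rep x) = x"
proof -
  have "\<exists>f. square_integrable f \<and> l2of f = x" using l2_cases[of x] by metis
  hence "square_integrable (l2rep x) \<and> l2of (l2rep x) = x" unfolding l2rep_def by (rule someI_ex)
  thus "square_integrable (l2rep x)" "l2of (l2rep x) = x" by auto
qed

lemma square_integrable_tensor: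
  fixes f g :: "real \<Rightarrow> real"
  assumes "square_integrable f" "square_integrable g"
  shows "square_integrable (\<lambda>(u, v). f u * g v)"
proof (rule square_integrable_nn)
  have [measurable]: "f \<in> borel_measurable borel" "g \<in> borel_measurable borel" using assms by auto
  show "(\<lambda>(u, v). f u * g v) \<in> borel_measurable borel"
    unfolding borel_prod[symmetric] by simp
  have "(\<integral>\<^sup>+p. ennreal ((case p of (u, v) \<Rightarrow> f u * g v)\<^sup>2) \<partial>lborel) =
      (\<integral>\<^sup>+p. ennreal ((case p of (u, v) \<Rightarrow> f u * g v)\<^sup>2) \<partial>(lborel \<Otimes>\<^sub>M lborel))"
    by (simp add: lborel_prod)
  also have "\<dots> = (\<integral>\<^sup>+u. \<integral>\<^sup>+v. ennreal ((f u)\<^sup>2) * ennreal ((g v)\<^sup>2) \<partial>lborel \<partial>lborel)"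
    by (subst lborel.nn_integral_fst[symmetric]) (auto simp: power_mult_distrib ennreal_mult)
  also have "\<dots> = ennreal ((norm (l2of f))\<^sup>2) * ennreal ((norm (l2of g))\<^sup>2)"
    by (simp add: nn_integral_cmult nn_integral_multc nn_integral_l2of assms)
  also have "\<dots> < \<infinity>" by (simp add: ennreal_mult[symmetric])
  finally show "(\<integral>\<^sup>+p. ennreal ((case p of (u, v) \<Rightarrow> f u * g v)\<^sup>2) \<partial>lborel) < \<infinity>" .
qed

lemma AE_lborel_pair_eq_iff:
  fixes F G :: "real \<times> real \<Rightarrow> real"
  assumes [measurable]: "F \<in> borel_measurable (borel \<Otimes>\<^sub>M borel)" "G \<in> borel_measurable (borel \<Otimes>\<^sub>M borel)"
  shows "(AE u in lborel. AE v in lborel. F (u, v) = G (u, v)) \<longleftrightarrow> (AE p in lborel. F p = G p)"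
    and "(AE v in lborel. AE u in lborel. F (u, v) = G (u, v)) \<longleftrightarrow> (AE p in lborel. F p = G p)"
proof -
  have "{p \<in> space (lborel \<Otimes>\<^sub>M lborel). F p = G p} \<in> sets (lborel \<Otimes>\<^sub>M lborel)"
    by (rule borel_measurable_eq) measurable
  hence S: "{p \<in> space (lborel \<Otimes>\<^sub>M lborel). F (fst p, snd p) = G (fst p, snd p)} \<in> sets (lborel \<Otimes>\<^sub>M lborel)"
    by simp
  show 1: "(AE u in lborel. AE v in lborel. F (u, v) = G (u, v)) \<longleftrightarrow> (AE p in lborel. F p = G p)"
    using lborel_pair.AE_pair_iff[OF S] unfolding lborel_prod by simp
  show "(AE v in lborel. AE u in lborel. F (u, v) = G (u, v)) \<longleftrightarrow> (AE p in lborel. F p = G p)"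
    using lborel_pair.AE_commute[OF S] 1 by simp
qed

text \<open>Defined through chosen representatives; by \<open>l2_tensor_of\<close> any other choice
  gives the same class.\<close>

definition l2_tensor :: "real l2 \<Rightarrow> real l2 \<Rightarrow> (real \<times> real) l2" where
  "l2_tensor x y = l2of (\<lambda>(u, v). l2rep x u * l2rep y v)"

lemma l2_tensor_of:
  assumes "square_integrable f" "square_integrable g"
  shows "l2_tensor (l2of f) (l2of g) = l2of (\<lambda>(u, v). f u * g v)"
  unfolding l2_tensor_def
proof (rule l2of_cong_AE)
  let ?f = "l2rep (l2of f)" and ?g = "l2rep (l2of g)"
  have si: "square_integrable ?f" "square_integrable ?g" by (rule l2rep)+
  have [measurable]: "f \<in> borel_measurable borel" "g \<in> borel_measurable borel"
    "?f \<in> borel_measurable borel" "?g \<in> borel_measurable borel" using assms si by auto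
  show "square_integrable (\<lambda>(u, v). ?f u * ?g v)" "square_integrable (\<lambda>(u, v). f u * g v)"
    by (intro square_integrable_tensor assms si)+
  have f: "AE u in lborel. ?f u = f u" and g: "AE v in lborel. ?g v = g v"
    by (rule l2of_eqD[OF l2rep(2)], fact+)+
  have "AE u in lborel. AE v in lborel. ?f u * ?g v = f u * g v"
    using f
  proof eventually_elim
    case (elim u)
    show ?case using g by eventually_elim (simp add: elim)
  qed
  thus "AE p in lborel. (case p of (u, v) \<Rightarrow> ?f u * ?g v) = (case p of (u, v) \<Rightarrow> f u * g v)"
    by (subst AE_lborel_pair_eq_iff(1)[symmetric]) auto
qed

lemma inner_l2_tensor_fubini:
  assumes k: "square_integrable k" and fg: "square_integrable f" "square_integrable g"
  shows "inner (l2of k) (l2_tensor (l2of f) (l2of g)) = (LINT u|lborel. f u * (LINT v|lborel. k (u, v) * g v))"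
    and "integrable lborel (\<lambda>u. f u * (LINT v|lborel. k (u, v) * g v))"
proof -
  have int: "integrable (lborel \<Otimes>\<^sub>M lborel) (\<lambda>p. k p * (case p of (u, v) \<Rightarrow> f u * g v))"
    using square_integrable_mult[OF k square_integrable_tensor[OF fg]] by (simp add: lborel_prod)
  have eq: "(LINT v|lborel. k (u, v) * (case (u, v) of (u, v) \<Rightarrow> f u * g v)) = f u * (LINT v|lborel. k (u, v) * g v)" for u
    by (simp add: mult_ac flip: integral_mult_right_zero)
  have eq': "(LINT v|lborel. k (u, v) * (f u * g v)) = f u * (LINT v|lborel. k (u, v) * g v)" for u
    using eq[of u] by simp
  show "inner (l2of k) (l2_tensor (l2of f) (l2of g)) = (LINT u|lborel. f u * (LINT v|lborel. k (u, v) * g v))"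
    using lborel_pair.integral_fst'[OF int]
    by (simp add: l2_tensor_of fg inner_l2of k square_integrable_tensor eq' lborel_prod)
  show "integrable lborel (\<lambda>u. f u * (LINT v|lborel. k (u, v) * g v))"
    using lborel_pair.integrable_fst'[OF int] by (simp only: eq)
qed

lemma inner_l2_tensor: "inner (l2_tensor x y) (l2_tensor x' y') = inner x x' * inner y y'"
proof -
  obtain f g f' g' where fg: "x = l2of f" "square_integrable f" "y = l2of g" "square_integrable g"
     "x' = l2of f'" "square_integrable f'" "y' = l2of g'" "square_integrable g'"
    by (metis l2_cases)
  have "inner (l2_tensor x y) (l2_tensor x' y') = (LINT u|lborel. f' u * (LINT v|lborel. (f u * g v) * g' v))"
    using inner_l2_tensor_fubini(1)[OF square_integrable_tensor[OF fg(2,4)] fg(6,8)] fg by (simp add: l2_tensor_of)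
  also have "\<dots> = (LINT u|lborel. (f u * f' u) * inner y y')"
    using fg by (simp add: inner_l2of mult_ac flip: integral_mult_right_zero)
  finally show ?thesis using fg by (simp add: inner_l2of)
qed

lemma norm_l2_tensor: "norm (l2_tensor x y) = norm x * norm y"
  by (simp add: norm_eq_sqrt_inner inner_l2_tensor real_sqrt_mult)

text \<open>Every identity follows from the Gram formula \<open>inner_l2_tensor\<close>: the
  difference of the two sides has inner product 0 with itself. No representatives are
  involved.\<close>

lemma bounded_bilinear_l2_tensor: "bounded_bilinear l2_tensor"
proof
  have z: "z = 0" if "inner z z = 0" for z :: "(real \<times> real) l2" using that by simp
  note simps = inner_add_left inner_add_right inner_diff_left inner_diff_right inner_l2_tensor algebra_simps
  show "l2_tensor (x + x') y = l2_tensor x y + l2_tensor x' y" for x x' y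
  proof -
    have "l2_tensor (x + x') y - (l2_tensor x y + l2_tensor x' y) = 0" by (rule z) (simp add: simps)
    thus ?thesis by simp
  qed
  show "l2_tensor x (y + y') = l2_tensor x y + l2_tensor x y'" for x y y'
  proof -
    have "l2_tensor x (y + y') - (l2_tensor x y + l2_tensor x y') = 0" by (rule z) (simp add: simps)
    thus ?thesis by simp
  qed
  show "l2_tensor (r *\<^sub>R x) y = r *\<^sub>R l2_tensor x y" for r x y
  proof -
    have "l2_tensor (r *\<^sub>R x) y - r *\<^sub>R l2_tensor x y = 0" by (rule z) (simp add: simps)
    thus ?thesis by simp
  qed
  show "l2_tensor x (r *\<^sub>R y) = r *\<^sub>R l2_tensor x y" for r x y
  proof -
    have "l2_tensor x (r *\<^sub>R y) - r *\<^sub>R l2_tensor x y = 0" by (rule z) (simp add: simps)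
    thus ?thesis by simp
  qed
  show "\<exists>K. \<forall>a b. norm (l2_tensor a b) \<le> norm a * norm b * K"
    by (intro exI[of _ 1]) (simp add: norm_l2_tensor)
qed

text \<open>For almost every \<open>u\<close> the section of \<open>k\<close> is square integrable
  and Cauchy--Schwarz applies; Tonelli then bounds the square integral by the product of the two
  squared norms.\<close>

lemma square_integrable_kernel_op:
  assumes k: "square_integrable k" and f: "square_integrable (f :: real \<Rightarrow> real)"
  shows "square_integrable (\<lambda>u. LINT v|lborel. k (u, v) * f v)"
proof (rule square_integrable_nn)
  have [measurable]: "f \<in> borel_measurable borel" "k \<in> borel_measurable (borel \<Otimes>\<^sub>M borel)"
    using k f by (auto simp: borel_prod)
  show "(\<lambda>u. LINT v|lborel. k (u, v) * f v) \<in> borel_measurable borel" by measurable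
  have int: "integrable (lborel \<Otimes>\<^sub>M lborel) (\<lambda>p. (k p)\<^sup>2)"
    using k by (simp add: square_integrable_def lborel_prod)
  have "AE u in lborel. integrable lborel (\<lambda>v. (k (u, v))\<^sup>2)"
    using lborel_pair.AE_integrable_fst'[OF int] .
  hence "AE u in lborel. ennreal ((LINT v|lborel. k (u, v) * f v)\<^sup>2) \<le>
      (\<integral>\<^sup>+v. ennreal ((k (u, v))\<^sup>2) \<partial>lborel) * ennreal ((norm (l2of f))\<^sup>2)"
  proof eventually_elim
    case (elim u)
    hence s: "square_integrable (\<lambda>v. k (u, v))" by (simp add: square_integrable_def)
    have "\<bar>inner (l2of (\<lambda>v. k (u, v))) (l2of f)\<bar> \<le> norm (l2of (\<lambda>v. k (u, v))) * norm (l2of f)"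
      by (rule Cauchy_Schwarz_ineq2)
    hence "\<bar>LINT v|lborel. k (u, v) * f v\<bar>\<^sup>2 \<le> (norm (l2of (\<lambda>v. k (u, v))) * norm (l2of f))\<^sup>2"
      by (intro power_mono) (simp_all add: inner_l2of s f)
    thus ?case by (simp add: nn_integral_l2of s ennreal_mult[symmetric] power_mult_distrib ennreal_leI)
  qed
  hence "(\<integral>\<^sup>+u. ennreal ((LINT v|lborel. k (u, v) * f v)\<^sup>2) \<partial>lborel) \<le>
     (\<integral>\<^sup>+u. (\<integral>\<^sup>+v. ennreal ((k (u, v))\<^sup>2) \<partial>lborel) * ennreal ((norm (l2of f))\<^sup>2) \<partial>lborel)"
    by (rule nn_integral_mono_AE)
  also have "\<dots> = (\<integral>\<^sup>+u. \<integral>\<^sup>+v. ennreal ((k (u, v))\<^sup>2) \<partial>lborel \<partial>lborel) * ennreal ((norm (l2of f))\<^sup>2)"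
    by (rule nn_integral_multc) simp
  also have "(\<integral>\<^sup>+u. \<integral>\<^sup>+v. ennreal ((k (u, v))\<^sup>2) \<partial>lborel \<partial>lborel) = (\<integral>\<^sup>+p. ennreal ((k p)\<^sup>2) \<partial>(lborel \<Otimes>\<^sub>M lborel))"
    by (subst lborel.nn_integral_fst[symmetric]) auto
  also have "\<dots> * ennreal ((norm (l2of f))\<^sup>2) < \<infinity>"
    by (simp add: lborel_prod nn_integral_l2of k ennreal_mult[symmetric])
  finally show "(\<integral>\<^sup>+u. ennreal ((LINT v|lborel. k (u, v) * f v)\<^sup>2) \<partial>lborel) < \<infinity>" .
qed

lemma inner_l2of': "square_integrable f \<Longrightarrow> square_integrable g \<Longrightarrow> inner (l2of f) (l2of g) = (LINT x|lborel. g x * f x)"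
  by (subst inner_commute) (rule inner_l2of)

lemma inner_ext:
  fixes x z :: "'b::real_inner"
  assumes "\<And>y. inner x y = inner z y"
  shows "x = z"
proof -
  have "inner (x - z) (x - z) = 0" using assms by (simp add: inner_diff_left)
  thus ?thesis by simp
qed

definition hs_op :: "(real \<times> real) l2 \<Rightarrow> real l2 \<Rightarrow> real l2" where
  "hs_op \<kappa> x = l2of (\<lambda>u. LINT v|lborel. l2rep \<kappa> (u, v) * l2rep x v)"

text \<open>This duality determines \<open>hs_op\<close> completely; its linearity, norm bound and
  adjoint are derived from it rather than from the integral formula.\<close>

lemma inner_hs_op: "inner (hs_op \<kappa> x) y = inner \<kappa> (l2_tensor y x)"
proof -
  have "inner (hs_op \<kappa> x) (l2of (l2rep y)) = inner (l2of (l2rep \<kappa>)) (l2_tensor (l2of (l2rep y)) (l2of (l2rep x)))"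
    unfolding hs_op_def
    by (subst inner_l2_tensor_fubini(1), (rule l2rep)+, rule inner_l2of') (simp_all add: l2rep square_integrable_kernel_op)
  thus ?thesis by (simp only: l2rep)
qed

lemma hs_op_of:
  assumes "square_integrable k" "square_integrable f"
  shows "hs_op (l2of k) (l2of f) = l2of (\<lambda>u. LINT v|lborel. k (u, v) * f v)"
proof -
  have "inner (hs_op (l2of k) (l2of f)) y = inner (l2of (\<lambda>u. LINT v|lborel. k (u, v) * f v)) y" for y
  proof -
    obtain g where g: "y = l2of g" "square_integrable g" by (rule l2_cases)
    show ?thesis unfolding inner_hs_op g(1) using assms g
      by (simp add: inner_l2_tensor_fubini inner_l2of' square_integrable_kernel_op)
  qed
  thus ?thesis by (rule inner_ext)
qed

lemma hs_op_diff_left: "hs_op (\<kappa> - \<kappa>') x = hs_op \<kappa> x - hs_op \<kappa>' x"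
  by (rule inner_ext) (simp add: inner_hs_op inner_diff_left)

lemma norm_hs_op: "norm (hs_op \<kappa> x) \<le> norm \<kappa> * norm x"
proof (cases "hs_op \<kappa> x = 0")
  case False
  have "(norm (hs_op \<kappa> x))\<^sup>2 = inner \<kappa> (l2_tensor (hs_op \<kappa> x) x)" by (simp add: power2_norm_eq_inner inner_hs_op)
  also have "\<dots> \<le> norm \<kappa> * (norm (hs_op \<kappa> x) * norm x)"
    using norm_cauchy_schwarz[of \<kappa> "l2_tensor (hs_op \<kappa> x) x"] by (simp add: norm_l2_tensor)
  finally have "norm (hs_op \<kappa> x) * norm (hs_op \<kappa> x) \<le> norm \<kappa> * norm x * norm (hs_op \<kappa> x)"
    by (simp add: power2_eq_square mult_ac)
  thus ?thesis using False by simp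
qed simp

lemma bounded_linear_hs_op: "bounded_linear (hs_op \<kappa>)"
proof (rule bounded_linear_intro[where K="norm \<kappa>"])
  interpret T: bounded_bilinear l2_tensor by (rule bounded_bilinear_l2_tensor)
  show "hs_op \<kappa> (x + y) = hs_op \<kappa> x + hs_op \<kappa> y" for x y
    by (rule inner_ext) (simp add: inner_hs_op inner_add_left inner_add_right T.add_right)
  show "hs_op \<kappa> (r *\<^sub>R x) = r *\<^sub>R hs_op \<kappa> x" for r x
    by (rule inner_ext) (simp add: inner_hs_op T.scaleR_right)
  show "norm (hs_op \<kappa> x) \<le> norm x * norm \<kappa>" for x using norm_hs_op[of \<kappa> x] by (simp add: mult.commute)
qed

text \<open>The sum of squares \<open>?S\<close> is the inner product of \<kappa> with the sum
  \<open>?T\<close> of the tensors \<open>l2_tensor (hs_op \<kappa> e) e\<close>, and the squared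
  norm of \<open>?T\<close> is \<open>?S\<close> again. Cauchy--Schwarz gives
  \<open>?S\<^sup>2 \<le> (norm \<kappa>)\<^sup>2 * ?S\<close>.\<close>

lemma hs_bounded_hs_op: "hs_bounded (hs_op \<kappa>) ((norm \<kappa>)\<^sup>2)"
  unfolding hs_bounded_def
proof (intro allI impI)
  fix E :: "real l2 set" assume E: "finite E" "orthonormal E"
  let ?S = "\<Sum>e\<in>E. (norm (hs_op \<kappa> e))\<^sup>2" and ?T = "\<Sum>e\<in>E. l2_tensor (hs_op \<kappa> e) e"
  have 1: "?S = inner \<kappa> ?T" by (simp add: inner_sum_right power2_norm_eq_inner inner_hs_op)
  have "inner ?T ?T = (\<Sum>e\<in>E. \<Sum>e'\<in>E. if e' = e then (norm (hs_op \<kappa> e))\<^sup>2 else 0)"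
    unfolding inner_sum_left inner_sum_right inner_l2_tensor
    using E(2) by (intro sum.cong) (auto simp: orthonormal_inner power2_norm_eq_inner)
  hence 2: "(norm ?T)\<^sup>2 = ?S" using E(1) by (simp add: power2_norm_eq_inner)
  have "?S\<^sup>2 \<le> (norm \<kappa> * norm ?T)\<^sup>2"
    unfolding 1 using Cauchy_Schwarz_ineq2[of \<kappa> ?T] by (simp add: abs_le_square_iff[symmetric])
  also have "\<dots> = (norm \<kappa>)\<^sup>2 * ?S" by (simp add: power_mult_distrib 2)
  finally have "?S * ?S \<le> (norm \<kappa>)\<^sup>2 * ?S" by (simp add: power2_eq_square)
  moreover have "?S \<ge> 0" by (intro sum_nonneg) simp
  ultimately show "?S \<le> (norm \<kappa>)\<^sup>2" by (cases "?S = 0") (auto simp: mult_le_cancel_right)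
qed

definition hs_adj :: "(real \<times> real) l2 \<Rightarrow> (real \<times> real) l2" where
  "hs_adj \<kappa> = l2of (\<lambda>(u, v). l2rep \<kappa> (v, u))"

lemma square_integrable_swap:
  assumes "square_integrable (k :: real \<times> real \<Rightarrow> real)"
  shows "square_integrable (\<lambda>(u, v). k (v, u))"
proof -
  have [measurable]: "k \<in> borel_measurable (borel \<Otimes>\<^sub>M borel)" using assms by (auto simp: borel_prod)
  have "(\<lambda>(u, v). k (v, u)) \<in> borel_measurable (borel \<Otimes>\<^sub>M borel)" by simp
  moreover have "integrable (lborel \<Otimes>\<^sub>M lborel) (\<lambda>p. (k p)\<^sup>2)"
    using assms by (simp add: square_integrable_def lborel_prod)
  hence "integrable (lborel \<Otimes>\<^sub>M lborel) (\<lambda>(u, v). (k (v, u))\<^sup>2)"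
    by (rule lborel_pair.integrable_product_swap)
  ultimately show ?thesis
    by (simp add: square_integrable_def lborel_prod borel_prod case_prod_unfold)
qed

lemma inner_hs_adj_tensor: "inner (hs_adj \<kappa>) (l2_tensor x y) = inner \<kappa> (l2_tensor y x)"
proof -
  obtain f g where fg: "x = l2of f" "square_integrable f" "y = l2of g" "square_integrable g" by (metis l2_cases)
  let ?k = "l2rep \<kappa>"
  have k: "square_integrable ?k" by (rule l2rep)
  have [measurable]: "f \<in> borel_measurable borel" "g \<in> borel_measurable borel" "?k \<in> borel_measurable (borel \<Otimes>\<^sub>M borel)"
    using fg k by (auto simp: borel_prod)
  have "inner (hs_adj \<kappa>) (l2_tensor x y) = (LINT p|(lborel \<Otimes>\<^sub>M lborel). (case p of (u, v) \<Rightarrow> ?k (v, u) * (f u * g v)))"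
    unfolding hs_adj_def fg(1,3) l2_tensor_of[OF fg(2,4)]
      inner_l2of[OF square_integrable_swap[OF k] square_integrable_tensor[OF fg(2,4)]]
    by (simp add: lborel_prod case_prod_unfold)
  also have "\<dots> = (LINT p|(lborel \<Otimes>\<^sub>M lborel). ?k p * (f (snd p) * g (fst p)))"
    using lborel_pair.integral_product_swap[of "\<lambda>p. ?k p * (f (snd p) * g (fst p))"] by simp
  also have "\<dots> = inner (l2of ?k) (l2_tensor y x)"
    unfolding fg(1,3) l2_tensor_of[OF fg(4,2)] inner_l2of[OF k square_integrable_tensor[OF fg(4,2)]]
    by (simp add: lborel_prod case_prod_unfold mult.commute)
  finally show ?thesis by (simp add: l2rep)
qed

lemma hs_op_adj: "inner (hs_op (hs_adj \<kappa>) x) y = inner x (hs_op \<kappa> y)"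
  by (simp add: inner_hs_op inner_hs_adj_tensor inner_commute[of x])

lemma hs_adj_of:
  assumes "square_integrable k"
  shows "hs_adj (l2of k) = l2of (\<lambda>(u, v). k (v, u))"
  unfolding hs_adj_def
proof (rule l2of_cong_AE)
  let ?k = "l2rep (l2of k)"
  have k: "square_integrable ?k" by (rule l2rep)
  have [measurable]: "k \<in> borel_measurable (borel \<Otimes>\<^sub>M borel)" "?k \<in> borel_measurable (borel \<Otimes>\<^sub>M borel)"
    using assms k by (auto simp: borel_prod)
  show "square_integrable (\<lambda>(u, v). ?k (v, u))" "square_integrable (\<lambda>(u, v). k (v, u))"
    by (intro square_integrable_swap assms k)+
  have "AE p in lborel. ?k p = k p" using l2of_eqD[OF l2rep(2) k assms] .
  hence "AE v in lborel. AE u in lborel. ?k (u, v) = k (u, v)"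
    by (subst AE_lborel_pair_eq_iff(2)) auto
  thus "AE p in lborel. (case p of (u, v) \<Rightarrow> ?k (v, u)) = (case p of (u, v) \<Rightarrow> k (v, u))"
    by (subst AE_lborel_pair_eq_iff(1)[symmetric]) auto
qed

lemma hs_adj_diff: "hs_op (hs_adj (\<kappa> - \<kappa>')) x = hs_op (hs_adj \<kappa>) x - hs_op (hs_adj \<kappa>') x"
  by (rule inner_ext) (simp add: inner_diff_left hs_op_adj hs_op_diff_left inner_diff_right)

lemma norm_hs_op_adj: "norm (hs_op (hs_adj \<kappa>) x) \<le> norm \<kappa> * norm x"
proof (cases "hs_op (hs_adj \<kappa>) x = 0")
  case False
  let ?z = "hs_op (hs_adj \<kappa>) x"
  have "norm ?z * norm ?z = inner x (hs_op \<kappa> ?z)" by (simp add: hs_op_adj power2_norm_eq_inner flip: power2_eq_square)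
  also have "\<dots> \<le> norm x * (norm \<kappa> * norm ?z)"
    by (rule order_trans[OF norm_cauchy_schwarz mult_left_mono[OF norm_hs_op]]) simp
  finally have "norm ?z * norm ?z \<le> norm \<kappa> * norm x * norm ?z" by (simp add: mult_ac)
  thus ?thesis using False by simp
qed simp

text \<open>Pettis' theorem in the separable case. A closed ball is cut out by countably many
  inequalities between inner products, and an open set is a countable union of closed balls.\<close>

lemma borel_measurable_weak:
  fixes f :: "'b \<Rightarrow> 'c::{real_inner, second_countable_topology}"
  assumes "\<And>x. (\<lambda>\<omega>. inner (f \<omega>) x) \<in> borel_measurable N"
  shows "f \<in> borel_measurable N"
proof (rule borel_measurableI)
  fix S :: "'c set" assume "open S"
  obtain D :: "'c set" where D: "countable D" "\<And>X. open X \<Longrightarrow> X \<noteq> {} \<Longrightarrow> \<exists>d\<in>D. d \<in> X"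
    using countable_dense_exists by blast
  have cb: "f -` cball v r \<inter> space N \<in> sets N" for v r
  proof -
    \<comment> \<open>By density and continuity, testing against \<open>D\<close> amounts to testing
      against \<open>z\<close> itself.\<close>
    have eq: "(norm z \<le> r) = (\<forall>d\<in>D. inner z d \<le> r * norm d)" if r: "r \<ge> 0" for z :: 'c
    proof
      assume "norm z \<le> r"
      thus "\<forall>d\<in>D. inner z d \<le> r * norm d"
        by (meson mult_right_mono norm_cauchy_schwarz norm_ge_zero order_trans)
    next
      assume a: "\<forall>d\<in>D. inner z d \<le> r * norm d"
      have "inner z z \<le> r * norm z"
      proof (rule ccontr)
        assume "\<not> ?thesis"
        hence z: "z \<in> {d. inner z d - r * norm d > 0}" by simp
        have "open {d. inner z d - r * norm d > 0}"
          by (intro open_Collect_less continuous_intros)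
        then obtain d where "d \<in> D" "inner z d - r * norm d > 0" using D(2) z by blast
        thus False using a by force
      qed
      hence "norm z * norm z \<le> r * norm z" by (simp add: power2_norm_eq_inner flip: power2_eq_square)
      thus "norm z \<le> r" using r by (cases "z = 0") auto
    qed
    show ?thesis
    proof (cases "r \<ge> 0")
      case True
      have "f -` cball v r \<inter> space N = {\<omega> \<in> space N. \<forall>d\<in>D. inner (f \<omega>) d - inner v d \<le> r * norm d}"
        using eq[OF True] by (auto simp: dist_norm norm_minus_commute[of v] inner_diff_left)
      also have "\<dots> \<in> sets N" using assms D(1) by measurable
      finally show ?thesis .
    qed auto
  qed
  define I where "I = {(d, q :: rat). d \<in> D \<and> cball d (of_rat q) \<subseteq> S}"
  have "S = (\<Union>(d, q)\<in>I. cball d (of_rat q))"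
  proof (intro equalityI subsetI)
    fix x assume "x \<in> S"
    then obtain e where e: "e > 0" "ball x e \<subseteq> S" using \<open>open S\<close> by (meson open_contains_ball)
    obtain q where q: "0 < real_of_rat q" "real_of_rat q < e / 2" using of_rat_dense[of 0 "e/2"] e by auto
    have "open (ball x (of_rat q))" "ball x (of_rat q) \<noteq> {}" using q by auto
    then obtain d where d: "d \<in> D" "dist x d < of_rat q" using D(2)[of "ball x (of_rat q)"] by auto
    have "cball d (of_rat q) \<subseteq> S"
    proof
      fix y assume "y \<in> cball d (of_rat q)"
      hence "dist x y < e" using d q dist_triangle[of x y d] by simp
      thus "y \<in> S" using e by auto
    qed
    thus "x \<in> (\<Union>(d, q)\<in>I. cball d (of_rat q))" 
      unfolding I_def using d by (intro UN_I[of "(d, q)"]) (auto simp: dist_commute)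
  qed (auto simp: I_def)
  hence "f -` S \<inter> space N = (\<Union>p\<in>I. f -` cball (fst p) (of_rat (snd p)) \<inter> space N)" by (auto simp: case_prod_unfold)
  also have "\<dots> \<in> sets N"
  proof (intro sets.countable_UN'' cb)
    have "I \<subseteq> D \<times> UNIV" by (auto simp: I_def)
    thus "countable I" using D(1) countable_subset by (metis countable_SIGMA countableI_type)
  qed
  finally show "f -` S \<inter> space N \<in> sets N" .
qed

section \<open>Functions and kernels on the interval as elements of L2\<close>

definition trunc :: "real \<Rightarrow> real \<Rightarrow> (real \<Rightarrow> real) \<Rightarrow> real \<Rightarrow> real" where
  "trunc a b f = (\<lambda>u. indicator {a..b} u * f u)"

definition ktrunc :: "real \<Rightarrow> real \<Rightarrow> (real \<Rightarrow> real \<Rightarrow> real) \<Rightarrow> real \<times> real \<Rightarrow> real" where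
  "ktrunc a b K = (\<lambda>(u, v). indicator {a..b} u * indicator {a..b} v * K u v)"

definition emb :: "real \<Rightarrow> real \<Rightarrow> (real \<Rightarrow> real) \<Rightarrow> real l2" where
  "emb a b f = l2of (trunc a b f)"

definition kemb :: "real \<Rightarrow> real \<Rightarrow> (real \<Rightarrow> real \<Rightarrow> real) \<Rightarrow> (real \<times> real) l2" where
  "kemb a b K = l2of (ktrunc a b K)"

text \<open>These relax \<open>sqint\<close> and \<open>hs_kernel\<close> to measurability of the restriction to \<open>{a..b}\<close>: empirical
  and true covariance kernels carry no information outside the interval.\<close>

abbreviation csi :: "real \<Rightarrow> real \<Rightarrow> (real \<Rightarrow> real) \<Rightarrow> bool" where
  "csi a b f \<equiv> square_integrable (trunc a b f)"

abbreviation ksi :: "real \<Rightarrow> real \<Rightarrow> (real \<Rightarrow> real \<Rightarrow> real) \<Rightarrow> bool" where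
  "ksi a b K \<equiv> square_integrable (ktrunc a b K)"

lemma indicator_square [simp]: "(indicator A x)\<^sup>2 = (indicator A x :: real)"
  by (simp add: indicator_def)

lemma indicator_mult_indicator [simp]: "indicator A x * indicator A x = (indicator A x :: real)"
  by (simp add: indicator_def)

lemma borel_measurable_lborel2: "borel_measurable (lborel \<Otimes>\<^sub>M lborel) = borel_measurable (borel \<Otimes>\<^sub>M borel)"
  by (intro measurable_cong_sets sets_pair_measure_cong sets_lborel refl)

lemma indicator_mult_self [simp]: "indicator A x * (indicator A x * y) = indicator A x * (y :: real)"
  by (simp add: indicator_def)

lemma trunc_trunc [simp]: "trunc a b (trunc a b f) = trunc a b f"
  by (simp add: trunc_def)

lemma sqint_csi: "sqint a b f \<Longrightarrow> csi a b f"
  unfolding sqint_def square_integrable_def trunc_def set_integrable_def by (auto simp: power_mult_distrib)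

lemma csi_sqint_trunc: "csi a b f \<Longrightarrow> sqint a b (trunc a b f)"
  unfolding sqint_def square_integrable_def set_integrable_def
  by (simp add: trunc_def power_mult_distrib)

lemma ip_emb: "csi a b f \<Longrightarrow> csi a b g \<Longrightarrow> ip a b f g = inner (emb a b f) (emb a b g)"
  unfolding emb_def ip_def set_lebesgue_integral_def
  by (simp add: inner_l2of) (simp add: trunc_def mult_ac)

lemma nrm_emb: "csi a b f \<Longrightarrow> nrm a b f = norm (emb a b f)"
  unfolding nrm_def by (simp add: ip_emb norm_eq_sqrt_inner)

lemma csi_diff: "csi a b f \<Longrightarrow> csi a b g \<Longrightarrow> csi a b (\<lambda>u. f u - g u)"
  using square_integrable_diff[of "trunc a b f" "trunc a b g"] by (simp add: trunc_def right_diff_distrib)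

lemma csi_scale: "csi a b f \<Longrightarrow> csi a b (\<lambda>u. c * f u)"
  using square_integrable_scale[of "trunc a b f" c] by (simp add: trunc_def mult.left_commute)

lemma csi_zero: "csi a b (\<lambda>u. 0)"
  by (simp add: trunc_def square_integrable_zero)

lemma csi_sum:
  "finite I \<Longrightarrow> (\<And>i. i \<in> I \<Longrightarrow> csi a b (f i)) \<Longrightarrow> csi a b (\<lambda>u. \<Sum>i\<in>I. f i u)"
  using square_integrable_sum[of I "\<lambda>i. trunc a b (f i)"] by (simp add: trunc_def sum_distrib_left)

lemma emb_diff: "csi a b f \<Longrightarrow> csi a b g \<Longrightarrow> emb a b (\<lambda>u. f u - g u) = emb a b f - emb a b g"
  unfolding emb_def by (simp add: l2of_diff) (simp add: trunc_def right_diff_distrib)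

lemma emb_scale: "csi a b f \<Longrightarrow> emb a b (\<lambda>u. c * f u) = c *\<^sub>R emb a b f"
  unfolding emb_def by (simp add: l2of_scale) (simp add: trunc_def mult.left_commute)

lemma emb_zero: "emb a b (\<lambda>u. 0) = 0"
  unfolding emb_def trunc_def by (simp add: l2of_zero)

lemma emb_sum:
  "finite I \<Longrightarrow> (\<And>i. i \<in> I \<Longrightarrow> csi a b (f i)) \<Longrightarrow> emb a b (\<lambda>u. \<Sum>i\<in>I. f i u) = (\<Sum>i\<in>I. emb a b (f i))"
  unfolding emb_def by (simp add: l2of_sum) (simp add: trunc_def sum_distrib_left)

lemma emb_trunc: "emb a b (trunc a b f) = emb a b f"
  by (simp add: emb_def)

lemma hs_kernel_ksi:
  assumes "hs_kernel a b K"
  shows "ksi a b K"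
proof -
  have [measurable]: "(\<lambda>(u, v). K u v) \<in> borel_measurable (borel \<Otimes>\<^sub>M borel)"
    using assms unfolding hs_kernel_def borel_measurable_lborel2 by simp
  have m: "ktrunc a b K \<in> borel_measurable (borel \<Otimes>\<^sub>M borel)" unfolding ktrunc_def by measurable
  have "(\<lambda>p. (ktrunc a b K p)\<^sup>2) = (\<lambda>p. indicator ({a..b} \<times> {a..b}) p *\<^sub>R (case p of (u, v) \<Rightarrow> (K u v)\<^sup>2))"
    by (auto simp: ktrunc_def indicator_def fun_eq_iff)
  thus ?thesis using assms m unfolding square_integrable_def hs_kernel_def set_integrable_def
    by (simp add: lborel_prod borel_prod)
qed

lemma hs_norm_kemb: "hs_kernel a b K \<Longrightarrow> hs_norm a b K = norm (kemb a b K)"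
proof -
  assume K: "hs_kernel a b K"
  have "(\<lambda>p. (ktrunc a b K p)\<^sup>2) = (\<lambda>p. indicator ({a..b} \<times> {a..b}) p *\<^sub>R (case p of (u, v) \<Rightarrow> (K u v)\<^sup>2))"
    by (auto simp: ktrunc_def indicator_def fun_eq_iff)
  hence "(norm (kemb a b K))\<^sup>2 = (hs_norm a b K)\<^sup>2"
    unfolding kemb_def hs_norm_def norm_l2of[OF hs_kernel_ksi[OF K]] set_lebesgue_integral_def
    by (subst real_sqrt_pow2) (auto simp: lborel_prod intro!: integral_nonneg_AE)
  moreover have "hs_norm a b K \<ge> 0"
    unfolding hs_norm_def set_lebesgue_integral_def by (auto intro!: integral_nonneg_AE)
  ultimately show ?thesis by (simp add: power2_eq_iff_nonneg)
qed

lemma trunc_kop: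
  "trunc a b (kop a b K f) = (\<lambda>u. LINT v|lborel. ktrunc a b K (u, v) * trunc a b f v)"
  unfolding trunc_def kop_def ktrunc_def set_lebesgue_integral_def
  by (auto simp: fun_eq_iff mult_ac simp flip: integral_mult_right_zero)

lemma csi_kop: "ksi a b K \<Longrightarrow> csi a b f \<Longrightarrow> csi a b (kop a b K f)"
  unfolding trunc_kop by (rule square_integrable_kernel_op)

lemma emb_kop: "ksi a b K \<Longrightarrow> csi a b f \<Longrightarrow> emb a b (kop a b K f) = hs_op (kemb a b K) (emb a b f)"
  unfolding emb_def kemb_def by (simp add: trunc_kop hs_op_of)

section \<open>The operators of the kernels \<open>Kmat\<close> and their eigenpairs\<close>

lemma square_integrable_cong_AE:
  assumes "square_integrable f" "g \<in> borel_measurable borel" "AE x in lborel. f x = g x"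
  shows "square_integrable g"
proof -
  have "f \<in> borel_measurable borel" using assms(1) by simp
  hence "integrable lborel (\<lambda>x. (f x)\<^sup>2) \<longleftrightarrow> integrable lborel (\<lambda>x. (g x)\<^sup>2)"
    using assms(2,3) by (intro integrable_cong_AE) auto
  thus ?thesis using assms by (simp add: square_integrable_def)
qed

text \<open>The operator of \<open>Kmat\<close>, written as a sum of compositions of each kernel
  operator with its adjoint. Positivity and symmetry are visible in this form, and the composed
  kernel itself never has to be embedded.\<close>

definition cov_square :: "(nat \<Rightarrow> (real \<times> real) l2) \<Rightarrow> nat \<Rightarrow> real l2 \<Rightarrow> real l2" where
  "cov_square \<kappa> L x = (\<Sum>h\<in>{1..L}. hs_op (\<kappa> h) (hs_op (hs_adj (\<kappa> h)) x))"

text \<open>Fubini is available only for those \<open>u\<close> whose section of \<open>k\<close> is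
  square integrable, which is why the composition formula is an almost everywhere statement.\<close>

lemma kernel_gram_op_AE:
  fixes k :: "real \<times> real \<Rightarrow> real"
  assumes k: "square_integrable k" and f: "square_integrable f"
  shows "AE u in lborel. integrable lborel (\<lambda>v. (LINT z|lborel. k (u, z) * k (v, z)) * f v) \<and>
    (LINT v|lborel. (LINT z|lborel. k (u, z) * k (v, z)) * f v) = (LINT z|lborel. k (u, z) * (LINT v|lborel. k (v, z) * f v))"
proof -
  have [measurable]: "k \<in> borel_measurable (borel \<Otimes>\<^sub>M borel)" using k by (simp add: borel_prod square_integrable_def)
  have "integrable (lborel \<Otimes>\<^sub>M lborel) (\<lambda>p. (k p)\<^sup>2)" using k by (simp add: square_integrable_def lborel_prod)
  hence "AE u in lborel. integrable lborel (\<lambda>z. (k (u, z))\<^sup>2)" by (rule lborel_pair.AE_integrable_fst')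
  thus ?thesis
  proof eventually_elim
    case (elim u)
    hence ku: "square_integrable (\<lambda>z. k (u, z))" by (simp add: square_integrable_def)
    have "integrable lborel (\<lambda>p. k p * (case p of (v, z) \<Rightarrow> f v * k (u, z)))"
      by (rule square_integrable_mult[OF k square_integrable_tensor[OF f ku]])
    also have "(\<lambda>p. k p * (case p of (v, z) \<Rightarrow> f v * k (u, z))) = (\<lambda>(v, z). k (u, z) * k (v, z) * f v)"
      by (auto simp: fun_eq_iff mult_ac)
    finally have int: "integrable (lborel \<Otimes>\<^sub>M lborel) (\<lambda>(v, z). k (u, z) * k (v, z) * f v)" by (simp add: lborel_prod)
    have 1: "(LINT z|lborel. k (u, z) * k (v, z) * f v) = (LINT z|lborel. k (u, z) * k (v, z)) * f v" for v by simp
    have 2: "(LINT v|lborel. k (u, z) * k (v, z) * f v) = k (u, z) * (LINT v|lborel. k (v, z) * f v)" for z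
      by (simp add: mult.assoc)
    show ?case using lborel_pair.integrable_fst[OF int] lborel_pair.Fubini_integral[OF int] unfolding 1 2 by simp
  qed
qed

text \<open>Both claims go through the iterated integral \<open>g\<close>, which is square
  integrable by construction and represents \<open>cov_square\<close>; the operator of
  \<open>Kmat\<close> equals it almost everywhere.\<close>

lemma
  assumes S: "\<And>h. h \<in> {1..L} \<Longrightarrow> ksi a b (S (int h) j j)" and f: "csi a b f"
  shows csi_kop_Kmat: "csi a b (kop a b (Kmat a b S L j) f)"
    and emb_kop_Kmat: "emb a b (kop a b (Kmat a b S L j) f) = cov_square (\<lambda>h. kemb a b (S (int h) j j)) L (emb a b f)"
proof -
  define k where "k h = ktrunc a b (S (int h) j j)" for h :: nat
  have k: "square_integrable (k h)" if "h \<in> {1..L}" for h using S[OF that] by (simp add: k_def)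
  hence km: "k h \<in> borel_measurable (borel \<Otimes>\<^sub>M borel)" if "h \<in> {1..L}" for h
    using that by (simp add: borel_prod square_integrable_def)
  have fm[measurable]: "trunc a b f \<in> borel_measurable borel" using f by simp
  define g where "g u = (\<Sum>h\<in>{1..L}. LINT z|lborel. k h (u, z) * (LINT v|lborel. k h (v, z) * trunc a b f v))" for u
  have adj: "hs_op (hs_adj (kemb a b (S (int h) j j))) (emb a b f) = l2of (\<lambda>z. LINT v|lborel. k h (v, z) * trunc a b f v)"
    and adjs: "square_integrable (\<lambda>z. LINT v|lborel. k h (v, z) * trunc a b f v)" if "h \<in> {1..L}" for h
    using hs_op_of[OF square_integrable_swap[OF k[OF that]] f] square_integrable_kernel_op[OF square_integrable_swap[OF k[OF that]] f]
      hs_adj_of[OF k[OF that]]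
    by (simp_all add: emb_def kemb_def k_def)
  have gs: "square_integrable g" unfolding g_def
    by (intro square_integrable_sum square_integrable_kernel_op k adjs) auto
  have g2: "l2of g = cov_square (\<lambda>h. kemb a b (S (int h) j j)) L (emb a b f)"
  proof -
    have "l2of g = (\<Sum>h\<in>{1..L}. l2of (\<lambda>u. LINT z|lborel. k h (u, z) * (LINT v|lborel. k h (v, z) * trunc a b f v)))"
      unfolding g_def by (rule l2of_sum[symmetric]) (auto intro!: square_integrable_kernel_op k adjs)
    also have "\<dots> = cov_square (\<lambda>h. kemb a b (S (int h) j j)) L (emb a b f)"
      unfolding cov_square_def
    proof (rule sum.cong[OF refl])
      fix h assume h: "h \<in> {1..L}"
      show "l2of (\<lambda>u. LINT z|lborel. k h (u, z) * (LINT v|lborel. k h (v, z) * trunc a b f v)) =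
        hs_op (kemb a b (S (int h) j j)) (hs_op (hs_adj (kemb a b (S (int h) j j))) (emb a b f))"
        unfolding adj[OF h] by (simp add: kemb_def k_def[symmetric] hs_op_of[OF k[OF h] adjs[OF h]])
    qed
    finally show ?thesis .
  qed
  have eq: "trunc a b (kop a b (Kmat a b S L j) f) u = (LINT v|lborel. (\<Sum>h\<in>{1..L}. (LINT z|lborel. k h (u, z) * k h (v, z)) * trunc a b f v))" for u
  proof -
    have "trunc a b (kop a b (Kmat a b S L j) f) u = (LINT v|lborel. ktrunc a b (Kmat a b S L j) (u, v) * trunc a b f v)"
      by (simp add: trunc_kop)
    also have "\<dots> = (LINT v|lborel. (\<Sum>h\<in>{1..L}. (LINT z|lborel. k h (u, z) * k h (v, z))) * trunc a b f v)"
    proof (rule Bochner_Integration.integral_cong[OF refl])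
      fix v
      have "ktrunc a b (Kmat a b S L j) (u, v) = (\<Sum>h\<in>{1..L}. (LINT z|lborel. k h (u, z) * k h (v, z)))"
        unfolding ktrunc_def Kmat_def k_def set_lebesgue_integral_def
        by (auto simp: sum_distrib_left mult_ac intro!: sum.cong Bochner_Integration.integral_cong simp flip: integral_mult_right_zero)
      thus "ktrunc a b (Kmat a b S L j) (u, v) * trunc a b f v = (\<Sum>h\<in>{1..L}. (LINT z|lborel. k h (u, z) * k h (v, z))) * trunc a b f v" by simp
    qed
    finally show ?thesis by (simp add: sum_distrib_right)
  qed
  have ae: "AE u in lborel. g u = trunc a b (kop a b (Kmat a b S L j) f) u"
  proof -
    have "AE u in lborel. \<forall>h\<in>{1..L}. integrable lborel (\<lambda>v. (LINT z|lborel. k h (u, z) * k h (v, z)) * trunc a b f v) \<and>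
      (LINT v|lborel. (LINT z|lborel. k h (u, z) * k h (v, z)) * trunc a b f v) = (LINT z|lborel. k h (u, z) * (LINT v|lborel. k h (v, z) * trunc a b f v))"
      by (intro AE_finite_allI kernel_gram_op_AE k f) auto
    thus ?thesis
    proof eventually_elim
      case (elim u)
      thus ?case unfolding eq g_def by (subst Bochner_Integration.integral_sum) auto
    qed
  qed
  \<comment> \<open>Agreement almost everywhere with \<open>g\<close> does not give Borel
    measurability, so this is shown from the integral formula.\<close>
  have m: "trunc a b (kop a b (Kmat a b S L j) f) \<in> borel_measurable borel"
  proof -
    have "(\<lambda>p. LINT z|lborel. k h (fst p, z) * k h (snd p, z)) \<in> borel_measurable (borel \<Otimes>\<^sub>M borel)" if "h \<in> {1..L}" for h
    proof -
      note [measurable] = km[OF that]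
      show ?thesis by measurable
    qed
    hence "(\<lambda>p. \<Sum>h\<in>{1..L}. (LINT z|lborel. k h (fst p, z) * k h (snd p, z)) * trunc a b f (snd p)) \<in> borel_measurable (borel \<Otimes>\<^sub>M borel)"
      by (intro borel_measurable_sum borel_measurable_times) auto
    hence "(\<lambda>(u, v). \<Sum>h\<in>{1..L}. (LINT z|lborel. k h (u, z) * k h (v, z)) * trunc a b f v) \<in> borel_measurable (borel \<Otimes>\<^sub>M lborel)"
      by (simp add: case_prod_unfold cong: measurable_cong_sets)
    hence "(\<lambda>u. LINT v|lborel. (\<Sum>h\<in>{1..L}. (LINT z|lborel. k h (u, z) * k h (v, z)) * trunc a b f v)) \<in> borel_measurable borel"
      by (rule lborel.borel_measurable_lebesgue_integral)
    thus ?thesis unfolding eq[abs_def] .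
  qed
  show c: "csi a b (kop a b (Kmat a b S L j) f)" by (rule square_integrable_cong_AE[OF gs m ae])
  show "emb a b (kop a b (Kmat a b S L j) f) = cov_square (\<lambda>h. kemb a b (S (int h) j j)) L (emb a b f)"
    using l2of_cong_AE[OF gs c ae] g2 by (simp add: emb_def)
qed

lemma inner_cov_square: "inner (cov_square \<kappa> L x) y = (\<Sum>h\<in>{1..L}. inner (hs_op (hs_adj (\<kappa> h)) x) (hs_op (hs_adj (\<kappa> h)) y))"
proof -
  have "inner (hs_op (\<kappa> h) (hs_op (hs_adj (\<kappa> h)) x)) y = inner (hs_op (hs_adj (\<kappa> h)) x) (hs_op (hs_adj (\<kappa> h)) y)" for h
    using hs_op_adj[of "\<kappa> h" y "hs_op (hs_adj (\<kappa> h)) x"] by (simp add: inner_commute)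
  thus ?thesis by (simp add: cov_square_def inner_sum_left)
qed

lemma bounded_linear_cov_square: "bounded_linear (cov_square \<kappa> L)"
  unfolding cov_square_def
  by (intro bounded_linear_sum bounded_linear_compose[OF bounded_linear_hs_op bounded_linear_hs_op])

text \<open>Each summand is controlled by the image under its adjoint factor, whose sums of squares
  are bounded by \<open>hs_bounded_hs_op\<close>; the two sums are then exchanged.\<close>

lemma hs_bounded_cov_square: "\<exists>s. hs_bounded (cov_square \<kappa> L) s"
proof -
  have pt: "(norm (cov_square \<kappa> L e))\<^sup>2 \<le> (\<Sum>h\<in>{1..L}. (norm (\<kappa> h))\<^sup>2 * (norm (hs_op (hs_adj (\<kappa> h)) e))\<^sup>2) * L" for e
  proof -
    have "norm (cov_square \<kappa> L e) \<le> (\<Sum>h\<in>{1..L}. norm (\<kappa> h) * norm (hs_op (hs_adj (\<kappa> h)) e))"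
      unfolding cov_square_def by (intro sum_norm_le norm_hs_op)
    hence "(norm (cov_square \<kappa> L e))\<^sup>2 \<le> (\<Sum>h\<in>{1..L}. norm (\<kappa> h) * norm (hs_op (hs_adj (\<kappa> h)) e))\<^sup>2"
      by (intro power_mono) auto
    also have "\<dots> \<le> (\<Sum>h\<in>{1..L}. (norm (\<kappa> h) * norm (hs_op (hs_adj (\<kappa> h)) e))\<^sup>2) * card {1..L}"
      by (rule sum_squared_le_sum_of_squares)
    finally show ?thesis by (simp add: power_mult_distrib)
  qed
  have "hs_bounded (cov_square \<kappa> L) ((\<Sum>h\<in>{1..L}. (norm (\<kappa> h))\<^sup>2 * (norm (hs_adj (\<kappa> h)))\<^sup>2) * L)"
    unfolding hs_bounded_def
  proof (intro allI impI)
    fix E :: "real l2 set" assume E: "finite E" "orthonormal E"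
    have "(\<Sum>e\<in>E. (norm (cov_square \<kappa> L e))\<^sup>2) \<le> (\<Sum>e\<in>E. (\<Sum>h\<in>{1..L}. (norm (\<kappa> h))\<^sup>2 * (norm (hs_op (hs_adj (\<kappa> h)) e))\<^sup>2) * L)"
      by (intro sum_mono pt)
    also have "\<dots> = (\<Sum>h\<in>{1..L}. (norm (\<kappa> h))\<^sup>2 * (\<Sum>e\<in>E. (norm (hs_op (hs_adj (\<kappa> h)) e))\<^sup>2)) * L"
      by (simp add: sum_distrib_right[symmetric] sum.swap[of _ "{1..L}"] sum_distrib_left del: sum.swap) (subst sum.swap, simp)
    also have "\<dots> \<le> (\<Sum>h\<in>{1..L}. (norm (\<kappa> h))\<^sup>2 * (norm (hs_adj (\<kappa> h)))\<^sup>2) * L"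
      using hs_bounded_hs_op E unfolding hs_bounded_def by (intro mult_right_mono sum_mono mult_left_mono) auto
    finally show "(\<Sum>e\<in>E. (norm (cov_square \<kappa> L e))\<^sup>2) \<le> (\<Sum>h\<in>{1..L}. (norm (\<kappa> h))\<^sup>2 * (norm (hs_adj (\<kappa> h)))\<^sup>2) * L" .
  qed
  thus ?thesis by blast
qed

text \<open>The spectrum of \<open>cov_square\<close> concerns classes of functions on the whole
  line, whereas \<open>eigpairs\<close> speaks about functions on the interval. The range of a
  cut-off kernel consists of embedded functions, which closes the gap for eigenvectors of nonzero
  eigenvalues.\<close>

lemma hs_op_kemb_emb:
  assumes "ksi a b K"
  shows "\<exists>f. csi a b f \<and> hs_op (kemb a b K) x = emb a b f"
proof -
  let ?f = "\<lambda>u. LINT v|lborel. indicator {a..b} v * K u v * l2rep x v"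
  have eq: "trunc a b ?f = (\<lambda>u. LINT v|lborel. ktrunc a b K (u, v) * l2rep x v)"
    by (auto simp: trunc_def ktrunc_def fun_eq_iff mult_ac simp flip: integral_mult_right_zero)
  have "csi a b ?f" unfolding eq by (rule square_integrable_kernel_op[OF assms l2rep(1)])
  moreover have "hs_op (kemb a b K) (l2of (l2rep x)) = emb a b ?f"
    unfolding emb_def eq kemb_def by (rule hs_op_of[OF assms l2rep(1)])
  ultimately show ?thesis unfolding l2rep(2) by blast
qed

text \<open>The clauses of \<open>eigpairs\<close> translate one by one; only \<open>exh\<close>
  needs a construction, since an abstract eigenvector must first be written as an embedded
  function.\<close>

lemma eigpairs_psd_spectrum:
  assumes S: "\<And>h. h \<in> {1..L} \<Longrightarrow> ksi a b (S (int h) j j)"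
    and eig: "eigpairs a b (Kmat a b S L j) lam psi"
  shows "\<exists>s. psd_spectrum (cov_square (\<lambda>h. kemb a b (S (int h) j j)) L) s lam (\<lambda>l. emb a b (psi l))"
proof -
  let ?k = "\<lambda>h. kemb a b (S (int h) j j)"
  let ?K = "cov_square ?k L"
  obtain s where s: "hs_bounded ?K s" using hs_bounded_cov_square by blast
  interpret BL: bounded_linear ?K by (rule bounded_linear_cov_square)
  have psi: "csi a b (psi l)" if "l \<ge> 1" for l using eig that unfolding eigpairs_def by (auto intro: sqint_csi)
  have nrm_eq: "nrm a b (\<lambda>u. kop a b (Kmat a b S L j) f u - \<mu> * f u) = norm (?K (emb a b f) - \<mu> *\<^sub>R emb a b f)"
    if "csi a b f" for f \<mu>
    using that csi_kop_Kmat[of L a b S j f, OF S that] emb_kop_Kmat[of L a b S j f, OF S that]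
    by (simp add: nrm_emb csi_diff csi_scale emb_diff emb_scale)
  have "psd_spectrum ?K s lam (\<lambda>l. emb a b (psi l))"
  proof
    show "inner (?K x) y = inner x (?K y)" for x y
      unfolding inner_commute[of x "?K y"] inner_cov_square by (intro sum.cong refl inner_commute)
    show "0 \<le> inner (?K x) x" for x by (simp add: inner_cov_square sum_nonneg)
    show "hs_bounded ?K s" by (rule s)
    show "inner (emb a b (psi l)) (emb a b (psi m)) = (if l = m then 1 else 0)" if "1 \<le> l" "1 \<le> m" for l m
      using eig that ip_emb[OF psi psi, of l m] unfolding eigpairs_def by auto
    show "?K (emb a b (psi l)) = lam l *\<^sub>R emb a b (psi l)" if "1 \<le> l" for l
      using eig that nrm_eq[OF psi[OF that], of "lam l"] unfolding eigpairs_def by auto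
    show "lam (Suc l) \<le> lam l" if "1 \<le> l" for l using eig that unfolding eigpairs_def by auto
  next
    fix \<mu> f assume mu: "\<mu> \<noteq> 0" "?K f = \<mu> *\<^sub>R f"
    have "\<exists>g. csi a b g \<and> hs_op (?k h) (hs_op (hs_adj (?k h)) f) = emb a b g" if "h \<in> {1..L}" for h
      using hs_op_kemb_emb[OF S[OF that]] by blast
    then obtain g where g: "\<And>h. h \<in> {1..L} \<Longrightarrow> csi a b (g h)"
      "\<And>h. h \<in> {1..L} \<Longrightarrow> hs_op (?k h) (hs_op (hs_adj (?k h)) f) = emb a b (g h)" by metis
    \<comment> \<open>\<open>eigpairs\<close> asks for measurability on the whole line, hence the
      truncation of this representative.\<close>
    define G where "G = trunc a b (\<lambda>u. inverse \<mu> * (\<Sum>h\<in>{1..L}. g h u))"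
    have c: "csi a b (\<lambda>u. inverse \<mu> * (\<Sum>h\<in>{1..L}. g h u))" using g by (intro csi_scale csi_sum) auto
    have sG: "sqint a b G" unfolding G_def by (rule csi_sqint_trunc[OF c])
    have "f = inverse \<mu> *\<^sub>R ?K f" using mu by simp
    also have "\<dots> = emb a b (\<lambda>u. inverse \<mu> * (\<Sum>h\<in>{1..L}. g h u))"
    proof -
      have "emb a b (\<lambda>u. inverse \<mu> * (\<Sum>h\<in>{1..L}. g h u)) = inverse \<mu> *\<^sub>R (\<Sum>h\<in>{1..L}. emb a b (g h))"
        using g(1) by (subst emb_scale) (auto intro!: csi_sum arg_cong[where f="scaleR _"] emb_sum)
      thus ?thesis unfolding cov_square_def using g(2) by simp
    qed
    finally have fG: "f = emb a b G" unfolding G_def emb_trunc .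
    have "nrm a b (\<lambda>u. kop a b (Kmat a b S L j) G u - \<mu> * G u) = 0"
      using nrm_eq[OF sqint_csi[OF sG], of \<mu>] mu fG by simp
    then obtain F c where F: "finite F" "F \<subseteq> {l. l \<ge> 1 \<and> lam l = \<mu>}" "nrm a b (\<lambda>u. G u - (\<Sum>l\<in>F. c l * psi l u)) = 0"
      using eig sG mu(1) unfolding eigpairs_def by blast
    have cF: "csi a b (\<lambda>u. c l * psi l u)" if "l \<in> F" for l using F(2) that by (intro csi_scale psi) auto
    have "norm (emb a b (\<lambda>u. G u - (\<Sum>l\<in>F. c l * psi l u))) = 0"
      using F(3) by (subst (asm) nrm_emb) (intro csi_diff sqint_csi[OF sG] csi_sum F cF, auto)
    hence "emb a b G - (\<Sum>l\<in>F. c l *\<^sub>R emb a b (psi l)) = 0"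
      using F(1,2) cF psi sqint_csi[OF sG] by (subst (asm) emb_diff) (auto simp: csi_sum emb_sum emb_scale subset_iff)
    hence "f = (\<Sum>l\<in>F. c l *\<^sub>R emb a b (psi l))" using fG by simp
    thus "\<exists>F c. finite F \<and> F \<subseteq> {l. l \<ge> 1 \<and> lam l = \<mu>} \<and> f = (\<Sum>l\<in>F. c l *\<^sub>R emb a b (psi l))"
      using F by blast
  qed
  thus ?thesis by blast
qed

text \<open>One factor is replaced at a time. The perturbed kernel has norm at most
  \<open>C + 1\<close> because \<eta> \<le> 1, so the two differences contribute \<open>C\<close>
  and \<open>C + 1\<close>.\<close>

lemma cov_square_perturbation:
  assumes "\<And>h. h \<in> {1..L} \<Longrightarrow> norm (\<kappa> h) \<le> C" "\<And>h. h \<in> {1..L} \<Longrightarrow> norm (\<kappa>' h - \<kappa> h) \<le> \<eta>" "\<eta> \<le> 1" "C \<ge> 0" "\<eta> \<ge> 0"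
  shows "norm (cov_square \<kappa> L x - cov_square \<kappa>' L x) \<le> L * (2 * C + 1) * \<eta> * norm x"
proof -
  have "norm (hs_op (\<kappa> h) (hs_op (hs_adj (\<kappa> h)) x) - hs_op (\<kappa>' h) (hs_op (hs_adj (\<kappa>' h)) x)) \<le> (2 * C + 1) * \<eta> * norm x"
    if h: "h \<in> {1..L}" for h
  proof -
    interpret B: bounded_linear "hs_op (\<kappa>' h)" by (rule bounded_linear_hs_op)
    have k': "norm (\<kappa>' h) \<le> C + 1"
      using assms(1)[OF h] assms(2)[OF h] assms(3) norm_triangle_sub[of "\<kappa>' h" "\<kappa> h"] by linarith
    have d: "norm (\<kappa> h - \<kappa>' h) \<le> \<eta>" using assms(2)[OF h] by (simp add: norm_minus_commute)
    have "hs_op (\<kappa> h) (hs_op (hs_adj (\<kappa> h)) x) - hs_op (\<kappa>' h) (hs_op (hs_adj (\<kappa>' h)) x)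
       = hs_op (\<kappa> h - \<kappa>' h) (hs_op (hs_adj (\<kappa> h)) x) + hs_op (\<kappa>' h) (hs_op (hs_adj (\<kappa> h - \<kappa>' h)) x)"
      by (simp add: hs_op_diff_left hs_adj_diff B.diff)
    also have "norm \<dots> \<le> norm (\<kappa> h - \<kappa>' h) * (norm (\<kappa> h) * norm x) + norm (\<kappa>' h) * (norm (\<kappa> h - \<kappa>' h) * norm x)"
      by (intro norm_triangle_le add_mono order_trans[OF norm_hs_op] mult_left_mono norm_hs_op_adj) auto
    also have "\<dots> \<le> \<eta> * (C * norm x) + (C + 1) * (\<eta> * norm x)"
      using assms(1)[OF h] d k' assms(4,5) by (intro add_mono mult_mono mult_right_mono) auto
    also have "\<dots> = (2 * C + 1) * \<eta> * norm x" by (simp add: algebra_simps)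
    finally show ?thesis .
  qed
  hence "norm (cov_square \<kappa> L x - cov_square \<kappa>' L x) \<le> (\<Sum>h\<in>{1..L}. (2 * C + 1) * \<eta> * norm x)"
    unfolding cov_square_def sum_subtractf[symmetric] by (intro sum_norm_le) auto
  thus ?thesis by (simp add: mult_ac)
qed

text \<open>The distance of \<open>lam l\<close> to an earlier eigenvalue \<open>lam m\<close> is at
  least the gap right after \<open>m\<close>, and the lower bounds for the gaps decrease with the
  index; so \<open>c0 * real l powr (- \<alpha> - 1)\<close> bounds the distance on both sides of
  \<open>lam l\<close>. Its inverse produces the growth
  \<open>real l powr (\<alpha> + 1)\<close>.\<close>

lemma eigenfunction_error:
  assumes S: "\<And>h. h \<in> {1..L} \<Longrightarrow> ksi a b (S (int h) j j)" "\<And>h. h \<in> {1..L} \<Longrightarrow> ksi a b (S' (int h) j j)"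
    and eig: "eigpairs a b (Kmat a b S L j) lam psi" "eigpairs a b (Kmat a b S' L j) lam' psi'"
    and gap: "\<And>l. l \<ge> 1 \<Longrightarrow> lam l - lam (Suc l) \<ge> c0 * real l powr (- \<alpha> - 1)" and c0: "c0 > 0" and \<alpha>: "\<alpha> > 1"
    and sgn: "ip a b (psi' l) (psi l) \<ge> 0" and l: "l \<ge> 1"
    and C: "\<And>h. h \<in> {1..L} \<Longrightarrow> norm (kemb a b (S (int h) j j)) \<le> C"
    and err: "\<And>h. h \<in> {1..L} \<Longrightarrow> norm (kemb a b (S' (int h) j j) - kemb a b (S (int h) j j)) \<le> \<eta>"
    and b: "\<eta> \<le> 1" "C \<ge> 0" "\<eta> \<ge> 0"
  shows "norm (emb a b (psi' l) - emb a b (psi l)) \<le> 3 * real L * (2 * C + 1) / c0 * real l powr (\<alpha> + 1) * \<eta>"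
proof -
  obtain s where 1: "psd_spectrum (cov_square (\<lambda>h. kemb a b (S (int h) j j)) L) s lam (\<lambda>l. emb a b (psi l))"
    using eigpairs_psd_spectrum[of L a b S j] S eig by blast
  obtain s' where 2: "psd_spectrum (cov_square (\<lambda>h. kemb a b (S' (int h) j j)) L) s' lam' (\<lambda>l. emb a b (psi' l))"
    using eigpairs_psd_spectrum[of L a b S' j] S eig by blast
  interpret A: psd_spectrum "cov_square (\<lambda>h. kemb a b (S (int h) j j)) L" s lam "\<lambda>l. emb a b (psi l)" by fact
  let ?d = "c0 * real l powr (- \<alpha> - 1)"
  have d: "?d > 0" using c0 l by simp
  have csi: "csi a b (psi l)" "csi a b (psi' l)" using eig l unfolding eigpairs_def by (auto intro: sqint_csi)
  have "norm (emb a b (psi' l) - emb a b (psi l)) \<le> 3 * (real L * (2 * C + 1) * \<eta>) / ?d"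
  proof (rule eigenvector_perturbation[OF 1 2 _ l d])
    show "norm (cov_square (\<lambda>h. kemb a b (S (int h) j j)) L x - cov_square (\<lambda>h. kemb a b (S' (int h) j j)) L x)
        \<le> L * (2 * C + 1) * \<eta> * norm x" for x
      using C err b by (intro cov_square_perturbation) auto
    show "lam l - lam (Suc l) \<ge> ?d" by (rule gap[OF l])
    show "lam m - lam l \<ge> ?d" if "1 \<le> m" "m < l" for m
    proof -
      have "real l powr (- \<alpha> - 1) \<le> real m powr (- \<alpha> - 1)"
        using that \<alpha> by (intro powr_mono2') auto
      hence "?d \<le> c0 * real m powr (- \<alpha> - 1)" using c0 by simp
      also have "\<dots> \<le> lam m - lam (Suc m)" by (rule gap[OF that(1)])
      also have "\<dots> \<le> lam m - lam l" using A.lam_mono[of "Suc m" l] that by simp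
      finally show ?thesis .
    qed
    show "inner (emb a b (psi' l)) (emb a b (psi l)) \<ge> 0" using sgn csi by (simp add: ip_emb)
  qed
  also have "\<dots> = 3 * real L * (2 * C + 1) / c0 * real l powr (\<alpha> + 1) * \<eta>"
  proof -
    have "real l powr (- \<alpha> - 1) = inverse (real l powr (\<alpha> + 1))" by (simp add: powr_minus[symmetric])
    hence "inverse ?d = inverse c0 * real l powr (\<alpha> + 1)" by simp
    thus ?thesis unfolding divide_inverse by (simp only: mult_ac)
  qed
  finally show ?thesis .
qed

lemma
  assumes W: "\<And>t. csi a b (W t j \<omega>)" "\<And>t. csi a b (W t k \<omega>)"
  shows ksi_sacov: "ksi a b (sacov n W \<omega> h j k)"
    and kemb_sacov: "kemb a b (sacov n W \<omega> h j k) =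
      (\<Sum>t\<in>{1..int n - h}. l2_tensor (emb a b (W t j \<omega>)) (emb a b (W (t + h) k \<omega>))) /\<^sub>R (real n - real_of_int h)"
proof -
  let ?c = "inverse (real n - real_of_int h)"
  let ?f = "\<lambda>t (u, v). trunc a b (W t j \<omega>) u * trunc a b (W (t + h) k \<omega>) v"
  have eq: "ktrunc a b (sacov n W \<omega> h j k) = (\<lambda>p. ?c * (\<Sum>t\<in>{1..int n - h}. ?f t p))"
    by (auto simp: ktrunc_def sacov_def trunc_def fun_eq_iff sum_distrib_left divide_inverse mult_ac)
  have si: "square_integrable (?f t)" for t by (intro square_integrable_tensor W)
  show "ksi a b (sacov n W \<omega> h j k)" unfolding eq by (intro square_integrable_scale square_integrable_sum si) auto
  show "kemb a b (sacov n W \<omega> h j k) =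
      (\<Sum>t\<in>{1..int n - h}. l2_tensor (emb a b (W t j \<omega>)) (emb a b (W (t + h) k \<omega>))) /\<^sub>R (real n - real_of_int h)"
    unfolding kemb_def eq using si
    by (simp add: l2of_scale[symmetric] square_integrable_sum l2of_sum[symmetric] emb_def l2_tensor_of W)
qed

lemma inner_bilinear_error:
  assumes "norm x' \<le> 1" "norm y' \<le> 1" "norm x \<le> 1" "norm y \<le> 1"
  shows "\<bar>inner \<kappa>' (l2_tensor x' y') - inner \<kappa> (l2_tensor x y)\<bar> \<le> norm (\<kappa>' - \<kappa>) + norm \<kappa> * (norm (x' - x) + norm (y' - y))"
proof -
  interpret T: bounded_bilinear l2_tensor by (rule bounded_bilinear_l2_tensor)
  have "inner \<kappa>' (l2_tensor x' y') - inner \<kappa> (l2_tensor x y) =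
     inner (\<kappa>' - \<kappa>) (l2_tensor x' y') + (inner \<kappa> (l2_tensor (x' - x) y') + inner \<kappa> (l2_tensor x (y' - y)))"
    by (simp add: T.diff_left T.diff_right inner_diff_left inner_diff_right)
  also have "\<bar>\<dots>\<bar> \<le> \<bar>inner (\<kappa>' - \<kappa>) (l2_tensor x' y')\<bar> + (\<bar>inner \<kappa> (l2_tensor (x' - x) y')\<bar> + \<bar>inner \<kappa> (l2_tensor x (y' - y))\<bar>)"
    by linarith
  also have "\<dots> \<le> norm (\<kappa>' - \<kappa>) * (norm x' * norm y') + (norm \<kappa> * (norm (x' - x) * norm y') + norm \<kappa> * (norm x * norm (y' - y)))"
    by (intro add_mono order_trans[OF Cauchy_Schwarz_ineq2]) (simp_all add: norm_l2_tensor)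
  also have "\<dots> \<le> norm (\<kappa>' - \<kappa>) * 1 + (norm \<kappa> * (norm (x' - x) * 1) + norm \<kappa> * (1 * norm (y' - y)))"
    using assms by (intro add_mono mult_left_mono mult_right_mono mult_le_one) auto
  finally show ?thesis by (simp add: distrib_left)
qed

section \<open>Random functions and covariance kernels\<close>

lemma rfun_measurable2: "rfun M a b Z \<Longrightarrow> (\<lambda>(\<omega>, u). Z \<omega> u) \<in> borel_measurable (M \<Otimes>\<^sub>M borel)"
  unfolding rfun_def by (simp cong: measurable_cong_sets)

lemma rfun_csi: "rfun M a b Z \<Longrightarrow> \<omega> \<in> space M \<Longrightarrow> csi a b (Z \<omega>)"
  unfolding rfun_def by (auto intro: sqint_csi)

lemma rfun_emb_measurable:
  assumes Z: "rfun M a b Z"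
  shows "(\<lambda>\<omega>. emb a b (Z \<omega>)) \<in> borel_measurable M"
proof (rule borel_measurable_weak)
  fix x :: "real l2"
  obtain g where g: "x = l2of g" "square_integrable g" by (rule l2_cases)
  have [measurable]: "g \<in> borel_measurable borel" "(\<lambda>(\<omega>, u). Z \<omega> u) \<in> borel_measurable (M \<Otimes>\<^sub>M borel)"
    using g rfun_measurable2[OF Z] by auto
  have "(\<lambda>\<omega>. LINT u|lborel. trunc a b (Z \<omega>) u * g u) \<in> borel_measurable M"
    unfolding trunc_def by measurable
  thus "(\<lambda>\<omega>. inner (emb a b (Z \<omega>)) x) \<in> borel_measurable M"
    by (rule measurable_cong[THEN iffD1, rotated]) (simp add: emb_def g inner_l2of rfun_csi[OF Z])
qed

lemma rfun_square_measurable: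
  assumes Z: "rfun M a b Z" and "sigma_finite_measure M"
  shows "(\<lambda>u. LINT \<omega>|M. (Z \<omega> u)\<^sup>2) \<in> borel_measurable borel"
proof -
  interpret sigma_finite_measure M by fact
  have [measurable]: "(\<lambda>(\<omega>, u). Z \<omega> u) \<in> borel_measurable (M \<Otimes>\<^sub>M borel)"
    using rfun_measurable2[OF Z] by auto
  have "(\<lambda>p. Z (snd p) (fst p)) \<in> borel_measurable (borel \<Otimes>\<^sub>M M)"
    using measurable_compose[OF measurable_pair_swap' rfun_measurable2[OF Z]] by (simp add: case_prod_unfold)
  hence "(\<lambda>(u, \<omega>). (Z \<omega> u)\<^sup>2) \<in> borel_measurable (borel \<Otimes>\<^sub>M M)" by (simp add: case_prod_unfold)
  thus ?thesis by (rule borel_measurable_lebesgue_integral)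
qed

lemma nn_integral_norm_emb:
  assumes Z: "rfun M a b Z" and "sigma_finite_measure M"
  shows "(\<integral>\<^sup>+\<omega>. ennreal ((norm (emb a b (Z \<omega>)))\<^sup>2) \<partial>M) = (\<integral>\<^sup>+u. ennreal (indicator {a..b} u * (LINT \<omega>|M. (Z \<omega> u)\<^sup>2)) \<partial>lborel)"
proof -
  interpret P: pair_sigma_finite M lborel using assms(2) by (intro pair_sigma_finite.intro) (auto intro: lborel.sigma_finite_measure_axioms)
  have [measurable]: "(\<lambda>(\<omega>, u). Z \<omega> u) \<in> borel_measurable (M \<Otimes>\<^sub>M borel)"
    using rfun_measurable2[OF Z] by auto
  have "(\<integral>\<^sup>+\<omega>. ennreal ((norm (emb a b (Z \<omega>)))\<^sup>2) \<partial>M) = (\<integral>\<^sup>+\<omega>. \<integral>\<^sup>+u. ennreal (indicator {a..b} u * (Z \<omega> u)\<^sup>2) \<partial>lborel \<partial>M)"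
  proof (intro nn_integral_cong)
    fix \<omega> assume "\<omega> \<in> space M"
    thus "ennreal ((norm (emb a b (Z \<omega>)))\<^sup>2) = (\<integral>\<^sup>+u. ennreal (indicator {a..b} u * (Z \<omega> u)\<^sup>2) \<partial>lborel)"
      using nn_integral_l2of[OF rfun_csi[OF Z]] by (simp add: emb_def trunc_def power_mult_distrib)
  qed
  also have "\<dots> = (\<integral>\<^sup>+u. \<integral>\<^sup>+\<omega>. ennreal (indicator {a..b} u * (Z \<omega> u)\<^sup>2) \<partial>M \<partial>lborel)"
    by (rule P.Fubini'[symmetric]) simp
  also have "\<dots> = (\<integral>\<^sup>+u. ennreal (indicator {a..b} u * (LINT \<omega>|M. (Z \<omega> u)\<^sup>2)) \<partial>lborel)"
  proof (intro nn_integral_cong)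
    fix u
    show "(\<integral>\<^sup>+\<omega>. ennreal (indicator {a..b} u * (Z \<omega> u)\<^sup>2) \<partial>M) = ennreal (indicator {a..b} u * (LINT \<omega>|M. (Z \<omega> u)\<^sup>2))"
    proof (cases "u \<in> {a..b}")
      case True
      hence "integrable M (\<lambda>\<omega>. (Z \<omega> u)\<^sup>2)" using Z unfolding rfun_def by auto
      thus ?thesis using True by (simp add: nn_integral_eq_integral)
    qed simp
  qed
  finally show ?thesis .
qed

lemma borel_measurable_l2_tensor [measurable (raw)]:
  assumes "f \<in> borel_measurable M" "g \<in> borel_measurable M"
  shows "(\<lambda>\<omega>. l2_tensor (f \<omega>) (g \<omega>)) \<in> borel_measurable M"
  by (rule borel_measurable_continuous_Pair[OF assms])
     (intro bounded_bilinear.continuous_on[OF bounded_bilinear_l2_tensor] continuous_intros)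

lemma integral_mult_square_le:
  fixes X Y :: "'w \<Rightarrow> real"
  assumes X: "X \<in> borel_measurable M" "integrable M (\<lambda>\<omega>. (X \<omega>)\<^sup>2)"
    and Y: "Y \<in> borel_measurable M" "integrable M (\<lambda>\<omega>. (Y \<omega>)\<^sup>2)"
  shows "(LINT \<omega>|M. X \<omega> * Y \<omega>)\<^sup>2 \<le> (LINT \<omega>|M. (X \<omega>)\<^sup>2) * (LINT \<omega>|M. (Y \<omega>)\<^sup>2)"
    and "integrable M (\<lambda>\<omega>. X \<omega> * Y \<omega>)"
proof -
  note [measurable] = X(1) Y(1)
  show int: "integrable M (\<lambda>\<omega>. X \<omega> * Y \<omega>)"
  proof (rule Bochner_Integration.integrable_bound[OF Bochner_Integration.integrable_add[OF X(2) Y(2)]])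
    show "AE \<omega> in M. norm (X \<omega> * Y \<omega>) \<le> norm ((X \<omega>)\<^sup>2 + (Y \<omega>)\<^sup>2)"
    proof (rule AE_I2)
      fix \<omega>
      have "0 \<le> (\<bar>X \<omega>\<bar> - \<bar>Y \<omega>\<bar>)\<^sup>2" by simp
      hence "2 * (\<bar>X \<omega>\<bar> * \<bar>Y \<omega>\<bar>) \<le> (X \<omega>)\<^sup>2 + (Y \<omega>)\<^sup>2" by (simp add: power2_diff)
      moreover have "\<bar>X \<omega>\<bar> * \<bar>Y \<omega>\<bar> \<ge> 0" by simp
      ultimately have "\<bar>X \<omega>\<bar> * \<bar>Y \<omega>\<bar> \<le> (X \<omega>)\<^sup>2 + (Y \<omega>)\<^sup>2" by linarith
      thus "norm (X \<omega> * Y \<omega>) \<le> norm ((X \<omega>)\<^sup>2 + (Y \<omega>)\<^sup>2)" by (simp add: abs_mult)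
    qed
  qed simp
  have "ennreal ((LINT \<omega>|M. \<bar>X \<omega> * Y \<omega>\<bar>)\<^sup>2) = (\<integral>\<^sup>+\<omega>. ennreal \<bar>X \<omega>\<bar> * ennreal \<bar>Y \<omega>\<bar> \<partial>M)\<^sup>2"
    using nn_integral_eq_integral[OF integrable_abs[OF int]] by (simp add: abs_mult ennreal_mult ennreal_power[symmetric])
  also have "\<dots> \<le> (\<integral>\<^sup>+\<omega>. (ennreal \<bar>X \<omega>\<bar>)\<^sup>2 \<partial>M) * (\<integral>\<^sup>+\<omega>. (ennreal \<bar>Y \<omega>\<bar>)\<^sup>2 \<partial>M)"
    by (rule Cauchy_Schwarz_nn_integral) auto
  also have "\<dots> = ennreal ((LINT \<omega>|M. (X \<omega>)\<^sup>2) * (LINT \<omega>|M. (Y \<omega>)\<^sup>2))"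
    using X Y by (simp add: ennreal_power nn_integral_eq_integral ennreal_mult)
  finally have "(LINT \<omega>|M. \<bar>X \<omega> * Y \<omega>\<bar>)\<^sup>2 \<le> (LINT \<omega>|M. (X \<omega>)\<^sup>2) * (LINT \<omega>|M. (Y \<omega>)\<^sup>2)"
    by (subst (asm) ennreal_le_iff) (auto intro: mult_nonneg_nonneg)
  moreover have "(LINT \<omega>|M. X \<omega> * Y \<omega>)\<^sup>2 \<le> (LINT \<omega>|M. \<bar>X \<omega> * Y \<omega>\<bar>)\<^sup>2"
    using integral_abs_bound[of M "\<lambda>\<omega>. X \<omega> * Y \<omega>"] by (simp add: abs_le_square_iff[symmetric] abs_of_nonneg)
  ultimately show "(LINT \<omega>|M. X \<omega> * Y \<omega>)\<^sup>2 \<le> (LINT \<omega>|M. (X \<omega>)\<^sup>2) * (LINT \<omega>|M. (Y \<omega>)\<^sup>2)" by linarith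
qed

abbreviation m2 :: "'w measure \<Rightarrow> real \<Rightarrow> real \<Rightarrow> ('w \<Rightarrow> real \<Rightarrow> real) \<Rightarrow> bool" where
  "m2 M a b Z \<equiv> integrable M (\<lambda>\<omega>. (norm (emb a b (Z \<omega>)))\<^sup>2)"

lemma m2_iff:
  assumes Z: "rfun M a b Z" and "sigma_finite_measure M"
  shows "m2 M a b Z \<longleftrightarrow> integrable lborel (\<lambda>u. indicator {a..b} u * (LINT \<omega>|M. (Z \<omega> u)\<^sup>2))"
proof -
  have [measurable]: "(\<lambda>\<omega>. emb a b (Z \<omega>)) \<in> borel_measurable M" "(\<lambda>u. LINT \<omega>|M. (Z \<omega> u)\<^sup>2) \<in> borel_measurable borel"
    using rfun_emb_measurable[OF Z] rfun_square_measurable[OF assms] by auto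
  show ?thesis
    using nn_integral_norm_emb[OF assms] by (simp add: integrable_iff_bounded)
qed

lemma m2_integral:
  assumes Z: "rfun M a b Z" and "sigma_finite_measure M"
  shows "(LINT \<omega>|M. (norm (emb a b (Z \<omega>)))\<^sup>2) = (LINT u:{a..b}|lborel. LINT \<omega>|M. (Z \<omega> u)\<^sup>2)"
proof -
  have [measurable]: "(\<lambda>\<omega>. emb a b (Z \<omega>)) \<in> borel_measurable M" "(\<lambda>u. LINT \<omega>|M. (Z \<omega> u)\<^sup>2) \<in> borel_measurable borel"
    using rfun_emb_measurable[OF Z] rfun_square_measurable[OF assms] by auto
  have "(LINT \<omega>|M. (norm (emb a b (Z \<omega>)))\<^sup>2) = (LINT u|lborel. indicator {a..b} u * (LINT \<omega>|M. (Z \<omega> u)\<^sup>2))"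
    using nn_integral_norm_emb[OF assms] by (subst (1 2) integral_eq_nn_integral) auto
  thus ?thesis by (simp add: set_lebesgue_integral_def)
qed

lemma integrable_tensor_emb:
  assumes Z: "rfun M a b Z" "m2 M a b Z" and Z': "rfun M a b Z'" "m2 M a b Z'"
  shows "integrable M (\<lambda>\<omega>. l2_tensor (emb a b (Z \<omega>)) (emb a b (Z' \<omega>)))"
proof (rule Bochner_Integration.integrable_bound)
  note [measurable] = rfun_emb_measurable[OF Z(1)] rfun_emb_measurable[OF Z'(1)]
  show "integrable M (\<lambda>\<omega>. norm (emb a b (Z \<omega>)) * norm (emb a b (Z' \<omega>)))"
    by (rule integral_mult_square_le) (use Z Z' in auto)
  show "(\<lambda>\<omega>. l2_tensor (emb a b (Z \<omega>)) (emb a b (Z' \<omega>))) \<in> borel_measurable M" by measurable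
qed (simp add: norm_l2_tensor)

text \<open>Connects the two descriptions of a cross moment: the kernel of pointwise moments and the
  expectation of a random tensor. The kernel is dominated by the tensor product of the pointwise
  root mean squares, and the two descriptions are compared by testing against an arbitrary
  \<open>g\<close> and Fubini.\<close>

lemma
  fixes Z Z' :: "'w \<Rightarrow> real \<Rightarrow> real"
  assumes sf: "sigma_finite_measure M" and Z: "rfun M a b Z" "m2 M a b Z" and Z': "rfun M a b Z'" "m2 M a b Z'"
  shows ksi_moment: "ksi a b (\<lambda>u v. LINT \<omega>|M. Z \<omega> u * Z' \<omega> v)"
    and integral_tensor_emb: "(LINT \<omega>|M. l2_tensor (emb a b (Z \<omega>)) (emb a b (Z' \<omega>))) = kemb a b (\<lambda>u v. LINT \<omega>|M. Z \<omega> u * Z' \<omega> v)"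
proof -
  interpret sigma_finite_measure M by fact
  interpret P: pair_sigma_finite M "lborel :: (real \<times> real) measure" ..
  have Zm: "(\<lambda>p. Z (fst p) (snd p)) \<in> borel_measurable (M \<Otimes>\<^sub>M borel)"
    and Zm': "(\<lambda>p. Z' (fst p) (snd p)) \<in> borel_measurable (M \<Otimes>\<^sub>M borel)"
    using rfun_measurable2[OF Z(1)] rfun_measurable2[OF Z'(1)] by (simp_all add: case_prod_unfold)
  have m1: "(\<lambda>p. Z (snd p) (fst (fst p))) \<in> borel_measurable ((borel \<Otimes>\<^sub>M borel) \<Otimes>\<^sub>M M)"
    using measurable_compose[OF _ Zm, of "\<lambda>p. (snd p, fst (fst p))" "(borel \<Otimes>\<^sub>M borel) \<Otimes>\<^sub>M M"] by simp
  have m1': "(\<lambda>p. Z' (snd p) (snd (fst p))) \<in> borel_measurable ((borel \<Otimes>\<^sub>M borel) \<Otimes>\<^sub>M M)"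
    using measurable_compose[OF _ Zm', of "\<lambda>p. (snd p, snd (fst p))" "(borel \<Otimes>\<^sub>M borel) \<Otimes>\<^sub>M M"] by simp
  have "(\<lambda>(p, \<omega>). Z \<omega> (fst p) * Z' \<omega> (snd p)) \<in> borel_measurable ((borel \<Otimes>\<^sub>M borel) \<Otimes>\<^sub>M M)"
    unfolding case_prod_unfold by (intro borel_measurable_times m1 m1')
  hence "(\<lambda>p. LINT \<omega>|M. Z \<omega> (fst p) * Z' \<omega> (snd p)) \<in> borel_measurable (borel \<Otimes>\<^sub>M borel)"
    by (rule borel_measurable_lebesgue_integral)
  hence kmeas: "ktrunc a b (\<lambda>u v. LINT \<omega>|M. Z \<omega> u * Z' \<omega> v) \<in> borel_measurable (borel \<Otimes>\<^sub>M borel)"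
    unfolding ktrunc_def case_prod_unfold by measurable
  have V: "\<And>W. rfun M a b W \<Longrightarrow> m2 M a b W \<Longrightarrow> square_integrable (\<lambda>u. sqrt (indicator {a..b} u * (LINT \<omega>|M. (W \<omega> u)\<^sup>2)))"
  proof -
    fix W assume W: "rfun M a b W" "m2 M a b W"
    have [measurable]: "(\<lambda>u. LINT \<omega>|M. (W \<omega> u)\<^sup>2) \<in> borel_measurable borel"
      using rfun_square_measurable[OF W(1) sf] .
    show "square_integrable (\<lambda>u. sqrt (indicator {a..b} u * (LINT \<omega>|M. (W \<omega> u)\<^sup>2)))"
      using m2_iff[OF W(1) sf] W(2) unfolding square_integrable_def by simp
  qed
  show ks: "ksi a b (\<lambda>u v. LINT \<omega>|M. Z \<omega> u * Z' \<omega> v)"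
  proof (rule square_integrable_bound[OF square_integrable_tensor[OF V[OF Z] V[OF Z']]])
    show "ktrunc a b (\<lambda>u v. LINT \<omega>|M. Z \<omega> u * Z' \<omega> v) \<in> borel_measurable borel" using kmeas by (simp add: borel_prod)
    fix p :: "real \<times> real"
    obtain u v where p: "p = (u, v)" by (cases p)
    show "\<bar>ktrunc a b (\<lambda>u v. LINT \<omega>|M. Z \<omega> u * Z' \<omega> v) p\<bar> \<le> \<bar>case p of (u, v) \<Rightarrow> sqrt (indicator {a..b} u * (LINT \<omega>|M. (Z \<omega> u)\<^sup>2)) *
       sqrt (indicator {a..b} v * (LINT \<omega>|M. (Z' \<omega> v)\<^sup>2))\<bar>"
    proof (cases "u \<in> {a..b} \<and> v \<in> {a..b}")
      case True
      have "(LINT \<omega>|M. Z \<omega> u * Z' \<omega> v)\<^sup>2 \<le> (LINT \<omega>|M. (Z \<omega> u)\<^sup>2) * (LINT \<omega>|M. (Z' \<omega> v)\<^sup>2)"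
        using Z Z' True unfolding rfun_def by (intro integral_mult_square_le) auto
      hence "sqrt ((LINT \<omega>|M. Z \<omega> u * Z' \<omega> v)\<^sup>2) \<le> sqrt ((LINT \<omega>|M. (Z \<omega> u)\<^sup>2) * (LINT \<omega>|M. (Z' \<omega> v)\<^sup>2))"
        by (rule real_sqrt_le_mono)
      thus ?thesis using True p by (simp add: ktrunc_def real_sqrt_mult)
    qed (auto simp: p ktrunc_def indicator_def)
  qed
  show "(LINT \<omega>|M. l2_tensor (emb a b (Z \<omega>)) (emb a b (Z' \<omega>))) = kemb a b (\<lambda>u v. LINT \<omega>|M. Z \<omega> u * Z' \<omega> v)"
  proof (rule inner_ext)
    fix y :: "(real \<times> real) l2"
    obtain g where g: "y = l2of g" "square_integrable g" by (rule l2_cases)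
    have gm[measurable]: "g \<in> borel_measurable borel" using g by auto
    define T where "T \<omega> p = trunc a b (Z \<omega>) (fst p) * trunc a b (Z' \<omega>) (snd p)" for \<omega> and p :: "real \<times> real"
    have Ts: "square_integrable (T \<omega>)" "l2of (T \<omega>) = l2_tensor (emb a b (Z \<omega>)) (emb a b (Z' \<omega>))" if "\<omega> \<in> space M" for \<omega>
    proof -
      have T: "T \<omega> = (\<lambda>(u, v). trunc a b (Z \<omega>) u * trunc a b (Z' \<omega>) v)" by (auto simp: T_def fun_eq_iff)
      show "square_integrable (T \<omega>)" "l2of (T \<omega>) = l2_tensor (emb a b (Z \<omega>)) (emb a b (Z' \<omega>))"
        unfolding T emb_def using rfun_csi[OF Z(1) that] rfun_csi[OF Z'(1) that]
        by (auto intro: square_integrable_tensor simp: l2_tensor_of)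
    qed
    have q1: "(\<lambda>p. Z (fst p) (fst (snd p))) \<in> borel_measurable (M \<Otimes>\<^sub>M (borel \<Otimes>\<^sub>M borel))"
      using measurable_compose[OF _ Zm, of "\<lambda>p. (fst p, fst (snd p))" "M \<Otimes>\<^sub>M (borel \<Otimes>\<^sub>M borel)"] by simp
    have q2: "(\<lambda>p. Z' (fst p) (snd (snd p))) \<in> borel_measurable (M \<Otimes>\<^sub>M (borel \<Otimes>\<^sub>M borel))"
      using measurable_compose[OF _ Zm', of "\<lambda>p. (fst p, snd (snd p))" "M \<Otimes>\<^sub>M (borel \<Otimes>\<^sub>M borel)"] by simp
    have g': "g \<in> borel_measurable (borel \<Otimes>\<^sub>M borel)" using gm by (simp add: borel_prod)
    have "(\<lambda>p. T (fst p) (snd p) * g (snd p)) \<in> borel_measurable (M \<Otimes>\<^sub>M (borel \<Otimes>\<^sub>M borel))"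
      unfolding T_def trunc_def
      by (intro borel_measurable_times q1 q2 measurable_compose[OF measurable_snd g']) measurable
    hence m: "(\<lambda>p. T (fst p) (snd p) * g (snd p)) \<in> borel_measurable (M \<Otimes>\<^sub>M lborel)"
      unfolding borel_prod measurable_cong_sets[OF sets_pair_measure_cong[OF refl sets_lborel] refl] .
    have absi: "square_integrable (\<lambda>x. \<bar>f x\<bar>) \<and> norm (l2of (\<lambda>x. \<bar>f x\<bar>)) = norm (l2of f)" if f: "square_integrable f" for f :: "real \<times> real \<Rightarrow> real"
    proof
      show s: "square_integrable (\<lambda>x. \<bar>f x\<bar>)" using f by (auto simp: square_integrable_def)
      have "(norm (l2of (\<lambda>x. \<bar>f x\<bar>)))\<^sup>2 = (norm (l2of f))\<^sup>2" using f s by (simp add: norm_l2of)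
      thus "norm (l2of (\<lambda>x. \<bar>f x\<bar>)) = norm (l2of f)" by (simp add: power2_eq_iff_nonneg)
    qed
    \<comment> \<open>Absolute values are taken before Cauchy--Schwarz, since Fubini needs absolute
      integrability on the product space.\<close>
    have bnd: "(LINT p|lborel. \<bar>T \<omega> p * g p\<bar>) \<le> norm (emb a b (Z \<omega>)) * norm (emb a b (Z' \<omega>)) * norm y" if w: "\<omega> \<in> space M" for \<omega>
    proof -
      have "(LINT p|lborel. \<bar>T \<omega> p * g p\<bar>) = inner (l2of (\<lambda>p. \<bar>T \<omega> p\<bar>)) (l2of (\<lambda>p. \<bar>g p\<bar>))"
        using absi[OF Ts(1)[OF w]] absi[OF g(2)] by (simp add: inner_l2of abs_mult)
      also have "\<dots> \<le> norm (l2of (\<lambda>p. \<bar>T \<omega> p\<bar>)) * norm (l2of (\<lambda>p. \<bar>g p\<bar>))" by (rule norm_cauchy_schwarz)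
      finally show ?thesis using absi[OF Ts(1)[OF w]] absi[OF g(2)] Ts(2)[OF w] g(1) by (simp add: norm_l2_tensor)
    qed
    have nm: "integrable M (\<lambda>\<omega>. norm (emb a b (Z \<omega>)) * norm (emb a b (Z' \<omega>)))"
      by (rule integral_mult_square_le) (use Z Z' rfun_emb_measurable[OF Z(1)] rfun_emb_measurable[OF Z'(1)] in auto)
    have int: "integrable (M \<Otimes>\<^sub>M lborel) (\<lambda>p. T (fst p) (snd p) * g (snd p))"
    proof (rule P.Fubini_integrable[OF m])
      show "integrable M (\<lambda>\<omega>. LINT p|lborel. norm (T (fst (\<omega>, p)) (snd (\<omega>, p)) * g (snd (\<omega>, p))))"
      proof (rule Bochner_Integration.integrable_bound[OF integrable_mult_left[OF nm, of "norm y"]])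
        show "(\<lambda>\<omega>. LINT p|lborel. norm (T (fst (\<omega>, p)) (snd (\<omega>, p)) * g (snd (\<omega>, p)))) \<in> borel_measurable M"
          using m by (intro lborel.borel_measurable_lebesgue_integral) (simp add: case_prod_unfold)
        show "AE \<omega> in M. norm (LINT p|lborel. norm (T (fst (\<omega>, p)) (snd (\<omega>, p)) * g (snd (\<omega>, p)))) \<le> norm (norm (emb a b (Z \<omega>)) * norm (emb a b (Z' \<omega>)) * norm y)"
        proof (rule AE_I2)
          fix \<omega> assume "\<omega> \<in> space M"
          thus "norm (LINT p|lborel. norm (T (fst (\<omega>, p)) (snd (\<omega>, p)) * g (snd (\<omega>, p)))) \<le> norm (norm (emb a b (Z \<omega>)) * norm (emb a b (Z' \<omega>)) * norm y)"
            using bnd[of \<omega>] by (simp add: integral_nonneg_AE)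
        qed
      qed
      show "AE \<omega> in M. integrable lborel (\<lambda>p. T (fst (\<omega>, p)) (snd (\<omega>, p)) * g (snd (\<omega>, p)))"
        using square_integrable_mult[OF Ts(1) g(2)] by (intro AE_I2) simp
    qed
    have int': "integrable (M \<Otimes>\<^sub>M lborel) (\<lambda>(\<omega>, p). T \<omega> p * g p)" using int by (simp add: case_prod_unfold)
    have "inner (LINT \<omega>|M. l2_tensor (emb a b (Z \<omega>)) (emb a b (Z' \<omega>))) y = (LINT \<omega>|M. inner (l2_tensor (emb a b (Z \<omega>)) (emb a b (Z' \<omega>))) y)"
      using integrable_tensor_emb[OF Z Z'] by (subst integral_inner_left) auto
    also have "\<dots> = (LINT \<omega>|M. LINT p|lborel. T \<omega> p * g p)"
      using Ts g by (intro Bochner_Integration.integral_cong refl) (simp add: Ts(2)[symmetric] inner_l2of)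
    also have "\<dots> = (LINT p|lborel. LINT \<omega>|M. T \<omega> p * g p)"
      by (rule P.Fubini_integral[OF int', symmetric])
    also have "\<dots> = (LINT p|lborel. ktrunc a b (\<lambda>u v. LINT \<omega>|M. Z \<omega> u * Z' \<omega> v) p * g p)"
    proof (intro Bochner_Integration.integral_cong refl)
      fix p
      have "(LINT \<omega>|M. T \<omega> p * g p) = (LINT \<omega>|M. (indicator {a..b} (fst p) * indicator {a..b} (snd p)) * (Z \<omega> (fst p) * Z' \<omega> (snd p))) * g p"
        by (simp add: T_def trunc_def mult_ac)
      thus "(LINT \<omega>|M. T \<omega> p * g p) = ktrunc a b (\<lambda>u v. LINT \<omega>|M. Z \<omega> u * Z' \<omega> v) p * g p"
        by (simp add: ktrunc_def case_prod_unfold)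
    qed
    also have "\<dots> = inner (kemb a b (\<lambda>u v. LINT \<omega>|M. Z \<omega> u * Z' \<omega> v)) y"
      unfolding kemb_def g(1) by (rule inner_l2of[OF ks g(2), symmetric])
    finally show "inner (LINT \<omega>|M. l2_tensor (emb a b (Z \<omega>)) (emb a b (Z' \<omega>))) y = inner (kemb a b (\<lambda>u v. LINT \<omega>|M. Z \<omega> u * Z' \<omega> v)) y" .
  qed
qed

lemma integral_inner_emb_mult:
  assumes sf: "sigma_finite_measure M" and Z: "rfun M a b Z" "m2 M a b Z" and Z': "rfun M a b Z'" "m2 M a b Z'"
  shows "(LINT \<omega>|M. inner (emb a b (Z \<omega>)) x * inner (emb a b (Z' \<omega>)) y) =
    inner (kemb a b (\<lambda>u v. LINT \<omega>|M. Z \<omega> u * Z' \<omega> v)) (l2_tensor x y)"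
proof -
  have "(LINT \<omega>|M. inner (emb a b (Z \<omega>)) x * inner (emb a b (Z' \<omega>)) y) =
    (LINT \<omega>|M. inner (l2_tensor (emb a b (Z \<omega>)) (emb a b (Z' \<omega>))) (l2_tensor x y))"
    by (simp add: inner_l2_tensor)
  also have "\<dots> = inner (LINT \<omega>|M. l2_tensor (emb a b (Z \<omega>)) (emb a b (Z' \<omega>))) (l2_tensor x y)"
    using integrable_tensor_emb[OF Z Z'] by (subst integral_inner_left) auto
  finally show ?thesis by (simp only: integral_tensor_emb[OF assms])
qed

lemma quadratic_form_emb:
  assumes "ksi a b K" "csi a b f" "csi a b g"
  shows "(LINT u:{a..b}|lborel. f u * kop a b K g u) = inner (kemb a b K) (l2_tensor (emb a b f) (emb a b g))"
proof -
  have "(LINT u:{a..b}|lborel. f u * kop a b K g u) = inner (emb a b f) (hs_op (kemb a b K) (emb a b g))"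
    using ip_emb[OF assms(2) csi_kop[OF assms(1,3)]] by (simp only: ip_def emb_kop[OF assms(1,3)])
  also have "\<dots> = inner (hs_op (kemb a b K) (emb a b g)) (emb a b f)" by (rule inner_commute)
  finally show ?thesis by (simp only: inner_hs_op)
qed

lemma (in prob_space) rfun_restrict:
  assumes Z: "rfun M a b Z" and A: "A \<in> sets borel"
  shows "rfun M a b (\<lambda>\<omega> u. indicator A u * Z \<omega> u)"
proof -
  have [measurable]: "(\<lambda>(\<omega>, u). Z \<omega> u) \<in> borel_measurable (M \<Otimes>\<^sub>M borel)"
    using rfun_measurable2[OF Z] by auto
  note [measurable] = A
  show ?thesis unfolding rfun_def
  proof (intro conjI ballI)
    fix \<omega> assume "\<omega> \<in> space M"
    hence z: "sqint a b (Z \<omega>)" using Z by (auto simp: rfun_def)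
    hence [measurable]: "Z \<omega> \<in> borel_measurable borel" by (simp add: sqint_def)
    have "integrable lborel (\<lambda>u. indicator {a..b} u * (indicator A u * Z \<omega> u)\<^sup>2)"
      by (rule Bochner_Integration.integrable_bound[where f="\<lambda>u. indicator {a..b} u * (Z \<omega> u)\<^sup>2"])
         (use z in \<open>auto simp: sqint_def set_integrable_def indicator_def\<close>)
    thus "sqint a b (\<lambda>u. indicator A u * Z \<omega> u)" by (simp add: sqint_def set_integrable_def)
  next
    show "(\<lambda>(\<omega>, u). indicator A u * Z \<omega> u) \<in> borel_measurable (M \<Otimes>\<^sub>M lborel)"
      unfolding measurable_cong_sets[OF sets_pair_measure_cong[OF refl sets_lborel] refl] by measurable
  next
    fix u assume u: "u \<in> {a..b}"
    show "(\<lambda>\<omega>. indicator A u * Z \<omega> u) \<in> borel_measurable M" "integrable M (\<lambda>\<omega>. (indicator A u * Z \<omega> u)\<^sup>2)"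
      using Z u unfolding rfun_def by (auto simp: power_mult_distrib)
  qed
qed

text \<open>The quadratic form in the definition of \<open>subgauss\<close> is the second moment of
  a projection. The restriction to \<open>A\<close> is carried along because square integrability of
  the whole process is not yet known when this is first applied; testing \<open>Z\<close> against a
  function cut off to \<open>A\<close> amounts to testing the restricted process.\<close>

lemma (in prob_space) subgauss_weak:
  assumes Z: "rfun M a b Z" and sg: "subgauss M a b c Z" and A: "A \<in> sets borel"
    and m: "m2 M a b (\<lambda>\<omega> u. indicator A u * Z \<omega> u)"
  shows "(\<integral>\<^sup>+\<omega>. ennreal (exp (inner x (emb a b (\<lambda>u. indicator A u * Z \<omega> u)))) \<partial>M) \<le>
    ennreal (exp (c\<^sup>2 * expectation (\<lambda>\<omega>. (inner x (emb a b (\<lambda>u. indicator A u * Z \<omega> u)))\<^sup>2) / 2))"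
proof -
  let ?Z = "\<lambda>\<omega> u. indicator A u * Z \<omega> u"
  note [measurable] = A
  obtain g where g: "x = l2of g" "square_integrable g" by (rule l2_cases)
  hence [measurable]: "g \<in> borel_measurable borel" by simp
  have RZ: "rfun M a b ?Z" by (rule rfun_restrict[OF Z A])
  let ?g = "\<lambda>u. indicator A u * g u"
  have cg: "csi a b g"
    by (rule square_integrable_bound[OF g(2)]) (auto simp: trunc_def indicator_def)
  have gs: "square_integrable ?g"
    by (rule square_integrable_bound[OF g(2)]) (auto simp: indicator_def)
  have sg': "sqint a b ?g"
  proof -
    have "integrable lborel (\<lambda>u. indicator {a..b} u * (?g u)\<^sup>2)"
      by (rule Bochner_Integration.integrable_bound[where f="\<lambda>u. (?g u)\<^sup>2"])
         (use gs in \<open>auto simp: square_integrable_def indicator_def\<close>)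
    thus ?thesis by (simp add: sqint_def set_integrable_def)
  qed
  have ip: "ip a b ?g (Z \<omega>) = inner x (emb a b (?Z \<omega>))" if "\<omega> \<in> space M" for \<omega>
    using rfun_csi[OF RZ that] g
    by (simp add: emb_def inner_l2of ip_def set_lebesgue_integral_def trunc_def mult_ac)
  have xg: "inner x (emb a b (?Z \<omega>)) = inner (emb a b (?Z \<omega>)) (emb a b g)" if "\<omega> \<in> space M" for \<omega>
    using rfun_csi[OF RZ that] g cg
    by (simp add: emb_def inner_l2of) (simp add: trunc_def mult_ac)
  have mean: "expectation (\<lambda>\<omega>. Z \<omega> u) = 0" if "u \<in> {a..b}" for u using sg that unfolding subgauss_def by auto
  have K: "ksi a b (\<lambda>u v. expectation (\<lambda>\<omega>. ?Z \<omega> u * ?Z \<omega> v))" by (rule ksi_moment[OF sigma_finite_measure_axioms RZ m RZ m])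
  have "(LINT u:{a..b}|lborel. ?g u * (LINT v:{a..b}|lborel. cov M (\<lambda>\<omega>. Z \<omega> u) (\<lambda>\<omega>. Z \<omega> v) * ?g v))
     = (LINT u:{a..b}|lborel. g u * kop a b (\<lambda>u v. expectation (\<lambda>\<omega>. ?Z \<omega> u * ?Z \<omega> v)) g u)"
  proof (rule set_lebesgue_integral_cong)
    show "\<forall>u. u \<in> {a..b} \<longrightarrow> ?g u * (LINT v:{a..b}|lborel. cov M (\<lambda>\<omega>. Z \<omega> u) (\<lambda>\<omega>. Z \<omega> v) * ?g v)
       = g u * kop a b (\<lambda>u v. expectation (\<lambda>\<omega>. ?Z \<omega> u * ?Z \<omega> v)) g u"
    proof (intro allI impI)
      fix u assume u: "u \<in> {a..b}"
      have "kop a b (\<lambda>u v. expectation (\<lambda>\<omega>. ?Z \<omega> u * ?Z \<omega> v)) g u =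
         (LINT v:{a..b}|lborel. indicator A u * (cov M (\<lambda>\<omega>. Z \<omega> u) (\<lambda>\<omega>. Z \<omega> v) * ?g v))"
        unfolding kop_def
      proof (rule set_lebesgue_integral_cong)
        show "\<forall>v. v \<in> {a..b} \<longrightarrow> expectation (\<lambda>\<omega>. ?Z \<omega> u * ?Z \<omega> v) * g v = indicator A u * (cov M (\<lambda>\<omega>. Z \<omega> u) (\<lambda>\<omega>. Z \<omega> v) * ?g v)"
        proof (intro allI impI)
          fix v assume v: "v \<in> {a..b}"
          have "expectation (\<lambda>\<omega>. ?Z \<omega> u * ?Z \<omega> v) = (indicator A u * indicator A v) * expectation (\<lambda>\<omega>. Z \<omega> u * Z \<omega> v)"
            by (simp add: mult_ac flip: integral_mult_right_zero)
          thus "expectation (\<lambda>\<omega>. ?Z \<omega> u * ?Z \<omega> v) * g v = indicator A u * (cov M (\<lambda>\<omega>. Z \<omega> u) (\<lambda>\<omega>. Z \<omega> v) * ?g v)"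
            using mean[OF u] by (simp add: cov_def)
        qed
      qed simp
      thus "?g u * (LINT v:{a..b}|lborel. cov M (\<lambda>\<omega>. Z \<omega> u) (\<lambda>\<omega>. Z \<omega> v) * ?g v)
       = g u * kop a b (\<lambda>u v. expectation (\<lambda>\<omega>. ?Z \<omega> u * ?Z \<omega> v)) g u" by simp
    qed
  qed simp
  also have "\<dots> = inner (kemb a b (\<lambda>u v. expectation (\<lambda>\<omega>. ?Z \<omega> u * ?Z \<omega> v))) (l2_tensor (emb a b g) (emb a b g))"
    by (rule quadratic_form_emb[OF K cg cg])
  also have "\<dots> = expectation (\<lambda>\<omega>. inner (emb a b (?Z \<omega>)) (emb a b g) * inner (emb a b (?Z \<omega>)) (emb a b g))"
    by (rule integral_inner_emb_mult[OF sigma_finite_measure_axioms RZ m RZ m, symmetric])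
  also have "\<dots> = expectation (\<lambda>\<omega>. (inner x (emb a b (?Z \<omega>)))\<^sup>2)"
    by (intro Bochner_Integration.integral_cong refl) (simp add: xg power2_eq_square)
  finally have v: "(LINT u:{a..b}|lborel. ?g u * (LINT v:{a..b}|lborel. cov M (\<lambda>\<omega>. Z \<omega> u) (\<lambda>\<omega>. Z \<omega> v) * ?g v))
     = expectation (\<lambda>\<omega>. (inner x (emb a b (?Z \<omega>)))\<^sup>2)" .
  have "(\<integral>\<^sup>+\<omega>. ennreal (exp (inner x (emb a b (?Z \<omega>)))) \<partial>M) = (\<integral>\<^sup>+\<omega>. ennreal (exp (ip a b ?g (Z \<omega>))) \<partial>M)"
    by (intro nn_integral_cong) (simp add: ip)
  also have "\<dots> \<le> ennreal (exp (c\<^sup>2 * expectation (\<lambda>\<omega>. (inner x (emb a b (?Z \<omega>)))\<^sup>2) / 2))"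
    using sg sg' unfolding subgauss_def v[symmetric] by blast
  finally show ?thesis .
qed

section \<open>Sub-Gaussian processes\<close>

text \<open>The exponential square moment bounds the second moment of
  \<open>X = (norm Z)\<^sup>2 / T\<close> by a constant depending on \<open>c\<close> alone, so this
  variable of mean 1 cannot stay below 1/2 with probability near 1. What matters is that the lower
  bound on the probability does not depend on \<open>T\<close>.\<close>

lemma (in prob_space) subgaussian_paley_zygmund:
  fixes Z :: "'a \<Rightarrow> 'b::{real_inner, second_countable_topology}"
  assumes [measurable]: "Z \<in> borel_measurable M" and c: "c > 0"
    and int: "integrable M (\<lambda>\<omega>. (norm (Z \<omega>))\<^sup>2)" and T: "T = expectation (\<lambda>\<omega>. (norm (Z \<omega>))\<^sup>2)" "T > 0"
    and sg: "\<And>x. (\<integral>\<^sup>+\<omega>. ennreal (exp (inner x (Z \<omega>))) \<partial>M) \<le> ennreal (exp (c\<^sup>2 * expectation (\<lambda>\<omega>. (inner x (Z \<omega>))\<^sup>2) / 2))"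
  shows "prob {\<omega> \<in> space M. (norm (Z \<omega>))\<^sup>2 \<ge> T / 2} \<ge> 1 / (800 * c ^ 4)"
proof -
  define X where "X \<omega> = (norm (Z \<omega>))\<^sup>2 / T" for \<omega>
  \<comment> \<open>Small enough that the middle term of the pointwise bound below has expectation
    at most \<open>96 / 400 \<le> 1 / 4\<close>.\<close>
  define \<theta> where "\<theta> = 1 / (400 * c ^ 4)"
  have [measurable]: "X \<in> borel_measurable M" unfolding X_def by measurable
  have X0: "X \<omega> \<ge> 0" for \<omega> using T by (simp add: X_def)
  have th: "\<theta> > 0" using c by (simp add: \<theta>_def)
  have EX: "expectation X = 1" "integrable M X" unfolding X_def using T int by auto
  have nb: "(\<integral>\<^sup>+\<omega>. ennreal (exp (X \<omega> / (8 * c\<^sup>2))) \<partial>M) \<le> ennreal (sqrt 2)"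
    using subgaussian_exp_norm_square[OF assms(1) c T(2) int _ sg] T by (simp add: X_def mult.commute)
  have ie: "integrable M (\<lambda>\<omega>. exp (X \<omega> / (8 * c\<^sup>2)))"
    using nb by (intro integrableI_bounded) (auto intro: le_less_trans simp: less_top[symmetric] top_unique)
  have Ee: "expectation (\<lambda>\<omega>. exp (X \<omega> / (8 * c\<^sup>2))) \<le> 3 / 2"
  proof -
    have "ennreal (expectation (\<lambda>\<omega>. exp (X \<omega> / (8 * c\<^sup>2)))) \<le> ennreal (sqrt 2)"
      using nb nn_integral_eq_integral[OF ie] by simp
    hence "expectation (\<lambda>\<omega>. exp (X \<omega> / (8 * c\<^sup>2))) \<le> sqrt 2" by (subst (asm) ennreal_le_iff) auto
    also have "sqrt 2 \<le> 3 / 2" by (rule real_le_lsqrt) (auto simp: power2_eq_square)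
    finally show ?thesis .
  qed
  have sq: "(X \<omega>)\<^sup>2 \<le> 128 * c ^ 4 * exp (X \<omega> / (8 * c\<^sup>2))" for \<omega>
  proof -
    define y where "y = X \<omega> / (8 * c\<^sup>2)"
    have "1 + y + y\<^sup>2 / 2 \<le> exp y" using X0 c by (intro exp_lower_Taylor_quadratic) (simp add: y_def)
    hence "y\<^sup>2 \<le> 2 * exp y" using X0[of \<omega>] c by (smt (verit, best) divide_nonneg_pos field_sum_of_halves y_def zero_less_mult_iff zero_less_power)
    hence "64 * c ^ 4 * y\<^sup>2 \<le> 64 * c ^ 4 * (2 * exp y)" by (intro mult_left_mono) auto
    moreover have "64 * c ^ 4 * y\<^sup>2 = (X \<omega>)\<^sup>2" using c by (simp add: y_def power_divide power_mult_distrib)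
    ultimately show ?thesis by (simp add: y_def)
  qed
  let ?A = "{\<omega> \<in> space M. X \<omega> \<ge> 1 / 2}"
  have [measurable]: "?A \<in> sets M" by measurable
  \<comment> \<open>Where \<open>X\<close> is at least 1/2 this is the inequality between arithmetic
    and geometric means, elsewhere the first summand suffices. It replaces the Cauchy--Schwarz step
    of the usual proof.\<close>
  have pt: "X \<omega> \<le> 1 / 2 + \<theta> / 2 * (128 * c ^ 4 * exp (X \<omega> / (8 * c\<^sup>2))) + 1 / (2 * \<theta>) * indicator ?A \<omega>" if w: "\<omega> \<in> space M" for \<omega>
  proof -
    have n: "\<theta> / 2 * (128 * c ^ 4 * exp (X \<omega> / (8 * c\<^sup>2))) \<ge> \<theta> / 2 * (X \<omega>)\<^sup>2" using th sq by (intro mult_left_mono) auto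
    have n0: "\<theta> / 2 * (X \<omega>)\<^sup>2 \<ge> 0" using th by simp
    show ?thesis
    proof (cases "X \<omega> \<ge> 1 / 2")
      case True
      have "0 \<le> (\<theta> * X \<omega> - 1)\<^sup>2 / (2 * \<theta>)" using th by simp
      also have "\<dots> = \<theta> / 2 * (X \<omega>)\<^sup>2 + 1 / (2 * \<theta>) - X \<omega>" using th by (simp add: power2_eq_square field_simps)
      finally show ?thesis using n True w by simp
    qed (use n n0 in auto)
  qed
  have ia: "integrable M (\<lambda>\<omega>. 1 / (2 * \<theta>) * indicator ?A \<omega>)" 
    by (intro integrable_mult_right integrable_real_indicator) (auto simp: less_top[symmetric])
  have ib: "integrable M (\<lambda>\<omega>. \<theta> / 2 * (128 * c ^ 4 * exp (X \<omega> / (8 * c\<^sup>2))))" using ie by simp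
  have "expectation X \<le> expectation (\<lambda>\<omega>. 1 / 2 + \<theta> / 2 * (128 * c ^ 4 * exp (X \<omega> / (8 * c\<^sup>2))) + 1 / (2 * \<theta>) * indicator ?A \<omega>)"
    by (intro integral_mono EX pt Bochner_Integration.integrable_add ia ib) auto
  also have "\<dots> = 1 / 2 + \<theta> / 2 * (128 * c ^ 4 * expectation (\<lambda>\<omega>. exp (X \<omega> / (8 * c\<^sup>2)))) + 1 / (2 * \<theta>) * prob ?A"
    using ia ib by (simp add: prob_space)
  also have "\<dots> \<le> 1 / 2 + \<theta> / 2 * (128 * c ^ 4 * (3 / 2)) + 1 / (2 * \<theta>) * prob ?A"
    using Ee th by (intro add_mono mult_left_mono) auto
  also have "\<theta> / 2 * (128 * c ^ 4 * (3 / 2)) \<le> 1 / 4" using c by (simp add: \<theta>_def)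
  finally have "1 / 4 \<le> prob ?A / (2 * \<theta>)" using EX(1) by simp
  hence "\<theta> / 2 \<le> prob ?A" using th by (simp add: field_simps)
  also have "?A = {\<omega> \<in> space M. (norm (Z \<omega>))\<^sup>2 \<ge> T / 2}" using T by (auto simp: X_def field_simps)
  finally show ?thesis by (simp add: \<theta>_def)
qed

text \<open>The hypothesis on the trace of the covariance kernel is void when that trace diverges, so
  square integrability of the innovations has to be derived: the process restricted to the set where
  the variance is at most \<open>R\<close> has a finite trace, and by the Paley--Zygmund bound its norm would
  exceed any level with probability bounded below if these traces were unbounded in \<open>R\<close>.\<close>

lemma (in prob_space) subgauss_m2:
  assumes Z: "rfun M a b Z" and sg: "subgauss M a b c Z" and c: "c > 0"
  shows "m2 M a b Z"
proof -
  define V where "V u = expectation (\<lambda>\<omega>. (Z \<omega> u)\<^sup>2)" for u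
  have Vm[measurable]: "V \<in> borel_measurable borel"
    unfolding V_def by (rule rfun_square_measurable[OF Z sigma_finite_measure_axioms])
  have V0: "V u \<ge> 0" for u unfolding V_def by simp
  define A where "A R = {u. V u \<le> real R}" for R :: nat
  have Am[measurable]: "A R \<in> sets borel" for R unfolding A_def by measurable
  define ZR where "ZR R \<omega> = (\<lambda>u. indicator (A R) u * Z \<omega> u)" for R \<omega>
  have RZ: "rfun M a b (ZR R)" for R unfolding ZR_def by (rule rfun_restrict[OF Z Am])
  have var: "expectation (\<lambda>\<omega>. (ZR R \<omega> u)\<^sup>2) = indicator (A R) u * V u" for R u
    by (simp add: ZR_def V_def power_mult_distrib)
  have mR: "m2 M a b (ZR R)" for R
    unfolding m2_iff[OF RZ sigma_finite_measure_axioms] var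
  proof (rule Bochner_Integration.integrable_bound[where f="\<lambda>u. indicator {a..b} u * real R"])
    show "integrable lborel (\<lambda>u. indicator {a..b} u * real R)" 
      by (intro integrable_mult_left integrable_real_indicator) (auto simp: emeasure_lborel_Icc_eq)
    show "AE u in lborel. norm (indicator {a..b} u * (indicator (A R) u * V u)) \<le> norm (indicator {a..b} u * real R)"
      using V0 by (auto simp: A_def indicator_def)
  qed measurable
  define T where "T R = expectation (\<lambda>\<omega>. (norm (emb a b (ZR R \<omega>)))\<^sup>2)" for R
  have em[measurable]: "(\<lambda>\<omega>. emb a b (ZR R \<omega>)) \<in> borel_measurable M" "(\<lambda>\<omega>. emb a b (Z \<omega>)) \<in> borel_measurable M" for R
    using rfun_emb_measurable[OF RZ] rfun_emb_measurable[OF Z] by auto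
  let ?d = "1 / (800 * c ^ 4)"
  have d: "?d > 0" using c by simp
  define E where "E m = {\<omega> \<in> space M. (norm (emb a b (Z \<omega>)))\<^sup>2 < real m}" for m :: nat
  have "(\<lambda>m. prob (E m)) \<longlonglongrightarrow> prob (\<Union>m. E m)"
    unfolding E_def by (intro finite_Lim_measure_incseq) (auto simp: incseq_def)
  also have "(\<Union>m. E m) = space M"
    unfolding E_def using reals_Archimedean2 by auto
  finally have "(\<lambda>m. prob (E m)) \<longlonglongrightarrow> 1" by (simp add: prob_space)
  then obtain m where m: "prob (E m) > 1 - ?d"
    using order_tendstoD(1)[of "\<lambda>m. prob (E m)" 1 sequentially "1 - ?d"] d eventually_sequentially by fastforce
  \<comment> \<open>Truncation decreases the norm, so for \<open>T R > 2 * m\<close> the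
    Paley--Zygmund event would lie in the complement of \<open>E m\<close>, whose probability is
    below \<open>?d\<close>.\<close>
  have Tb: "T R \<le> 2 * real m" for R
  proof (rule ccontr)
    assume a: "\<not> T R \<le> 2 * real m"
    hence pos: "T R > 0" by linarith
    have "?d \<le> prob {\<omega> \<in> space M. (norm (emb a b (ZR R \<omega>)))\<^sup>2 \<ge> T R / 2}"
      using subgaussian_paley_zygmund[OF em(1) c mR T_def pos] subgauss_weak[OF Z sg Am mR[unfolded ZR_def]]
      by (simp add: ZR_def)
    also have "\<dots> \<le> prob (space M - E m)"
    proof (rule finite_measure_mono)
      show "{\<omega> \<in> space M. (norm (emb a b (ZR R \<omega>)))\<^sup>2 \<ge> T R / 2} \<subseteq> space M - E m"
      proof safe
        fix \<omega> assume w: "\<omega> \<in> space M" "T R / 2 \<le> (norm (emb a b (ZR R \<omega>)))\<^sup>2" "\<omega> \<in> E m"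
        have "(norm (emb a b (ZR R \<omega>)))\<^sup>2 \<le> (norm (emb a b (Z \<omega>)))\<^sup>2"
          unfolding emb_def norm_l2of[OF rfun_csi[OF RZ w(1)]] norm_l2of[OF rfun_csi[OF Z w(1)]]
          using rfun_csi[OF RZ w(1), of R] rfun_csi[OF Z w(1)]
          by (intro integral_mono) (auto simp: square_integrable_def ZR_def trunc_def indicator_def)
        moreover have "(norm (emb a b (Z \<omega>)))\<^sup>2 < real m" using w(3) by (simp add: E_def)
        ultimately show False using w(2) a by linarith
      qed
      show "space M - E m \<in> events" unfolding E_def by measurable
    qed
    also have "\<dots> = 1 - prob (E m)" unfolding E_def by (intro prob_compl) measurable
    finally show False using m by simp
  qed
  have "(\<integral>\<^sup>+u. ennreal (indicator {a..b} u * V u) \<partial>lborel) = (\<integral>\<^sup>+u. liminf (\<lambda>R. ennreal (indicator {a..b} u * (indicator (A R) u * V u))) \<partial>lborel)"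
  proof (intro nn_integral_cong)
    fix u
    have "eventually (\<lambda>R. ennreal (indicator {a..b} u * (indicator (A R) u * V u)) = ennreal (indicator {a..b} u * V u)) sequentially"
    proof (rule eventually_sequentiallyI)
      fix R assume "nat \<lceil>V u\<rceil> \<le> R"
      hence "V u \<le> real R" by linarith
      thus "ennreal (indicator {a..b} u * (indicator (A R) u * V u)) = ennreal (indicator {a..b} u * V u)"
        by (simp add: A_def)
    qed
    hence "(\<lambda>R. ennreal (indicator {a..b} u * (indicator (A R) u * V u))) \<longlonglongrightarrow> ennreal (indicator {a..b} u * V u)"
      by (rule tendsto_eventually)
    thus "ennreal (indicator {a..b} u * V u) = liminf (\<lambda>R. ennreal (indicator {a..b} u * (indicator (A R) u * V u)))"
      by (rule lim_imp_Liminf[OF sequentially_bot, symmetric])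
  qed
  also have "\<dots> \<le> liminf (\<lambda>R. \<integral>\<^sup>+u. ennreal (indicator {a..b} u * (indicator (A R) u * V u)) \<partial>lborel)"
    by (rule nn_integral_liminf) measurable
  also have "\<dots> \<le> liminf (\<lambda>R::nat. ennreal (2 * real m))"
  proof (intro Liminf_mono always_eventually allI)
    fix R
    have "(\<integral>\<^sup>+u. ennreal (indicator {a..b} u * (indicator (A R) u * V u)) \<partial>lborel) = ennreal (T R)"
      using nn_integral_norm_emb[OF RZ sigma_finite_measure_axioms, of R] nn_integral_eq_integral[OF mR, of R]
      unfolding var T_def by simp
    thus "(\<integral>\<^sup>+u. ennreal (indicator {a..b} u * (indicator (A R) u * V u)) \<partial>lborel) \<le> ennreal (2 * real m)"
      using Tb[of R] by (simp add: ennreal_leI)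
  qed
  also have "\<dots> < \<infinity>" by (simp add: Liminf_const)
  finally have "(\<integral>\<^sup>+\<omega>. ennreal ((norm (emb a b (Z \<omega>)))\<^sup>2) \<partial>M) < \<infinity>"
    unfolding nn_integral_norm_emb[OF Z sigma_finite_measure_axioms] V_def .
  thus ?thesis by (intro integrableI_bounded) auto
qed

lemma (in prob_space) subgauss_exp_norm_square:
  assumes Z: "rfun M a b Z" and sg: "subgauss M a b c Z" and c: "c > 0"
    and C: "(LINT u:{a..b}|lborel. cov M (\<lambda>\<omega>. Z \<omega> u) (\<lambda>\<omega>. Z \<omega> u)) \<le> C" "C > 0"
  shows "integrable M (\<lambda>\<omega>. exp ((norm (emb a b (Z \<omega>)))\<^sup>2 / (8 * c\<^sup>2 * C)))"
    and "expectation (\<lambda>\<omega>. exp ((norm (emb a b (Z \<omega>)))\<^sup>2 / (8 * c\<^sup>2 * C))) \<le> 2"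
    and "expectation (\<lambda>\<omega>. (norm (emb a b (Z \<omega>)))\<^sup>2) \<le> C"
proof -
  have m: "m2 M a b Z" by (rule subgauss_m2[OF Z sg c])
  have em[measurable]: "(\<lambda>\<omega>. emb a b (Z \<omega>)) \<in> borel_measurable M" by (rule rfun_emb_measurable[OF Z])
  have "expectation (\<lambda>\<omega>. (norm (emb a b (Z \<omega>)))\<^sup>2) = (LINT u:{a..b}|lborel. LINT \<omega>|M. (Z \<omega> u)\<^sup>2)"
    by (rule m2_integral[OF Z sigma_finite_measure_axioms])
  also have "\<dots> = (LINT u:{a..b}|lborel. cov M (\<lambda>\<omega>. Z \<omega> u) (\<lambda>\<omega>. Z \<omega> u))"
    using sg by (intro set_lebesgue_integral_cong) (auto simp: cov_def subgauss_def power2_eq_square)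
  finally show T: "expectation (\<lambda>\<omega>. (norm (emb a b (Z \<omega>)))\<^sup>2) \<le> C" using C by simp
  have w: "(\<integral>\<^sup>+\<omega>. ennreal (exp (inner x (emb a b (Z \<omega>)))) \<partial>M) \<le> ennreal (exp (c\<^sup>2 * expectation (\<lambda>\<omega>. (inner x (emb a b (Z \<omega>)))\<^sup>2) / 2))" for x
    using subgauss_weak[OF Z sg, of UNIV x] m by simp
  have nb: "(\<integral>\<^sup>+\<omega>. ennreal (exp ((norm (emb a b (Z \<omega>)))\<^sup>2 / (8 * c\<^sup>2 * C))) \<partial>M) \<le> ennreal (sqrt 2)"
    by (rule subgaussian_exp_norm_square[OF em c C(2) m T w])
  show i: "integrable M (\<lambda>\<omega>. exp ((norm (emb a b (Z \<omega>)))\<^sup>2 / (8 * c\<^sup>2 * C)))"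
    using nb by (intro integrableI_bounded) (auto intro: le_less_trans)
  have "ennreal (expectation (\<lambda>\<omega>. exp ((norm (emb a b (Z \<omega>)))\<^sup>2 / (8 * c\<^sup>2 * C)))) \<le> ennreal (sqrt 2)"
    using nb nn_integral_eq_integral[OF i] by simp
  hence "expectation (\<lambda>\<omega>. exp ((norm (emb a b (Z \<omega>)))\<^sup>2 / (8 * c\<^sup>2 * C))) \<le> sqrt 2" by (subst (asm) ennreal_le_iff) auto
  also have "sqrt 2 \<le> 2" by (rule real_le_lsqrt) auto
  finally show "expectation (\<lambda>\<omega>. exp ((norm (emb a b (Z \<omega>)))\<^sup>2 / (8 * c\<^sup>2 * C))) \<le> 2" .
qed

text \<open>Independence of processes refers to the product \<open>\<sigma>\<close>-algebra, for which the map into \<open>L\<^sup>2\<close> is only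
  measurable up to null sets.\<close>

lemma (in prob_space) indep_vars_weak_AE:
  fixes Y :: "'i \<Rightarrow> 'a \<Rightarrow> 'b::{real_inner, second_countable_topology}"
  assumes ind: "indep_vars M' X I" and Y: "\<And>i. i \<in> I \<Longrightarrow> Y i \<in> borel_measurable M"
    and AE: "\<And>i x. i \<in> I \<Longrightarrow> \<exists>J \<in> borel_measurable (vimage_algebra (space M) (X i) (M' i)). AE \<omega> in M. inner (Y i \<omega>) x = J \<omega>"
  shows "indep_vars (\<lambda>_. borel) Y I"
proof -
  define G where "G i = {X i -` A \<inter> space M | A. A \<in> sets (M' i)}" for i
  \<comment> \<open>The events that agree almost surely with one from the \<sigma>-algebra generated
    by \<open>X i\<close>. They form a \<sigma>-algebra themselves, and the product formula passes
    to them from the generated events.\<close>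
  define C where "C i = {B \<in> sets M. \<exists>A \<in> G i. AE \<omega> in M. \<omega> \<in> B \<longleftrightarrow> \<omega> \<in> A}" for i
  have X: "X i \<in> measurable M (M' i)" if "i \<in> I" for i using ind that unfolding indep_vars_def by auto
  have GM: "G i \<subseteq> sets M" if "i \<in> I" for i unfolding G_def using X[OF that] by (auto intro: measurable_sets)
  have SG: "sets (vimage_algebra (space M) (X i) (M' i)) = G i" if "i \<in> I" for i
    unfolding G_def using X[OF that] by (intro sets_vimage_algebra2) (auto simp: measurable_def)
  have Gsa: "sigma_algebra (space M) (G i)" if "i \<in> I" for i
    using sets.sigma_algebra_axioms[of "vimage_algebra (space M) (X i) (M' i)"] by (simp add: SG[OF that])
  have C: "sigma_algebra (space M) (C i)" if i: "i \<in> I" for i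
    unfolding sigma_algebra_iff2
  proof (intro conjI ballI allI impI)
    interpret G: sigma_algebra "space M" "G i" by (rule Gsa[OF i])
    show "C i \<subseteq> Pow (space M)" unfolding C_def using sets.sets_into_space by auto
    show "{} \<in> C i" unfolding C_def by auto
    fix B assume "B \<in> C i"
    then obtain A where A: "B \<in> sets M" "A \<in> G i" "AE \<omega> in M. \<omega> \<in> B \<longleftrightarrow> \<omega> \<in> A" unfolding C_def by auto
    from A(3) have "AE \<omega> in M. \<omega> \<in> space M - B \<longleftrightarrow> \<omega> \<in> space M - A" by eventually_elim auto
    moreover have "space M - B \<in> sets M" "space M - A \<in> G i" using A by auto
    ultimately show "space M - B \<in> C i" unfolding C_def by blast
  next
    interpret G: sigma_algebra "space M" "G i" by (rule Gsa[OF i])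
    fix B :: "nat \<Rightarrow> 'a set" assume "range B \<subseteq> C i"
    hence "\<forall>n. \<exists>A\<in>G i. AE \<omega> in M. \<omega> \<in> B n \<longleftrightarrow> \<omega> \<in> A" unfolding C_def by auto
    then obtain A where A: "\<And>n. A n \<in> G i" "\<And>n. AE \<omega> in M. \<omega> \<in> B n \<longleftrightarrow> \<omega> \<in> A n" by metis
    have "AE \<omega> in M. \<forall>n. \<omega> \<in> B n \<longleftrightarrow> \<omega> \<in> A n" using A(2) by (simp add: AE_all_countable)
    hence "AE \<omega> in M. \<omega> \<in> (\<Union>n. B n) \<longleftrightarrow> \<omega> \<in> (\<Union>n. A n)" by eventually_elim auto
    moreover have "(\<Union>n. A n) \<in> G i" using A(1) by auto
    moreover have "(\<Union>n. B n) \<in> sets M" using \<open>range B \<subseteq> C i\<close> unfolding C_def by (intro sets.countable_UN) auto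
    ultimately show "(\<Union>n. B n) \<in> C i" unfolding C_def by blast
  qed
  have YC: "Y i -` A \<inter> space M \<in> C i" if i: "i \<in> I" and A: "A \<in> sets borel" for i A
  proof -
    let ?N = "sigma (space M) (C i)"
    have sN: "sets ?N = C i" using sigma_algebra.sets_measure_of_eq[OF C[OF i]] .
    have "Y i \<in> borel_measurable ?N"
    proof (rule borel_measurable_weak)
      fix x
      obtain J where J: "J \<in> borel_measurable (vimage_algebra (space M) (X i) (M' i))" "AE \<omega> in M. inner (Y i \<omega>) x = J \<omega>"
        using AE[OF i] by blast
      show "(\<lambda>\<omega>. inner (Y i \<omega>) x) \<in> borel_measurable ?N"
      proof (rule measurableI)
        fix B :: "real set" assume B: "B \<in> sets borel"
        have "(\<lambda>\<omega>. inner (Y i \<omega>) x) -` B \<inter> space M \<in> sets M"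
          using Y[OF i] B by (intro measurable_sets) auto
        moreover have "J -` B \<inter> space M \<in> G i"
          using measurable_sets[OF J(1) B] by (simp add: SG[OF i])
        moreover have "AE \<omega> in M. \<omega> \<in> (\<lambda>\<omega>. inner (Y i \<omega>) x) -` B \<inter> space M \<longleftrightarrow> \<omega> \<in> J -` B \<inter> space M"
          using J(2) by eventually_elim auto
        ultimately have "(\<lambda>\<omega>. inner (Y i \<omega>) x) -` B \<inter> space M \<in> C i" unfolding C_def by blast
        thus "(\<lambda>\<omega>. inner (Y i \<omega>) x) -` B \<inter> space ?N \<in> sets ?N"
          unfolding sN by (simp add: space_measure_of_conv)
      qed simp
    qed
    from measurable_sets[OF this A] show ?thesis unfolding sN by (simp add: space_measure_of_conv)
  qed
  have indG: "indep_sets G I" using ind unfolding indep_vars_def2 G_def by simp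
  show ?thesis unfolding indep_vars_def2
  proof (intro conjI ballI)
    show "random_variable borel (Y i)" if "i \<in> I" for i by (rule Y[OF that])
    show "indep_sets (\<lambda>i. {Y i -` A \<inter> space M |A. A \<in> sets borel}) I"
    proof (rule indep_setsI)
      show "{Y i -` A \<inter> space M |A. A \<in> sets borel} \<subseteq> events" if "i \<in> I" for i
        using Y[OF that] by (auto intro: measurable_sets)
      fix A J assume J: "J \<noteq> {}" "J \<subseteq> I" "finite J" and A: "\<forall>j\<in>J. A j \<in> {Y j -` A \<inter> space M |A. A \<in> sets borel}"
      have AC: "A j \<in> C j" if j: "j \<in> J" for j
      proof -
        obtain A' where A': "A' \<in> sets borel" "A j = Y j -` A' \<inter> space M" using A j by auto
        show ?thesis unfolding A'(2) by (rule YC) (use j J(2) A' in auto)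
      qed
      have "\<forall>j\<in>J. \<exists>B. B \<in> G j \<and> (AE \<omega> in M. \<omega> \<in> A j \<longleftrightarrow> \<omega> \<in> B)"
        using AC unfolding C_def by auto
      then obtain B where B0: "\<forall>j\<in>J. B j \<in> G j \<and> (AE \<omega> in M. \<omega> \<in> A j \<longleftrightarrow> \<omega> \<in> B j)"
        using bchoice[of J "\<lambda>j B. B \<in> G j \<and> (AE \<omega> in M. \<omega> \<in> A j \<longleftrightarrow> \<omega> \<in> B)"] by blast
      have B: "A j \<in> sets M" "B j \<in> G j" "AE \<omega> in M. \<omega> \<in> A j \<longleftrightarrow> \<omega> \<in> B j" if "j \<in> J" for j
        using B0 that AC[OF that] unfolding C_def by auto
      have Bm: "B j \<in> sets M" if "j \<in> J" for j using B(2)[OF that] GM J(2) that by blast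
      have "AE \<omega> in M. \<forall>j\<in>J. \<omega> \<in> A j \<longleftrightarrow> \<omega> \<in> B j" using J(3) B(3) by (intro AE_finite_allI)
      hence "AE \<omega> in M. \<omega> \<in> (\<Inter>j\<in>J. A j) \<longleftrightarrow> \<omega> \<in> (\<Inter>j\<in>J. B j)" by eventually_elim auto
      hence "prob (\<Inter>j\<in>J. A j) = prob (\<Inter>j\<in>J. B j)"
        using J B(1) Bm by (intro finite_measure_eq_AE sets.finite_INT) auto
      also have "\<dots> = (\<Prod>j\<in>J. prob (B j))"
        using indG J B(2) by (intro indep_setsD) auto
      also have "\<dots> = (\<Prod>j\<in>J. prob (A j))"
        using B Bm by (intro prod.cong refl finite_measure_eq_AE) (auto simp: eq_commute)
      finally show "prob (\<Inter>j\<in>J. A j) = (\<Prod>j\<in>J. prob (A j))" .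
    qed
  qed
qed

text \<open>The conditional expectation of \<open>\<langle>Z, x\<rangle>\<close> given the pointwise evaluations of \<open>Z\<close> is \<open>\<langle>Z, x\<rangle>\<close> itself,
  since the difference is orthogonal to every \<open>Z(u)\<close> and hence, by Fubini, to \<open>\<langle>Z, x\<rangle>\<close>.\<close>

lemma (in prob_space) inner_emb_AE_eq:
  fixes x :: "real l2"
  assumes Z: "rfun M a b Z" and m: "m2 M a b Z" and ZP: "Z \<in> measurable M (Pi\<^sub>M UNIV (\<lambda>_. borel))"
  shows "\<exists>J \<in> borel_measurable (vimage_algebra (space M) Z (Pi\<^sub>M UNIV (\<lambda>_. borel))). AE \<omega> in M. inner (emb a b (Z \<omega>)) x = J \<omega>"
proof -
  let ?G = "vimage_algebra (space M) Z (Pi\<^sub>M UNIV (\<lambda>_. borel))"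
  have sub: "subalgebra M ?G"
  proof -
    have "sets ?G = {Z -` A \<inter> space M | A. A \<in> sets (Pi\<^sub>M UNIV (\<lambda>_. borel))}"
      using ZP by (intro sets_vimage_algebra2) (auto simp: measurable_def)
    thus ?thesis using ZP by (auto simp: subalgebra_def intro: measurable_sets)
  qed
  interpret G: finite_measure_subalgebra M ?G by standard (rule sub)
  obtain g where g: "x = l2of g" "square_integrable g" by (rule l2_cases)
  have gm[measurable]: "g \<in> borel_measurable borel" using g by auto
  have em[measurable]: "(\<lambda>\<omega>. emb a b (Z \<omega>)) \<in> borel_measurable M" by (rule rfun_emb_measurable[OF Z])
  have Zm[measurable]: "(\<lambda>(\<omega>, u). Z \<omega> u) \<in> borel_measurable (M \<Otimes>\<^sub>M borel)" by (rule rfun_measurable2[OF Z])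
  define I where "I \<omega> = inner (emb a b (Z \<omega>)) x" for \<omega>
  define J where "J = real_cond_exp M ?G I"
  have [measurable]: "I \<in> borel_measurable M" unfolding I_def by measurable
  have JG: "J \<in> borel_measurable ?G" unfolding J_def by (rule borel_measurable_cond_exp)
  have [measurable]: "J \<in> borel_measurable M" unfolding J_def by (rule borel_measurable_cond_exp2)
  have I2: "integrable M (\<lambda>\<omega>. (I \<omega>)\<^sup>2)"
  proof (rule Bochner_Integration.integrable_bound[OF integrable_mult_right[OF m, of "(norm x)\<^sup>2"]])
    show "AE \<omega> in M. norm ((I \<omega>)\<^sup>2) \<le> norm ((norm x)\<^sup>2 * (norm (emb a b (Z \<omega>)))\<^sup>2)"
    proof (rule AE_I2)
      fix \<omega>
      have "\<bar>I \<omega>\<bar>\<^sup>2 \<le> (norm (emb a b (Z \<omega>)) * norm x)\<^sup>2" unfolding I_def by (intro power_mono Cauchy_Schwarz_ineq2) auto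
      thus "norm ((I \<omega>)\<^sup>2) \<le> norm ((norm x)\<^sup>2 * (norm (emb a b (Z \<omega>)))\<^sup>2)" by (simp add: power_mult_distrib mult.commute)
    qed
  qed simp
  have I1: "integrable M I" using integral_mult_square_le(2)[of I M "\<lambda>_. 1"] I2 by simp
  have J2: "integrable M (\<lambda>\<omega>. (J \<omega>)\<^sup>2)"
  proof (rule Bochner_Integration.integrable_bound[OF G.real_cond_exp_int(1)[OF I2]])
    have "AE \<omega> in M. (J \<omega>)\<^sup>2 \<le> real_cond_exp M ?G (\<lambda>\<omega>. (I \<omega>)\<^sup>2) \<omega>"
      unfolding J_def by (rule G.real_cond_exp_jensens_inequality(2)[where q="\<lambda>x. x\<^sup>2" and I=UNIV])
        (use I1 I2 convex_power2 in auto)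
    thus "AE \<omega> in M. norm ((J \<omega>)\<^sup>2) \<le> norm (real_cond_exp M ?G (\<lambda>\<omega>. (I \<omega>)\<^sup>2) \<omega>)" by eventually_elim auto
  qed simp
  define D where "D \<omega> = I \<omega> - J \<omega>" for \<omega>
  have [measurable]: "D \<in> borel_measurable M" unfolding D_def by measurable
  have IJ: "integrable M (\<lambda>\<omega>. I \<omega> * J \<omega>)" by (rule integral_mult_square_le) (use I2 J2 in auto)
  have D2: "integrable M (\<lambda>\<omega>. (D \<omega>)\<^sup>2)"
  proof -
    have "(\<lambda>\<omega>. (D \<omega>)\<^sup>2) = (\<lambda>\<omega>. (I \<omega>)\<^sup>2 - 2 * (I \<omega> * J \<omega>) + (J \<omega>)\<^sup>2)" by (simp add: D_def power2_diff algebra_simps)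
    thus ?thesis using I2 J2 IJ by simp
  qed
  have JD: "expectation (\<lambda>\<omega>. J \<omega> * D \<omega>) = 0"
  proof -
    have "expectation (\<lambda>\<omega>. J \<omega> * J \<omega>) = expectation (\<lambda>\<omega>. J \<omega> * I \<omega>)"
      using G.real_cond_exp_intg(2)[of J I] JG IJ unfolding J_def by (simp add: mult.commute)
    thus ?thesis using J2 IJ by (simp add: D_def right_diff_distrib power2_eq_square mult.commute)
  qed
  have ZD: "expectation (\<lambda>\<omega>. Z \<omega> u * D \<omega>) = 0" if u: "u \<in> {a..b}" for u
  proof -
    have Zu: "(\<lambda>\<omega>. Z \<omega> u) \<in> borel_measurable M" "integrable M (\<lambda>\<omega>. (Z \<omega> u)\<^sup>2)" using Z u unfolding rfun_def by auto
    have "Z \<in> measurable ?G (Pi\<^sub>M UNIV (\<lambda>_. borel))" using ZP by (intro measurable_vimage_algebra1) (auto simp: measurable_def)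
    hence ZG: "(\<lambda>\<omega>. Z \<omega> u) \<in> borel_measurable ?G"
      by (rule measurable_compose) (rule measurable_component_singleton, simp)
    have i1: "integrable M (\<lambda>\<omega>. Z \<omega> u * I \<omega>)" by (rule integral_mult_square_le) (use Zu I2 in auto)
    have i2: "integrable M (\<lambda>\<omega>. Z \<omega> u * J \<omega>)" by (rule integral_mult_square_le) (use Zu J2 in auto)
    have "expectation (\<lambda>\<omega>. Z \<omega> u * J \<omega>) = expectation (\<lambda>\<omega>. Z \<omega> u * I \<omega>)"
      using G.real_cond_exp_intg(2)[OF i1 ZG] unfolding J_def by simp
    thus ?thesis using i1 i2 by (simp add: D_def right_diff_distrib)
  qed
  interpret P: pair_sigma_finite M "lborel :: real measure" ..
  have ID: "expectation (\<lambda>\<omega>. I \<omega> * D \<omega>) = 0"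
  proof -
    have Iw: "I \<omega> = (LINT u|lborel. trunc a b (Z \<omega>) u * g u)" if "\<omega> \<in> space M" for \<omega>
      unfolding I_def emb_def g by (rule inner_l2of[OF rfun_csi[OF Z that] g(2)])
    have m': "(\<lambda>p. (trunc a b (Z (fst p)) (snd p) * g (snd p)) * D (fst p)) \<in> borel_measurable (M \<Otimes>\<^sub>M lborel)"
      unfolding trunc_def measurable_cong_sets[OF sets_pair_measure_cong[OF refl sets_lborel] refl]
      using Zm by (simp add: case_prod_unfold)
    have absi: "square_integrable (\<lambda>x. \<bar>f x\<bar>) \<and> norm (l2of (\<lambda>x. \<bar>f x\<bar>)) = norm (l2of f)" if f: "square_integrable f" for f :: "real \<Rightarrow> real"
    proof
      show s: "square_integrable (\<lambda>x. \<bar>f x\<bar>)" using f by (auto simp: square_integrable_def)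
      have "(norm (l2of (\<lambda>x. \<bar>f x\<bar>)))\<^sup>2 = (norm (l2of f))\<^sup>2" using f s by (simp add: norm_l2of)
      thus "norm (l2of (\<lambda>x. \<bar>f x\<bar>)) = norm (l2of f)" by (simp add: power2_eq_iff_nonneg)
    qed
    have bnd: "(LINT u|lborel. \<bar>trunc a b (Z \<omega>) u * g u * D \<omega>\<bar>) \<le> norm (emb a b (Z \<omega>)) * \<bar>D \<omega>\<bar> * norm x" if w: "\<omega> \<in> space M" for \<omega>
    proof -
      note c = rfun_csi[OF Z w]
      have "(LINT u|lborel. \<bar>trunc a b (Z \<omega>) u * g u * D \<omega>\<bar>) = inner (l2of (\<lambda>u. \<bar>trunc a b (Z \<omega>) u\<bar>)) (l2of (\<lambda>u. \<bar>g u\<bar>)) * \<bar>D \<omega>\<bar>"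
        using absi[OF c] absi[OF g(2)] by (simp add: inner_l2of abs_mult)
      also have "\<dots> \<le> (norm (l2of (\<lambda>u. \<bar>trunc a b (Z \<omega>) u\<bar>)) * norm (l2of (\<lambda>u. \<bar>g u\<bar>))) * \<bar>D \<omega>\<bar>"
        by (intro mult_right_mono norm_cauchy_schwarz) auto
      finally show ?thesis using absi[OF c] absi[OF g(2)] g(1) by (simp add: emb_def mult_ac)
    qed
    have nm: "integrable M (\<lambda>\<omega>. norm (emb a b (Z \<omega>)) * \<bar>D \<omega>\<bar>)"
      by (rule integral_mult_square_le) (use m D2 in auto)
    have "integrable (M \<Otimes>\<^sub>M lborel) (\<lambda>p. (trunc a b (Z (fst p)) (snd p) * g (snd p)) * D (fst p))"
    proof (rule P.Fubini_integrable[OF m'])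
      show "integrable M (\<lambda>\<omega>. LINT u|lborel. norm ((trunc a b (Z (fst (\<omega>, u))) (snd (\<omega>, u)) * g (snd (\<omega>, u))) * D (fst (\<omega>, u))))"
      proof (rule Bochner_Integration.integrable_bound[OF integrable_mult_left[OF nm, of "norm x"]])
        show "(\<lambda>\<omega>. LINT u|lborel. norm ((trunc a b (Z (fst (\<omega>, u))) (snd (\<omega>, u)) * g (snd (\<omega>, u))) * D (fst (\<omega>, u)))) \<in> borel_measurable M"
          using m' by (intro lborel.borel_measurable_lebesgue_integral) (simp add: case_prod_unfold)
        show "AE \<omega> in M. norm (LINT u|lborel. norm ((trunc a b (Z (fst (\<omega>, u))) (snd (\<omega>, u)) * g (snd (\<omega>, u))) * D (fst (\<omega>, u)))) \<le> norm (norm (emb a b (Z \<omega>)) * \<bar>D \<omega>\<bar> * norm x)"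
        proof (rule AE_I2)
          fix \<omega> assume "\<omega> \<in> space M"
          thus "norm (LINT u|lborel. norm ((trunc a b (Z (fst (\<omega>, u))) (snd (\<omega>, u)) * g (snd (\<omega>, u))) * D (fst (\<omega>, u)))) \<le> norm (norm (emb a b (Z \<omega>)) * \<bar>D \<omega>\<bar> * norm x)"
            using bnd[of \<omega>] by (simp add: integral_nonneg_AE)
        qed
      qed
      show "AE \<omega> in M. integrable lborel (\<lambda>u. (trunc a b (Z (fst (\<omega>, u))) (snd (\<omega>, u)) * g (snd (\<omega>, u))) * D (fst (\<omega>, u)))"
        using square_integrable_mult[OF rfun_csi[OF Z] g(2)] by (intro AE_I2) simp
    qed
    hence int: "integrable (M \<Otimes>\<^sub>M lborel) (\<lambda>(\<omega>, u). trunc a b (Z \<omega>) u * g u * D \<omega>)" by (simp add: case_prod_unfold)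
    have "expectation (\<lambda>\<omega>. I \<omega> * D \<omega>) = (LINT \<omega>|M. LINT u|lborel. trunc a b (Z \<omega>) u * g u * D \<omega>)"
      by (intro Bochner_Integration.integral_cong refl) (simp add: Iw)
    also have "\<dots> = (LINT u|lborel. LINT \<omega>|M. trunc a b (Z \<omega>) u * g u * D \<omega>)"
      by (rule P.Fubini_integral[OF int, symmetric])
    also have "\<dots> = (LINT u|(lborel :: real measure). 0)"
    proof (intro Bochner_Integration.integral_cong refl)
      fix u
      have "(LINT \<omega>|M. trunc a b (Z \<omega>) u * g u * D \<omega>) = indicator {a..b} u * g u * (LINT \<omega>|M. Z \<omega> u * D \<omega>)"
        by (simp add: trunc_def mult_ac flip: integral_mult_right_zero)
      thus "(LINT \<omega>|M. trunc a b (Z \<omega>) u * g u * D \<omega>) = 0" using ZD[of u] by (cases "u \<in> {a..b}") auto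
    qed
    finally show ?thesis by simp
  qed
  have iD: "integrable M (\<lambda>\<omega>. I \<omega> * D \<omega>)" "integrable M (\<lambda>\<omega>. J \<omega> * D \<omega>)"
    by (rule integral_mult_square_le, use I2 J2 D2 in auto)+
  have "expectation (\<lambda>\<omega>. (D \<omega>)\<^sup>2) = expectation (\<lambda>\<omega>. I \<omega> * D \<omega> - J \<omega> * D \<omega>)"
    by (intro Bochner_Integration.integral_cong refl) (simp add: D_def power2_eq_square algebra_simps)
  also have "\<dots> = 0" using iD ID JD by simp
  finally have "AE \<omega> in M. (D \<omega>)\<^sup>2 = 0" using integral_nonneg_eq_0_iff_AE[OF D2] by simp
  hence "AE \<omega> in M. inner (emb a b (Z \<omega>)) x = J \<omega>" by eventually_elim (simp add: D_def I_def)
  thus ?thesis using JG by blast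
qed

section \<open>Concentration for linear processes\<close>

lemma cosh_weighted_sum_le:
  fixes w y :: "'i \<Rightarrow> real"
  assumes "finite E" "E \<noteq> {}" "\<And>e. e \<in> E \<Longrightarrow> w e \<ge> 0" "(\<Sum>e\<in>E. w e) = 1"
  shows "cosh (\<Sum>e\<in>E. w e * y e) \<le> (\<Sum>e\<in>E. w e * cosh (y e))"
proof -
  have "exp (\<Sum>e\<in>E. w e * y e) \<le> (\<Sum>e\<in>E. w e * exp (y e))" by (rule exp_weighted_sum_le[OF assms])
  moreover have "exp (- (\<Sum>e\<in>E. w e * y e)) \<le> (\<Sum>e\<in>E. w e * exp (- y e))"
    using exp_weighted_sum_le[OF assms, of "\<lambda>e. - y e"] by (simp add: sum_negf)
  ultimately have "exp (\<Sum>e\<in>E. w e * y e) + exp (- (\<Sum>e\<in>E. w e * y e)) \<le> (\<Sum>e\<in>E. w e * exp (y e) + w e * exp (- y e))"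
    by (simp add: sum.distrib)
  thus ?thesis by (simp add: cosh_field_def sum_divide_distrib[symmetric] distrib_left)
qed

lemma cosh_add_le: "cosh (x + y) \<le> (cosh (2 * x) + cosh (2 * y)) / (2 :: real)"
proof -
  have "cosh (y + x) \<le> cosh (2 * y) / 2 + cosh (2 * x) / 2"
    using cosh_weighted_sum_le[of UNIV "\<lambda>b. 1 / 2" "\<lambda>b. if b then 2 * x else 2 * y"] by (simp add: UNIV_bool)
  thus ?thesis by (simp add: add.commute)
qed

lemma cosh_mono: "0 \<le> x \<Longrightarrow> x \<le> y \<Longrightarrow> cosh x \<le> cosh (y :: real)"
  by (subst cosh_real_nonneg_le_iff) auto

lemma integrable_norm_le:
  fixes f :: "'b \<Rightarrow> 'c::{banach, second_countable_topology}" and g :: "'b \<Rightarrow> real"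
  assumes "integrable M g" "f \<in> borel_measurable M" "\<And>x. norm (f x) \<le> g x"
  shows "integrable M f"
proof (rule Bochner_Integration.integrable_bound[OF assms(1,2)])
  have "norm (f x) \<le> norm (g x)" for x using assms(3)[of x] by simp
  thus "AE x in M. norm (f x) \<le> norm (g x)" by simp
qed

lemma ennreal_half_sum:
  "0 \<le> x \<Longrightarrow> 0 \<le> y \<Longrightarrow> ennreal (1 / 2) * (ennreal x + ennreal y) = ennreal ((x + y) / 2)"
  by (subst ennreal_plus[symmetric], simp, simp, subst ennreal_mult[symmetric]) auto

text \<open>Products of innovations at the times \<open>t\<close> and \<open>t + r\<close> overlap only for times at distance \<open>\<bar>r\<bar>\<close>. Cutting
  time into blocks of length \<open>\<bar>r\<bar>\<close> and separating blocks of even and odd index makes them independent.\<close>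

lemma split_by_parity:
  fixes t s r :: int
  assumes "t = s + r" "r \<noteq> 0"
  shows "(t div \<bar>r\<bar>) mod 2 \<noteq> (s div \<bar>r\<bar>) mod 2"
proof -
  have "t div \<bar>r\<bar> = s div \<bar>r\<bar> + 1 \<or> t div \<bar>r\<bar> = s div \<bar>r\<bar> - 1"
  proof (cases "r > 0")
    case True
    thus ?thesis using assms by simp
  next
    case False
    hence "s = t + \<bar>r\<bar>" "\<bar>r\<bar> \<noteq> 0" using assms by auto
    hence "s div \<bar>r\<bar> = t div \<bar>r\<bar> + 1" by simp
    thus ?thesis by simp
  qed
  moreover have "x mod 2 \<noteq> y mod 2" if "x = y + 1 \<or> x = y - 1" for x y :: int using that by presburger
  ultimately show ?thesis by blast
qed

text \<open>The normalization by 2 is that of the Orlicz norm for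
  \<open>exp (x\<^sup>2) - 1\<close>: in it every innovation has norm at most
  \<open>1 / sqrt \<kappa>\<close>.\<close>

locale innovations = prob_space M for M :: "'w measure" +
  fixes eps :: "int \<Rightarrow> nat \<Rightarrow> 'w \<Rightarrow> 'h::{real_inner, banach, second_countable_topology}"
    and p :: nat and \<kappa> :: real
  assumes ind: "indep_vars (\<lambda>_. borel) (\<lambda>(t, j). eps t j) (UNIV \<times> {..<p})"
    and expi: "j < p \<Longrightarrow> integrable M (\<lambda>\<omega>. exp (\<kappa> * (norm (eps t j \<omega>))\<^sup>2))"
    and expE: "j < p \<Longrightarrow> expectation (\<lambda>\<omega>. exp (\<kappa> * (norm (eps t j \<omega>))\<^sup>2)) \<le> 2"
    and kpos: "\<kappa> > 0"
    and centered: "j < p \<Longrightarrow> expectation (\<lambda>\<omega>. inner x (eps t j \<omega>)) = 0"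
begin

lemma eps_measurable [measurable]: "j < p \<Longrightarrow> eps t j \<in> borel_measurable M"
  using ind unfolding indep_vars_def by auto

lemma eps_square:
  assumes j: "j < p"
  shows "integrable M (\<lambda>\<omega>. (norm (eps t j \<omega>))\<^sup>2)" "expectation (\<lambda>\<omega>. (norm (eps t j \<omega>))\<^sup>2) \<le> 1 / \<kappa>"
proof -
  note [measurable] = eps_measurable[OF j]
  have pt: "(norm (eps t j \<omega>))\<^sup>2 \<le> (exp (\<kappa> * (norm (eps t j \<omega>))\<^sup>2) - 1) / \<kappa>" for \<omega>
    using exp_ge_add_one_self[of "\<kappa> * (norm (eps t j \<omega>))\<^sup>2"] kpos by (simp add: field_simps)
  have i: "integrable M (\<lambda>\<omega>. (exp (\<kappa> * (norm (eps t j \<omega>))\<^sup>2) - 1) / \<kappa>)" using expi[OF j] by simp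
  show 1: "integrable M (\<lambda>\<omega>. (norm (eps t j \<omega>))\<^sup>2)"
    by (rule integrable_norm_le[OF i]) (use pt in auto)
  have "expectation (\<lambda>\<omega>. (norm (eps t j \<omega>))\<^sup>2) \<le> expectation (\<lambda>\<omega>. (exp (\<kappa> * (norm (eps t j \<omega>))\<^sup>2) - 1) / \<kappa>)"
    by (intro integral_mono 1 i pt)
  also have "\<dots> = (expectation (\<lambda>\<omega>. exp (\<kappa> * (norm (eps t j \<omega>))\<^sup>2)) - 1) / \<kappa>" using expi[OF j] by (simp add: prob_space)
  also have "\<dots> \<le> 1 / \<kappa>" using expE[OF j, of t] kpos by (intro divide_right_mono) auto
  finally show "expectation (\<lambda>\<omega>. (norm (eps t j \<omega>))\<^sup>2) \<le> 1 / \<kappa>" .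
qed

text \<open>\<open>r1\<close> and \<open>r2\<close> are the time offsets of two filter taps: as
  \<open>t\<close> moves, the two times keep a fixed distance.\<close>

definition prodterm :: "('h \<Rightarrow> 'h \<Rightarrow> 'g::{real_inner, banach, second_countable_topology}) \<Rightarrow> int \<Rightarrow> nat \<Rightarrow> int \<Rightarrow> nat \<Rightarrow> int \<Rightarrow> 'w \<Rightarrow> 'g" where
  "prodterm F r1 i1 r2 i2 t \<omega> = F (eps (t + r1) i1 \<omega>) (eps (t + r2) i2 \<omega>)"

definition centterm :: "('h \<Rightarrow> 'h \<Rightarrow> 'g::{real_inner, banach, second_countable_topology}) \<Rightarrow> int \<Rightarrow> nat \<Rightarrow> int \<Rightarrow> nat \<Rightarrow> int \<Rightarrow> 'w \<Rightarrow> 'g" where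
  "centterm F r1 i1 r2 i2 t \<omega> = prodterm F r1 i1 r2 i2 t \<omega> - expectation (prodterm F r1 i1 r2 i2 t)"

context
  fixes F :: "'h \<Rightarrow> 'h \<Rightarrow> 'g::{real_inner, banach, second_countable_topology}" and \<beta> :: real
    and r1 r2 :: int and i1 i2 :: nat
  assumes Fm: "(\<lambda>(x, y). F x y) \<in> borel_measurable (borel \<Otimes>\<^sub>M borel)"
    and Fb: "\<And>x y. norm (F x y) \<le> \<beta> * norm x * norm y" and b: "\<beta> > 0" and i: "i1 < p" "i2 < p"
begin

lemma prodterm_measurable: "prodterm F r1 i1 r2 i2 t \<in> borel_measurable M"
  using measurable_compose[OF measurable_Pair[OF eps_measurable[OF i(1)] eps_measurable[OF i(2)]] Fm]
  unfolding prodterm_def[abs_def] by simp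

lemma prodterm_norm: "norm (prodterm F r1 i1 r2 i2 t \<omega>) \<le> \<beta> / 2 * ((norm (eps (t + r1) i1 \<omega>))\<^sup>2 + (norm (eps (t + r2) i2 \<omega>))\<^sup>2)"
proof -
  let ?x = "norm (eps (t + r1) i1 \<omega>)" and ?y = "norm (eps (t + r2) i2 \<omega>)"
  have "0 \<le> (?x - ?y)\<^sup>2" by simp
  hence "?x * ?y \<le> (?x\<^sup>2 + ?y\<^sup>2) / 2" by (simp add: power2_diff)
  hence "\<beta> * (?x * ?y) \<le> \<beta> * ((?x\<^sup>2 + ?y\<^sup>2) / 2)" using b by (intro mult_left_mono) auto
  thus ?thesis using Fb[of "eps (t + r1) i1 \<omega>" "eps (t + r2) i2 \<omega>"] by (simp add: prodterm_def mult.assoc)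
qed

lemma prodterm_integrable: "integrable M (prodterm F r1 i1 r2 i2 t)"
  by (rule integrable_norm_le[OF integrable_mult_right[OF Bochner_Integration.integrable_add[OF eps_square(1)[OF i(1)] eps_square(1)[OF i(2)]]]
        prodterm_measurable prodterm_norm])

lemma expectation_prodterm_norm: "norm (expectation (prodterm F r1 i1 r2 i2 t)) \<le> \<beta> / \<kappa>"
proof -
  have "norm (expectation (prodterm F r1 i1 r2 i2 t)) \<le> expectation (\<lambda>\<omega>. norm (prodterm F r1 i1 r2 i2 t \<omega>))"
    by (rule integral_norm_bound)
  also have "\<dots> \<le> expectation (\<lambda>\<omega>. \<beta> / 2 * ((norm (eps (t + r1) i1 \<omega>))\<^sup>2 + (norm (eps (t + r2) i2 \<omega>))\<^sup>2))"
    by (intro integral_mono integrable_norm prodterm_integrable integrable_mult_right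
        Bochner_Integration.integrable_add eps_square i prodterm_norm)
  also have "\<dots> = \<beta> / 2 * (expectation (\<lambda>\<omega>. (norm (eps (t + r1) i1 \<omega>))\<^sup>2) + expectation (\<lambda>\<omega>. (norm (eps (t + r2) i2 \<omega>))\<^sup>2))"
    using eps_square(1)[OF i(1)] eps_square(1)[OF i(2)] by simp
  also have "\<dots> \<le> \<beta> / 2 * (1 / \<kappa> + 1 / \<kappa>)"
    using b by (intro mult_left_mono add_mono eps_square(2) i) auto
  finally show ?thesis by simp
qed

text \<open>The product of two norms is at most half the sum of their squares, and the exponentials
  are recombined in the same way, so only the square moments of single innovations enter. Centering
  costs a factor \<open>exp 1\<close>, and \<open>exp 1 / 2 * (2 + 2) \<le> 6\<close>.\<close>

lemma centterm_exp:
  "integrable M (\<lambda>\<omega>. exp (\<kappa> / \<beta> * norm (centterm F r1 i1 r2 i2 t \<omega>)))"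
  "expectation (\<lambda>\<omega>. exp (\<kappa> / \<beta> * norm (centterm F r1 i1 r2 i2 t \<omega>))) \<le> 6"
proof -
  let ?X = "\<lambda>\<omega>. exp (\<kappa> * (norm (eps (t + r1) i1 \<omega>))\<^sup>2)" and ?Y = "\<lambda>\<omega>. exp (\<kappa> * (norm (eps (t + r2) i2 \<omega>))\<^sup>2)"
  note [measurable] = prodterm_measurable
  have cm[measurable]: "centterm F r1 i1 r2 i2 t \<in> borel_measurable M" unfolding centterm_def[abs_def] by measurable
  have pt: "exp (\<kappa> / \<beta> * norm (centterm F r1 i1 r2 i2 t \<omega>)) \<le> exp 1 / 2 * (?X \<omega> + ?Y \<omega>)" for \<omega>
  proof -
    let ?x = "norm (eps (t + r1) i1 \<omega>)" and ?y = "norm (eps (t + r2) i2 \<omega>)"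
    have "norm (centterm F r1 i1 r2 i2 t \<omega>) \<le> \<beta> / 2 * (?x\<^sup>2 + ?y\<^sup>2) + \<beta> / \<kappa>"
      unfolding centterm_def by (intro norm_triangle_le_diff add_mono prodterm_norm expectation_prodterm_norm)
    hence "\<kappa> / \<beta> * norm (centterm F r1 i1 r2 i2 t \<omega>) \<le> \<kappa> / \<beta> * (\<beta> / 2 * (?x\<^sup>2 + ?y\<^sup>2) + \<beta> / \<kappa>)"
      using b kpos by (intro mult_left_mono) auto
    also have "\<dots> = \<kappa> * ?x\<^sup>2 / 2 + \<kappa> * ?y\<^sup>2 / 2 + 1" using b kpos by (simp add: field_simps)
    finally have "exp (\<kappa> / \<beta> * norm (centterm F r1 i1 r2 i2 t \<omega>)) \<le> exp (\<kappa> * ?x\<^sup>2 / 2 + \<kappa> * ?y\<^sup>2 / 2 + 1)" by simp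
    also have "\<dots> = exp 1 * (exp (\<kappa> * ?x\<^sup>2 / 2) * exp (\<kappa> * ?y\<^sup>2 / 2))" by (simp add: exp_add)
    also have "exp (\<kappa> * ?x\<^sup>2 / 2) * exp (\<kappa> * ?y\<^sup>2 / 2) \<le> (?X \<omega> + ?Y \<omega>) / 2"
    proof -
      have "0 \<le> (exp (\<kappa> * ?x\<^sup>2 / 2) - exp (\<kappa> * ?y\<^sup>2 / 2))\<^sup>2" by simp
      moreover have "(exp (\<kappa> * ?x\<^sup>2 / 2))\<^sup>2 = ?X \<omega>" "(exp (\<kappa> * ?y\<^sup>2 / 2))\<^sup>2 = ?Y \<omega>" by (simp_all add: exp_double[symmetric])
      ultimately show ?thesis by (simp add: power2_diff)
    qed
    finally show ?thesis by simp
  qed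
  have int: "integrable M (\<lambda>\<omega>. exp 1 / 2 * (?X \<omega> + ?Y \<omega>))"
    by (intro integrable_mult_right Bochner_Integration.integrable_add expi i)
  show 1: "integrable M (\<lambda>\<omega>. exp (\<kappa> / \<beta> * norm (centterm F r1 i1 r2 i2 t \<omega>)))"
  proof (rule Bochner_Integration.integrable_bound[OF int])
    show "AE \<omega> in M. norm (exp (\<kappa> / \<beta> * norm (centterm F r1 i1 r2 i2 t \<omega>))) \<le> norm (exp 1 / 2 * (?X \<omega> + ?Y \<omega>))"
      using pt by (intro AE_I2) (simp add: abs_of_nonneg add_nonneg_nonneg)
  qed measurable
  have "expectation (\<lambda>\<omega>. exp (\<kappa> / \<beta> * norm (centterm F r1 i1 r2 i2 t \<omega>))) \<le> expectation (\<lambda>\<omega>. exp 1 / 2 * (?X \<omega> + ?Y \<omega>))"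
    by (intro integral_mono 1 int pt)
  also have "\<dots> = exp 1 / 2 * (expectation ?X + expectation ?Y)"
    using expi[OF i(1)] expi[OF i(2)] by simp
  also have "\<dots> \<le> exp 1 / 2 * (2 + 2)" by (intro mult_left_mono add_mono expE i) auto
  also have "\<dots> \<le> 6" using exp_le by simp
  finally show "expectation (\<lambda>\<omega>. exp (\<kappa> / \<beta> * norm (centterm F r1 i1 r2 i2 t \<omega>))) \<le> 6" .
qed

text \<open>By \<open>disj\<close> the index pairs used at different times do not overlap, so the
  terms are functions of disjoint groups of independent innovations. The two indices of one term may
  coincide.\<close>

lemma centterm_pinelis_disjoint:
  assumes T: "finite T" and disj: "\<And>t s. t \<in> T \<Longrightarrow> s \<in> T \<Longrightarrow> t \<noteq> s \<Longrightarrow> (t + r1, i1) \<noteq> (s + r2, i2)"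
    and tau: "0 \<le> \<tau>" "\<tau> * \<beta> \<le> \<kappa>"
  shows "(\<integral>\<^sup>+\<omega>. cosh (\<tau> * norm (\<Sum>t\<in>T. centterm F r1 i1 r2 i2 t \<omega>)) \<partial>M) \<le> ennreal (exp (6 * (\<tau> * \<beta> / \<kappa>)\<^sup>2 * card T))"
proof -
  define K where "K t = {(t + r1, i1), (t + r2, i2)}" for t :: int
  have dK: "disjoint_family_on K T"
    using disj unfolding disjoint_family_on_def K_def by fastforce
  have "indep_vars (\<lambda>t. PiM (K t) (\<lambda>_. borel)) (\<lambda>t \<omega>. restrict (\<lambda>q. (\<lambda>(t, j). eps t j) q \<omega>) (K t)) T"
    using i by (intro indep_vars_restrict[OF ind _ dK]) (auto simp: K_def)
  hence "indep_vars (\<lambda>_. borel) (\<lambda>t \<omega>. (\<lambda>f. F (f (t + r1, i1)) (f (t + r2, i2)) - expectation (prodterm F r1 i1 r2 i2 t))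
     (restrict (\<lambda>q. (\<lambda>(t, j). eps t j) q \<omega>) (K t))) T"
  proof (rule indep_vars_compose2)
    fix t
    have "(\<lambda>f. (f (t + r1, i1), f (t + r2, i2))) \<in> measurable (PiM (K t) (\<lambda>_. borel)) (borel \<Otimes>\<^sub>M borel)"
      by (intro measurable_Pair measurable_component_singleton) (auto simp: K_def)
    from measurable_compose[OF this Fm]
    have "(\<lambda>f. F (f (t + r1, i1)) (f (t + r2, i2))) \<in> borel_measurable (PiM (K t) (\<lambda>_. borel))" by simp
    thus "(\<lambda>f. F (f (t + r1, i1)) (f (t + r2, i2)) - expectation (prodterm F r1 i1 r2 i2 t)) \<in> borel_measurable (PiM (K t) (\<lambda>_. borel))"
      by measurable
  qed
  also have "(\<lambda>t \<omega>. (\<lambda>f. F (f (t + r1, i1)) (f (t + r2, i2)) - expectation (prodterm F r1 i1 r2 i2 t))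
     (restrict (\<lambda>q. (\<lambda>(t, j). eps t j) q \<omega>) (K t))) = centterm F r1 i1 r2 i2"
    by (auto simp: fun_eq_iff centterm_def prodterm_def K_def)
  finally have iv: "indep_vars (\<lambda>_. borel) (centterm F r1 i1 r2 i2) T" .
  have cent: "expectation (\<lambda>\<omega>. inner v (centterm F r1 i1 r2 i2 t \<omega>)) = 0" for v t
  proof -
    have c: "integrable M (centterm F r1 i1 r2 i2 t)"
      unfolding centterm_def[abs_def] using prodterm_integrable by (intro Bochner_Integration.integrable_diff) auto
    have "expectation (\<lambda>\<omega>. inner v (centterm F r1 i1 r2 i2 t \<omega>)) = inner v (expectation (centterm F r1 i1 r2 i2 t))"
      using c by (intro integral_inner_right)
    also have "expectation (centterm F r1 i1 r2 i2 t) = 0"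
      unfolding centterm_def[abs_def] using prodterm_integrable by (subst Bochner_Integration.integral_diff) (auto simp: prob_space)
    finally show ?thesis by simp
  qed
  have "(\<integral>\<^sup>+\<omega>. cosh (\<tau> * norm (\<Sum>t\<in>T. centterm F r1 i1 r2 i2 t \<omega>)) \<partial>M) \<le> ennreal ((1 + 6 * (\<tau> / (\<kappa> / \<beta>))\<^sup>2) ^ card T)"
    using b kpos tau by (intro pinelis T iv centterm_exp cent) (auto simp: field_simps)
  also have "\<dots> \<le> ennreal (exp (6 * (\<tau> * \<beta> / \<kappa>)\<^sup>2 * card T))"
  proof (rule ennreal_leI)
    have "(1 + 6 * (\<tau> / (\<kappa> / \<beta>))\<^sup>2) ^ card T \<le> (exp (6 * (\<tau> / (\<kappa> / \<beta>))\<^sup>2)) ^ card T"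
      by (intro power_mono exp_ge_add_one_self) auto
    also have "\<dots> = exp (6 * (\<tau> * \<beta> / \<kappa>)\<^sup>2 * card T)" by (simp add: exp_of_nat_mult[symmetric] mult.commute)
    finally show "(1 + 6 * (\<tau> / (\<kappa> / \<beta>))\<^sup>2) ^ card T \<le> exp (6 * (\<tau> * \<beta> / \<kappa>)\<^sup>2 * card T)" .
  qed
  finally show ?thesis .
qed

text \<open>Each half of the parity split satisfies the previous bound. Recombining them by
  convexity of \<open>cosh\<close> doubles the rate \<tau>, which quadruples the exponent: 24 = 4 *
  6.\<close>

lemma centterm_pinelis:
  assumes T: "finite T" and tau: "0 \<le> \<tau>" "2 * \<tau> * \<beta> \<le> \<kappa>"
  shows "(\<integral>\<^sup>+\<omega>. cosh (\<tau> * norm (\<Sum>t\<in>T. centterm F r1 i1 r2 i2 t \<omega>)) \<partial>M) \<le> ennreal (exp (24 * (\<tau> * \<beta> / \<kappa>)\<^sup>2 * card T))"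
proof -
  define r where "r = r2 - r1"
  \<comment> \<open>For equal offsets, \<open>r = 0\<close>, the division yields 0: every time falls
    into the first class, and different times do not overlap.\<close>
  define cl where "cl t = (t div \<bar>r\<bar>) mod 2" for t
  define T0 where "T0 = {t \<in> T. cl t = 0}"
  define T1 where "T1 = {t \<in> T. cl t \<noteq> 0}"
  let ?S = "\<lambda>T \<omega>. \<Sum>t\<in>T. centterm F r1 i1 r2 i2 t \<omega>"
  have fin: "finite T0" "finite T1" using T by (auto simp: T0_def T1_def)
  have TT: "T = T0 \<union> T1" "T0 \<inter> T1 = {}" by (auto simp: T0_def T1_def)
  have cl01: "cl t = 0 \<or> cl t = 1" for t unfolding cl_def by presburger
  have dj: "(t + r1, i1) \<noteq> (s + r2, i2)" if "t \<noteq> s" "cl t = cl s" for t s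
  proof
    assume "(t + r1, i1) = (s + r2, i2)"
    hence "t = s + r" by (simp add: r_def)
    moreover have "r \<noteq> 0" using calculation that(1) by auto
    ultimately show False using split_by_parity[of t s r] that(2) by (simp add: cl_def)
  qed
  have meas[measurable]: "centterm F r1 i1 r2 i2 t \<in> borel_measurable M" for t
    unfolding centterm_def[abs_def] using prodterm_measurable by measurable
  have part: "(\<integral>\<^sup>+\<omega>. cosh (2 * \<tau> * norm (?S U \<omega>)) \<partial>M) \<le> ennreal (exp (24 * (\<tau> * \<beta> / \<kappa>)\<^sup>2 * card T))"
    if U: "U = T0 \<or> U = T1" for U
  proof -
    have "finite U" using U fin by auto
    have "(\<integral>\<^sup>+\<omega>. cosh (2 * \<tau> * norm (?S U \<omega>)) \<partial>M) \<le> ennreal (exp (6 * (2 * \<tau> * \<beta> / \<kappa>)\<^sup>2 * card U))"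
    proof (rule centterm_pinelis_disjoint[OF \<open>finite U\<close>])
      fix t s assume "t \<in> U" "s \<in> U" "t \<noteq> s"
      moreover have "cl t = cl s" using calculation U cl01[of t] cl01[of s] by (auto simp: T0_def T1_def)
      ultimately show "(t + r1, i1) \<noteq> (s + r2, i2)" by (intro dj)
    qed (use tau in auto)
    also have "\<dots> \<le> ennreal (exp (24 * (\<tau> * \<beta> / \<kappa>)\<^sup>2 * card T))"
    proof (rule ennreal_leI)
      have "card U \<le> card T" using U TT(1) T by (intro card_mono) auto
      hence "24 * (\<tau> * \<beta> / \<kappa>)\<^sup>2 * real (card U) \<le> 24 * (\<tau> * \<beta> / \<kappa>)\<^sup>2 * real (card T)" by (intro mult_left_mono) auto
      thus "exp (6 * (2 * \<tau> * \<beta> / \<kappa>)\<^sup>2 * real (card U)) \<le> exp (24 * (\<tau> * \<beta> / \<kappa>)\<^sup>2 * real (card T))"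
        by (simp add: power_mult_distrib power_divide)
    qed
    finally show ?thesis .
  qed
  have pt: "cosh (\<tau> * norm (?S T \<omega>)) \<le> (cosh (2 * \<tau> * norm (?S T0 \<omega>)) + cosh (2 * \<tau> * norm (?S T1 \<omega>))) / 2" for \<omega>
  proof -
    have "?S T \<omega> = ?S T0 \<omega> + ?S T1 \<omega>" unfolding TT(1) using fin TT(2) by (rule sum.union_disjoint)
    hence "norm (?S T \<omega>) \<le> norm (?S T0 \<omega>) + norm (?S T1 \<omega>)" by (simp add: norm_triangle_ineq)
    hence "\<tau> * norm (?S T \<omega>) \<le> \<tau> * (norm (?S T0 \<omega>) + norm (?S T1 \<omega>))" using tau by (intro mult_left_mono) auto
    hence "cosh (\<tau> * norm (?S T \<omega>)) \<le> cosh (\<tau> * norm (?S T0 \<omega>) + \<tau> * norm (?S T1 \<omega>))"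
      using tau by (intro cosh_mono) (auto simp: distrib_left)
    also have "\<dots> \<le> (cosh (2 * (\<tau> * norm (?S T0 \<omega>))) + cosh (2 * (\<tau> * norm (?S T1 \<omega>)))) / 2" by (rule cosh_add_le)
    finally show ?thesis by (simp add: mult.assoc)
  qed
  have "(\<integral>\<^sup>+\<omega>. cosh (\<tau> * norm (?S T \<omega>)) \<partial>M) \<le> (\<integral>\<^sup>+\<omega>. ennreal (1/2) * (ennreal (cosh (2 * \<tau> * norm (?S T0 \<omega>))) + ennreal (cosh (2 * \<tau> * norm (?S T1 \<omega>)))) \<partial>M)"
    using pt by (intro nn_integral_mono, subst ennreal_half_sum) (auto intro: ennreal_leI)
  also have "\<dots> = ennreal (1/2) * ((\<integral>\<^sup>+\<omega>. cosh (2 * \<tau> * norm (?S T0 \<omega>)) \<partial>M) + (\<integral>\<^sup>+\<omega>. cosh (2 * \<tau> * norm (?S T1 \<omega>)) \<partial>M))"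
    by (subst nn_integral_cmult) (auto simp: nn_integral_add)
  also have "\<dots> \<le> ennreal (1/2) * (ennreal (exp (24 * (\<tau> * \<beta> / \<kappa>)\<^sup>2 * card T)) + ennreal (exp (24 * (\<tau> * \<beta> / \<kappa>)\<^sup>2 * card T)))"
    by (intro mult_left_mono add_mono part) auto
  also have "\<dots> = ennreal (exp (24 * (\<tau> * \<beta> / \<kappa>)\<^sup>2 * card T))"
    by (subst ennreal_half_sum) auto
  finally show ?thesis .
qed

end

text \<open>Convexity reduces the sum over all pairs of filter coefficients, weighted by the product of their
  norms, to a single pair, so that the filter enters only through the sum of its norms.\<close>

lemma weighted_terms_bound:
  fixes F :: "'q \<Rightarrow> 'h \<Rightarrow> 'h \<Rightarrow> 'g::{real_inner, banach, second_countable_topology}"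
  assumes Q: "finite Q" "Q \<noteq> {}" and T: "finite T"
    and Fm: "\<And>q. q \<in> Q \<Longrightarrow> (\<lambda>(x, y). F q x y) \<in> borel_measurable (borel \<Otimes>\<^sub>M borel)"
    and Fb: "\<And>q x y. q \<in> Q \<Longrightarrow> norm (F q x y) \<le> \<beta> q * norm x * norm y" and b: "\<And>q. q \<in> Q \<Longrightarrow> \<beta> q > 0"
    and i: "\<And>q. q \<in> Q \<Longrightarrow> i1 q < p" "\<And>q. q \<in> Q \<Longrightarrow> i2 q < p"
    and bs: "(\<Sum>q\<in>Q. \<beta> q) \<le> B" and tau: "0 \<le> \<tau>" "2 * \<tau> * B \<le> \<kappa>"
  shows "(\<integral>\<^sup>+\<omega>. cosh (\<tau> * norm (\<Sum>q\<in>Q. \<Sum>t\<in>T. centterm (F q) (r1 q) (i1 q) (r2 q) (i2 q) t \<omega>)) \<partial>M) \<le> ennreal (exp (24 * (\<tau> * B / \<kappa>)\<^sup>2 * card T))"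
proof -
  define s where "s = (\<Sum>q\<in>Q. \<beta> q)"
  have s: "s > 0" "s \<le> B" using bs b Q unfolding s_def by (auto intro: sum_pos)
  define S where "S q \<omega> = (\<Sum>t\<in>T. centterm (F q) (r1 q) (i1 q) (r2 q) (i2 q) t \<omega>)" for q \<omega>
  have Sm: "S q \<in> borel_measurable M" if "q \<in> Q" for q
    unfolding S_def[abs_def] centterm_def[abs_def]
    by (intro borel_measurable_sum borel_measurable_diff prodterm_measurable[OF Fm[OF that] Fb[OF that] b[OF that] i[OF that]]) auto
  \<comment> \<open>The rate is rescaled by \<open>s / \<beta> q\<close>, which cancels the size
    \<open>\<beta> q\<close> of the term and makes all bounds equal.\<close>
  have part: "(\<integral>\<^sup>+\<omega>. cosh (\<tau> * s / \<beta> q * norm (S q \<omega>)) \<partial>M) \<le> ennreal (exp (24 * (\<tau> * B / \<kappa>)\<^sup>2 * card T))" if q: "q \<in> Q" for q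
  proof -
    have "2 * \<tau> * s \<le> 2 * \<tau> * B" using s tau by (intro mult_left_mono) auto
    hence "(\<integral>\<^sup>+\<omega>. cosh (\<tau> * s / \<beta> q * norm (S q \<omega>)) \<partial>M) \<le> ennreal (exp (24 * (\<tau> * s / \<beta> q * \<beta> q / \<kappa>)\<^sup>2 * card T))"
      unfolding S_def using b[OF q] s tau
      by (intro centterm_pinelis[OF Fm[OF q] Fb[OF q] b[OF q] i[OF q] T]) auto
    also have "\<dots> \<le> ennreal (exp (24 * (\<tau> * B / \<kappa>)\<^sup>2 * card T))"
    proof (rule ennreal_leI)
      have "\<tau> * s / \<beta> q * \<beta> q / \<kappa> \<le> \<tau> * B / \<kappa>" using b[OF q] s tau kpos by (auto intro!: divide_right_mono mult_left_mono)
      moreover have "0 \<le> \<tau> * s / \<beta> q * \<beta> q / \<kappa>" using b[OF q] s tau kpos by auto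
      ultimately have "(\<tau> * s / \<beta> q * \<beta> q / \<kappa>)\<^sup>2 \<le> (\<tau> * B / \<kappa>)\<^sup>2" by (rule power_mono)
      thus "exp (24 * (\<tau> * s / \<beta> q * \<beta> q / \<kappa>)\<^sup>2 * card T) \<le> exp (24 * (\<tau> * B / \<kappa>)\<^sup>2 * card T)"
        by (auto intro!: mult_right_mono)
    qed
    finally show ?thesis .
  qed
  have pt: "cosh (\<tau> * norm (\<Sum>q\<in>Q. S q \<omega>)) \<le> (\<Sum>q\<in>Q. \<beta> q / s * cosh (\<tau> * s / \<beta> q * norm (S q \<omega>)))" for \<omega>
  proof -
    have "\<tau> * norm (\<Sum>q\<in>Q. S q \<omega>) \<le> \<tau> * (\<Sum>q\<in>Q. norm (S q \<omega>))" using tau by (intro mult_left_mono norm_sum) auto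
    also have "\<dots> = (\<Sum>q\<in>Q. \<beta> q / s * (\<tau> * s / \<beta> q * norm (S q \<omega>)))"
      unfolding sum_distrib_left using b s by (intro sum.cong) (auto simp: less_imp_neq[THEN not_sym])
    finally have "cosh (\<tau> * norm (\<Sum>q\<in>Q. S q \<omega>)) \<le> cosh (\<Sum>q\<in>Q. \<beta> q / s * (\<tau> * s / \<beta> q * norm (S q \<omega>)))"
      using tau by (intro cosh_mono) auto
    also have "\<dots> \<le> (\<Sum>q\<in>Q. \<beta> q / s * cosh (\<tau> * s / \<beta> q * norm (S q \<omega>)))"
      using Q b s by (intro cosh_weighted_sum_le) (auto simp: less_imp_le s_def sum_divide_distrib[symmetric])
    finally show ?thesis .
  qed
  have "(\<integral>\<^sup>+\<omega>. cosh (\<tau> * norm (\<Sum>q\<in>Q. S q \<omega>)) \<partial>M) \<le> (\<integral>\<^sup>+\<omega>. (\<Sum>q\<in>Q. ennreal (\<beta> q / s) * ennreal (cosh (\<tau> * s / \<beta> q * norm (S q \<omega>)))) \<partial>M)"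
  proof (rule nn_integral_mono)
    fix \<omega>
    have "(\<Sum>q\<in>Q. ennreal (\<beta> q / s) * ennreal (cosh (\<tau> * s / \<beta> q * norm (S q \<omega>)))) = (\<Sum>q\<in>Q. ennreal (\<beta> q / s * cosh (\<tau> * s / \<beta> q * norm (S q \<omega>))))"
      using b s by (intro sum.cong refl ennreal_mult[symmetric]) (auto simp: less_imp_le)
    also have "\<dots> = ennreal (\<Sum>q\<in>Q. \<beta> q / s * cosh (\<tau> * s / \<beta> q * norm (S q \<omega>)))"
      using b s by (intro sum_ennreal) (auto simp: less_imp_le)
    finally show "ennreal (cosh (\<tau> * norm (\<Sum>q\<in>Q. S q \<omega>))) \<le> (\<Sum>q\<in>Q. ennreal (\<beta> q / s) * ennreal (cosh (\<tau> * s / \<beta> q * norm (S q \<omega>))))"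
      using pt[of \<omega>] by (simp add: ennreal_leI)
  qed
  also have "\<dots> = (\<Sum>q\<in>Q. ennreal (\<beta> q / s) * (\<integral>\<^sup>+\<omega>. cosh (\<tau> * s / \<beta> q * norm (S q \<omega>)) \<partial>M))"
    using Sm by (subst nn_integral_sum) (auto intro!: sum.cong nn_integral_cmult)
  also have "\<dots> \<le> (\<Sum>q\<in>Q. ennreal (\<beta> q / s) * ennreal (exp (24 * (\<tau> * B / \<kappa>)\<^sup>2 * card T)))"
    by (intro sum_mono mult_left_mono part) auto
  also have "\<dots> = (\<Sum>q\<in>Q. ennreal (\<beta> q / s)) * ennreal (exp (24 * (\<tau> * B / \<kappa>)\<^sup>2 * card T))"
    by (rule sum_distrib_right[symmetric])
  also have "(\<Sum>q\<in>Q. ennreal (\<beta> q / s)) = ennreal (\<Sum>q\<in>Q. \<beta> q / s)"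
    using b s by (intro sum_ennreal) (auto simp: less_imp_le)
  also have "(\<Sum>q\<in>Q. \<beta> q / s) = 1" using s by (simp add: s_def sum_divide_distrib[symmetric])
  finally show ?thesis by (simp add: S_def)
qed

end

section \<open>Truncated linear processes and the passage to the limit\<close>

lemma weighted_square_sum_le:
  fixes w y :: "'i \<Rightarrow> real"
  assumes "\<And>i. i \<in> I \<Longrightarrow> w i \<ge> 0"
  shows "(\<Sum>i\<in>I. w i * y i)\<^sup>2 \<le> (\<Sum>i\<in>I. w i) * (\<Sum>i\<in>I. w i * (y i)\<^sup>2)"
proof -
  have "(\<Sum>i\<in>I. w i * y i) = (\<Sum>i\<in>I. sqrt (w i) * (sqrt (w i) * y i))"
    using assms by (intro sum.cong) auto
  also have "\<dots>\<^sup>2 \<le> (\<Sum>i\<in>I. (sqrt (w i))\<^sup>2) * (\<Sum>i\<in>I. (sqrt (w i) * y i)\<^sup>2)" by (rule Cauchy_Schwarz_ineq_sum)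
  also have "\<dots> = (\<Sum>i\<in>I. w i) * (\<Sum>i\<in>I. w i * (y i)\<^sup>2)"
    using assms by (intro arg_cong2[where f="(*)"] sum.cong) (auto simp: power_mult_distrib)
  finally show ?thesis .
qed

text \<open>A moving average in an abstract Hilbert space. \<open>W_lim\<close> asks for almost sure
  convergence at each single time; uniform control of the truncations is derived from the weights
  \<open>bb\<close>.\<close>

locale linear_process = innovations M eps p \<kappa>
  for M :: "'w measure" and eps :: "int \<Rightarrow> nat \<Rightarrow> 'w \<Rightarrow> 'h::{real_inner, banach, second_countable_topology}"
    and p :: nat and \<kappa> :: real +
  fixes A :: "nat \<Rightarrow> nat \<Rightarrow> nat \<Rightarrow> 'h \<Rightarrow> 'h" and bb :: "nat \<Rightarrow> nat \<Rightarrow> nat \<Rightarrow> real" and C :: real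
    and W :: "int \<Rightarrow> nat \<Rightarrow> 'w \<Rightarrow> 'h"
  assumes A_linear: "j < p \<Longrightarrow> k < p \<Longrightarrow> bounded_linear (A l j k)"
    and A_bound: "j < p \<Longrightarrow> k < p \<Longrightarrow> norm (A l j k x) \<le> bb l j k * norm x"
    and bb_pos: "bb l j k > 0" and bb_sum: "j < p \<Longrightarrow> (\<Sum>l<m. \<Sum>k<p. bb l j k) \<le> C"
    and W_measurable: "j < p \<Longrightarrow> W t j \<in> borel_measurable M"
    and W_lim: "j < p \<Longrightarrow> AE \<omega> in M. (\<lambda>m. \<Sum>l<m. \<Sum>k<p. A l j k (eps (t - int l) k \<omega>)) \<longlonglongrightarrow> W t j \<omega>"
begin

definition Wm :: "nat \<Rightarrow> int \<Rightarrow> nat \<Rightarrow> 'w \<Rightarrow> 'h" where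
  "Wm m t j \<omega> = (\<Sum>l<m. \<Sum>k<p. A l j k (eps (t - int l) k \<omega>))"

abbreviation idx :: "nat \<Rightarrow> (nat \<times> nat) set" where "idx m \<equiv> {..<m} \<times> {..<p}"

lemma Wm_idx: "Wm m t j \<omega> = (\<Sum>a\<in>idx m. A (fst a) j (snd a) (eps (t - int (fst a)) (snd a) \<omega>))"
  unfolding Wm_def by (simp add: sum.cartesian_product case_prod_unfold)

lemma bb_idx: "j < p \<Longrightarrow> (\<Sum>a\<in>idx m. bb (fst a) j (snd a)) \<le> C"
  using bb_sum[of j m] by (simp add: sum.cartesian_product case_prod_unfold)

lemma C_nonneg: "j < p \<Longrightarrow> C \<ge> 0"
  using bb_sum[of j 0] by simp

lemma A_measurable: "j < p \<Longrightarrow> k < p \<Longrightarrow> (\<lambda>\<omega>. A l j k (eps t k \<omega>)) \<in> borel_measurable M"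
  by (rule measurable_compose[OF eps_measurable borel_measurable_continuous_onI])
     (auto intro: linear_continuous_on A_linear)

lemma Wm_measurable: "j < p \<Longrightarrow> Wm m t j \<in> borel_measurable M"
  unfolding Wm_def[abs_def] by (intro borel_measurable_sum A_measurable) auto

text \<open>An integrable majorant: by the weighted Cauchy--Schwarz inequality
  \<open>C * H t j\<close> dominates the squared norms of all truncations \<open>Wm m t j\<close> at
  once. Its values are extended because the series is finite only almost surely.\<close>

definition H :: "int \<Rightarrow> nat \<Rightarrow> 'w \<Rightarrow> ennreal" where
  "H t j \<omega> = (\<Sum>l. ennreal (\<Sum>k<p. bb l j k * (norm (eps (t - int l) k \<omega>))\<^sup>2))"

lemma H_measurable: "H t j \<in> borel_measurable M"
proof -
  have "(\<lambda>\<omega>. \<Sum>k<p. bb l j k * (norm (eps (t - int l) k \<omega>))\<^sup>2) \<in> borel_measurable M" for l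
    by (intro borel_measurable_sum borel_measurable_times borel_measurable_power borel_measurable_norm eps_measurable) auto
  thus ?thesis unfolding H_def[abs_def] by measurable
qed

lemma H_integral:
  assumes j: "j < p"
  shows "(\<integral>\<^sup>+\<omega>. H t j \<omega> \<partial>M) \<le> ennreal (C / \<kappa>)"
proof -
  have m: "(\<lambda>\<omega>. \<Sum>k<p. bb l j k * (norm (eps (t - int l) k \<omega>))\<^sup>2) \<in> borel_measurable M" for l
    by (intro borel_measurable_sum borel_measurable_times borel_measurable_power borel_measurable_norm eps_measurable) auto
  have i: "integrable M (\<lambda>\<omega>. bb l j k * (norm (eps s k \<omega>))\<^sup>2)" if "k < p" for l k s
    by (intro integrable_mult_right eps_square that)
  have "(\<integral>\<^sup>+\<omega>. H t j \<omega> \<partial>M) = (\<Sum>l. \<integral>\<^sup>+\<omega>. ennreal (\<Sum>k<p. bb l j k * (norm (eps (t - int l) k \<omega>))\<^sup>2) \<partial>M)"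
    unfolding H_def using m by (intro nn_integral_suminf) auto
  also have "\<dots> \<le> (\<Sum>l. ennreal ((\<Sum>k<p. bb l j k) / \<kappa>))"
  proof (intro suminf_le)
    fix l
    have "(\<integral>\<^sup>+\<omega>. ennreal (\<Sum>k<p. bb l j k * (norm (eps (t - int l) k \<omega>))\<^sup>2) \<partial>M) = ennreal (expectation (\<lambda>\<omega>. \<Sum>k<p. bb l j k * (norm (eps (t - int l) k \<omega>))\<^sup>2))"
      using i bb_pos by (intro nn_integral_eq_integral Bochner_Integration.integrable_sum) (auto intro!: sum_nonneg mult_nonneg_nonneg simp: less_imp_le)
    also have "expectation (\<lambda>\<omega>. \<Sum>k<p. bb l j k * (norm (eps (t - int l) k \<omega>))\<^sup>2) = (\<Sum>k<p. bb l j k * expectation (\<lambda>\<omega>. (norm (eps (t - int l) k \<omega>))\<^sup>2))"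
      using i by (subst Bochner_Integration.integral_sum) auto
    also have "\<dots> \<le> (\<Sum>k<p. bb l j k * (1 / \<kappa>))"
      using bb_pos eps_square(2) by (intro sum_mono mult_left_mono) (auto simp: less_imp_le)
    also have "\<dots> = (\<Sum>k<p. bb l j k) / \<kappa>" by (simp add: sum_divide_distrib)
    finally show "(\<integral>\<^sup>+\<omega>. ennreal (\<Sum>k<p. bb l j k * (norm (eps (t - int l) k \<omega>))\<^sup>2) \<partial>M) \<le> ennreal ((\<Sum>k<p. bb l j k) / \<kappa>)"
      by (simp add: ennreal_leI)
  qed auto
  also have "\<dots> \<le> ennreal (C / \<kappa>)"
  proof (rule suminf_le_const)
    fix m
    have "(\<Sum>l<m. ennreal ((\<Sum>k<p. bb l j k) / \<kappa>)) = ennreal ((\<Sum>l<m. \<Sum>k<p. bb l j k) / \<kappa>)"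
      using bb_pos kpos by (subst sum_ennreal) (auto intro!: divide_nonneg_pos sum_nonneg simp: less_imp_le sum_divide_distrib)
    thus "(\<Sum>l<m. ennreal ((\<Sum>k<p. bb l j k) / \<kappa>)) \<le> ennreal (C / \<kappa>)"
      using bb_sum[OF j, of m] kpos by (simp add: ennreal_leI divide_right_mono)
  qed auto
  finally show ?thesis .
qed

definition Hr :: "int \<Rightarrow> nat \<Rightarrow> 'w \<Rightarrow> real" where "Hr t j \<omega> = enn2real (H t j \<omega>)"

lemma Hr:
  assumes j: "j < p"
  shows "integrable M (Hr t j)" "expectation (Hr t j) \<le> C / \<kappa>"
    and "AE \<omega> in M. \<forall>m. (norm (Wm m t j \<omega>))\<^sup>2 \<le> C * Hr t j \<omega>"
proof -
  note [measurable] = H_measurable[of t j]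
  have [measurable]: "Hr t j \<in> borel_measurable M" unfolding Hr_def[abs_def] by measurable
  have fin: "(\<integral>\<^sup>+\<omega>. H t j \<omega> \<partial>M) \<noteq> \<infinity>" using H_integral[OF j, of t] by (auto simp: top_unique)
  have AEfin: "AE \<omega> in M. H t j \<omega> \<noteq> \<infinity>" by (rule nn_integral_noteq_infinite[OF _ fin]) measurable
  hence eq: "AE \<omega> in M. ennreal (Hr t j \<omega>) = H t j \<omega>"
    by eventually_elim (simp add: Hr_def less_top)
  have nn: "(\<integral>\<^sup>+\<omega>. ennreal (Hr t j \<omega>) \<partial>M) = (\<integral>\<^sup>+\<omega>. H t j \<omega> \<partial>M)" using eq by (rule nn_integral_cong_AE)
  have Hr0: "Hr t j \<omega> \<ge> 0" for \<omega> by (simp add: Hr_def)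
  show 1: "integrable M (Hr t j)" using nn fin Hr0 by (intro integrableI_bounded) (auto simp: less_top)
  have "ennreal (expectation (Hr t j)) \<le> ennreal (C / \<kappa>)"
    using H_integral[OF j, of t] nn nn_integral_eq_integral[OF 1] Hr0 by simp
  thus "expectation (Hr t j) \<le> C / \<kappa>" using C_nonneg[OF j] kpos by (subst (asm) ennreal_le_iff) auto
  show "AE \<omega> in M. \<forall>m. (norm (Wm m t j \<omega>))\<^sup>2 \<le> C * Hr t j \<omega>"
    using eq
  proof eventually_elim
    case (elim \<omega>)
    show ?case
    proof
      fix m
      let ?n = "\<lambda>a. norm (eps (t - int (fst a)) (snd a) \<omega>)" and ?b = "\<lambda>a. bb (fst a) j (snd a)"
      have "norm (Wm m t j \<omega>) \<le> (\<Sum>a\<in>idx m. ?b a * ?n a)"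
        unfolding Wm_idx using j by (intro sum_norm_le A_bound) auto
      hence "(norm (Wm m t j \<omega>))\<^sup>2 \<le> (\<Sum>a\<in>idx m. ?b a * ?n a)\<^sup>2" by (intro power_mono) auto
      also have "\<dots> \<le> (\<Sum>a\<in>idx m. ?b a) * (\<Sum>a\<in>idx m. ?b a * (?n a)\<^sup>2)"
        using bb_pos by (intro weighted_square_sum_le) (simp add: less_imp_le)
      also have "\<dots> \<le> C * (\<Sum>a\<in>idx m. ?b a * (?n a)\<^sup>2)"
        using bb_pos by (intro mult_right_mono bb_idx j sum_nonneg) (simp add: less_imp_le)
      also have "(\<Sum>a\<in>idx m. ?b a * (?n a)\<^sup>2) = (\<Sum>l<m. \<Sum>k<p. bb l j k * (norm (eps (t - int l) k \<omega>))\<^sup>2)"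
        by (simp add: sum.cartesian_product case_prod_unfold)
      also have "\<dots> \<le> Hr t j \<omega>"
      proof -
        have "ennreal (\<Sum>l<m. \<Sum>k<p. bb l j k * (norm (eps (t - int l) k \<omega>))\<^sup>2) = (\<Sum>l<m. ennreal (\<Sum>k<p. bb l j k * (norm (eps (t - int l) k \<omega>))\<^sup>2))"
          using bb_pos by (intro sum_ennreal[symmetric] sum_nonneg mult_nonneg_nonneg) (auto simp: less_imp_le)
        also have "\<dots> \<le> H t j \<omega>" unfolding H_def by (intro sum_le_suminf summableI) auto
        also have "\<dots> = ennreal (Hr t j \<omega>)" using elim by simp
        finally show ?thesis using Hr0 by (subst (asm) ennreal_le_iff) auto
      qed
      finally show "(norm (Wm m t j \<omega>))\<^sup>2 \<le> C * Hr t j \<omega>" using C_nonneg[OF j] by (simp add: mult_left_mono)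
    qed
  qed
qed

lemma W_Hr: "j < p \<Longrightarrow> AE \<omega> in M. (norm (W t j \<omega>))\<^sup>2 \<le> C * Hr t j \<omega>"
proof -
  assume j: "j < p"
  show ?thesis using W_lim[OF j, of t] Hr(3)[OF j, of t]
  proof eventually_elim
    case (elim \<omega>)
    have "(\<lambda>m. (norm (Wm m t j \<omega>))\<^sup>2) \<longlonglongrightarrow> (norm (W t j \<omega>))\<^sup>2"
      unfolding Wm_def using elim(1) by (intro tendsto_intros)
    thus ?case using elim(2) by (intro LIMSEQ_le_const2) auto
  qed
qed

lemma W_square:
  assumes j: "j < p"
  shows "integrable M (\<lambda>\<omega>. (norm (W t j \<omega>))\<^sup>2)" "expectation (\<lambda>\<omega>. (norm (W t j \<omega>))\<^sup>2) \<le> C\<^sup>2 / \<kappa>"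
proof -
  note [measurable] = W_measurable[OF j]
  have i: "integrable M (\<lambda>\<omega>. C * Hr t j \<omega>)" by (intro integrable_mult_right Hr j)
  show 1: "integrable M (\<lambda>\<omega>. (norm (W t j \<omega>))\<^sup>2)"
    by (rule Bochner_Integration.integrable_bound[OF i]) (use W_Hr[OF j, of t] in \<open>auto elim: eventually_mono\<close>)
  have "expectation (\<lambda>\<omega>. (norm (W t j \<omega>))\<^sup>2) \<le> expectation (\<lambda>\<omega>. C * Hr t j \<omega>)"
    by (rule integral_mono_AE[OF 1 i W_Hr[OF j]])
  also have "\<dots> = C * expectation (Hr t j)" by simp
  also have "\<dots> \<le> C * (C / \<kappa>)" by (intro mult_left_mono Hr(2) j C_nonneg[OF j])
  finally show "expectation (\<lambda>\<omega>. (norm (W t j \<omega>))\<^sup>2) \<le> C\<^sup>2 / \<kappa>" by (simp add: power2_eq_square)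
qed

text \<open>Kept general because two bilinear maps are needed: \<open>l2_tensor\<close> for the
  covariance kernels, and products of scalar projections for the summability of the
  autocovariances.\<close>

context
  fixes tn :: "'h \<Rightarrow> 'h \<Rightarrow> 'g::{real_inner, banach, second_countable_topology}" and K :: real
  assumes tn: "bounded_bilinear tn" and tnb: "\<And>x y. norm (tn x y) \<le> K * (norm x * norm y)" and K: "K > 0"
begin

lemma tn_measurable:
  assumes "f \<in> borel_measurable M" "g \<in> borel_measurable M"
  shows "(\<lambda>\<omega>. tn (f \<omega>) (g \<omega>)) \<in> borel_measurable M"
  by (rule borel_measurable_continuous_Pair[OF assms])
     (intro bounded_bilinear.continuous_on[OF tn] continuous_intros)

lemma tn_dominated:
  assumes "(norm x)\<^sup>2 \<le> X" "(norm y)\<^sup>2 \<le> Y"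
  shows "norm (tn x y) \<le> K * (X + Y)"
proof -
  have "0 \<le> (norm x - norm y)\<^sup>2" by simp
  hence "2 * (norm x * norm y) \<le> (norm x)\<^sup>2 + (norm y)\<^sup>2" by (simp add: power2_diff)
  moreover have "0 \<le> norm x * norm y" by simp
  ultimately have "norm x * norm y \<le> X + Y" using assms by linarith
  hence "K * (norm x * norm y) \<le> K * (X + Y)" using K by (intro mult_left_mono) auto
  thus ?thesis using tnb[of x y] by linarith
qed

text \<open>\<open>Hr\<close> bounds all truncated products at once, so the constants that center
  the truncated sums converge to those of the limit.\<close>

lemma tn_Wm_limit:
  assumes j: "j < p" "k < p"
  shows "(\<lambda>m. expectation (\<lambda>\<omega>. tn (Wm m t j \<omega>) (Wm m s k \<omega>))) \<longlonglongrightarrow> expectation (\<lambda>\<omega>. tn (W t j \<omega>) (W s k \<omega>))"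
    and "integrable M (\<lambda>\<omega>. tn (Wm m t j \<omega>) (Wm m s k \<omega>))"
proof -
  let ?w = "\<lambda>\<omega>. K * (C * Hr t j \<omega> + C * Hr s k \<omega>)"
  have w: "integrable M ?w" by (intro integrable_mult_right Bochner_Integration.integrable_add Hr j)
  have m: "(\<lambda>\<omega>. tn (Wm m t j \<omega>) (Wm m s k \<omega>)) \<in> borel_measurable M" for m
    by (intro tn_measurable Wm_measurable j)
  have b: "AE \<omega> in M. norm (tn (Wm m t j \<omega>) (Wm m s k \<omega>)) \<le> ?w \<omega>" for m
    using Hr(3)[OF j(1), of t] Hr(3)[OF j(2), of s] by eventually_elim (intro tn_dominated, auto)
  show "(\<lambda>m. expectation (\<lambda>\<omega>. tn (Wm m t j \<omega>) (Wm m s k \<omega>))) \<longlonglongrightarrow> expectation (\<lambda>\<omega>. tn (W t j \<omega>) (W s k \<omega>))"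
  proof (rule integral_dominated_convergence[OF _ m w _ b])
    show "(\<lambda>\<omega>. tn (W t j \<omega>) (W s k \<omega>)) \<in> borel_measurable M" by (intro tn_measurable W_measurable j)
    show "AE \<omega> in M. (\<lambda>m. tn (Wm m t j \<omega>) (Wm m s k \<omega>)) \<longlonglongrightarrow> tn (W t j \<omega>) (W s k \<omega>)"
      using W_lim[OF j(1), of t] W_lim[OF j(2), of s]
      by eventually_elim (auto simp: Wm_def intro: bounded_bilinear.tendsto[OF tn])
  qed
  show "integrable M (\<lambda>\<omega>. tn (Wm m t j \<omega>) (Wm m s k \<omega>))"
  proof (rule Bochner_Integration.integrable_bound[OF w m])
    show "AE \<omega> in M. norm (tn (Wm m t j \<omega>) (Wm m s k \<omega>)) \<le> norm (?w \<omega>)"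
      using b[of m] by eventually_elim auto
  qed
qed

text \<open>The product of two truncated processes is a double sum over filter taps, with one
  \<open>prodterm\<close> per pair of taps. The weights multiply, so their sum is at most
  \<open>K * C\<^sup>2\<close> whatever \<open>m\<close> and \<open>p\<close> are.\<close>

lemma tn_Wm_pinelis:
  assumes j: "j < p" "k < p" and T: "finite T" and tau: "0 \<le> \<tau>" "2 * \<tau> * (K * C\<^sup>2) \<le> \<kappa>"
  shows "(\<integral>\<^sup>+\<omega>. cosh (\<tau> * norm (\<Sum>t\<in>T. tn (Wm m t j \<omega>) (Wm m (t + h) k \<omega>) - expectation (\<lambda>\<omega>. tn (Wm m t j \<omega>) (Wm m (t + h) k \<omega>)))) \<partial>M)
    \<le> ennreal (exp (24 * (\<tau> * (K * C\<^sup>2) / \<kappa>)\<^sup>2 * card T))"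
proof (cases "m = 0")
  \<comment> \<open>Without taps the index set is empty, a case outside the convexity bound.\<close>
  case True
  interpret tn: bounded_bilinear tn by (rule tn)
  have "ennreal 1 \<le> ennreal (exp (24 * (\<tau> * (K * C\<^sup>2) / \<kappa>)\<^sup>2 * card T))" by (rule ennreal_leI) simp
  thus ?thesis using True by (simp add: Wm_def tn.zero_left emeasure_space_1)
next
  case False
  interpret tn: bounded_bilinear tn by (rule tn)
  define F where "F q x y = tn (A (fst (fst q)) j (snd (fst q)) x) (A (fst (snd q)) k (snd (snd q)) y)" for q :: "(nat \<times> nat) \<times> (nat \<times> nat)" and x y
  define \<beta> where "\<beta> q = K * (bb (fst (fst q)) j (snd (fst q)) * bb (fst (snd q)) k (snd (snd q)))" for q :: "(nat \<times> nat) \<times> (nat \<times> nat)"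
  let ?Q = "idx m \<times> idx m"
  let ?c = "\<lambda>q. centterm (F q) (- int (fst (fst q))) (snd (fst q)) (h - int (fst (snd q))) (snd (snd q))"
  have Fm: "(\<lambda>(x, y). F q x y) \<in> borel_measurable (borel \<Otimes>\<^sub>M borel)" if "q \<in> ?Q" for q
  proof -
    have "continuous_on UNIV (\<lambda>z. tn (A (fst (fst q)) j (snd (fst q)) (fst z)) (A (fst (snd q)) k (snd (snd q)) (snd z)))"
      using that j by (intro tn.continuous_on bounded_linear.continuous_on[OF A_linear] continuous_intros) auto
    thus ?thesis unfolding borel_prod F_def case_prod_unfold by (rule borel_measurable_continuous_onI)
  qed
  have Fb: "norm (F q x y) \<le> \<beta> q * norm x * norm y" if "q \<in> ?Q" for q x y
  proof -
    have "norm (F q x y) \<le> K * ((bb (fst (fst q)) j (snd (fst q)) * norm x) * (bb (fst (snd q)) k (snd (snd q)) * norm y))"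
      unfolding F_def using that j K bb_pos
      by (intro order_trans[OF tnb] mult_left_mono mult_mono A_bound) (auto simp: less_imp_le)
    thus ?thesis by (simp add: \<beta>_def mult_ac)
  qed
  have b: "\<beta> q > 0" for q using bb_pos K by (simp add: \<beta>_def)
  have bs: "(\<Sum>q\<in>?Q. \<beta> q) \<le> K * C\<^sup>2"
  proof -
    have "(\<Sum>q\<in>?Q. \<beta> q) = K * ((\<Sum>a\<in>idx m. bb (fst a) j (snd a)) * (\<Sum>a\<in>idx m. bb (fst a) k (snd a)))"
    proof -
      have "(\<Sum>q\<in>?Q. \<beta> q) = K * (\<Sum>q\<in>?Q. bb (fst (fst q)) j (snd (fst q)) * bb (fst (snd q)) k (snd (snd q)))"
        by (simp only: \<beta>_def sum_distrib_left)
      also have "(\<Sum>q\<in>?Q. bb (fst (fst q)) j (snd (fst q)) * bb (fst (snd q)) k (snd (snd q))) =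
          (\<Sum>a\<in>idx m. \<Sum>b\<in>idx m. bb (fst a) j (snd a) * bb (fst b) k (snd b))"
        by (simp only: sum.cartesian_product case_prod_unfold)
      finally show ?thesis by (simp only: sum_product)
    qed
    also have "\<dots> \<le> K * (C * C)"
      using K bb_pos C_nonneg[OF j(1)] by (intro mult_left_mono mult_mono bb_idx j sum_nonneg) (auto simp: less_imp_le)
    finally show ?thesis by (simp add: power2_eq_square)
  qed
  have int: "integrable M (prodterm (F q) r1 (snd (fst q)) r2 (snd (snd q)) t)" if "q \<in> ?Q" for q r1 r2 t
    using that by (intro prodterm_integrable[OF Fm[OF that] Fb[OF that] b]) auto
  have tnW: "tn (Wm m t j \<omega>) (Wm m (t + h) k \<omega>) = (\<Sum>q\<in>?Q. prodterm (F q) (- int (fst (fst q))) (snd (fst q)) (h - int (fst (snd q))) (snd (snd q)) t \<omega>)" for t \<omega>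
    unfolding Wm_idx tn.sum_left tn.sum_right prodterm_def F_def
    by (subst sum.swap, subst sum.cartesian_product) (simp add: case_prod_unfold algebra_simps)
  have EW: "expectation (\<lambda>\<omega>. tn (Wm m t j \<omega>) (Wm m (t + h) k \<omega>)) = (\<Sum>q\<in>?Q. expectation (prodterm (F q) (- int (fst (fst q))) (snd (fst q)) (h - int (fst (snd q))) (snd (snd q)) t))" for t
    unfolding tnW using int by (subst Bochner_Integration.integral_sum) auto
  have "(\<Sum>t\<in>T. tn (Wm m t j \<omega>) (Wm m (t + h) k \<omega>) - expectation (\<lambda>\<omega>. tn (Wm m t j \<omega>) (Wm m (t + h) k \<omega>))) = (\<Sum>q\<in>?Q. \<Sum>t\<in>T. ?c q t \<omega>)" for \<omega>
    unfolding EW unfolding tnW unfolding sum_subtractf[symmetric] centterm_def by (rule sum.swap)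
  moreover have "(\<integral>\<^sup>+\<omega>. cosh (\<tau> * norm (\<Sum>q\<in>?Q. \<Sum>t\<in>T. ?c q t \<omega>)) \<partial>M) \<le> ennreal (exp (24 * (\<tau> * (K * C\<^sup>2) / \<kappa>)\<^sup>2 * card T))"
    using False j by (intro weighted_terms_bound[OF _ _ T Fm Fb b _ _ bs tau]) auto
  ultimately show ?thesis by simp
qed

text \<open>Fatou's lemma, since the bound for the truncations is uniform in
  \<open>m\<close>.\<close>

lemma tn_W_pinelis:
  assumes j: "j < p" "k < p" and T: "finite T" and tau: "0 \<le> \<tau>" "2 * \<tau> * (K * C\<^sup>2) \<le> \<kappa>"
  shows "(\<integral>\<^sup>+\<omega>. cosh (\<tau> * norm (\<Sum>t\<in>T. tn (W t j \<omega>) (W (t + h) k \<omega>) - expectation (\<lambda>\<omega>. tn (W t j \<omega>) (W (t + h) k \<omega>)))) \<partial>M)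
    \<le> ennreal (exp (24 * (\<tau> * (K * C\<^sup>2) / \<kappa>)\<^sup>2 * card T))"
proof -
  let ?f = "\<lambda>m \<omega>. ennreal (cosh (\<tau> * norm (\<Sum>t\<in>T. tn (Wm m t j \<omega>) (Wm m (t + h) k \<omega>) - expectation (\<lambda>\<omega>. tn (Wm m t j \<omega>) (Wm m (t + h) k \<omega>)))))"
  let ?g = "\<lambda>\<omega>. ennreal (cosh (\<tau> * norm (\<Sum>t\<in>T. tn (W t j \<omega>) (W (t + h) k \<omega>) - expectation (\<lambda>\<omega>. tn (W t j \<omega>) (W (t + h) k \<omega>)))))"
  have "AE \<omega> in M. \<forall>t\<in>T. (\<lambda>m. Wm m t j \<omega>) \<longlonglongrightarrow> W t j \<omega> \<and> (\<lambda>m. Wm m (t + h) k \<omega>) \<longlonglongrightarrow> W (t + h) k \<omega>"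
    using W_lim[OF j(1)] W_lim[OF j(2)] unfolding Wm_def by (intro AE_finite_allI T AE_conjI)
  hence "AE \<omega> in M. ?g \<omega> = liminf (\<lambda>m. ?f m \<omega>)"
  proof eventually_elim
    case (elim \<omega>)
    have "(\<lambda>m. ?f m \<omega>) \<longlonglongrightarrow> ?g \<omega>"
      using elim by (intro tendsto_ennrealI tendsto_cosh tendsto_mult tendsto_const tendsto_norm tendsto_sum tendsto_diff
          bounded_bilinear.tendsto[OF tn] tn_Wm_limit j) auto
    thus ?case by (rule lim_imp_Liminf[OF sequentially_bot, symmetric])
  qed
  hence "(\<integral>\<^sup>+\<omega>. ?g \<omega> \<partial>M) = (\<integral>\<^sup>+\<omega>. liminf (\<lambda>m. ?f m \<omega>) \<partial>M)" by (rule nn_integral_cong_AE)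
  also have "\<dots> \<le> liminf (\<lambda>m. \<integral>\<^sup>+\<omega>. ?f m \<omega> \<partial>M)"
  proof (rule nn_integral_liminf)
    fix m
    have "(\<lambda>\<omega>. tn (Wm m t j \<omega>) (Wm m (t + h) k \<omega>)) \<in> borel_measurable M" for t by (intro tn_measurable Wm_measurable j)
    thus "?f m \<in> borel_measurable M" by measurable
  qed
  also have "\<dots> \<le> liminf (\<lambda>m. ennreal (exp (24 * (\<tau> * (K * C\<^sup>2) / \<kappa>)\<^sup>2 * card T)))"
    by (intro Liminf_mono always_eventually allI tn_Wm_pinelis assms)
  finally show ?thesis by (simp add: Liminf_const)
qed

lemma tn_W_tail:
  fixes \<eta> :: real
  assumes j: "j < p" "k < p" and T: "finite T" and C: "C > 0" and eta: "0 \<le> \<eta>" "\<eta> \<le> 24 * (K * C\<^sup>2) / \<kappa>"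
  shows "prob {\<omega> \<in> space M. norm (\<Sum>t\<in>T. tn (W t j \<omega>) (W (t + h) k \<omega>) - expectation (\<lambda>\<omega>. tn (W t j \<omega>) (W (t + h) k \<omega>))) \<ge> card T * \<eta>}
     \<le> 2 * exp (- (card T * \<eta>\<^sup>2 * \<kappa>\<^sup>2 / (96 * (K * C\<^sup>2)\<^sup>2)))"
proof -
  define B where "B = K * C\<^sup>2"
  have B: "B > 0" using K C by (simp add: B_def)
  define N where "N = real (card T)"
  define S where "S \<omega> = norm (\<Sum>t\<in>T. tn (W t j \<omega>) (W (t + h) k \<omega>) - expectation (\<lambda>\<omega>. tn (W t j \<omega>) (W (t + h) k \<omega>)))" for \<omega>
  \<comment> \<open>The minimizer of \<open>24 * (\<tau> * B / \<kappa>)\<^sup>2 * N - \<tau> * N *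
    \<eta>\<close>. The upper bound on \<eta> keeps it in the range
    \<open>2 * \<tau> * B \<le> \<kappa>\<close> where the moment bound holds.\<close>
  define \<tau> where "\<tau> = \<eta> * \<kappa>\<^sup>2 / (48 * B\<^sup>2)"
  have tau: "0 \<le> \<tau>" "2 * \<tau> * B \<le> \<kappa>"
  proof -
    show "0 \<le> \<tau>" using eta by (simp add: \<tau>_def)
    have "2 * \<tau> * B = \<eta> * (\<kappa>\<^sup>2 / (24 * B))" using B by (simp add: \<tau>_def field_simps power2_eq_square)
    also have "\<dots> \<le> 24 * B / \<kappa> * (\<kappa>\<^sup>2 / (24 * B))" using eta B by (intro mult_right_mono) (auto simp: B_def)
    also have "\<dots> = \<kappa>" using B kpos by (simp add: field_simps power2_eq_square)
    finally show "2 * \<tau> * B \<le> \<kappa>" .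
  qed
  have [measurable]: "(\<lambda>\<omega>. tn (W t j \<omega>) (W (t + h) k \<omega>)) \<in> borel_measurable M" for t by (intro tn_measurable W_measurable j)
  have [measurable]: "S \<in> borel_measurable M" unfolding S_def[abs_def] by measurable
  let ?E = "{\<omega> \<in> space M. S \<omega> \<ge> N * \<eta>}"
  have "ennreal (exp (\<tau> * N * \<eta>) / 2) * emeasure M ?E = (\<integral>\<^sup>+\<omega>. ennreal (exp (\<tau> * N * \<eta>) / 2) * indicator ?E \<omega> \<partial>M)"
    by (rule nn_integral_cmult_indicator[symmetric]) measurable
  also have "\<dots> \<le> (\<integral>\<^sup>+\<omega>. cosh (\<tau> * S \<omega>) \<partial>M)"
  proof (rule nn_integral_mono)
    fix \<omega>
    show "ennreal (exp (\<tau> * N * \<eta>) / 2) * indicator ?E \<omega> \<le> ennreal (cosh (\<tau> * S \<omega>))"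
    proof (cases "\<omega> \<in> ?E")
      case True
      hence "\<tau> * (N * \<eta>) \<le> \<tau> * S \<omega>" using tau by (intro mult_left_mono) auto
      hence "exp (\<tau> * N * \<eta>) \<le> exp (\<tau> * S \<omega>)" by (simp add: mult.assoc)
      also have "exp (\<tau> * S \<omega>) / 2 \<le> cosh (\<tau> * S \<omega>)" by (simp add: cosh_field_def)
      finally have "exp (\<tau> * N * \<eta>) / 2 \<le> cosh (\<tau> * S \<omega>)" by simp
      thus ?thesis using True by (simp add: ennreal_leI)
    qed simp
  qed
  also have "\<dots> \<le> ennreal (exp (24 * (\<tau> * B / \<kappa>)\<^sup>2 * N))"
    unfolding S_def N_def B_def using tau by (intro tn_W_pinelis j T) (auto simp: B_def)
  finally have "ennreal (exp (\<tau> * N * \<eta>) / 2 * prob ?E) \<le> ennreal (exp (24 * (\<tau> * B / \<kappa>)\<^sup>2 * N))"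
    by (simp add: emeasure_eq_measure ennreal_mult[symmetric])
  hence "exp (\<tau> * N * \<eta>) / 2 * prob ?E \<le> exp (24 * (\<tau> * B / \<kappa>)\<^sup>2 * N)" by (subst (asm) ennreal_le_iff) auto
  hence "prob ?E \<le> 2 * (exp (24 * (\<tau> * B / \<kappa>)\<^sup>2 * N) / exp (\<tau> * N * \<eta>))" by (simp add: field_simps)
  also have "exp (24 * (\<tau> * B / \<kappa>)\<^sup>2 * N) / exp (\<tau> * N * \<eta>) = exp (24 * (\<tau> * B / \<kappa>)\<^sup>2 * N - \<tau> * N * \<eta>)"
    by (simp add: exp_diff)
  also have "24 * (\<tau> * B / \<kappa>)\<^sup>2 * N - \<tau> * N * \<eta> = - (N * \<eta>\<^sup>2 * \<kappa>\<^sup>2 / (96 * B\<^sup>2))"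
  proof -
    have "(\<tau> * B / \<kappa>)\<^sup>2 = \<eta>\<^sup>2 * \<kappa>\<^sup>2 / (2304 * B\<^sup>2)"
      using B kpos by (simp add: \<tau>_def power_mult_distrib power_divide field_simps power2_eq_square)
    moreover have "\<tau> * N * \<eta> = N * \<eta>\<^sup>2 * \<kappa>\<^sup>2 / (48 * B\<^sup>2)" by (simp add: \<tau>_def power2_eq_square)
    ultimately show ?thesis by (simp add: field_simps)
  qed
  finally show ?thesis by (simp add: S_def N_def B_def mult.commute)
qed

end

section \<open>Absolute summability of the autocovariances\<close>

lemma eps_integrable:
  assumes k: "k < p"
  shows "integrable M (eps t k)" "expectation (eps t k) = 0"
proof -
  show 1: "integrable M (eps t k)"
  proof (rule integrable_norm_le[OF Bochner_Integration.integrable_add[OF integrable_const eps_square(1)[OF k]]])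
    show "norm (eps t k x) \<le> 1 + (norm (eps t k x))\<^sup>2" for x
    proof -
      have "0 \<le> (norm (eps t k x) - 1)\<^sup>2" by simp
      hence "2 * norm (eps t k x) \<le> (norm (eps t k x))\<^sup>2 + 1" by (simp add: power2_diff)
      thus ?thesis using norm_ge_zero[of "eps t k x"] by linarith
    qed
  qed (rule eps_measurable[OF k])
  have "inner (expectation (eps t k)) (expectation (eps t k)) = expectation (\<lambda>\<omega>. inner (expectation (eps t k)) (eps t k \<omega>))"
    using 1 by (intro integral_inner_right[symmetric])
  thus "expectation (eps t k) = 0" using centered[OF k] by simp
qed

lemma eps_uncorrelated:
  fixes f g :: "'h \<Rightarrow> real"
  assumes f: "bounded_linear f" "bounded_linear g" and k: "k < p" "k' < p" and ne: "(t, k) \<noteq> (s, k')"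
  shows "expectation (\<lambda>\<omega>. f (eps t k \<omega>) * g (eps s k' \<omega>)) = 0"
proof -
  let ?X = "\<lambda>q. (\<lambda>(t, j). eps t j) q"
  have m: "(\<lambda>z. f (z q)) \<in> borel_measurable (PiM {q} (\<lambda>_. borel))" if "bounded_linear f" for f :: "'h \<Rightarrow> real" and q :: "int \<times> nat"
  proof -
    have "(\<lambda>z. z q) \<in> measurable (PiM {q} (\<lambda>_. borel)) borel" by (rule measurable_component_singleton) simp
    from measurable_compose[OF this borel_measurable_continuous_onI[OF linear_continuous_on[OF that]]] show ?thesis .
  qed
  have "indep_var (PiM {(t, k)} (\<lambda>_. borel)) (\<lambda>\<omega>. restrict (\<lambda>i. ?X i \<omega>) {(t, k)}) (PiM {(s, k')} (\<lambda>_. borel)) (\<lambda>\<omega>. restrict (\<lambda>i. ?X i \<omega>) {(s, k')})"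
    using k ne by (intro indep_var_restrict[OF ind]) auto
  from indep_var_compose[OF this m[OF f(1)] m[OF f(2)]]
  have "indep_var borel (\<lambda>\<omega>. f (eps t k \<omega>)) borel (\<lambda>\<omega>. g (eps s k' \<omega>))" by (simp add: o_def)
  moreover have "integrable M (\<lambda>\<omega>. f (eps t k \<omega>))" "integrable M (\<lambda>\<omega>. g (eps s k' \<omega>))"
    using eps_integrable k f by (auto intro: integrable_bounded_linear)
  ultimately have "expectation (\<lambda>\<omega>. f (eps t k \<omega>) * g (eps s k' \<omega>)) = expectation (\<lambda>\<omega>. f (eps t k \<omega>)) * expectation (\<lambda>\<omega>. g (eps s k' \<omega>))"
    by (intro indep_var_lebesgue_integral)
  also have "expectation (\<lambda>\<omega>. f (eps t k \<omega>)) = f (expectation (eps t k))"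
    by (rule integral_bounded_linear[OF f(1) eps_integrable(1)[OF k(1)]])
  also have "\<dots> = 0" using eps_integrable(2)[OF k(1)] linear_0[OF bounded_linear.linear[OF f(1)]] by simp
  finally show ?thesis by simp
qed

text \<open>Distinct innovations are uncorrelated, so a pair of taps contributes to one lag only,
  the difference of its two delays. Summing over all lags therefore counts each pair at most once,
  which keeps the bound free of \<open>N\<close>.\<close>

lemma autocovariance_abs_summable:
  assumes j: "j < p"
  shows "(\<Sum>h\<in>{- int N..int N}. \<bar>expectation (\<lambda>\<omega>. inner \<phi> (W 0 j \<omega>) * inner \<phi> (W h j \<omega>))\<bar>) \<le> (norm \<phi>)\<^sup>2 * C\<^sup>2 / \<kappa>"
proof -
  let ?tn = "\<lambda>x y. inner \<phi> x * inner \<phi> y"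
  have tn: "bounded_bilinear ?tn"
    by (intro bounded_bilinear.comp[OF bounded_bilinear_mult] bounded_linear_inner_right)
  \<comment> \<open>The added 1 makes the constant positive also for \<phi> = 0.\<close>
  have tnb: "norm (?tn x y) \<le> ((norm \<phi>)\<^sup>2 + 1) * (norm x * norm y)" for x y
  proof -
    have "\<bar>inner \<phi> x\<bar> * \<bar>inner \<phi> y\<bar> \<le> (norm \<phi> * norm x) * (norm \<phi> * norm y)"
      by (intro mult_mono Cauchy_Schwarz_ineq2) auto
    also have "\<dots> = (norm \<phi>)\<^sup>2 * (norm x * norm y)" by (simp add: power2_eq_square)
    also have "\<dots> \<le> ((norm \<phi>)\<^sup>2 + 1) * (norm x * norm y)" by (intro mult_right_mono) auto
    finally show ?thesis by (simp add: abs_mult)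
  qed
  have pos: "(norm \<phi>)\<^sup>2 + 1 > 0" by (intro add_nonneg_pos) auto
  let ?e = "\<lambda>h a b. expectation (\<lambda>\<omega>. inner \<phi> (A (fst a) j (snd a) (eps (0 - int (fst a)) (snd a) \<omega>)) * inner \<phi> (A (fst b) j (snd b) (eps (h - int (fst b)) (snd b) \<omega>)))"
  let ?b = "\<lambda>a. bb (fst a) j (snd a)"
  have sq: "integrable M (\<lambda>\<omega>. (inner \<phi> (A (fst a) j (snd a) (eps s (snd a) \<omega>)))\<^sup>2) \<and>
     expectation (\<lambda>\<omega>. (inner \<phi> (A (fst a) j (snd a) (eps s (snd a) \<omega>)))\<^sup>2) \<le> (norm \<phi> * ?b a)\<^sup>2 / \<kappa> \<and>
     (\<lambda>\<omega>. inner \<phi> (A (fst a) j (snd a) (eps s (snd a) \<omega>))) \<in> borel_measurable M" if a: "a \<in> idx m" for a s m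
  proof -
    have k: "snd a < p" using a by auto
    have m: "(\<lambda>\<omega>. inner \<phi> (A (fst a) j (snd a) (eps s (snd a) \<omega>))) \<in> borel_measurable M"
      using A_measurable[OF j k] by measurable
    have pt: "(inner \<phi> (A (fst a) j (snd a) (eps s (snd a) \<omega>)))\<^sup>2 \<le> (norm \<phi> * ?b a)\<^sup>2 * (norm (eps s (snd a) \<omega>))\<^sup>2" for \<omega>
    proof -
      have "\<bar>inner \<phi> (A (fst a) j (snd a) (eps s (snd a) \<omega>))\<bar> \<le> norm \<phi> * (?b a * norm (eps s (snd a) \<omega>))"
        by (rule order_trans[OF Cauchy_Schwarz_ineq2 mult_left_mono[OF A_bound[OF j k]]]) simp
      hence "\<bar>inner \<phi> (A (fst a) j (snd a) (eps s (snd a) \<omega>))\<bar>\<^sup>2 \<le> (norm \<phi> * (?b a * norm (eps s (snd a) \<omega>)))\<^sup>2" by (intro power_mono) auto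
      thus ?thesis by (simp add: power_mult_distrib mult.assoc)
    qed
    have i: "integrable M (\<lambda>\<omega>. (norm \<phi> * ?b a)\<^sup>2 * (norm (eps s (snd a) \<omega>))\<^sup>2)" by (intro integrable_mult_right eps_square k)
    have 1: "integrable M (\<lambda>\<omega>. (inner \<phi> (A (fst a) j (snd a) (eps s (snd a) \<omega>)))\<^sup>2)"
      by (rule integrable_norm_le[OF i]) (use m pt in auto)
    have "expectation (\<lambda>\<omega>. (inner \<phi> (A (fst a) j (snd a) (eps s (snd a) \<omega>)))\<^sup>2) \<le> expectation (\<lambda>\<omega>. (norm \<phi> * ?b a)\<^sup>2 * (norm (eps s (snd a) \<omega>))\<^sup>2)"
      by (intro integral_mono 1 i pt)
    also have "\<dots> = (norm \<phi> * ?b a)\<^sup>2 * expectation (\<lambda>\<omega>. (norm (eps s (snd a) \<omega>))\<^sup>2)" by simp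
    also have "\<dots> \<le> (norm \<phi> * ?b a)\<^sup>2 * (1 / \<kappa>)" by (intro mult_left_mono eps_square k) auto
    finally show ?thesis using 1 m by simp
  qed
  have ebound: "\<bar>?e h a b\<bar> \<le> (norm \<phi>)\<^sup>2 / \<kappa> * (?b a * ?b b)" if ab: "a \<in> idx m" "b \<in> idx m" for h a b m
  proof -
    have "(?e h a b)\<^sup>2 \<le> expectation (\<lambda>\<omega>. (inner \<phi> (A (fst a) j (snd a) (eps (0 - int (fst a)) (snd a) \<omega>)))\<^sup>2) *
       expectation (\<lambda>\<omega>. (inner \<phi> (A (fst b) j (snd b) (eps (h - int (fst b)) (snd b) \<omega>)))\<^sup>2)"
      using sq[OF ab(1)] sq[OF ab(2)] by (intro integral_mult_square_le) auto
    also have "\<dots> \<le> ((norm \<phi> * ?b a)\<^sup>2 / \<kappa>) * ((norm \<phi> * ?b b)\<^sup>2 / \<kappa>)"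
      using sq[OF ab(1)] sq[OF ab(2)] kpos by (intro mult_mono) auto
    also have "\<dots> = ((norm \<phi>)\<^sup>2 / \<kappa> * (?b a * ?b b))\<^sup>2" by (simp add: power_mult_distrib power_divide power2_eq_square)
    finally have "\<bar>?e h a b\<bar> \<le> \<bar>(norm \<phi>)\<^sup>2 / \<kappa> * (?b a * ?b b)\<bar>" by (simp only: abs_le_square_iff)
    also have "\<dots> = (norm \<phi>)\<^sup>2 / \<kappa> * (?b a * ?b b)" using kpos bb_pos by (intro abs_of_nonneg) (simp add: less_imp_le)
    finally show ?thesis .
  qed
  have ezero: "?e h a b = 0" if ab: "a \<in> idx m" "b \<in> idx m" and h: "h \<noteq> int (fst b) - int (fst a)" for h a b m
  proof (rule eps_uncorrelated)
    show "bounded_linear (\<lambda>x. inner \<phi> (A (fst a) j (snd a) x))" "bounded_linear (\<lambda>x. inner \<phi> (A (fst b) j (snd b) x))"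
      using ab j by (auto intro!: bounded_linear_compose[OF bounded_linear_inner_right] A_linear)
  qed (use ab h in auto)
  have fin: "(\<Sum>h\<in>{- int N..int N}. \<bar>expectation (\<lambda>\<omega>. ?tn (Wm m 0 j \<omega>) (Wm m h j \<omega>))\<bar>) \<le> (norm \<phi>)\<^sup>2 * C\<^sup>2 / \<kappa>" for m
  proof -
    have ew: "expectation (\<lambda>\<omega>. ?tn (Wm m 0 j \<omega>) (Wm m h j \<omega>)) = (\<Sum>a\<in>idx m. \<Sum>b\<in>idx m. ?e h a b)" for h
    proof -
      have i: "integrable M (\<lambda>\<omega>. inner \<phi> (A (fst a) j (snd a) (eps (0 - int (fst a)) (snd a) \<omega>)) * inner \<phi> (A (fst b) j (snd b) (eps (h - int (fst b)) (snd b) \<omega>)))"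
        if "a \<in> idx m" "b \<in> idx m" for a b
        using sq[OF that(1)] sq[OF that(2)] by (intro integral_mult_square_le) auto
      show ?thesis unfolding Wm_idx inner_sum_right sum_product
        using i by (subst Bochner_Integration.integral_sum) (auto intro!: sum.cong Bochner_Integration.integral_sum Bochner_Integration.integrable_sum)
    qed
    have "(\<Sum>h\<in>{- int N..int N}. \<bar>expectation (\<lambda>\<omega>. ?tn (Wm m 0 j \<omega>) (Wm m h j \<omega>))\<bar>) \<le> (\<Sum>h\<in>{- int N..int N}. \<Sum>a\<in>idx m. \<Sum>b\<in>idx m. \<bar>?e h a b\<bar>)"
      unfolding ew by (intro sum_mono order_trans[OF sum_abs] sum_mono sum_abs)
    also have "\<dots> = (\<Sum>a\<in>idx m. \<Sum>b\<in>idx m. \<Sum>h\<in>{- int N..int N}. \<bar>?e h a b\<bar>)"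
      by (subst sum.swap, intro sum.cong refl, subst sum.swap) simp
    also have "\<dots> \<le> (\<Sum>a\<in>idx m. \<Sum>b\<in>idx m. (norm \<phi>)\<^sup>2 / \<kappa> * (?b a * ?b b))"
    proof (intro sum_mono)
      fix a b assume ab: "a \<in> idx m" "b \<in> idx m"
      let ?h = "int (fst b) - int (fst a)"
      have "(\<Sum>h\<in>{- int N..int N}. \<bar>?e h a b\<bar>) \<le> (\<Sum>h\<in>{- int N..int N}. if h = ?h then (norm \<phi>)\<^sup>2 / \<kappa> * (?b a * ?b b) else 0)"
      proof (intro sum_mono)
        fix h
        show "\<bar>?e h a b\<bar> \<le> (if h = ?h then (norm \<phi>)\<^sup>2 / \<kappa> * (?b a * ?b b) else 0)"
        proof (cases "h = ?h")
          case True
          show ?thesis unfolding if_P[OF True] by (rule ebound[OF ab])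
        next
          case False
          show ?thesis unfolding if_not_P[OF False] using ezero[OF ab False] by simp
        qed
      qed
      also have "\<dots> \<le> (norm \<phi>)\<^sup>2 / \<kappa> * (?b a * ?b b)"
        using kpos bb_pos by (simp add: less_imp_le)
      finally show "(\<Sum>h\<in>{- int N..int N}. \<bar>?e h a b\<bar>) \<le> (norm \<phi>)\<^sup>2 / \<kappa> * (?b a * ?b b)" .
    qed
    also have "\<dots> = (norm \<phi>)\<^sup>2 / \<kappa> * (\<Sum>a\<in>idx m. \<Sum>b\<in>idx m. ?b a * ?b b)"
      by (simp only: sum_distrib_left)
    also have "\<dots> = (norm \<phi>)\<^sup>2 / \<kappa> * ((\<Sum>a\<in>idx m. ?b a) * (\<Sum>b\<in>idx m. ?b b))"
      by (simp only: sum_product)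
    also have "\<dots> \<le> (norm \<phi>)\<^sup>2 / \<kappa> * (C * C)"
      using kpos bb_pos C_nonneg[OF j] by (intro mult_left_mono mult_mono bb_idx j sum_nonneg) (auto simp: less_imp_le)
    finally show ?thesis by (simp add: power2_eq_square)
  qed
  have "(\<lambda>m. \<Sum>h\<in>{- int N..int N}. \<bar>expectation (\<lambda>\<omega>. ?tn (Wm m 0 j \<omega>) (Wm m h j \<omega>))\<bar>)
      \<longlonglongrightarrow> (\<Sum>h\<in>{- int N..int N}. \<bar>expectation (\<lambda>\<omega>. ?tn (W 0 j \<omega>) (W h j \<omega>))\<bar>)"
    by (intro tendsto_sum tendsto_rabs tn_Wm_limit(1)[OF tn tnb pos j j])
  thus ?thesis by (rule LIMSEQ_le_const2) (use fin in auto)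
qed

end

section \<open>Sample autocovariances of functional linear processes\<close>

locale functional_process = prob_space M for M :: "'w measure" +
  fixes a b c Ce CB :: real and p :: nat
    and W :: "int \<Rightarrow> nat \<Rightarrow> 'w \<Rightarrow> real \<Rightarrow> real" and \<epsilon> :: "int \<Rightarrow> nat \<Rightarrow> 'w \<Rightarrow> real \<Rightarrow> real"
    and B :: "nat \<Rightarrow> nat \<Rightarrow> nat \<Rightarrow> real \<Rightarrow> real \<Rightarrow> real"
  assumes ab: "a < b" and p1: "p \<ge> 1" and c: "c > 0" and Ce: "Ce > 0"
    and Wst: "wstat M a b p W"
    and eps_rfun: "j < p \<Longrightarrow> rfun M a b (\<epsilon> t j)" and eps_sg: "j < p \<Longrightarrow> subgauss M a b c (\<epsilon> t j)"
    and eps_ind: "indep_vars (\<lambda>_. Pi\<^sub>M UNIV (\<lambda>_. borel)) (\<lambda>(t, j). \<epsilon> t j) (UNIV \<times> {..<p})"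
    and B_hs: "i < p \<Longrightarrow> k < p \<Longrightarrow> hs_kernel a b (B l i k)"
    and B_summable: "summable (\<lambda>l. kinf a b p (B l))" and B_sum: "(\<Sum>l. kinf a b p (B l)) \<le> CB"
    and eps_trace: "j < p \<Longrightarrow> (LINT u:{a..b}|lborel. cov M (\<lambda>\<omega>. \<epsilon> t j \<omega> u) (\<lambda>\<omega>. \<epsilon> t j \<omega> u)) \<le> Ce"
    and ma: "ma_rep M a b p W B \<epsilon>"
begin

lemma W_rfun: "j < p \<Longrightarrow> rfun M a b (W t j)"
  using Wst unfolding wstat_def by blast

lemma W_mean: "j < p \<Longrightarrow> u \<in> {a..b} \<Longrightarrow> expectation (\<lambda>\<omega>. W t j \<omega> u) = 0"
  using Wst unfolding wstat_def by blast

abbreviation "Wv t j \<omega> \<equiv> emb a b (W t j \<omega>)"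
abbreviation "epsv t j \<omega> \<equiv> emb a b (\<epsilon> t j \<omega>)"
text \<open>The second summand only makes the bounds strictly positive and costs at most 2 in total.\<close>

abbreviation "bnd l j k \<equiv> norm (kemb a b (B l j k)) + (1/2) ^ l / real p"

lemma rfun_one: "rfun M a b (\<lambda>\<omega> u. 1)"
  using emeasure_lborel_Icc[of a b] ab
  unfolding rfun_def sqint_def set_integrable_def by (auto intro!: integrable_real_indicator)

text \<open>The embedding lemmas concern second moments. Pairing with the constant function 1,
  regarded as a random function, turns the mean into a cross moment; dividing by
  \<open>b - a\<close> recovers it.\<close>

lemma mean_zero_inner:
  assumes Z: "rfun M a b Z" "m2 M a b Z" and z: "\<And>u. u \<in> {a..b} \<Longrightarrow> expectation (\<lambda>\<omega>. Z \<omega> u) = 0"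
  shows "expectation (\<lambda>\<omega>. inner x (emb a b (Z \<omega>))) = 0"
proof -
  let ?o = "emb a b (\<lambda>u. 1)"
  have o: "csi a b (\<lambda>u. 1)"
  proof -
    obtain \<omega> where "\<omega> \<in> space M" using not_empty by blast
    thus ?thesis using rfun_csi[OF rfun_one] by blast
  qed
  have on: "inner ?o ?o = b - a"
    using ab o unfolding emb_def by (simp add: inner_l2of) (simp add: trunc_def)
  have "expectation (\<lambda>\<omega>. inner (emb a b (Z \<omega>)) x * inner ?o ?o) = inner (kemb a b (\<lambda>u v. expectation (\<lambda>\<omega>. Z \<omega> u * 1))) (l2_tensor x ?o)"
    by (rule integral_inner_emb_mult[OF sigma_finite_measure_axioms Z rfun_one]) simp
  also have "kemb a b (\<lambda>u v. expectation (\<lambda>\<omega>. Z \<omega> u * 1)) = 0"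
  proof -
    have "ktrunc a b (\<lambda>u v. expectation (\<lambda>\<omega>. Z \<omega> u * 1)) = (\<lambda>_. 0)" using z by (auto simp: ktrunc_def fun_eq_iff indicator_def)
    thus ?thesis by (simp add: kemb_def l2of_zero)
  qed
  finally have "expectation (\<lambda>\<omega>. inner (emb a b (Z \<omega>)) x) * (b - a) = 0" unfolding on by simp
  thus ?thesis using ab by (simp add: inner_commute)
qed

lemma kinf_ge: "j < p \<Longrightarrow> (\<Sum>k<p. norm (kemb a b (B l j k))) \<le> kinf a b p (B l)"
proof -
  assume j: "j < p"
  have "(\<Sum>k<p. norm (kemb a b (B l j k))) = (\<Sum>k<p. hs_norm a b (B l j k))"
    using B_hs[OF j] by (intro sum.cong) (auto simp: hs_norm_kemb)
  also have "\<dots> \<le> kinf a b p (B l)" unfolding kinf_def using j by (intro Max_ge) auto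
  finally show ?thesis .
qed

lemma bnd_sum: "j < p \<Longrightarrow> (\<Sum>l<m. \<Sum>k<p. bnd l j k) \<le> max CB 0 + 2"
proof -
  assume j: "j < p"
  have "(\<Sum>k<p. bnd l j k) \<le> kinf a b p (B l) + (1/2) ^ l" for l
    using kinf_ge[OF j, of l] p1 by (simp add: sum.distrib)
  hence "(\<Sum>l<m. \<Sum>k<p. bnd l j k) \<le> (\<Sum>l<m. kinf a b p (B l)) + (\<Sum>l<m. (1/2) ^ l)"
    unfolding sum.distrib[symmetric] by (intro sum_mono)
  also have "(\<Sum>l<m. kinf a b p (B l)) \<le> (\<Sum>l. kinf a b p (B l))"
  proof (intro sum_le_suminf B_summable)
    fix l
    have "0 \<le> (\<Sum>k<p. norm (kemb a b (B l j k)))" by (intro sum_nonneg) auto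
    thus "0 \<le> kinf a b p (B l)" using kinf_ge[OF j, of l] by linarith
  qed auto
  also have "\<dots> \<le> max CB 0" using B_sum by simp
  also have "(\<Sum>l<m. (1/2) ^ l) \<le> (2 :: real)"
  proof -
    have "(\<Sum>l<m. (1/2) ^ l) \<le> (\<Sum>l. (1/2 :: real) ^ l)" by (intro sum_le_suminf summable_geometric) auto
    also have "\<dots> = 2" by (subst suminf_geometric) auto
    finally show ?thesis .
  qed
  finally show ?thesis by simp
qed

text \<open>The rate is that of \<open>subgauss_exp_norm_square\<close> for the trace bound
  \<open>Ce\<close>. The total filter weight is \<open>max CB 0\<close>, plus 2 for the geometric
  part of \<open>bnd\<close>.\<close>

sublocale lp: linear_process M epsv p "1 / (8 * c\<^sup>2 * Ce)" "\<lambda>l j k. hs_op (kemb a b (B l j k))" "\<lambda>l j k. bnd l j k" "max CB 0 + 2" Wv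
proof (intro linear_process.intro innovations.intro innovations_axioms.intro linear_process_axioms.intro)
  show "prob_space M" by (rule prob_space_axioms)
  have sm: "j < p \<Longrightarrow> m2 M a b (\<epsilon> t j)" for t j by (rule subgauss_m2[OF eps_rfun eps_sg c])
  have "indep_vars (\<lambda>_. borel) (\<lambda>q \<omega>. emb a b ((case q of (t, j) \<Rightarrow> \<epsilon> t j) \<omega>)) (UNIV \<times> {..<p})"
  proof (rule indep_vars_weak_AE[OF eps_ind])
    fix q :: "int \<times> nat" assume q: "q \<in> UNIV \<times> {..<p}"
    obtain t j where tj: "q = (t, j)" "j < p" using q by auto
    show "(\<lambda>\<omega>. emb a b ((case q of (t, j) \<Rightarrow> \<epsilon> t j) \<omega>)) \<in> borel_measurable M"
      using rfun_emb_measurable[OF eps_rfun[OF tj(2)]] tj by simp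
    fix x
    have "\<epsilon> t j \<in> measurable M (Pi\<^sub>M UNIV (\<lambda>_. borel))"
      using eps_ind q tj unfolding indep_vars_def by fastforce
    from inner_emb_AE_eq[OF eps_rfun[OF tj(2)] sm[OF tj(2)] this]
    show "\<exists>J\<in>borel_measurable (vimage_algebra (space M) (case q of (t, j) \<Rightarrow> \<epsilon> t j) (Pi\<^sub>M UNIV (\<lambda>_. borel))).
        AE \<omega> in M. inner (emb a b ((case q of (t, j) \<Rightarrow> \<epsilon> t j) \<omega>)) x = J \<omega>" using tj by simp
  qed
  thus "indep_vars (\<lambda>_. borel) (\<lambda>(t, j). epsv t j) (UNIV \<times> {..<p})" by (simp add: case_prod_unfold)
  fix j t assume j: "j < p"
  have eq: "1 / (8 * c\<^sup>2 * Ce) * x = x / (8 * c\<^sup>2 * Ce)" for x by simp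
  show "integrable M (\<lambda>\<omega>. exp (1 / (8 * c\<^sup>2 * Ce) * (norm (epsv t j \<omega>))\<^sup>2))"
    "expectation (\<lambda>\<omega>. exp (1 / (8 * c\<^sup>2 * Ce) * (norm (epsv t j \<omega>))\<^sup>2)) \<le> 2"
    unfolding eq by (intro subgauss_exp_norm_square eps_rfun eps_sg c eps_trace Ce j)+
  show "expectation (\<lambda>\<omega>. inner x (epsv t j \<omega>)) = 0" for x
    using eps_sg[OF j] by (intro mean_zero_inner eps_rfun sm j) (auto simp: subgauss_def)
  show "Wv t j \<in> borel_measurable M" by (intro rfun_emb_measurable W_rfun j)
  show "(\<Sum>l<m. \<Sum>k<p. bnd l j k) \<le> max CB 0 + 2" for m by (rule bnd_sum[OF j])
  show "AE \<omega> in M. (\<lambda>m. \<Sum>l<m. \<Sum>k<p. hs_op (kemb a b (B l j k)) (epsv (t - int l) k \<omega>)) \<longlonglongrightarrow> Wv t j \<omega>"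
  proof -
    have "AE \<omega> in M. (\<lambda>N. nrm a b (\<lambda>u. W t j \<omega> u - (\<Sum>l<N. \<Sum>k<p. kop a b (B l j k) (\<epsilon> (t - int l) k \<omega>) u))) \<longlonglongrightarrow> 0"
      using ma j unfolding ma_rep_def by blast
    moreover have "AE \<omega> in M. \<omega> \<in> space M" by simp
    ultimately show ?thesis
    proof eventually_elim
      case (elim \<omega>)
      have ck: "csi a b (kop a b (B l j k) (\<epsilon> (t - int l) k \<omega>))" if "k < p" for l k
        by (intro csi_kop hs_kernel_ksi B_hs j that rfun_csi[OF eps_rfun] elim(2))
      have cs: "csi a b (\<lambda>u. \<Sum>k<p. kop a b (B l j k) (\<epsilon> (t - int l) k \<omega>) u)" for l
        by (intro csi_sum ck) auto
      have "nrm a b (\<lambda>u. W t j \<omega> u - (\<Sum>l<N. \<Sum>k<p. kop a b (B l j k) (\<epsilon> (t - int l) k \<omega>) u))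
         = norm ((\<Sum>l<N. \<Sum>k<p. hs_op (kemb a b (B l j k)) (epsv (t - int l) k \<omega>)) - Wv t j \<omega>)" for N
      proof -
        have W: "csi a b (W t j \<omega>)" by (rule rfun_csi[OF W_rfun[OF j] elim(2)])
        have S: "csi a b (\<lambda>u. \<Sum>l<N. \<Sum>k<p. kop a b (B l j k) (\<epsilon> (t - int l) k \<omega>) u)" by (intro csi_sum cs) auto
        have "emb a b (\<lambda>u. \<Sum>l<N. \<Sum>k<p. kop a b (B l j k) (\<epsilon> (t - int l) k \<omega>) u) = (\<Sum>l<N. emb a b (\<lambda>u. \<Sum>k<p. kop a b (B l j k) (\<epsilon> (t - int l) k \<omega>) u))"
          by (intro emb_sum cs) auto
        also have "\<dots> = (\<Sum>l<N. \<Sum>k<p. emb a b (kop a b (B l j k) (\<epsilon> (t - int l) k \<omega>)))"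
          by (intro sum.cong refl emb_sum ck) auto
        also have "\<dots> = (\<Sum>l<N. \<Sum>k<p. hs_op (kemb a b (B l j k)) (epsv (t - int l) k \<omega>))"
          by (intro sum.cong refl emb_kop hs_kernel_ksi B_hs j rfun_csi[OF eps_rfun] elim(2)) auto
        finally have S2: "emb a b (\<lambda>u. \<Sum>l<N. \<Sum>k<p. kop a b (B l j k) (\<epsilon> (t - int l) k \<omega>) u) = \<dots>" .
        show ?thesis by (subst nrm_emb[OF csi_diff[OF W S]], subst emb_diff[OF W S], subst S2) (rule norm_minus_commute)
      qed
      hence "(\<lambda>N. norm ((\<Sum>l<N. \<Sum>k<p. hs_op (kemb a b (B l j k)) (epsv (t - int l) k \<omega>)) - Wv t j \<omega>)) \<longlonglongrightarrow> 0"
        using elim(1) by simp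
      thus ?case by (simp add: LIM_zero_iff tendsto_norm_zero_iff)
    qed
  qed
  fix k l assume k: "k < p"
  show "bounded_linear (hs_op (kemb a b (B l j k)))" by (rule bounded_linear_hs_op)
  show "norm (hs_op (kemb a b (B l j k)) x) \<le> bnd l j k * norm x" for x
    by (rule order_trans[OF norm_hs_op mult_right_mono]) auto
next
  show "1 / (8 * c\<^sup>2 * Ce) > 0" using c Ce by simp
  show "bnd l j k > 0" for l j k using p1 by (intro add_nonneg_pos) auto
qed

text \<open>The squared filter weight over the rate: the common scale of the second moments, the
  covariance kernels and the deviations of the sample kernels.\<close>

definition D :: real where "D = (max CB 0 + 2)\<^sup>2 / (1 / (8 * c\<^sup>2 * Ce))"

lemma D_pos: "D > 0" unfolding D_def using c Ce by simp

lemma W_m2: "j < p \<Longrightarrow> m2 M a b (W t j)"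
  using lp.W_square(1)[of j t] by simp

text \<open>Stationarity and zero means are given for arguments in \<open>{a..b}\<close> only, so
  the identity is stated for truncated kernels.\<close>

lemma acov_moment:
  assumes jk: "j < p" "k < p"
  shows "ktrunc a b (\<lambda>u v. expectation (\<lambda>\<omega>. W t j \<omega> u * W (t + h) k \<omega> v)) = ktrunc a b (acov M W h j k)"
proof -
  have "expectation (\<lambda>\<omega>. W t j \<omega> u * W (t + h) k \<omega> v) = acov M W h j k u v" if uv: "u \<in> {a..b}" "v \<in> {a..b}" for u v
  proof -
    have "cov M (\<lambda>\<omega>. W t j \<omega> u) (\<lambda>\<omega>. W (t + h) k \<omega> v) = cov M (\<lambda>\<omega>. W 0 j \<omega> u) (\<lambda>\<omega>. W (0 + h) k \<omega> v)"
      using Wst jk uv unfolding wstat_def by blast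
    moreover have "cov M (\<lambda>\<omega>. W t j \<omega> u) (\<lambda>\<omega>. W (t + h) k \<omega> v) = expectation (\<lambda>\<omega>. W t j \<omega> u * W (t + h) k \<omega> v)"
      using W_mean[OF jk(1) uv(1)] by (simp add: cov_def)
    ultimately show ?thesis by (simp add: acov_def)
  qed
  thus ?thesis by (auto simp: ktrunc_def fun_eq_iff indicator_def)
qed

lemma
  assumes jk: "j < p" "k < p"
  shows ksi_acov: "ksi a b (acov M W h j k)"
    and kemb_acov: "kemb a b (acov M W h j k) = expectation (\<lambda>\<omega>. l2_tensor (Wv t j \<omega>) (Wv (t + h) k \<omega>))"
proof -
  show "ksi a b (acov M W h j k)"
    using ksi_moment[OF sigma_finite_measure_axioms W_rfun[OF jk(1)] W_m2[OF jk(1)] W_rfun[OF jk(2)] W_m2[OF jk(2)], of 0 "0 + h"]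
    unfolding acov_moment[OF jk] .
  show "kemb a b (acov M W h j k) = expectation (\<lambda>\<omega>. l2_tensor (Wv t j \<omega>) (Wv (t + h) k \<omega>))"
    using integral_tensor_emb[OF sigma_finite_measure_axioms W_rfun[OF jk(1)] W_m2[OF jk(1)] W_rfun[OF jk(2)] W_m2[OF jk(2)], of t "t + h"]
    unfolding kemb_def acov_moment[OF jk] by simp
qed

lemma inner_kemb_acov:
  assumes jk: "j < p" "k < p"
  shows "inner (kemb a b (acov M W h j k)) (l2_tensor x y) = expectation (\<lambda>\<omega>. inner (Wv t j \<omega>) x * inner (Wv (t + h) k \<omega>) y)"
proof -
  have "inner (kemb a b (acov M W h j k)) (l2_tensor x y) = expectation (\<lambda>\<omega>. inner (l2_tensor (Wv t j \<omega>) (Wv (t + h) k \<omega>)) (l2_tensor x y))"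
    unfolding kemb_acov[OF jk, of h t]
    by (intro integral_inner_left[symmetric] integrable_tensor_emb W_rfun W_m2 jk)
  thus ?thesis by (simp only: inner_l2_tensor)
qed

lemma norm_kemb_acov:
  assumes jk: "j < p" "k < p"
  shows "norm (kemb a b (acov M W h j k)) \<le> D"
proof -
  have i: "integrable M (\<lambda>\<omega>. ((norm (Wv 0 j \<omega>))\<^sup>2 + (norm (Wv (0 + h) k \<omega>))\<^sup>2) / 2)"
    using W_m2[OF jk(1)] W_m2[OF jk(2)] by simp
  have pt: "norm (l2_tensor (Wv 0 j \<omega>) (Wv (0 + h) k \<omega>)) \<le> ((norm (Wv 0 j \<omega>))\<^sup>2 + (norm (Wv (0 + h) k \<omega>))\<^sup>2) / 2" for \<omega>
  proof -
    have "0 \<le> (norm (Wv 0 j \<omega>) - norm (Wv (0 + h) k \<omega>))\<^sup>2" by simp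
    thus ?thesis by (simp add: norm_l2_tensor power2_diff)
  qed
  have "norm (kemb a b (acov M W h j k)) \<le> expectation (\<lambda>\<omega>. norm (l2_tensor (Wv 0 j \<omega>) (Wv (0 + h) k \<omega>)))"
    unfolding kemb_acov[OF jk, of h 0] by (rule integral_norm_bound)
  also have "\<dots> \<le> expectation (\<lambda>\<omega>. ((norm (Wv 0 j \<omega>))\<^sup>2 + (norm (Wv (0 + h) k \<omega>))\<^sup>2) / 2)"
    by (intro integral_mono integrable_norm integrable_tensor_emb W_rfun W_m2 jk i pt)
  also have "\<dots> = (expectation (\<lambda>\<omega>. (norm (Wv 0 j \<omega>))\<^sup>2) + expectation (\<lambda>\<omega>. (norm (Wv (0 + h) k \<omega>))\<^sup>2)) / 2"
    using W_m2[OF jk(1)] W_m2[OF jk(2)] by simp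
  also have "\<dots> \<le> (D + D) / 2"
    unfolding D_def by (intro divide_right_mono add_mono lp.W_square(2) jk) auto
  finally show ?thesis by simp
qed

text \<open>The sample kernel is the mean of \<open>n - h\<close> random tensors with the common
  expectation \<open>acov\<close>, so its error is the centered sum of \<open>tn_W_tail\<close>
  divided by \<open>n - h\<close>.\<close>

lemma sacov_tail:
  assumes jk: "j < p" "k < p" and h: "0 \<le> h" "h < int n" and eta: "0 \<le> \<eta>" "\<eta> \<le> 24 * D"
  shows "\<exists>E\<in>sets M. prob E \<le> 2 * exp (- ((real n - h) * \<eta>\<^sup>2 / (96 * D\<^sup>2))) \<and>
    (\<forall>\<omega>\<in>space M - E. norm (kemb a b (sacov n W \<omega> h j k) - kemb a b (acov M W h j k)) \<le> \<eta>)"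
proof -
  let ?T = "{1..int n - h}"
  let ?N = "real n - real_of_int h"
  have N: "real (card ?T) = ?N" "?N > 0" using h by auto
  let ?S = "\<lambda>\<omega>. \<Sum>t\<in>?T. l2_tensor (Wv t j \<omega>) (Wv (t + h) k \<omega>) - expectation (\<lambda>\<omega>. l2_tensor (Wv t j \<omega>) (Wv (t + h) k \<omega>))"
  let ?E = "{\<omega> \<in> space M. norm (?S \<omega>) \<ge> card ?T * \<eta>}"
  have nt: "norm (l2_tensor x y) \<le> 1 * (norm x * norm y)" for x y by (simp add: norm_l2_tensor)
  have [measurable]: "(\<lambda>\<omega>. l2_tensor (Wv t j \<omega>) (Wv (t + h) k \<omega>)) \<in> borel_measurable M" for t
    using jk by (intro borel_measurable_l2_tensor rfun_emb_measurable W_rfun)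
  have "?E \<in> sets M" by measurable
  moreover have "prob ?E \<le> 2 * exp (- (?N * \<eta>\<^sup>2 / (96 * D\<^sup>2)))"
  proof -
    have "prob ?E \<le> 2 * exp (- (real (card ?T) * \<eta>\<^sup>2 * (1 / (8 * c\<^sup>2 * Ce))\<^sup>2 / (96 * (1 * (max CB 0 + 2)\<^sup>2)\<^sup>2)))"
    proof (rule lp.tn_W_tail[OF bounded_bilinear_l2_tensor nt _ jk])
      show "\<eta> \<le> 24 * (1 * (max CB 0 + 2)\<^sup>2) / (1 / (8 * c\<^sup>2 * Ce))" using eta by (simp add: D_def)
    qed (use eta in auto)
    also have "real (card ?T) * \<eta>\<^sup>2 * (1 / (8 * c\<^sup>2 * Ce))\<^sup>2 / (96 * (1 * (max CB 0 + 2)\<^sup>2)\<^sup>2) = ?N * \<eta>\<^sup>2 / (96 * D\<^sup>2)"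
    proof -
      have "1 / (96 * D\<^sup>2) = (1 / (8 * c\<^sup>2 * Ce))\<^sup>2 / (96 * (1 * (max CB 0 + 2)\<^sup>2)\<^sup>2)"
        unfolding D_def using c Ce by (simp add: power_divide power_mult_distrib)
      hence "?N * \<eta>\<^sup>2 * (1 / (96 * D\<^sup>2)) = ?N * \<eta>\<^sup>2 * ((1 / (8 * c\<^sup>2 * Ce))\<^sup>2 / (96 * (1 * (max CB 0 + 2)\<^sup>2)\<^sup>2))" by (rule arg_cong)
      thus ?thesis unfolding N(1) by (simp only: times_divide_eq_right mult_1_right)
    qed
    finally show ?thesis .
  qed
  moreover have "norm (kemb a b (sacov n W \<omega> h j k) - kemb a b (acov M W h j k)) \<le> \<eta>" if w: "\<omega> \<in> space M - ?E" for \<omega>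
  proof -
    have W: "csi a b (W t j \<omega>)" "csi a b (W t k \<omega>)" for t
      using rfun_csi[OF W_rfun[OF jk(1)]] rfun_csi[OF W_rfun[OF jk(2)]] w by auto
    have "?S \<omega> = (\<Sum>t\<in>?T. l2_tensor (Wv t j \<omega>) (Wv (t + h) k \<omega>)) - ?N *\<^sub>R kemb a b (acov M W h j k)"
      unfolding kemb_acov[OF jk, symmetric] sum_subtractf using N(1) by (simp add: sum_constant_scaleR)
    hence "(1 / ?N) *\<^sub>R ?S \<omega> = kemb a b (sacov n W \<omega> h j k) - kemb a b (acov M W h j k)"
      using N(2) kemb_sacov[where W=W and j=j and k=k, OF W, of n h] by (simp add: scaleR_diff_right divide_inverse)
    hence "norm (kemb a b (sacov n W \<omega> h j k) - kemb a b (acov M W h j k)) = norm ((1 / ?N) *\<^sub>R ?S \<omega>)"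
      by (rule arg_cong[OF sym])
    also have "\<dots> = norm (?S \<omega>) / ?N"
      unfolding norm_scaleR using N(2) by simp
    also have "\<dots> \<le> \<eta>"
    proof -
      have "norm (?S \<omega>) \<le> ?N * \<eta>" using w unfolding N(1) by auto
      thus ?thesis using N(2) by (simp add: pos_divide_le_eq mult.commute)
    qed
    finally show ?thesis .
  qed
  ultimately show ?thesis by blast
qed

end

section \<open>The lower bound for the stability measure\<close>

lemma integral_cos_period:
  fixes h :: int
  shows "(LINT \<theta>|lborel. indicator {-pi..pi} \<theta> * cos (h * \<theta>)) = (if h = 0 then 2 * pi else 0)"
    and "integrable lborel (\<lambda>\<theta>. indicator {-pi..pi} \<theta> * cos (h * \<theta>))"
proof -
  have "integrable lborel (\<lambda>\<theta>. indicator {-pi..pi} \<theta> *\<^sub>R cos (h * \<theta>))"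
    by (intro borel_integrable_compact continuous_intros) auto
  thus "integrable lborel (\<lambda>\<theta>. indicator {-pi..pi} \<theta> * cos (h * \<theta>))" by simp
  show "(LINT \<theta>|lborel. indicator {-pi..pi} \<theta> * cos (h * \<theta>)) = (if h = 0 then 2 * pi else 0)"
  proof (cases "h = 0")
    case True
    thus ?thesis by (simp add: measure_lborel_Icc)
  next
    case False
    have "(LINT \<theta>|lborel. cos (h * \<theta>) * indicator {-pi..pi} \<theta>) = sin (h * pi) / h - sin (h * (- pi)) / h"
      using False by (intro integral_FTC_Icc_real) (auto intro!: derivative_eq_intros continuous_intros)
    also have "\<dots> = 0" using sin_zero_iff_int2[of "h * pi"] by simp
    finally show ?thesis using False by (simp add: mult.commute)
  qed
qed

text \<open>An essential supremum is at least an average. In the application \<open>G\<close> is an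
  uncountable supremum, about whose measurability nothing is assumed, so it is compared with an
  integrable minorant \<open>F\<close>.\<close>

lemma ess_sup_theta_ge_average:
  fixes F :: "real \<Rightarrow> real"
  assumes int: "integrable lborel (\<lambda>\<theta>. indicator {-pi..pi} \<theta> * F \<theta>)"
    and avg: "(LINT \<theta>|lborel. indicator {-pi..pi} \<theta> * F \<theta>) = 2 * pi * x"
    and le: "\<And>\<theta>. ereal (F \<theta>) \<le> G \<theta>"
  shows "ereal x \<le> ess_sup_theta G"
  unfolding ess_sup_theta_def
proof (rule Inf_greatest)
  fix z assume "z \<in> {z. AE \<theta> in lborel. \<theta> \<in> {- pi..pi} \<longrightarrow> G \<theta> \<le> z}"
  hence z: "AE \<theta> in lborel. \<theta> \<in> {- pi..pi} \<longrightarrow> G \<theta> \<le> z" by simp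
  show "ereal x \<le> z"
  proof (rule ccontr)
    assume "\<not> ereal x \<le> z"
    then obtain r where r: "z < ereal r" "ereal r < ereal x" using ereal_dense2[of z "ereal x"] unfolding not_le by blast
    have i2: "integrable lborel (\<lambda>\<theta>. indicator {-pi..pi} \<theta> * r)"
      using emeasure_lborel_Icc[of "-pi" pi] by (intro integrable_mult_left integrable_real_indicator) auto
    have "(LINT \<theta>|lborel. indicator {-pi..pi} \<theta> * F \<theta>) \<le> (LINT \<theta>|lborel. indicator {-pi..pi} \<theta> * r)"
    proof (rule integral_mono_AE[OF int i2])
      show "AE \<theta> in lborel. indicator {-pi..pi} \<theta> * F \<theta> \<le> indicator {-pi..pi} \<theta> * r"
        using z
      proof eventually_elim
        case (elim \<theta>)
        show ?case
        proof (cases "\<theta> \<in> {-pi..pi}")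
          case True
          hence "ereal (F \<theta>) < ereal r" using elim by (intro le_less_trans[OF order_trans[OF le[of \<theta>]] r(1)]) auto
          thus ?thesis using True by simp
        qed simp
      qed
    qed
    also have "\<dots> = 2 * pi * r" by (simp add: measure_lborel_Icc)
    finally have "2 * pi * x \<le> 2 * pi * r" unfolding avg .
    hence "x \<le> r" using pi_gt_zero by (simp add: mult_le_cancel_left)
    thus False using r(2) by simp
  qed
qed

lemma ess_sup_theta_mono:
  assumes "\<And>\<theta>. F \<theta> \<le> G \<theta>"
  shows "ess_sup_theta F \<le> ess_sup_theta G"
  unfolding ess_sup_theta_def
proof (rule Inf_superset_mono, rule Collect_mono, rule impI)
  fix z assume "AE \<theta> in lborel. \<theta> \<in> {- pi..pi} \<longrightarrow> G \<theta> \<le> z"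
  thus "AE \<theta> in lborel. \<theta> \<in> {- pi..pi} \<longrightarrow> F \<theta> \<le> z"
    by eventually_elim (use assms order_trans in blast)
qed

context functional_process begin

text \<open>If the variance vanished, Cauchy--Schwarz would make all lagged covariances in the
  direction of \<open>psi 1\<close> vanish. Then the operator of \<open>Kmat\<close> would
  annihilate \<open>psi 1\<close>, contradicting its positive eigenvalue.\<close>

lemma variance_eigenfunction_pos:
  assumes eig: "eigpairs a b (Kmat a b (acov M W) L 0) lam psi" and lam: "lam 1 > 0"
  shows "expectation (\<lambda>\<omega>. inner (Wv 0 0 \<omega>) (emb a b (psi 1)) * inner (Wv 0 0 \<omega>) (emb a b (psi 1))) > 0"
proof (rule ccontr)
  let ?e = "emb a b (psi 1)"
  have p: "0 < p" using p1 by simp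
  assume "\<not> expectation (\<lambda>\<omega>. inner (Wv 0 0 \<omega>) ?e * inner (Wv 0 0 \<omega>) ?e) > 0"
  moreover have "expectation (\<lambda>\<omega>. (inner (Wv 0 0 \<omega>) ?e)\<^sup>2) \<ge> 0" by simp
  ultimately have z: "expectation (\<lambda>\<omega>. (inner (Wv 0 0 \<omega>) ?e)\<^sup>2) = 0" unfolding power2_eq_square by linarith
  have m: "Wv t 0 \<in> borel_measurable M" for t by (rule rfun_emb_measurable[OF W_rfun[OF p]])
  have sq: "integrable M (\<lambda>\<omega>. (inner (Wv t 0 \<omega>) y)\<^sup>2)" for t y
  proof (rule integrable_norm_le[OF integrable_mult_left[OF W_m2[OF p]]])
    show "(\<lambda>\<omega>. (inner (Wv t 0 \<omega>) y)\<^sup>2) \<in> borel_measurable M" using m by measurable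
    show "norm ((inner (Wv t 0 \<omega>) y)\<^sup>2) \<le> (norm (Wv t 0 \<omega>))\<^sup>2 * (norm y)\<^sup>2" for \<omega>
      using power_mono[OF Cauchy_Schwarz_ineq2[of "Wv t 0 \<omega>" y] abs_ge_zero, of 2] by (simp add: power_mult_distrib)
  qed
  have "hs_op (hs_adj (kemb a b (acov M W (int h) 0 0))) ?e = 0" for h
  proof (rule inner_ext)
    fix y
    have "(expectation (\<lambda>\<omega>. inner (Wv 0 0 \<omega>) ?e * inner (Wv (0 + int h) 0 \<omega>) y))\<^sup>2
       \<le> expectation (\<lambda>\<omega>. (inner (Wv 0 0 \<omega>) ?e)\<^sup>2) * expectation (\<lambda>\<omega>. (inner (Wv (0 + int h) 0 \<omega>) y)\<^sup>2)"
      using m by (intro integral_mult_square_le sq borel_measurable_inner borel_measurable_const) auto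
    hence "expectation (\<lambda>\<omega>. inner (Wv 0 0 \<omega>) ?e * inner (Wv (0 + int h) 0 \<omega>) y) = 0" unfolding z by simp
    hence "inner (kemb a b (acov M W (int h) 0 0)) (l2_tensor ?e y) = 0" by (simp only: inner_kemb_acov[OF p p, of "int h" _ _ 0])
    moreover have "inner (hs_op (hs_adj \<kappa>) ?e) y = inner \<kappa> (l2_tensor ?e y)" for \<kappa>
      by (simp only: hs_op_adj) (simp only: inner_commute[of ?e] inner_hs_op)
    ultimately show "inner (hs_op (hs_adj (kemb a b (acov M W (int h) 0 0))) ?e) y = inner 0 y" by simp
  qed
  hence "inner (cov_square (\<lambda>h. kemb a b (acov M W (int h) 0 0)) L ?e) ?e = 0" by (simp add: inner_cov_square)
  moreover obtain s where "psd_spectrum (cov_square (\<lambda>h. kemb a b (acov M W (int h) 0 0)) L) s lam (\<lambda>l. emb a b (psi l))"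
    using eigpairs_psd_spectrum[of L a b "acov M W" 0, OF ksi_acov[OF p p] eig] by blast
  then interpret ps: psd_spectrum "cov_square (\<lambda>h. kemb a b (acov M W (int h) 0 0)) L" s lam "\<lambda>l. emb a b (psi l)" .
  have "inner (cov_square (\<lambda>h. kemb a b (acov M W (int h) 0 0)) L ?e) ?e = lam 1"
    using ps.eig[of 1] ps.orth[of 1 1] by simp
  ultimately show False using lam by simp
qed

text \<open>The test vector has \<open>psi 1\<close> in component 0 and zero elsewhere, so it is
  admissible at sparsity level 1. Its spectral density averages over \<open>{-pi..pi}\<close> to
  \<open>\<gamma> 0 / (2 * pi)\<close>, hence the essential supremum in \<open>stab\<close> is at
  least \<open>1 / (2 * pi)\<close>.\<close>

lemma stab_ge_1:
  assumes eig: "eigpairs a b (Kmat a b (acov M W) L 0) lam psi" and lam: "lam 1 > 0"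
    and sd: "sd_exists a b p (acov M W)" and fin: "stab a b p (acov M W) p < \<infinity>"
  shows "1 \<le> real_of_ereal (stab a b p (acov M W) 1)"
proof -
  let ?e = "emb a b (psi 1)"
  define \<Phi> where "\<Phi> i = (if i = 0 then psi 1 else (\<lambda>u. 0))" for i :: nat
  define \<gamma> where "\<gamma> h = expectation (\<lambda>\<omega>. inner (Wv 0 0 \<omega>) ?e * inner (Wv h 0 \<omega>) ?e)" for h :: int
  have p: "0 < p" using p1 by simp
  have psi: "sqint a b (psi 1)" using eig unfolding eigpairs_def by auto
  have cphi: "csi a b (\<Phi> i)" for i using sqint_csi[OF psi] csi_zero by (simp add: \<Phi>_def)
  have qf: "qf a b p (acov M W h) \<Phi> = \<gamma> h" for h
  proof -
    have "qf a b p (acov M W h) \<Phi> = (\<Sum>i<p. \<Sum>j<p. inner (kemb a b (acov M W h i j)) (l2_tensor (emb a b (\<Phi> i)) (emb a b (\<Phi> j))))"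
      unfolding qf_def by (intro sum.cong refl quadratic_form_emb ksi_acov cphi) auto
    also have "\<dots> = (\<Sum>i<p. \<Sum>j<p. if i = 0 then if j = 0 then inner (kemb a b (acov M W h 0 0)) (l2_tensor ?e ?e) else 0 else 0)"
      by (intro sum.cong refl)
         (auto simp: \<Phi>_def emb_zero bounded_bilinear.zero_left[OF bounded_bilinear_l2_tensor] bounded_bilinear.zero_right[OF bounded_bilinear_l2_tensor])
    also have "\<dots> = (\<Sum>i<p. if i = 0 then inner (kemb a b (acov M W h 0 0)) (l2_tensor ?e ?e) else 0)"
      using p by (intro sum.cong refl) (auto simp: sum.delta)
    also have "\<dots> = inner (kemb a b (acov M W h 0 0)) (l2_tensor ?e ?e)" using p by (simp add: sum.delta)
    also have "\<dots> = \<gamma> h" unfolding \<gamma>_def inner_kemb_acov[OF p p, of h _ _ 0] by simp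
    finally show ?thesis .
  qed
  have g0: "\<gamma> 0 > 0" unfolding \<gamma>_def using variance_eigenfunction_pos[OF eig lam] by simp
  have in_Hp: "in_Hp a b p \<Phi>"
    using psi by (auto simp: in_Hp_def \<Phi>_def sqint_def set_integrable_def)
  have mem: "\<Phi> \<in> {\<Phi> \<in> H0 a b p (acov M W 0). l0 a b p \<Phi> \<le> 1}"
  proof -
    have "{i. i < p \<and> nrm a b (\<Phi> i) \<noteq> 0} \<subseteq> {0}" by (auto simp: nrm_emb[OF cphi]) (auto simp: \<Phi>_def emb_zero split: if_splits)
    hence "l0 a b p \<Phi> \<le> card {0 :: nat}" unfolding l0_def by (intro card_mono) auto
    thus ?thesis using in_Hp qf[of 0] g0 by (simp add: H0_def)
  qed
  define P where "P N \<theta> = (\<Sum>h\<in>{- int N..int N}. \<gamma> h * cos (h * \<theta>)) / (2 * pi)" for N :: nat and \<theta> :: real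
  have Pre: "Re (sd_partial a b p (acov M W) \<theta> \<Phi> N) = P N \<theta>" for N \<theta>
    unfolding sd_partial_def qf P_def by (simp add: Re_divide_of_real)
  have lim: "(\<lambda>N. P N \<theta>) \<longlonglongrightarrow> sdq a b p (acov M W) \<theta> \<Phi>" for \<theta>
  proof -
    have "sd_partial a b p (acov M W) \<theta> \<Phi> \<longlonglongrightarrow> lim (sd_partial a b p (acov M W) \<theta> \<Phi>)"
      using sd in_Hp unfolding sd_exists_def convergent_LIMSEQ_iff by blast
    from tendsto_Re[OF this] show ?thesis unfolding sdq_def Pre .
  qed
  define Q where "Q = (norm ?e)\<^sup>2 * (max CB 0 + 2)\<^sup>2 / (1 / (8 * c\<^sup>2 * Ce))"
  \<comment> \<open>Uniform in \<open>N\<close> and \<theta>, by the absolute summability of the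
    autocovariances; this justifies exchanging limit and integral.\<close>
  have bnd: "\<bar>P N \<theta>\<bar> \<le> Q / (2 * pi)" for N \<theta>
  proof -
    have "\<bar>\<Sum>h\<in>{- int N..int N}. \<gamma> h * cos (h * \<theta>)\<bar> \<le> (\<Sum>h\<in>{- int N..int N}. \<bar>\<gamma> h\<bar>)"
      by (intro order_trans[OF sum_abs sum_mono]) (simp add: abs_mult mult_left_le)
    also have "\<dots> \<le> Q"
      using lp.autocovariance_abs_summable[OF p, of ?e N] by (simp add: \<gamma>_def Q_def inner_commute)
    finally show ?thesis unfolding P_def by (simp add: divide_right_mono)
  qed
  have Pint: "(LINT \<theta>|lborel. indicator {-pi..pi} \<theta> * P N \<theta>) = \<gamma> 0" for N
  proof -
    have "(\<lambda>\<theta> :: real. indicator {-pi..pi} \<theta> * P N \<theta>) = (\<lambda>\<theta>. \<Sum>h\<in>{- int N..int N}. \<gamma> h / (2 * pi) * (indicator {-pi..pi} \<theta> * cos (real_of_int h * \<theta>)))"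
      by (simp add: P_def sum_divide_distrib sum_distrib_left mult_ac)
    hence "(LINT \<theta>|lborel. indicator {-pi..pi} \<theta> * P N \<theta>) = (LINT \<theta>|lborel. (\<Sum>h\<in>{- int N..int N}. \<gamma> h / (2 * pi) * (indicator {-pi..pi} \<theta> * cos (h * \<theta>))))"
      by (rule arg_cong)
    also have "\<dots> = (\<Sum>h\<in>{- int N..int N}. LINT \<theta>|lborel. \<gamma> h / (2 * pi) * (indicator {-pi..pi} \<theta> * cos (h * \<theta>)))"
      by (intro Bochner_Integration.integral_sum integrable_mult_right integral_cos_period)
    also have "\<dots> = (\<Sum>h\<in>{- int N..int N}. if h = 0 then \<gamma> 0 else 0)"
      by (intro sum.cong refl) (simp only: integral_mult_right_zero integral_cos_period(1), simp)
    also have "\<dots> = \<gamma> 0" by (simp add: sum.delta)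
    finally show ?thesis .
  qed
  let ?F = "\<lambda>\<theta>. sdq a b p (acov M W) \<theta> \<Phi>"
  have Pm: "P N \<in> borel_measurable borel" for N unfolding P_def by measurable
  have Fm: "?F \<in> borel_measurable borel" by (rule borel_measurable_LIMSEQ_real[OF lim Pm])
  have w: "integrable lborel (\<lambda>\<theta>. indicator {-pi..pi} \<theta> * (Q / (2 * pi)))"
    using emeasure_lborel_Icc[of "-pi" pi] by (intro integrable_mult_left integrable_real_indicator) auto
  have pw: "AE \<theta> in lborel. (\<lambda>N. indicator {-pi..pi} \<theta> * P N \<theta>) \<longlonglongrightarrow> indicator {-pi..pi} \<theta> * ?F \<theta>"
    by (intro AE_I2 tendsto_intros lim)
  have dom: "AE \<theta> in lborel. norm (indicator {-pi..pi} \<theta> * P N \<theta>) \<le> indicator {-pi..pi} \<theta> * (Q / (2 * pi))" for N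
    using bnd by (intro AE_I2) (simp add: abs_mult indicator_def)
  have m1: "(\<lambda>\<theta>. indicator {-pi..pi} \<theta> * ?F \<theta>) \<in> borel_measurable lborel"
    and m2: "(\<lambda>\<theta>. indicator {-pi..pi} \<theta> * P N \<theta>) \<in> borel_measurable lborel" for N
    using Pm Fm by simp_all
  note dc = m1 m2 w pw dom
  have Fi: "integrable lborel (\<lambda>\<theta>. indicator {-pi..pi} \<theta> * ?F \<theta>)"
    by (rule integrable_dominated_convergence[OF dc])
  have "(\<lambda>N. LINT \<theta>|lborel. indicator {-pi..pi} \<theta> * P N \<theta>) \<longlonglongrightarrow> (LINT \<theta>|lborel. indicator {-pi..pi} \<theta> * ?F \<theta>)"
    by (rule integral_dominated_convergence[OF dc])
  hence FI: "(LINT \<theta>|lborel. indicator {-pi..pi} \<theta> * ?F \<theta>) = \<gamma> 0"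
    unfolding Pint by (rule LIMSEQ_unique[OF _ tendsto_const])
  let ?G = "\<lambda>k \<theta>. SUP \<Phi>\<in>{\<Phi> \<in> H0 a b p (acov M W 0). l0 a b p \<Phi> \<le> k}. ereal (sdq a b p (acov M W) \<theta> \<Phi> / qf a b p (acov M W 0) \<Phi>)"
  have "ereal (1 / (2 * pi)) \<le> ess_sup_theta (?G 1)"
  proof (rule ess_sup_theta_ge_average[where F="\<lambda>\<theta>. ?F \<theta> / \<gamma> 0"])
    have eq: "(\<lambda>\<theta>. indicator {-pi..pi} \<theta> * (?F \<theta> / \<gamma> 0)) = (\<lambda>\<theta>. indicator {-pi..pi} \<theta> * ?F \<theta> / \<gamma> 0)" by simp
    show "integrable lborel (\<lambda>\<theta>. indicator {-pi..pi} \<theta> * (?F \<theta> / \<gamma> 0))"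
      unfolding eq using Fi by simp
    show "(LINT \<theta>|lborel. indicator {-pi..pi} \<theta> * (?F \<theta> / \<gamma> 0)) = 2 * pi * (1 / (2 * pi))"
      unfolding eq using FI g0 by simp
    show "ereal (?F \<theta> / \<gamma> 0) \<le> ?G 1 \<theta>" for \<theta>
      using SUP_upper[OF mem, of "\<lambda>\<Phi>. ereal (sdq a b p (acov M W) \<theta> \<Phi> / qf a b p (acov M W 0) \<Phi>)"] unfolding qf .
  qed
  hence "ereal (2 * pi) * ereal (1 / (2 * pi)) \<le> stab a b p (acov M W) 1"
    unfolding stab_def by (intro ereal_mult_left_mono) auto
  hence ge: "1 \<le> stab a b p (acov M W) 1" by (simp add: one_ereal_def)
  \<comment> \<open>\<open>real_of_ereal\<close> sends infinity to 0, so finiteness at level 1 is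
    needed; it comes from level \<open>p\<close> by monotonicity.\<close>
  have "stab a b p (acov M W) 1 \<le> stab a b p (acov M W) p"
    unfolding stab_def using p1
    by (intro ereal_mult_left_mono ess_sup_theta_mono SUP_subset_mono) auto
  hence "stab a b p (acov M W) 1 < \<infinity>" using fin by (rule le_less_trans)
  thus ?thesis using ge by (cases "stab a b p (acov M W) 1") (auto simp: one_ereal_def)
qed

section \<open>Coefficients as values of kernels at tensor products\<close>

lemma sighat_eq:
  assumes w: "\<omega> \<in> space M" and jk: "j < p" "k < p" and f: "csi a b (psih \<omega> j l)" "csi a b (psih \<omega> k m)"
  shows "sighat a b n W psih \<omega> h j k l m =
    inner (kemb a b (sacov n W \<omega> (int h) j k)) (l2_tensor (emb a b (psih \<omega> j l)) (emb a b (psih \<omega> k m)))"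
proof -
  have W: "csi a b (W t j \<omega>)" "csi a b (W t k \<omega>)" for t
    using rfun_csi[OF W_rfun[OF jk(1)] w] rfun_csi[OF W_rfun[OF jk(2)] w] by auto
  show ?thesis
    unfolding sighat_def kemb_sacov[where W=W and j=j and k=k, OF W]
    by (simp add: inner_sum_left inner_l2_tensor ip_emb W f divide_inverse)
qed

text \<open>Since \<open>X\<close> and \<open>e\<close> are uncorrelated and \<open>e\<close> is
  white, \<open>W\<close> and \<open>X\<close> have the same cross moments at every nonzero lag.
  This is where \<open>h \<ge> 1\<close> is used.\<close>

lemma sig_eq:
  assumes We: "\<And>t j \<omega>. W t j \<omega> = (\<lambda>u. X t j \<omega> u + e t j \<omega> u)" and e: "wstat M a b p e"
    and X: "\<And>t j. j < p \<Longrightarrow> rfun M a b (X t j)"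
    and white: "\<And>t s j k u v. j < p \<Longrightarrow> k < p \<Longrightarrow> u \<in> {a..b} \<Longrightarrow> v \<in> {a..b} \<Longrightarrow> s \<noteq> t \<Longrightarrow>
          cov M (\<lambda>\<omega>. e t j \<omega> u) (\<lambda>\<omega>. e s k \<omega> v) = 0"
    and uncor: "\<And>t s j k u v. j < p \<Longrightarrow> k < p \<Longrightarrow> u \<in> {a..b} \<Longrightarrow> v \<in> {a..b} \<Longrightarrow>
          cov M (\<lambda>\<omega>. X t j \<omega> u) (\<lambda>\<omega>. e s k \<omega> v) = 0"
    and h: "h \<ge> 1" and jk: "j < p" "k < p" and f: "csi a b (psi j l)" "csi a b (psi k m)"
  shows "sig M a b X psi h j k l m =
    inner (kemb a b (acov M W (int h) j k)) (l2_tensor (emb a b (psi j l)) (emb a b (psi k m)))"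
proof -
  have er: "rfun M a b (e t j)" "\<And>u. u \<in> {a..b} \<Longrightarrow> expectation (\<lambda>\<omega>. e t j \<omega> u) = 0" if "j < p" for t j
    using e that unfolding wstat_def by auto
  have ip: "integrable M (\<lambda>\<omega>. Z \<omega> u * Z' \<omega> v)" if "rfun M a b Z" "rfun M a b Z'" "u \<in> {a..b}" "v \<in> {a..b}" for Z Z' u v
    using that unfolding rfun_def by (intro integral_mult_square_le) auto
  have Xe: "expectation (\<lambda>\<omega>. X t j \<omega> u * e s k \<omega> v) = 0" if "j < p" "k < p" "u \<in> {a..b}" "v \<in> {a..b}" for t s j k u v
    using uncor[OF that, of t s] er(2)[OF that(2,4)] by (simp add: cov_def)
  have ee: "expectation (\<lambda>\<omega>. e t j \<omega> u * e s k \<omega> v) = 0" if "j < p" "k < p" "u \<in> {a..b}" "v \<in> {a..b}" "s \<noteq> t" for t s j k u v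
    using white[OF that] er(2)[OF that(2,4)] by (simp add: cov_def)
  have WW: "expectation (\<lambda>\<omega>. W t j \<omega> u * W s k \<omega> v) = expectation (\<lambda>\<omega>. X t j \<omega> u * X s k \<omega> v) + expectation (\<lambda>\<omega>. e t j \<omega> u * e s k \<omega> v)"
    if jk: "j < p" "k < p" and uv: "u \<in> {a..b}" "v \<in> {a..b}" for t s j k u v
  proof -
    have "expectation (\<lambda>\<omega>. W t j \<omega> u * W s k \<omega> v) =
      expectation (\<lambda>\<omega>. X t j \<omega> u * X s k \<omega> v + X t j \<omega> u * e s k \<omega> v + (X s k \<omega> v * e t j \<omega> u + e t j \<omega> u * e s k \<omega> v))"
      unfolding We by (intro Bochner_Integration.integral_cong refl) (simp add: algebra_simps)
    also have "\<dots> = expectation (\<lambda>\<omega>. X t j \<omega> u * X s k \<omega> v) + expectation (\<lambda>\<omega>. X t j \<omega> u * e s k \<omega> v)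
        + (expectation (\<lambda>\<omega>. X s k \<omega> v * e t j \<omega> u) + expectation (\<lambda>\<omega>. e t j \<omega> u * e s k \<omega> v))"
      by (simp only: Bochner_Integration.integral_add Bochner_Integration.integrable_add ip X er(1) jk uv)
    finally show ?thesis using Xe[OF jk uv, of t s] Xe[OF jk(2,1) uv(2,1), of s t] by simp
  qed
  \<comment> \<open>Square integrability is known for \<open>W\<close>; it passes to
    \<open>X\<close> because uncorrelatedness makes the pointwise second moment of \<open>X\<close>
    at most that of \<open>W\<close>.\<close>
  have Xm2: "m2 M a b (X t j)" if j: "j < p" for t j
  proof -
    have i: "integrable lborel (\<lambda>u. indicator {a..b} u * expectation (\<lambda>\<omega>. (W t j \<omega> u)\<^sup>2))"
      using m2_iff[OF W_rfun[OF j] sigma_finite_measure_axioms] W_m2[OF j] by blast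
    have "integrable lborel (\<lambda>u. indicator {a..b} u * expectation (\<lambda>\<omega>. (X t j \<omega> u)\<^sup>2))"
    proof (rule integrable_norm_le[OF i])
      show "(\<lambda>u. indicator {a..b} u * expectation (\<lambda>\<omega>. (X t j \<omega> u)\<^sup>2)) \<in> borel_measurable lborel"
        using rfun_square_measurable[OF X[OF j] sigma_finite_measure_axioms] by simp
      fix u
      show "norm (indicator {a..b} u * expectation (\<lambda>\<omega>. (X t j \<omega> u)\<^sup>2)) \<le> indicator {a..b} u * expectation (\<lambda>\<omega>. (W t j \<omega> u)\<^sup>2)"
      proof (cases "u \<in> {a..b}")
        case True
        have "0 \<le> expectation (\<lambda>\<omega>. e t j \<omega> u * e t j \<omega> u)" by simp
        moreover have "0 \<le> expectation (\<lambda>\<omega>. X t j \<omega> u * X t j \<omega> u)" by simp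
        ultimately show ?thesis using WW[OF j j True True, of t t] True by (simp add: power2_eq_square)
      qed simp
    qed
    thus ?thesis using m2_iff[OF X[OF j] sigma_finite_measure_axioms] by blast
  qed
  have "sig M a b X psi h j k l m = expectation (\<lambda>\<omega>. inner (emb a b (X 0 j \<omega>)) (emb a b (psi j l)) * inner (emb a b (X (int h) k \<omega>)) (emb a b (psi k m)))"
    unfolding sig_def using rfun_csi[OF X[OF jk(1)]] rfun_csi[OF X[OF jk(2)]] f
    by (intro Bochner_Integration.integral_cong refl) (simp add: ip_emb)
  also have "\<dots> = inner (kemb a b (\<lambda>u v. expectation (\<lambda>\<omega>. X 0 j \<omega> u * X (int h) k \<omega> v))) (l2_tensor (emb a b (psi j l)) (emb a b (psi k m)))"
    by (intro integral_inner_emb_mult sigma_finite_measure_axioms X Xm2 jk)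
  also have "kemb a b (\<lambda>u v. expectation (\<lambda>\<omega>. X 0 j \<omega> u * X (int h) k \<omega> v)) = kemb a b (acov M W (int h) j k)"
  proof -
    have "ktrunc a b (\<lambda>u v. expectation (\<lambda>\<omega>. X 0 j \<omega> u * X (int h) k \<omega> v)) = ktrunc a b (\<lambda>u v. expectation (\<lambda>\<omega>. W 0 j \<omega> u * W (0 + int h) k \<omega> v))"
      using WW[OF jk, of _ _ 0 "int h"] ee[OF jk, of _ _ "int h" 0] h by (auto simp: ktrunc_def fun_eq_iff indicator_def)
    thus ?thesis unfolding kemb_def acov_moment[OF jk] by simp
  qed
  finally show ?thesis .
qed

section \<open>Error of the estimated coefficients\<close>

text \<open>Purely deterministic, at a fixed \<omega>. The summand 1 accounts for the kernel error,
  using that the power of \<open>max l m\<close> is at least 1; the rest is the kernel norm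
  \<open>D\<close> times the errors of the two eigenfunctions.\<close>

lemma coefficient_error:
  assumes w: "\<omega> \<in> space M" and jk: "j < p" "k < p" and lm: "l \<ge> 1" "m \<ge> 1"
    and eig: "\<And>j. j < p \<Longrightarrow> eigpairs a b (Kmat a b (acov M W) L j) (lam j) (psi j)"
    and eigh: "\<And>j. j < p \<Longrightarrow> eigpairs a b (Kmat a b (sacov n W \<omega>) L j) (lamh j) (psih j)"
    and sgn: "\<And>j l. j < p \<Longrightarrow> l \<ge> 1 \<Longrightarrow> ip a b (psih j l) (psi j l) \<ge> 0"
    and gap: "\<And>j l. j < p \<Longrightarrow> l \<ge> 1 \<Longrightarrow> lam j l - lam j (Suc l) \<ge> c0 * real l powr (- \<alpha> - 1)"
    and c0: "c0 > 0" and \<alpha>: "\<alpha> > 1"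
    and err: "\<And>g j k. g \<in> insert h {1..L} \<Longrightarrow> j < p \<Longrightarrow> k < p \<Longrightarrow>
      norm (kemb a b (sacov n W \<omega> (int g) j k) - kemb a b (acov M W (int g) j k)) \<le> \<eta>"
    and \<eta>: "0 \<le> \<eta>" "\<eta> \<le> 1"
  shows "\<bar>inner (kemb a b (sacov n W \<omega> (int h) j k)) (l2_tensor (emb a b (psih j l)) (emb a b (psih k m)))
      - inner (kemb a b (acov M W (int h) j k)) (l2_tensor (emb a b (psi j l)) (emb a b (psi k m)))\<bar>
    \<le> (1 + 2 * D * (3 * real L * (2 * D + 1) / c0)) * real (max l m) powr (\<alpha> + 1) * \<eta>"
proof -
  define E where "E = 3 * real L * (2 * D + 1) / c0"
  define Q where "Q = real (max l m) powr (\<alpha> + 1)"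
  have E0: "E \<ge> 0" using D_pos c0 by (simp add: E_def)
  have unit: "norm (emb a b (f l)) = 1" if "eigpairs a b K \<mu> f" "l \<ge> 1" for K \<mu> f l
  proof -
    have "csi a b (f l)" "ip a b (f l) (f l) = 1" using that unfolding eigpairs_def by (auto intro: sqint_csi)
    thus ?thesis by (simp add: ip_emb norm_eq_1)
  qed
  have W: "csi a b (W t j \<omega>)" if "j < p" for t j by (rule rfun_csi[OF W_rfun[OF that] w])
  have ef: "norm (emb a b (psih j l) - emb a b (psi j l)) \<le> E * Q * \<eta>"
    if jl: "j < p" "l \<ge> 1" "real l powr (\<alpha> + 1) \<le> Q" for j l
  proof -
    have "norm (emb a b (psih j l) - emb a b (psi j l)) \<le> 3 * real L * (2 * D + 1) / c0 * real l powr (\<alpha> + 1) * \<eta>"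
    proof (rule eigenfunction_error[OF _ _ eig[OF jl(1)] eigh[OF jl(1)] gap[OF jl(1)] c0 \<alpha> sgn[OF jl(1,2)] jl(2)])
      fix g assume g: "g \<in> {1..L}"
      show "ksi a b (acov M W (int g) j j)" by (rule ksi_acov[OF jl(1) jl(1)])
      show "ksi a b (sacov n W \<omega> (int g) j j)" by (rule ksi_sacov) (rule W[OF jl(1)])+
      show "norm (kemb a b (acov M W (int g) j j)) \<le> D" by (rule norm_kemb_acov[OF jl(1) jl(1)])
      show "norm (kemb a b (sacov n W \<omega> (int g) j j) - kemb a b (acov M W (int g) j j)) \<le> \<eta>"
        using g by (intro err jl) auto
    qed (use \<eta> D_pos in auto)
    also have "\<dots> \<le> E * Q * \<eta>"
      unfolding E_def[symmetric] using E0 \<eta> jl(3) by (intro mult_right_mono mult_left_mono) auto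
    finally show ?thesis .
  qed
  have Ql: "real l powr (\<alpha> + 1) \<le> Q" and Qm: "real m powr (\<alpha> + 1) \<le> Q"
    unfolding Q_def using \<alpha> by (auto intro!: powr_mono2)
  have Q1: "Q \<ge> 1" unfolding Q_def using lm \<alpha> by (intro ge_one_powr_ge_zero) auto
  have "\<bar>inner (kemb a b (sacov n W \<omega> (int h) j k)) (l2_tensor (emb a b (psih j l)) (emb a b (psih k m)))
      - inner (kemb a b (acov M W (int h) j k)) (l2_tensor (emb a b (psi j l)) (emb a b (psi k m)))\<bar>
    \<le> norm (kemb a b (sacov n W \<omega> (int h) j k) - kemb a b (acov M W (int h) j k))
      + norm (kemb a b (acov M W (int h) j k)) * (norm (emb a b (psih j l) - emb a b (psi j l)) + norm (emb a b (psih k m) - emb a b (psi k m)))"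
    using unit[OF eig] unit[OF eigh] jk lm by (intro inner_bilinear_error) auto
  also have "\<dots> \<le> Q * \<eta> + D * (E * Q * \<eta> + E * Q * \<eta>)"
  proof (intro add_mono mult_mono norm_kemb_acov jk ef lm Ql Qm)
    have "1 * \<eta> \<le> Q * \<eta>" by (rule mult_right_mono[OF Q1 \<eta>(1)])
    thus "norm (kemb a b (sacov n W \<omega> (int h) j k) - kemb a b (acov M W (int h) j k)) \<le> Q * \<eta>"
      using err[of h j k] jk by simp
  qed (use D_pos in auto)
  also have "\<dots> = (1 + 2 * D * E) * Q * \<eta>" by (simp add: algebra_simps)
  finally show ?thesis unfolding E_def Q_def .
qed

text \<open>Lags below \<open>n / 2\<close> leave at least \<open>n / 2\<close> terms in each
  average, which turns the 96 of the single tail into 192. The union runs over the lags in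
  \<open>H\<close> and all pairs of components.\<close>

lemma uniform_sacov_tail:
  assumes H: "finite H" "\<And>g. g \<in> H \<Longrightarrow> 2 * g < n" and eta: "0 \<le> \<eta>" "\<eta> \<le> 24 * D"
  shows "\<exists>A\<in>sets M. prob A \<ge> 1 - 2 * real (card H) * (real p)\<^sup>2 * exp (- (real n * \<eta>\<^sup>2 / (192 * D\<^sup>2))) \<and>
    (\<forall>\<omega>\<in>A. \<forall>g\<in>H. \<forall>j<p. \<forall>k<p.
       norm (kemb a b (sacov n W \<omega> (int g) j k) - kemb a b (acov M W (int g) j k)) \<le> \<eta>)"
proof -
  let ?r = "2 * exp (- (real n * \<eta>\<^sup>2 / (192 * D\<^sup>2)))"
  let ?I = "H \<times> {..<p} \<times> {..<p}"
  have *: "\<exists>E\<in>sets M. prob E \<le> ?r \<and>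
    (\<forall>\<omega>\<in>space M - E. norm (kemb a b (sacov n W \<omega> (int g) j k) - kemb a b (acov M W (int g) j k)) \<le> \<eta>)"
    if gjk: "g \<in> H" "j < p" "k < p" for g j k
  proof -
    have g: "int g < int n" using H(2)[OF gjk(1)] by simp
    obtain E where E: "E \<in> sets M" "prob E \<le> 2 * exp (- ((real n - real_of_int (int g)) * \<eta>\<^sup>2 / (96 * D\<^sup>2)))"
      "\<forall>\<omega>\<in>space M - E. norm (kemb a b (sacov n W \<omega> (int g) j k) - kemb a b (acov M W (int g) j k)) \<le> \<eta>"
      using sacov_tail[OF gjk(2,3) _ g eta] by auto
    have "real n / 2 * (\<eta>\<^sup>2 / (96 * D\<^sup>2)) \<le> (real n - real g) * (\<eta>\<^sup>2 / (96 * D\<^sup>2))"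
      using H(2)[OF gjk(1)] by (intro mult_right_mono) auto
    hence "real n * \<eta>\<^sup>2 / (192 * D\<^sup>2) \<le> (real n - real_of_int (int g)) * \<eta>\<^sup>2 / (96 * D\<^sup>2)" by simp
    hence "2 * exp (- ((real n - real_of_int (int g)) * \<eta>\<^sup>2 / (96 * D\<^sup>2))) \<le> ?r" by simp
    from order_trans[OF E(2) this] have "prob E \<le> ?r" .
    thus ?thesis using E(1,3) by (intro bexI[of _ E]) auto
  qed
  have "\<forall>q\<in>?I. \<exists>E. E \<in> sets M \<and> prob E \<le> ?r \<and> (\<forall>\<omega>\<in>space M - E.
      norm (kemb a b (sacov n W \<omega> (int (fst q)) (fst (snd q)) (snd (snd q))) - kemb a b (acov M W (int (fst q)) (fst (snd q)) (snd (snd q)))) \<le> \<eta>)"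
  proof
    fix q assume "q \<in> ?I"
    then obtain g j k where q: "q = (g, j, k)" "g \<in> H" "j < p" "k < p" by auto
    show "\<exists>E. E \<in> sets M \<and> prob E \<le> ?r \<and> (\<forall>\<omega>\<in>space M - E.
      norm (kemb a b (sacov n W \<omega> (int (fst q)) (fst (snd q)) (snd (snd q))) - kemb a b (acov M W (int (fst q)) (fst (snd q)) (snd (snd q)))) \<le> \<eta>)"
      using *[OF q(2-4)] unfolding q(1) fst_conv snd_conv by blast
  qed
  then obtain E where E: "\<And>q. q \<in> ?I \<Longrightarrow> E q \<in> sets M" "\<And>q. q \<in> ?I \<Longrightarrow> prob (E q) \<le> ?r"
    "\<And>q \<omega>. q \<in> ?I \<Longrightarrow> \<omega> \<in> space M - E q \<Longrightarrow>
      norm (kemb a b (sacov n W \<omega> (int (fst q)) (fst (snd q)) (snd (snd q))) - kemb a b (acov M W (int (fst q)) (fst (snd q)) (snd (snd q)))) \<le> \<eta>"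
    using bchoice[of ?I] by metis
  let ?U = "\<Union>q\<in>?I. E q"
  have fin: "finite ?I" using H(1) by simp
  have U: "?U \<in> sets M" using fin E(1) by (intro sets.finite_UN) auto
  have "prob ?U \<le> (\<Sum>q\<in>?I. prob (E q))" using E(1) by (intro finite_measure_subadditive_finite fin) auto
  also have "\<dots> \<le> (\<Sum>q\<in>?I. ?r)" by (intro sum_mono E(2))
  also have "\<dots> = 2 * real (card H) * (real p)\<^sup>2 * exp (- (real n * \<eta>\<^sup>2 / (192 * D\<^sup>2)))"
    by (simp add: card_cartesian_product power2_eq_square)
  finally have "prob (space M - ?U) \<ge> 1 - 2 * real (card H) * (real p)\<^sup>2 * exp (- (real n * \<eta>\<^sup>2 / (192 * D\<^sup>2)))"
    using prob_compl[OF U] by simp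
  moreover have "norm (kemb a b (sacov n W \<omega> (int g) j k) - kemb a b (acov M W (int g) j k)) \<le> \<eta>"
    if "\<omega> \<in> space M - ?U" "g \<in> H" "j < p" "k < p" for \<omega> g j k
    using E(3)[of "(g, j, k)" \<omega>] that by fastforce
  ultimately show ?thesis using U by (intro bexI[of _ "space M - ?U"]) auto
qed

end

text \<open>The level \<open>24 * D * sqrt (x / n)\<close> gives the exponent
  \<open>576 / 192 * x = 3 * x\<close>. The three summands of the sample size constant secure in
  turn that the level is at most 1, that all lags lie below \<open>n / 2\<close>, and that
  \<open>x \<le> n\<close>, whence the level is at most \<open>24 * D\<close>.\<close>

lemma sample_size_consequences:
  fixes D x :: real
  assumes x: "x \<ge> 1 / 2" and D: "D > 0" and n: "real n \<ge> ((24 * D)\<^sup>2 + 4 * (real h + real L) + 1) * x"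
  shows "24 * D * sqrt (x / n) \<le> 1" "24 * D * sqrt (x / n) \<le> 24 * D" "2 * (h + L) < n"
    "real n * (24 * D * sqrt (x / n))\<^sup>2 / (192 * D\<^sup>2) = 3 * x"
proof -
  have ge: "real n \<ge> (24 * D)\<^sup>2 * x + 4 * (real h + real L) * x + x" using n by (simp add: algebra_simps)
  have hl: "4 * (real h + real L) * x \<ge> 2 * (real h + real L)"
    using mult_left_mono[OF x, of "4 * (real h + real L)"] by simp
  have D2: "(24 * D)\<^sup>2 * x \<ge> 0" using x by simp
  have "2 * (real h + real L) < real n" using ge hl D2 x by linarith
  hence "real (2 * (h + L)) < real n" by simp
  thus "2 * (h + L) < n" by (simp only: of_nat_less_iff)
  have hl0: "4 * (real h + real L) * x \<ge> 0" using x by simp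
  have xn: "x \<le> real n" using ge hl0 D2 by linarith
  have n0: "real n > 0" using xn x by linarith
  have "x / n \<le> 1" using xn n0 by (simp add: divide_le_eq)
  hence "sqrt (x / n) \<le> 1" by simp
  from mult_left_mono[OF this, of "24 * D"] show "24 * D * sqrt (x / n) \<le> 24 * D" using D by simp
  have sq: "(24 * D * sqrt (x / n))\<^sup>2 = (24 * D)\<^sup>2 * x / n" using x by (simp add: power_mult_distrib)
  show "real n * (24 * D * sqrt (x / n))\<^sup>2 / (192 * D\<^sup>2) = 3 * x"
    unfolding sq using n0 D by (simp add: power_mult_distrib)
  have "(24 * D)\<^sup>2 * x \<le> real n" using ge hl0 x by linarith
  hence "(24 * D * sqrt (x / n))\<^sup>2 \<le> 1\<^sup>2" unfolding sq using n0 by (simp add: divide_le_eq)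
  thus "24 * D * sqrt (x / n) \<le> 1" by (rule power2_le_imp_le) simp
qed

theorem theorem2:
  fixes a b \<alpha> c0 C_B C_eps c_sg :: real and L h :: nat
  assumes "a < b" and "L \<ge> 1" and "h \<ge> 1" and "\<alpha> > 1" and "c0 > 0" and "c_sg > 0"
  shows "\<exists>C0>0. \<exists>C>0. \<exists>c3>0. \<exists>c4>0.
    \<forall>(M :: 'w measure) (n::nat) (p::nat) (d::nat)
      (W :: int \<Rightarrow> nat \<Rightarrow> 'w \<Rightarrow> real \<Rightarrow> real) (X :: int \<Rightarrow> nat \<Rightarrow> 'w \<Rightarrow> real \<Rightarrow> real)
      (e :: int \<Rightarrow> nat \<Rightarrow> 'w \<Rightarrow> real \<Rightarrow> real) (\<epsilon> :: int \<Rightarrow> nat \<Rightarrow> 'w \<Rightarrow> real \<Rightarrow> real)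
      (B :: nat \<Rightarrow> nat \<Rightarrow> nat \<Rightarrow> real \<Rightarrow> real \<Rightarrow> real)
      (lam :: nat \<Rightarrow> nat \<Rightarrow> real) (psi :: nat \<Rightarrow> nat \<Rightarrow> real \<Rightarrow> real)
      (kap :: nat \<Rightarrow> nat \<Rightarrow> real) (nu :: nat \<Rightarrow> nat \<Rightarrow> real \<Rightarrow> real)
      (lamh :: 'w \<Rightarrow> nat \<Rightarrow> nat \<Rightarrow> real) (psih :: 'w \<Rightarrow> nat \<Rightarrow> nat \<Rightarrow> real \<Rightarrow> real).
      prob_space M \<and> p \<ge> 1 \<and> d \<ge> 1 \<and>
      \<comment> \<open>setting: W = X + e, W weakly stationary, e white noise uncorrelated with X\<close>
      wstat M a b p W \<and> wstat M a b p e \<and> (\<forall>t j. j < p \<longrightarrow> rfun M a b (X t j)) \<and>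
      (\<forall>t j \<omega>. W t j \<omega> = (\<lambda>u. X t j \<omega> u + e t j \<omega> u)) \<and>
      (\<forall>t s j k u v. j < p \<longrightarrow> k < p \<longrightarrow> u \<in> {a..b} \<longrightarrow> v \<in> {a..b} \<longrightarrow> s \<noteq> t \<longrightarrow>
          cov M (\<lambda>\<omega>. e t j \<omega> u) (\<lambda>\<omega>. e s k \<omega> v) = 0) \<and>
      (\<forall>t s j k u v. j < p \<longrightarrow> k < p \<longrightarrow> u \<in> {a..b} \<longrightarrow> v \<in> {a..b} \<longrightarrow>
          cov M (\<lambda>\<omega>. X t j \<omega> u) (\<lambda>\<omega>. e s k \<omega> v) = 0) \<and>
      \<comment> \<open>(A1)\<close>
      sd_exists a b p (acov M W) \<and> stab a b p (acov M W) p < \<infinity> \<and>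
      \<comment> \<open>(A2)\<close>
      (\<forall>t j. j < p \<longrightarrow> rfun M a b (\<epsilon> t j) \<and> subgauss M a b c_sg (\<epsilon> t j)) \<and>
      prob_space.indep_vars M (\<lambda>_. Pi\<^sub>M UNIV (\<lambda>_. borel)) (\<lambda>(t, j). \<epsilon> t j) (UNIV \<times> {..<p}) \<and>
      (\<forall>l i k. i < p \<longrightarrow> k < p \<longrightarrow> hs_kernel a b (B l i k)) \<and>
      summable (\<lambda>l. kinf a b p (B l)) \<and> (\<Sum>l. kinf a b p (B l)) \<le> C_B \<and>
      (\<forall>t j. j < p \<longrightarrow> (LINT u:{a..b}|lborel. cov M (\<lambda>\<omega>. \<epsilon> t j \<omega> u) (\<lambda>\<omega>. \<epsilon> t j \<omega> u)) \<le> C_eps) \<and>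
      ma_rep M a b p W B \<epsilon> \<and>
      \<comment> \<open>(A3), with (lam j l, psi j l) the eigenpairs of K_jj and (kap j l, nu j l) those of Sigma^X_{0,jj}\<close>
      (\<forall>j<p. eigpairs a b (Kmat a b (acov M W) L j) (lam j) (psi j) \<and>
         (\<forall>l\<ge>1. lam j l > 0 \<and> lam j l > lam j (Suc l) \<and>
                 lam j l - lam j (Suc l) \<ge> c0 * real l powr (- \<alpha> - 1)) \<and>
         eigpairs a b (acov M X 0 j j) (kap j) (nu j) \<and>
         nu j ` {l. l \<ge> 1 \<and> kap j l \<noteq> 0} \<subseteq> l2_closed_span a b (psi j ` {l. l \<ge> 1}) \<and>
         psi j ` {l. l \<ge> 1} \<subseteq> l2_closed_span a b (nu j ` {l. l \<ge> 1 \<and> kap j l \<noteq> 0})) \<and>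
      \<comment> \<open>sample eigenpairs of hat K_jj (built from W_1..W_n), signs aligned with psi\<close>
      (\<forall>\<omega>\<in>space M. \<forall>j<p. eigpairs a b (Kmat a b (sacov n W \<omega>) L j) (lamh \<omega> j) (psih \<omega> j) \<and>
         (\<forall>l\<ge>1. ip a b (psih \<omega> j l) (psi j l) \<ge> 0)) \<and>
      \<comment> \<open>sample size condition\<close>
      real n \<ge> C0 * real d powr (2 * \<alpha> + 2) * (real_of_ereal (stab a b p (acov M W) 1))^2 * ln (real (p * d))
    \<longrightarrow> (\<exists>A\<in>sets M. measure M A > 1 - c3 * real (p * d) powr (- c4) \<and>
          (\<forall>\<omega>\<in>A. \<forall>j<p. \<forall>k<p. \<forall>l\<in>{1..d}. \<forall>m\<in>{1..d}.
             \<bar>sighat a b n W psih \<omega> h j k l m - sig M a b X psi h j k l m\<bar> / real (max l m) powr (\<alpha> + 1)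
               \<le> C * real_of_ereal (stab a b p (acov M W) 1) * sqrt (ln (real (p * d)) / real n)))"
proof -
  \<comment> \<open>At least 1, so that the exponential rate is well defined and \<open>D\<close> is
    positive.\<close>
  define Ce where "Ce = max C_eps 1"
  define D where "D = (max C_B 0 + 2)\<^sup>2 / (1 / (8 * c_sg\<^sup>2 * Ce))"
  define F where "F = 1 + 2 * D * (3 * real L * (2 * D + 1) / c0)"
  define C0 where "C0 = (24 * D)\<^sup>2 + 4 * (real h + real L) + 1"
  \<comment> \<open>The union over at most \<open>L + 1\<close> lags contributes
    \<open>2 * (L + 1)\<close>; the extra 1 makes the final inequality strict.\<close>
  define c3 where "c3 = 2 * (real L + 1) + 1"
  have D: "D > 0" unfolding D_def Ce_def using assms(6) by simp
  have F: "F > 0" unfolding F_def using D assms(5) by (intro add_pos_nonneg) auto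
  have FD: "F * (24 * D) > 0" using F D by simp
  have C0: "C0 > 0" unfolding C0_def by (intro add_nonneg_pos) auto
  have c3: "c3 > 0" by (simp add: c3_def)
  show ?thesis
  proof (rule exI[of _ C0], rule conjI[OF C0], rule exI[of _ "F * (24 * D)"], rule conjI[OF FD],
      rule exI[of _ c3], rule conjI[OF c3], rule exI[of _ 1], rule conjI[OF zero_less_one], intro allI impI, elim conjE)
    fix M :: "'w measure" and n p d :: nat
      and W X e \<epsilon> :: "int \<Rightarrow> nat \<Rightarrow> 'w \<Rightarrow> real \<Rightarrow> real" and B :: "nat \<Rightarrow> nat \<Rightarrow> nat \<Rightarrow> real \<Rightarrow> real \<Rightarrow> real"
      and lam :: "nat \<Rightarrow> nat \<Rightarrow> real" and psi :: "nat \<Rightarrow> nat \<Rightarrow> real \<Rightarrow> real"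
      and kap :: "nat \<Rightarrow> nat \<Rightarrow> real" and nu :: "nat \<Rightarrow> nat \<Rightarrow> real \<Rightarrow> real"
      and lamh :: "'w \<Rightarrow> nat \<Rightarrow> nat \<Rightarrow> real" and psih :: "'w \<Rightarrow> nat \<Rightarrow> nat \<Rightarrow> real \<Rightarrow> real"
    assume pr: "prob_space M" and p: "p \<ge> 1" and d: "d \<ge> 1"
      and Wst: "wstat M a b p W" and est: "wstat M a b p e" and Xr: "\<forall>t j. j < p \<longrightarrow> rfun M a b (X t j)"
      and We: "\<forall>t j \<omega>. W t j \<omega> = (\<lambda>u. X t j \<omega> u + e t j \<omega> u)"
      and white: "\<forall>t s j k u v. j < p \<longrightarrow> k < p \<longrightarrow> u \<in> {a..b} \<longrightarrow> v \<in> {a..b} \<longrightarrow> s \<noteq> t \<longrightarrow>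
          cov M (\<lambda>\<omega>. e t j \<omega> u) (\<lambda>\<omega>. e s k \<omega> v) = 0"
      and uncor: "\<forall>t s j k u v. j < p \<longrightarrow> k < p \<longrightarrow> u \<in> {a..b} \<longrightarrow> v \<in> {a..b} \<longrightarrow>
          cov M (\<lambda>\<omega>. X t j \<omega> u) (\<lambda>\<omega>. e s k \<omega> v) = 0"
      and sd: "sd_exists a b p (acov M W)" "stab a b p (acov M W) p < \<infinity>"
      and eps: "\<forall>t j. j < p \<longrightarrow> rfun M a b (\<epsilon> t j) \<and> subgauss M a b c_sg (\<epsilon> t j)"
      and ind: "prob_space.indep_vars M (\<lambda>_. Pi\<^sub>M UNIV (\<lambda>_. borel)) (\<lambda>(t, j). \<epsilon> t j) (UNIV \<times> {..<p})"
      and B: "\<forall>l i k. i < p \<longrightarrow> k < p \<longrightarrow> hs_kernel a b (B l i k)"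
        "summable (\<lambda>l. kinf a b p (B l))" "(\<Sum>l. kinf a b p (B l)) \<le> C_B"
      and trace: "\<forall>t j. j < p \<longrightarrow> (LINT u:{a..b}|lborel. cov M (\<lambda>\<omega>. \<epsilon> t j \<omega> u) (\<lambda>\<omega>. \<epsilon> t j \<omega> u)) \<le> C_eps"
      and ma: "ma_rep M a b p W B \<epsilon>"
      and A3: "\<forall>j<p. eigpairs a b (Kmat a b (acov M W) L j) (lam j) (psi j) \<and>
         (\<forall>l\<ge>1. lam j l > 0 \<and> lam j l > lam j (Suc l) \<and>
                 lam j l - lam j (Suc l) \<ge> c0 * real l powr (- \<alpha> - 1)) \<and>
         eigpairs a b (acov M X 0 j j) (kap j) (nu j) \<and>
         nu j ` {l. l \<ge> 1 \<and> kap j l \<noteq> 0} \<subseteq> l2_closed_span a b (psi j ` {l. l \<ge> 1}) \<and>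
         psi j ` {l. l \<ge> 1} \<subseteq> l2_closed_span a b (nu j ` {l. l \<ge> 1 \<and> kap j l \<noteq> 0})"
      and hat: "\<forall>\<omega>\<in>space M. \<forall>j<p. eigpairs a b (Kmat a b (sacov n W \<omega>) L j) (lamh \<omega> j) (psih \<omega> j) \<and>
         (\<forall>l\<ge>1. ip a b (psih \<omega> j l) (psi j l) \<ge> 0)"
      and n: "real n \<ge> C0 * real d powr (2 * \<alpha> + 2) * (real_of_ereal (stab a b p (acov M W) 1))^2 * ln (real (p * d))"
    define S where "S = real_of_ereal (stab a b p (acov M W) 1)"
    define x where "x = ln (real (p * d))"
    interpret fp: functional_process M a b c_sg Ce C_B p W \<epsilon> B
    proof (intro functional_process.intro functional_process_axioms.intro pr assms(1,6) p Wst ind B(2,3) ma)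
      show "Ce > 0" by (simp add: Ce_def)
      fix t j assume j: "j < p"
      show "rfun M a b (\<epsilon> t j)" "subgauss M a b c_sg (\<epsilon> t j)" using eps j by auto
      have "(LINT u:{a..b}|lborel. cov M (\<lambda>\<omega>. \<epsilon> t j \<omega> u) (\<lambda>\<omega>. \<epsilon> t j \<omega> u)) \<le> C_eps" using trace j by blast
      thus "(LINT u:{a..b}|lborel. cov M (\<lambda>\<omega>. \<epsilon> t j \<omega> u) (\<lambda>\<omega>. \<epsilon> t j \<omega> u)) \<le> Ce" by (simp add: Ce_def)
    qed (use B(1) in auto)
    have fpD: "fp.D = D" by (simp add: fp.D_def D_def)
    have eig: "eigpairs a b (Kmat a b (acov M W) L j) (lam j) (psi j)"
      and lam: "l \<ge> 1 \<Longrightarrow> lam j l > 0" and gap: "l \<ge> 1 \<Longrightarrow> lam j l - lam j (Suc l) \<ge> c0 * real l powr (- \<alpha> - 1)"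
      if "j < p" for j l using A3 that by auto
    have S1: "1 \<le> S" unfolding S_def by (rule fp.stab_ge_1[OF eig lam sd]) (use p in auto)
    have "\<exists>A\<in>sets M. measure M A > 1 - c3 * real (p * d) powr (- 1) \<and>
          (\<forall>\<omega>\<in>A. \<forall>j<p. \<forall>k<p. \<forall>l\<in>{1..d}. \<forall>m\<in>{1..d}.
             \<bar>sighat a b n W psih \<omega> h j k l m - sig M a b X psi h j k l m\<bar> / real (max l m) powr (\<alpha> + 1)
               \<le> F * (24 * D) * S * sqrt (x / real n))"
    proof (cases "p * d = 1")
      \<comment> \<open>Here the logarithm is 0 and so is the claimed accuracy. The required
        probability exceeds only the negative number \<open>1 - c3\<close>, so the empty event will
        do.\<close>
      case True
      show ?thesis unfolding True by (intro bexI[of _ "{}"]) (auto simp: c3_def)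
    next
      case False
      define \<eta> where "\<eta> = 24 * D * sqrt (x / real n)"
      have "p * d \<ge> 1" using p d by simp
      hence pd: "p * d \<ge> 2" using False by linarith
      \<comment> \<open>From \<open>ln 2 \<ge> 1 / 2\<close>. A positive lower bound for the
        logarithm is what lets the sample size condition dominate the fixed lags.\<close>
      have x: "x \<ge> 1 / 2"
      proof -
        have "ln (1 / 2 :: real) \<le> 1 / 2 - 1" by (rule ln_le_minus_one) simp
        hence "1 / 2 \<le> ln (2 :: real)" by (simp add: ln_div)
        also have "ln 2 \<le> x"
        proof -
          have "(2 :: real) \<le> real (p * d)" using pd by (metis of_nat_le_iff of_nat_numeral)
          thus ?thesis unfolding x_def by simp
        qed
        finally show ?thesis .
      qed
      \<comment> \<open>Both further factors of the sample size condition are at least 1, the second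
        by the lower bound for the stability measure.\<close>
      have nx: "real n \<ge> C0 * x"
      proof -
        have "1 \<le> real d powr (2 * \<alpha> + 2)" using d assms(4) by (intro ge_one_powr_ge_zero) auto
        moreover have "1 \<le> S\<^sup>2" using S1 by simp
        ultimately have "1 * 1 \<le> real d powr (2 * \<alpha> + 2) * S\<^sup>2" by (intro mult_mono) auto
        hence "C0 * x * (1 * 1) \<le> C0 * x * (real d powr (2 * \<alpha> + 2) * S\<^sup>2)"
          using C0 x by (intro mult_left_mono) auto
        thus ?thesis using n by (simp add: S_def x_def mult_ac)
      qed
      note ss = sample_size_consequences[OF x D nx[unfolded C0_def], folded \<eta>_def]
      have eta0: "0 \<le> \<eta>" unfolding \<eta>_def using D x by simp
      have H: "finite (insert h {1..L})" "\<And>g. g \<in> insert h {1..L} \<Longrightarrow> 2 * g < n" using ss(3) by auto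
      from fp.uniform_sacov_tail[OF H eta0] ss(2) obtain A where A: "A \<in> sets M"
        "measure M A \<ge> 1 - 2 * real (card (insert h {1..L})) * (real p)\<^sup>2 * exp (- (real n * \<eta>\<^sup>2 / (192 * D\<^sup>2)))"
        "\<And>\<omega> g j k. \<omega> \<in> A \<Longrightarrow> g \<in> insert h {1..L} \<Longrightarrow> j < p \<Longrightarrow> k < p \<Longrightarrow>
           norm (kemb a b (sacov n W \<omega> (int g) j k) - kemb a b (acov M W (int g) j k)) \<le> \<eta>"
        unfolding fpD by blast
      have "measure M A > 1 - c3 * real (p * d) powr (- 1)"
      proof -
        define y where "y = real (p * d)"
        have y: "y \<ge> 2" unfolding y_def using pd by (metis of_nat_le_iff of_nat_numeral)
        \<comment> \<open>Two of the three powers of \<open>p * d\<close> pay for the pairs of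
          components; one is left for the claim.\<close>
        have "exp (- (3 * x)) = 1 / y ^ 3"
          using y exp_of_nat_mult[of 3 x] by (simp add: x_def y_def exp_minus divide_inverse)
        moreover have "(real p)\<^sup>2 \<le> y\<^sup>2"
          unfolding y_def using d by (intro power_mono, subst of_nat_le_iff) auto
        ultimately have "(real p)\<^sup>2 * exp (- (3 * x)) \<le> y\<^sup>2 * (1 / y ^ 3)"
          using y by (simp add: divide_right_mono)
        also have "\<dots> = 1 / y" using y by (simp add: power2_eq_square power3_eq_cube)
        finally have e: "(real p)\<^sup>2 * exp (- (3 * x)) \<le> 1 / y" .
        have "card (insert h {1..L}) \<le> L + 1" using card_insert_le_m1[of "L + 1" "{1..L}" h] by simp
        hence "2 * real (card (insert h {1..L})) * ((real p)\<^sup>2 * exp (- (3 * x))) \<le> 2 * (real L + 1) * (1 / y)"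
          using e y by (intro mult_mono) auto
        also have "\<dots> < c3 * (1 / y)" unfolding c3_def using y by (intro mult_strict_right_mono) auto
        finally show ?thesis using A(2) y unfolding ss(4) y_def[symmetric]
          by (simp add: powr_minus_divide mult.assoc)
      qed
      moreover have "\<bar>sighat a b n W psih \<omega> h j k l m - sig M a b X psi h j k l m\<bar> / real (max l m) powr (\<alpha> + 1)
               \<le> F * (24 * D) * S * sqrt (x / real n)"
        if w: "\<omega> \<in> A" and jk: "j < p" "k < p" and lm: "l \<in> {1..d}" "m \<in> {1..d}" for \<omega> j k l m
      proof -
        have ws: "\<omega> \<in> space M" using A(1) w sets.sets_into_space by blast
        have lm1: "l \<ge> 1" "m \<ge> 1" using lm by auto
        have eigh: "eigpairs a b (Kmat a b (sacov n W \<omega>) L j) (lamh \<omega> j) (psih \<omega> j)"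
          and sgn: "l \<ge> 1 \<Longrightarrow> ip a b (psih \<omega> j l) (psi j l) \<ge> 0" if "j < p" for j l
          using hat ws that by auto
        have cs: "csi a b (psi j l)" "csi a b (psih \<omega> j l)" if "j < p" "l \<ge> 1" for j l
          using eig[OF that(1)] eigh[OF that(1)] that(2) unfolding eigpairs_def by (auto intro: sqint_csi)
        have sg: "sig M a b X psi h j k l m =
            inner (kemb a b (acov M W (int h) j k)) (l2_tensor (emb a b (psi j l)) (emb a b (psi k m)))"
        proof (rule fp.sig_eq[where X=X and e=e])
          show "W t j \<omega> = (\<lambda>u. X t j \<omega> u + e t j \<omega> u)" for t j \<omega> by (rule We[rule_format])
          show "rfun M a b (X t j)" if "j < p" for t j by (rule Xr[rule_format, OF that])
          show "cov M (\<lambda>\<omega>. e t j \<omega> u) (\<lambda>\<omega>. e s k \<omega> v) = 0"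
            if "j < p" "k < p" "u \<in> {a..b}" "v \<in> {a..b}" "s \<noteq> t" for t s j k u v by (rule white[rule_format, OF that])
          show "cov M (\<lambda>\<omega>. X t j \<omega> u) (\<lambda>\<omega>. e s k \<omega> v) = 0"
            if "j < p" "k < p" "u \<in> {a..b}" "v \<in> {a..b}" for t s j k u v by (rule uncor[rule_format, OF that])
        qed (rule est assms(3) jk cs(1)[OF jk(1) lm1(1)] cs(1)[OF jk(2) lm1(2)])+
        have sh: "sighat a b n W psih \<omega> h j k l m =
            inner (kemb a b (sacov n W \<omega> (int h) j k)) (l2_tensor (emb a b (psih \<omega> j l)) (emb a b (psih \<omega> k m)))"
          by (rule fp.sighat_eq[where psih=psih, OF ws jk cs(2)[OF jk(1) lm1(1)] cs(2)[OF jk(2) lm1(2)]])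
        define Q where "Q = real (max l m) powr (\<alpha> + 1)"
        have Q: "Q > 0" unfolding Q_def using lm1 by simp
        have "\<bar>sighat a b n W psih \<omega> h j k l m - sig M a b X psi h j k l m\<bar> \<le> F * Q * \<eta>"
          unfolding sg sh F_def Q_def fpD[symmetric]
          by (rule fp.coefficient_error[OF ws jk lm1 eig eigh sgn gap assms(5,4) A(3)[OF w] eta0 ss(1)])
        hence "\<bar>sighat a b n W psih \<omega> h j k l m - sig M a b X psi h j k l m\<bar> / Q \<le> F * \<eta>"
          using Q by (simp add: pos_divide_le_eq mult_ac)
        \<comment> \<open>The stability measure enters the bound here, as a factor that is at least
          1.\<close>
        also have "\<dots> \<le> F * \<eta> * S" using S1 F eta0 mult_left_mono[OF S1, of "F * \<eta>"] by simp
        also have "\<dots> = F * (24 * D) * S * sqrt (x / real n)" by (simp add: \<eta>_def mult_ac)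
        finally show ?thesis unfolding Q_def .
      qed
      ultimately show ?thesis using A(1) by (intro bexI[of _ A]) auto
    qed
    thus "\<exists>A\<in>sets M. measure M A > 1 - c3 * real (p * d) powr (- 1) \<and>
          (\<forall>\<omega>\<in>A. \<forall>j<p. \<forall>k<p. \<forall>l\<in>{1..d}. \<forall>m\<in>{1..d}.
             \<bar>sighat a b n W psih \<omega> h j k l m - sig M a b X psi h j k l m\<bar> / real (max l m) powr (\<alpha> + 1)
               \<le> F * (24 * D) * real_of_ereal (stab a b p (acov M W) 1) * sqrt (ln (real (p * d)) / real n))"
      unfolding S_def x_def .
  qed
qed

end
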